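(* Let $k\ge 3$ and assume $m_0(0)<2R_0/3$. Then, for any initial data for the system $$R_{xx}-R_{tt}=0,$$ $$W_{tt}-W_{xx}+\frac{R_t}{R}W_t-\frac{R_x}{R}W_x+\frac{q_t^2-q_x^2}{2}e^{-4W}=0,$$ $$q_{tt}-q_{xx}+\frac{R_t}{R}q_t-\frac{R_x}{R}q_x-4q_tW_t+4q_xW_x=0,$$ satisfying $(R-R_b)(0,\cdot)\in C_0^k$, $\partial_t(R-R_b)(0,\cdot)\in C_0^{k-1}$, $(W-W_b)(0,\cdot)\in\widetilde H^k$, $\partial_t(W-W_b)(0,\cdot)\in\widetilde H^{k-1}$ and $q(0,\cdot)=q_t(0,\cdot)=0$, there is a unique $C^{k-1}$ solution of the system defined for all $t\ge 0$, with $q$ identically zero, and $$\widetilde{\mathcal M}_k(t)\le C e^{-t}(t+1)\left(\widetilde{\mathcal M}_k(0)+m_k(0)\right)\quad\text{for all } t\ge 0.$$ Moreover, the constant $C$ depends only on an upper bound on $m_k(0)$ and on $k$.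
   Context: The unknowns $R,W,q$ are real functions of $(t,x)$, $x\in\mathbb{R}$. The background (polarized double cusp) is fixed: with constants $R_0>0$, $W_0\neq0$, $W_1\in\mathbb{R}$, $$R_b=R_0e^{2t}\cosh(2x),\qquad W_b=W_1+W_0\arctan(e^{2x}),\qquad q_b=0;$$ constants may depend on these background parameters. Norms are taken in $x$ at fixed $t$: $$m_0(t)=\|R-R_b\|_{C^0}+\|R_t-\partial_tR_b\|_{C^0},\qquad m_k(t)=\|R-R_b\|_{C^k}+\|R_t-\partial_tR_b\|_{C^{k-1}}\ (k\ge1),$$ $$\widetilde{\mathcal M}_k(t)=\|W-W_b\|_{\widetilde H^k}+\|\partial_t(W-W_b)\|_{\widetilde H^{k-1}}+\|q\|_{\widetilde H^k}+\|\partial_tq\|_{\widetilde H^{k-1}}.$$ $\widetilde H^k$ (also written $\widetilde H_k$) is the completion of $C_c^\infty(\mathbb{R})$ in the norm $\|f\|_{\widetilde H^k}^2=\sum_{i=0}^k\int_{\mathbb{R}}(f^{(i)}(x))^2\cosh(2x)\,dx$. $C_0^k$ is the space of $C^k$ functions $f$ on $\mathbb{R}$ with $f^{(i)}(x)\to0$ as $|x|\to\infty$ for every $i\le k$. "The constant depends only on an upper bound on $m_k(0)$ and $k$" means: for every $B$ and $k$ the same constant $C$ works for all solutions with $m_k(0)<B$. *)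

theory Defs
  imports "HOL-Analysis.Analysis"
begin

section \<open>Functions of one real variable\<close>

definition Ck_fun :: "nat \<Rightarrow> (real \<Rightarrow> real) \<Rightarrow> bool" where
  "Ck_fun k f \<longleftrightarrow>
     (\<forall>i<k. \<forall>x. (deriv ^^ i) f differentiable (at x)) \<and>
     continuous_on UNIV ((deriv ^^ k) f)"

text \<open>On the reals, the filter \<open>at_infinity\<close> is the one for \<open>\<bar>x\<bar> \<rightarrow> \<infinity>\<close>.\<close>

definition C0_space :: "nat \<Rightarrow> (real \<Rightarrow> real) set" where
  "C0_space k = {f. Ck_fun k f \<and> (\<forall>i\<le>k. ((deriv ^^ i) f \<longlongrightarrow> 0) at_infinity)}"

text \<open>Only meaningful for functions whose derivatives up to order \<open>k\<close> are bounded,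
  in particular on \<open>C0_space k\<close>.\<close>

definition Ck_norm :: "nat \<Rightarrow> (real \<Rightarrow> real) \<Rightarrow> real" where
  "Ck_norm k f = (\<Sum>i\<le>k. SUP x. \<bar>(deriv ^^ i) f x\<bar>)"

definition test_functions :: "(real \<Rightarrow> real) set" where
  "test_functions = {\<phi>. (\<forall>k. Ck_fun k \<phi>) \<and> (\<exists>a. \<forall>x. \<bar>x\<bar> > a \<longrightarrow> \<phi> x = 0)}"

definition weighted_norm :: "nat \<Rightarrow> (real \<Rightarrow> real) \<Rightarrow> real" where
  "weighted_norm k \<phi> =
     sqrt (\<Sum>i\<le>k. LINT x|lebesgue. ((deriv ^^ i) \<phi> x)\<^sup>2 * cosh (2 * x))"

text \<open>The completion of the test functions under \<open>weighted_norm k\<close>, realised as a space of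
  functions: a Cauchy sequence converges in \<open>L\<^sup>2(cosh (2x) dx)\<close>, and the point of the completion
  it represents is identified with that limit \<open>f\<close> (a function up to equality almost everywhere).
  The norm on the completion is the limit of the norms along the Cauchy sequence; it does not
  depend on the chosen sequence, because distributional derivatives are unique.\<close>

definition represents :: "nat \<Rightarrow> (nat \<Rightarrow> real \<Rightarrow> real) \<Rightarrow> (real \<Rightarrow> real) \<Rightarrow> bool" where
  "represents k \<phi> f \<longleftrightarrow>
     (\<forall>n. \<phi> n \<in> test_functions) \<and>
     (\<forall>e>0. \<exists>N. \<forall>m\<ge>N. \<forall>n\<ge>N. weighted_norm k (\<lambda>x. \<phi> m x - \<phi> n x) < e) \<and>
     f \<in> borel_measurable lebesgue \<and>
     (\<lambda>n. \<integral>\<^sup>+ x. ennreal ((\<phi> n x - f x)\<^sup>2 * cosh (2 * x)) \<partial>lebesgue) \<longlonglongrightarrow> 0"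

definition Ht_space :: "nat \<Rightarrow> (real \<Rightarrow> real) set" where
  "Ht_space k = {f. \<exists>\<phi>. represents k \<phi> f}"

definition Ht_norm :: "nat \<Rightarrow> (real \<Rightarrow> real) \<Rightarrow> real" where
  "Ht_norm k f = (THE l. \<exists>\<phi>. represents k \<phi> f \<and> (\<lambda>n. weighted_norm k (\<phi> n)) \<longlonglongrightarrow> l)"

section \<open>Functions of \<open>(t, x)\<close> on the closed half plane \<open>t \<ge> 0\<close>\<close>

text \<open>A function on \<open>{0..} \<times> UNIV\<close> is a curried total function \<open>u t x\<close> whose values at negative
  \<open>t\<close> are irrelevant; accordingly time derivatives at \<open>t = 0\<close> are one-sided.\<close>

definition Dt :: "(real \<Rightarrow> real \<Rightarrow> real) \<Rightarrow> real \<Rightarrow> real \<Rightarrow> real" where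
  "Dt u t x = vector_derivative (\<lambda>s. u s x) (at t within {0..})"

definition Dx :: "(real \<Rightarrow> real \<Rightarrow> real) \<Rightarrow> real \<Rightarrow> real \<Rightarrow> real" where
  "Dx u t x = deriv (\<lambda>y. u t y) x"

fun Ck_halfplane :: "nat \<Rightarrow> (real \<Rightarrow> real \<Rightarrow> real) \<Rightarrow> bool" where
  "Ck_halfplane 0 u \<longleftrightarrow> continuous_on ({0..} \<times> UNIV) (\<lambda>(t, x). u t x)"
| "Ck_halfplane (Suc k) u \<longleftrightarrow>
     continuous_on ({0..} \<times> UNIV) (\<lambda>(t, x). u t x) \<and>
     (\<forall>t\<ge>0. \<forall>x. (\<lambda>s. u s x) differentiable (at t within {0..}) \<and>
                (\<lambda>y. u t y) differentiable (at x)) \<and>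
     Ck_halfplane k (Dt u) \<and> Ck_halfplane k (Dx u)"

section \<open>The system and its polarized double cusp background\<close>

definition Rb :: "real \<Rightarrow> real \<Rightarrow> real \<Rightarrow> real" where
  "Rb R0 t x = R0 * exp (2 * t) * cosh (2 * x)"

definition Wb :: "real \<Rightarrow> real \<Rightarrow> real \<Rightarrow> real \<Rightarrow> real" where
  "Wb W0 W1 t x = W1 + W0 * arctan (exp (2 * x))"

text \<open>The condition \<open>R t x \<noteq> 0\<close> makes the quotients in the equations meaningful.\<close>

definition solves_system ::
  "(real \<Rightarrow> real \<Rightarrow> real) \<Rightarrow> (real \<Rightarrow> real \<Rightarrow> real) \<Rightarrow> (real \<Rightarrow> real \<Rightarrow> real) \<Rightarrow> bool" where
  "solves_system R W q \<longleftrightarrow> (\<forall>t\<ge>0. \<forall>x.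
     R t x \<noteq> 0 \<and>
     Dx (Dx R) t x - Dt (Dt R) t x = 0 \<and>
     Dt (Dt W) t x - Dx (Dx W) t x
       + Dt R t x / R t x * Dt W t x - Dx R t x / R t x * Dx W t x
       + ((Dt q t x)\<^sup>2 - (Dx q t x)\<^sup>2) / 2 * exp (- 4 * W t x) = 0 \<and>
     Dt (Dt q) t x - Dx (Dx q) t x
       + Dt R t x / R t x * Dt q t x - Dx R t x / R t x * Dx q t x
       - 4 * Dt q t x * Dt W t x + 4 * Dx q t x * Dx W t x = 0)"

text \<open>The data \<open>w, w'\<close> for \<open>W\<close> are only determined up to null sets (elements of weighted Sobolev
  spaces), so they are attained almost everywhere.\<close>

definition Ck_solution_with_data ::
  "nat \<Rightarrow> (real \<Rightarrow> real) \<Rightarrow> (real \<Rightarrow> real) \<Rightarrow> (real \<Rightarrow> real) \<Rightarrow> (real \<Rightarrow> real) \<Rightarrow>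
   (real \<Rightarrow> real \<Rightarrow> real) \<Rightarrow> (real \<Rightarrow> real \<Rightarrow> real) \<Rightarrow> (real \<Rightarrow> real \<Rightarrow> real) \<Rightarrow> bool" where
  "Ck_solution_with_data j r r' w w' R W q \<longleftrightarrow>
     Ck_halfplane j R \<and> Ck_halfplane j W \<and> Ck_halfplane j q \<and>
     solves_system R W q \<and>
     (\<forall>x. R 0 x = r x \<and> Dt R 0 x = r' x) \<and>
     (AE x in lebesgue. W 0 x = w x \<and> Dt W 0 x = w' x) \<and>
     (\<forall>x. q 0 x = 0 \<and> Dt q 0 x = 0)"

text \<open>\<open>m_norm k f g\<close> is the quantity \<open>m\<^sub>k\<close> when \<open>f\<close> and \<open>g\<close> are \<open>R - R\<^sub>b\<close> and its time
  derivative at a fixed time. Truncated subtraction makes the formula correct for \<open>k = 0\<close> too.\<close>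

definition m_norm :: "nat \<Rightarrow> (real \<Rightarrow> real) \<Rightarrow> (real \<Rightarrow> real) \<Rightarrow> real" where
  "m_norm k f g = Ck_norm k f + Ck_norm (k - 1) g"

definition M_norm ::
  "real \<Rightarrow> real \<Rightarrow> nat \<Rightarrow> (real \<Rightarrow> real \<Rightarrow> real) \<Rightarrow> (real \<Rightarrow> real \<Rightarrow> real) \<Rightarrow> real \<Rightarrow> real" where
  "M_norm W0 W1 k W q t =
     Ht_norm k (\<lambda>x. W t x - Wb W0 W1 t x)
     + Ht_norm (k - 1) (Dt (\<lambda>s x. W s x - Wb W0 W1 s x) t)
     + Ht_norm k (q t) + Ht_norm (k - 1) (Dt q t)"

end

theory Submission
  imports Defs
begin

text \<open>With \<open>q = 0\<close> and \<open>v = W - W\<^sub>b\<close> the system reduces to the linear equation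
  \<open>v\<^sub>t\<^sub>t + 2 v\<^sub>t + D\<^sup>* D v = - a v\<^sub>t + b v\<^sub>x + W\<^sub>0 b / cosh (2x)\<close>, where \<open>D\<close> is differentiation, \<open>D\<^sup>*\<close> is its
  adjoint for the weight \<open>cosh (2x)\<close>, and \<open>a = R\<^sub>t / R - 2\<close>, \<open>b = R\<^sub>x / R - 2 tanh (2x)\<close>. By d'Alembert's
  formula \<open>R - R\<^sub>b\<close> grows at most linearly, so \<open>a\<close> and \<open>b\<close> are \<open>O((1 + t) e\<^sup>-\<^sup>2\<^sup>t)\<close>. A Hardy inequality
  gives \<open>D\<^sup>* D \<ge> 1\<close>, hence \<open>u = e\<^sup>t v\<close> has the nonnegative energy
  \<open>\<parallel>u\<^sub>t\<parallel>\<^sup>2 + \<langle>(D\<^sup>* D - 1) u, u\<rangle>\<close>, which stays bounded, while \<open>\<parallel>u\<parallel>\<close> itself may grow linearly; this is the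
  factor \<open>e\<^sup>-\<^sup>t (t + 1)\<close>. Higher norms are treated by applying \<open>D\<close> and \<open>D\<^sup>*\<close> alternately.

  Rough data are approximated by test functions, for which iteration along characteristics gives
  smooth solutions with compact support in space. The energy estimate for differences makes these
  solutions a Cauchy sequence, and its limit is \<open>C\<^sup>k\<^sup>-\<^sup>1\<close> by Sobolev embedding in \<open>x\<close> and the first
  order characteristic system in \<open>t\<close>. For uniqueness, first \<open>R\<close>, then \<open>q\<close>, then \<open>W\<close> is determined
  by a linear wave equation.\<close>

section \<open>Functions of one variable\<close>

text \<open>The damping 2 v_t and the spectral gap 1 match exactly: passing to u = e^t v removes the
  first order term and leaves the zero order term - u, which the Hardy inequality just balances. At
  the bottom of the spectrum the equation degenerates to u_tt = 0, hence the linear growth. The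
  weight is the spatial profile of \<open>Rb\<close>, and the x derivative of \<open>Wb\<close> is a
  multiple of sech (2x), which \<open>Dstar\<close> annihilates; so the background leaves no source
  except W0 b / cosh (2x), whose weighted norm is controlled by supremum norms of b. The bound 2 R0
  / 3 works through 1 + t <= e^(2t): it keeps R at or above a third of \<open>Rb\<close>. Since a
  and b contain first derivatives of R, everything is estimated at level n = k - 1, with n + 1
  derivatives of v and n of v_t. Constants are fixed before the smooth data are quantified, so they
  survive the passage to rough data. Sobolev embedding loses one derivative; k >= 3 then still gives
  class C^2 and pointwise equations.\<close>

lemma deriv_funpow_Suc: "(deriv ^^ Suc i) f = (deriv ^^ i) (deriv f)"
  by (simp only: funpow_Suc_right o_apply)

lemma Ck_fun_0: "Ck_fun 0 f \<longleftrightarrow> continuous_on UNIV f"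
  by (simp add: Ck_fun_def)

text \<open>Recasts \<open>Ck_fun\<close> as a recursion that peels off the innermost derivative;
  the closure properties below are inductions along it.\<close>

lemma Ck_fun_Suc: "Ck_fun (Suc k) f \<longleftrightarrow> (\<forall>x. f differentiable (at x)) \<and> Ck_fun k (deriv f)"
  unfolding Ck_fun_def deriv_funpow_Suc All_less_Suc2 by auto

lemma Ck_fun_DERIV: "Ck_fun (Suc k) f \<Longrightarrow> (f has_real_derivative deriv f x) (at x)"
  by (simp add: Ck_fun_Suc DERIV_deriv_iff_real_differentiable)

lemma Ck_fun_deriv: "Ck_fun (Suc k) f \<Longrightarrow> Ck_fun k (deriv f)"
  by (simp add: Ck_fun_Suc)

lemma Ck_fun_SucI:
  assumes "\<And>x. (f has_real_derivative f' x) (at x)" and "Ck_fun k f'"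
  shows "Ck_fun (Suc k) f"
proof -
  have "deriv f = f'" using assms(1) by (auto intro: DERIV_imp_deriv)
  with assms show ?thesis
    by (auto simp: Ck_fun_Suc real_differentiable_def)
qed

lemma Ck_fun_continuous: "Ck_fun k f \<Longrightarrow> continuous_on UNIV f"
proof (cases k)
  case (Suc j)
  assume "Ck_fun k f"
  then show ?thesis using Suc
    by (auto simp: Ck_fun_Suc intro!: continuous_at_imp_continuous_on differentiable_imp_continuous_within)
qed (simp add: Ck_fun_0)

lemma Ck_fun_Suc_mono: "Ck_fun (Suc k) f \<Longrightarrow> Ck_fun k f"
proof (induction k arbitrary: f)
  case 0
  then show ?case using Ck_fun_0 Ck_fun_continuous by blast
next
  case (Suc k)
  then show ?case by (metis Ck_fun_Suc)
qed

lemma Ck_fun_mono: "Ck_fun k f \<Longrightarrow> j \<le> k \<Longrightarrow> Ck_fun j f"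
  by (induction k) (use Ck_fun_Suc_mono le_Suc_eq in blast)+

lemma Ck_fun_const: "Ck_fun k (\<lambda>x. c)"
proof (induction k arbitrary: c)
  case (Suc k)
  show ?case by (rule Ck_fun_SucI[OF DERIV_const Suc])
qed (simp add: Ck_fun_0)

lemma Ck_fun_ident: "Ck_fun k (\<lambda>x. x)"
proof (cases k)
  case (Suc j)
  show ?thesis unfolding Suc by (rule Ck_fun_SucI[OF DERIV_ident Ck_fun_const])
qed (simp add: Ck_fun_0)

lemma Ck_fun_add: "Ck_fun k f \<Longrightarrow> Ck_fun k g \<Longrightarrow> Ck_fun k (\<lambda>x. f x + g x)"
proof (induction k arbitrary: f g)
  case (Suc k)
  show ?case
    by (rule Ck_fun_SucI[OF DERIV_add[OF Ck_fun_DERIV[OF Suc(2)] Ck_fun_DERIV[OF Suc(3)]]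
          Suc.IH[OF Ck_fun_deriv[OF Suc(2)] Ck_fun_deriv[OF Suc(3)]]])
qed (simp add: Ck_fun_0 continuous_on_add)

lemma Ck_fun_mult: "Ck_fun k f \<Longrightarrow> Ck_fun k g \<Longrightarrow> Ck_fun k (\<lambda>x. f x * g x)"
proof (induction k arbitrary: f g)
  case (Suc k)
  have "Ck_fun k (\<lambda>x. deriv f x * g x + deriv g x * f x)"
    using Suc.prems by (intro Ck_fun_add Suc.IH) (simp_all add: Ck_fun_deriv Ck_fun_Suc_mono)
  from Ck_fun_SucI[OF DERIV_mult[OF Ck_fun_DERIV[OF Suc(2)] Ck_fun_DERIV[OF Suc(3)]] this]
  show ?case .
qed (simp add: Ck_fun_0 continuous_on_mult)

lemma Ck_fun_cmult: "Ck_fun k f \<Longrightarrow> Ck_fun k (\<lambda>x. c * f x)"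
  by (intro Ck_fun_mult Ck_fun_const)

lemma Ck_fun_minus: "Ck_fun k f \<Longrightarrow> Ck_fun k (\<lambda>x. - f x)"
  using Ck_fun_cmult[of k f "-1"] by simp

lemma Ck_fun_diff: "Ck_fun k f \<Longrightarrow> Ck_fun k g \<Longrightarrow> Ck_fun k (\<lambda>x. f x - g x)"
  using Ck_fun_add[OF _ Ck_fun_minus] by fastforce

lemma Ck_fun_inverse:
  "Ck_fun k f \<Longrightarrow> (\<And>x. f x \<noteq> 0) \<Longrightarrow> Ck_fun k (\<lambda>x. inverse (f x))"
proof (induction k)
  case (Suc k)
  have inv: "Ck_fun k (\<lambda>x. inverse (f x))" using Suc by (simp add: Ck_fun_Suc_mono)
  have "Ck_fun k (\<lambda>x. - (inverse (f x) * deriv f x * inverse (f x)))"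
    by (intro Ck_fun_minus Ck_fun_mult inv Ck_fun_deriv Suc.prems)
  moreover have "((\<lambda>x. inverse (f x)) has_real_derivative - (inverse (f x) * deriv f x * inverse (f x))) (at x)" for x
    using DERIV_inverse'[OF Ck_fun_DERIV[OF Suc.prems(1)] Suc.prems(2)] .
  ultimately show ?case by (rule Ck_fun_SucI[rotated])
qed (auto simp: Ck_fun_0 intro!: continuous_on_inverse)

lemma Ck_fun_affine: "Ck_fun k f \<Longrightarrow> Ck_fun k (\<lambda>x. f (c * x + d))"
proof (induction k arbitrary: f)
  case 0
  then show ?case
    by (auto simp: Ck_fun_0 intro!: continuous_on_compose2[of UNIV f] continuous_intros)
next
  case (Suc k)
  have "((\<lambda>x. f (c * x + d)) has_real_derivative deriv f (c * x + d) * c) (at x)" for x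
    by (rule DERIV_chain2[OF Ck_fun_DERIV[OF Suc(2)]]) (auto intro!: derivative_eq_intros)
  then show ?case
    by (rule Ck_fun_SucI) (intro Ck_fun_mult Ck_fun_const Suc.IH Ck_fun_deriv Suc.prems)
qed

lemma deriv_add_fun:
  "Ck_fun (Suc k) f \<Longrightarrow> Ck_fun (Suc j) g \<Longrightarrow> deriv (\<lambda>x. f x + g x) = (\<lambda>x. deriv f x + deriv g x)"
  by (intro ext DERIV_imp_deriv DERIV_add Ck_fun_DERIV)

lemma deriv_mult_fun:
  "Ck_fun (Suc k) f \<Longrightarrow> Ck_fun (Suc j) g \<Longrightarrow>
    deriv (\<lambda>x. f x * g x) = (\<lambda>x. deriv f x * g x + f x * deriv g x)"
  by (intro ext DERIV_imp_deriv) (auto intro!: derivative_eq_intros Ck_fun_DERIV)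

lemma deriv_cmult_fun:
  "Ck_fun (Suc k) f \<Longrightarrow> deriv (\<lambda>x. c * f x) = (\<lambda>x. c * deriv f x)"
  by (intro ext DERIV_imp_deriv DERIV_cmult Ck_fun_DERIV)

lemma funpow_deriv_add:
  "Ck_fun k f \<Longrightarrow> Ck_fun k g \<Longrightarrow> i \<le> k \<Longrightarrow>
    (deriv ^^ i) (\<lambda>x. f x + g x) = (\<lambda>x. (deriv ^^ i) f x + (deriv ^^ i) g x)"
proof (induction i arbitrary: f g k)
  case (Suc i)
  then obtain j where k: "k = Suc j" by (cases k) auto
  show ?case unfolding deriv_funpow_Suc
    using Suc.IH[of j "deriv f" "deriv g"] deriv_add_fun[of j f j g] Suc.prems
    by (simp add: k Ck_fun_deriv)
qed auto

lemma funpow_deriv_cmult: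
  "Ck_fun k f \<Longrightarrow> i \<le> k \<Longrightarrow> (deriv ^^ i) (\<lambda>x. c * f x) = (\<lambda>x. c * (deriv ^^ i) f x)"
proof (induction i arbitrary: f k)
  case (Suc i)
  then obtain j where k: "k = Suc j" by (cases k) auto
  show ?case unfolding deriv_funpow_Suc
    using Suc.IH[of j "deriv f"] deriv_cmult_fun[of j f c] Suc.prems
    by (simp add: k Ck_fun_deriv)
qed auto

lemma funpow_deriv_diff:
  "Ck_fun k f \<Longrightarrow> Ck_fun k g \<Longrightarrow> i \<le> k \<Longrightarrow>
    (deriv ^^ i) (\<lambda>x. f x - g x) = (\<lambda>x. (deriv ^^ i) f x - (deriv ^^ i) g x)"
  using funpow_deriv_add[of k f "\<lambda>x. -1 * g x" i] funpow_deriv_cmult[of k g i "-1"]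
  by (simp add: Ck_fun_minus)

lemma funpow_deriv_affine:
  "Ck_fun k f \<Longrightarrow> i \<le> k \<Longrightarrow>
    (deriv ^^ i) (\<lambda>x. f (c * x + d)) = (\<lambda>x. c ^ i * (deriv ^^ i) f (c * x + d))"
proof (induction i arbitrary: f k)
  case (Suc i)
  then obtain j where k: "k = Suc j" by (cases k) auto
  have "((\<lambda>x. f (c * x + d)) has_real_derivative c * deriv f (c * x + d)) (at x)" for x
  proof -
    have "((\<lambda>x. f (c * x + d)) has_real_derivative deriv f (c * x + d) * c) (at x)"
      by (rule DERIV_chain2[OF Ck_fun_DERIV[OF Suc(2)[unfolded k]]]) (auto intro!: derivative_eq_intros)
    then show ?thesis by (simp add: mult.commute)
  qed
  then have "deriv (\<lambda>x. f (c * x + d)) = (\<lambda>x. c * deriv f (c * x + d))"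
    by (intro ext DERIV_imp_deriv)
  moreover have "Ck_fun j (\<lambda>x. deriv f (c * x + d))"
    using Suc.prems k by (intro Ck_fun_affine Ck_fun_deriv) auto
  ultimately show ?case unfolding deriv_funpow_Suc
    using Suc.IH[of j "deriv f"] Suc.prems funpow_deriv_cmult[of j "\<lambda>x. deriv f (c * x + d)" i c]
    by (simp add: k Ck_fun_deriv mult.assoc)
qed auto

text \<open>A Leibniz bound without binomial coefficients: each differentiation doubles the number
  of terms, hence 2^j. The bound on f is required at the single point x, so the lemma also serves
  where f is controlled only locally or vanishes to high order at x.\<close>

lemma funpow_deriv_mult_bound:
  "Ck_fun j f \<Longrightarrow> Ck_fun j g \<Longrightarrow> (\<And>i. i \<le> j \<Longrightarrow> \<bar>(deriv ^^ i) f x\<bar> \<le> K) \<Longrightarrow>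
    \<bar>(deriv ^^ j) (\<lambda>x. f x * g x) x\<bar> \<le> 2 ^ j * K * (\<Sum>l\<le>j. \<bar>(deriv ^^ l) g x\<bar>)"
proof (induction j arbitrary: f g)
  case 0
  show ?case using 0(3)[of 0] by (simp add: abs_mult mult_right_mono)
next
  case (Suc j)
  have K: "0 \<le> K" using Suc.prems(3)[of 0] by auto
  have f': "Ck_fun j (deriv f)" and g': "Ck_fun j (deriv g)"
    and f: "Ck_fun j f" and g: "Ck_fun j g"
    using Suc.prems by (auto intro: Ck_fun_deriv Ck_fun_Suc_mono)
  have eq: "(deriv ^^ Suc j) (\<lambda>x. f x * g x) x
     = (deriv ^^ j) (\<lambda>x. deriv f x * g x) x + (deriv ^^ j) (\<lambda>x. f x * deriv g x) x"
    unfolding deriv_funpow_Suc deriv_mult_fun[OF Suc.prems(1,2)]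
    by (subst funpow_deriv_add[of j]) (auto intro!: Ck_fun_mult f g f' g')
  have 1: "\<bar>(deriv ^^ j) (\<lambda>x. deriv f x * g x) x\<bar> \<le> 2 ^ j * K * (\<Sum>l\<le>j. \<bar>(deriv ^^ l) g x\<bar>)"
    by (rule Suc.IH[OF f' g]) (use Suc.prems(3) deriv_funpow_Suc in \<open>metis Suc_le_mono\<close>)
  have 2: "\<bar>(deriv ^^ j) (\<lambda>x. f x * deriv g x) x\<bar> \<le> 2 ^ j * K * (\<Sum>l\<le>j. \<bar>(deriv ^^ l) (deriv g) x\<bar>)"
    by (rule Suc.IH[OF f g']) (use Suc.prems(3) in auto)
  have 3: "(\<Sum>l\<le>j. \<bar>(deriv ^^ l) (deriv g) x\<bar>) \<le> (\<Sum>l\<le>Suc j. \<bar>(deriv ^^ l) g x\<bar>)"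
    by (subst sum.atMost_Suc_shift) (simp add: deriv_funpow_Suc del: funpow.simps)
  have 4: "(\<Sum>l\<le>j. \<bar>(deriv ^^ l) g x\<bar>) \<le> (\<Sum>l\<le>Suc j. \<bar>(deriv ^^ l) g x\<bar>)"
    by simp
  have "\<bar>(deriv ^^ Suc j) (\<lambda>x. f x * g x) x\<bar>
      \<le> 2 ^ j * K * (\<Sum>l\<le>j. \<bar>(deriv ^^ l) g x\<bar>) + 2 ^ j * K * (\<Sum>l\<le>j. \<bar>(deriv ^^ l) (deriv g) x\<bar>)"
    unfolding eq using 1 2 by linarith
  also have "\<dots> \<le> 2 ^ j * K * (\<Sum>l\<le>Suc j. \<bar>(deriv ^^ l) g x\<bar>) + 2 ^ j * K * (\<Sum>l\<le>Suc j. \<bar>(deriv ^^ l) g x\<bar>)"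
    using K 3 4 by (intro add_mono mult_left_mono) auto
  finally show ?case by (simp add: algebra_simps)
qed

text \<open>One constant for all orders, instead of the sum of suprema in \<open>Ck_norm\<close>, so
  that explicit constants pass easily through sums, products and reciprocals.\<close>

definition Ck_bounded :: "nat \<Rightarrow> real \<Rightarrow> (real \<Rightarrow> real) \<Rightarrow> bool" where
  "Ck_bounded k K f \<longleftrightarrow> Ck_fun k f \<and> (\<forall>i\<le>k. \<forall>x. \<bar>(deriv ^^ i) f x\<bar> \<le> K)"

lemma Ck_bounded_0: "Ck_bounded 0 K f \<longleftrightarrow> continuous_on UNIV f \<and> (\<forall>x. \<bar>f x\<bar> \<le> K)"
  by (simp add: Ck_bounded_def Ck_fun_0)

lemma Ck_boundedD: "Ck_bounded k K f \<Longrightarrow> Ck_fun k f" "Ck_bounded k K f \<Longrightarrow> i \<le> k \<Longrightarrow> \<bar>(deriv ^^ i) f x\<bar> \<le> K"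
  "Ck_bounded k K f \<Longrightarrow> \<bar>f x\<bar> \<le> K" "Ck_bounded k K f \<Longrightarrow> 0 \<le> K"
  unfolding Ck_bounded_def using order_trans[OF abs_ge_zero] by (force elim: allE[of _ 0])+

lemma Ck_bounded_mono: "Ck_bounded k K f \<Longrightarrow> j \<le> k \<Longrightarrow> K \<le> L \<Longrightarrow> Ck_bounded j L f"
  unfolding Ck_bounded_def by (meson Ck_fun_mono order_trans)

lemma Ck_bounded_Suc:
  "Ck_bounded (Suc k) K f \<longleftrightarrow> (\<forall>x. f differentiable (at x)) \<and> (\<forall>x. \<bar>f x\<bar> \<le> K) \<and> Ck_bounded k K (deriv f)"
proof -
  have "(\<forall>i\<le>Suc k. \<forall>x. \<bar>(deriv ^^ i) f x\<bar> \<le> K) \<longleftrightarrow>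
      (\<forall>x. \<bar>f x\<bar> \<le> K) \<and> (\<forall>i\<le>k. \<forall>x. \<bar>(deriv ^^ i) (deriv f) x\<bar> \<le> K)"
    unfolding deriv_funpow_Suc[symmetric]
    by (auto simp del: funpow.simps(2)) (metis Suc_le_mono funpow_0 not0_implies_Suc)
  then show ?thesis by (auto simp: Ck_bounded_def Ck_fun_Suc)
qed

lemma Ck_bounded_SucI:
  assumes "\<And>x. (f has_real_derivative f' x) (at x)" and "\<And>x. \<bar>f x\<bar> \<le> K" and "Ck_bounded k K f'"
  shows "Ck_bounded (Suc k) K f"
proof -
  have "deriv f = f'" using assms(1) by (auto intro: DERIV_imp_deriv)
  with assms show ?thesis
    by (auto simp: Ck_bounded_Suc real_differentiable_def)
qed

lemma Ck_bounded_mult: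
  assumes f: "Ck_bounded k K f" and g: "Ck_bounded k L g"
  shows "Ck_bounded k (2 ^ k * (real k + 1) * K * L) (\<lambda>x. f x * g x)"
  unfolding Ck_bounded_def
proof (intro conjI allI impI)
  show "Ck_fun k (\<lambda>x. f x * g x)" using assms by (intro Ck_fun_mult) (auto dest: Ck_boundedD)
  fix i x assume i: "i \<le> k"
  have K: "0 \<le> K" and L: "0 \<le> L" using Ck_boundedD(4)[OF f] Ck_boundedD(4)[OF g] by auto
  have "\<bar>(deriv ^^ i) (\<lambda>x. f x * g x) x\<bar> \<le> 2 ^ i * K * (\<Sum>l\<le>i. \<bar>(deriv ^^ l) g x\<bar>)"
    using i by (intro funpow_deriv_mult_bound)
      (auto intro: Ck_fun_mono[OF Ck_boundedD(1)[OF f]] Ck_fun_mono[OF Ck_boundedD(1)[OF g]] Ck_boundedD(2)[OF f])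
  also have "\<dots> \<le> 2 ^ k * K * ((real k + 1) * L)"
  proof (intro mult_mono)
    have "(\<Sum>l\<le>i. \<bar>(deriv ^^ l) g x\<bar>) \<le> (\<Sum>l\<le>i. L)"
      using i by (intro sum_mono Ck_boundedD(2)[OF g]) auto
    also have "\<dots> \<le> (real k + 1) * L" using i L by (simp add: mult_right_mono)
    finally show "(\<Sum>l\<le>i. \<bar>(deriv ^^ l) g x\<bar>) \<le> (real k + 1) * L" .
  qed (use i K L in \<open>auto intro: sum_nonneg\<close>)
  finally show "\<bar>(deriv ^^ i) (\<lambda>x. f x * g x) x\<bar> \<le> 2 ^ k * (real k + 1) * K * L" by (simp add: mult_ac)
qed

lemma Ck_bounded_add:
  "Ck_bounded k K f \<Longrightarrow> Ck_bounded k L g \<Longrightarrow> Ck_bounded k (K + L) (\<lambda>x. f x + g x)"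
  unfolding Ck_bounded_def
  by (auto simp: funpow_deriv_add[of k] intro!: Ck_fun_add order_trans[OF abs_triangle_ineq] add_mono)

lemma Ck_bounded_cmult: "Ck_bounded k K f \<Longrightarrow> Ck_bounded k (\<bar>c\<bar> * K) (\<lambda>x. c * f x)"
  unfolding Ck_bounded_def
  by (auto simp: funpow_deriv_cmult[of k] abs_mult intro!: Ck_fun_cmult mult_left_mono)

lemma Ck_bounded_diff:
  "Ck_bounded k K f \<Longrightarrow> Ck_bounded k L g \<Longrightarrow> Ck_bounded k (K + L) (\<lambda>x. f x - g x)"
  using Ck_bounded_add[of k K f L "\<lambda>x. -1 * g x"] Ck_bounded_cmult[of k L g "-1"] by simp

lemma Ck_bounded_const: "\<bar>c\<bar> \<le> K \<Longrightarrow> Ck_bounded k K (\<lambda>x. c)"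
proof (induction k arbitrary: c)
  case (Suc k)
  show ?case by (rule Ck_bounded_SucI[OF DERIV_const Suc(2) Suc.IH]) (use Suc.prems in auto)
qed (simp add: Ck_bounded_0)

section \<open>Hyperbolic functions and reciprocals with uniform derivative bounds\<close>

lemma tanh2_DERIV: "((\<lambda>x. tanh (2 * x)) has_real_derivative 2 - 2 * (tanh (2 * x) * tanh (2 * x))) (at x)"
  by (rule derivative_eq_intros refl | simp add: power2_eq_square cosh_real_nonzero)+

text \<open>The derivative of tanh (2x) is a polynomial in tanh (2x), so bounds at order k give
  bounds at order k + 1.\<close>

lemma Ck_bounded_tanh: "\<exists>K. Ck_bounded k K (\<lambda>x. tanh (2 * x))"
proof (induction k)
  case 0
  have "\<bar>tanh (2 * x)\<bar> \<le> 1" for x :: real by (simp add: abs_le_iff tanh_real_lt_1 less_imp_le tanh_real_gt_neg1 minus_le_iff)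
  then show ?case by (auto simp: Ck_bounded_0 intro!: exI[of _ 1] continuous_intros)
next
  case (Suc k)
  then obtain K where K: "Ck_bounded k K (\<lambda>x. tanh (2 * x))" ..
  have 1: "Ck_bounded k (2 + \<bar>2\<bar> * (2 ^ k * (real k + 1) * K * K)) (\<lambda>x. 2 - 2 * (tanh (2 * x) * tanh (2 * x)))"
    by (intro Ck_bounded_diff Ck_bounded_cmult Ck_bounded_mult K Ck_bounded_const) simp
  let ?L = "max K (2 + \<bar>2\<bar> * (2 ^ k * (real k + 1) * K * K))"
  have "Ck_bounded (Suc k) ?L (\<lambda>x. tanh (2 * x))"
    by (rule Ck_bounded_SucI[OF tanh2_DERIV _ Ck_bounded_mono[OF 1]])
      (use Ck_boundedD(3)[OF K] in \<open>auto intro: max.coboundedI1\<close>)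
  then show ?case by blast
qed

lemma sech2_DERIV: "((\<lambda>x. inverse (cosh (2 * x))) has_real_derivative
   -2 * (tanh (2 * x) * inverse (cosh (2 * x)))) (at x)"
  by (rule derivative_eq_intros refl | simp add: cosh_real_nonzero tanh_def divide_inverse mult_ac)+

lemma Ck_bounded_sech: "\<exists>K. Ck_bounded k K (\<lambda>x. inverse (cosh (2 * x)))"
proof (induction k)
  case 0
  have "\<bar>inverse (cosh (2 * x))\<bar> \<le> 1" for x :: real
    by (simp add: cosh_real_ge_1 inverse_le_1_iff)
  then show ?case by (auto simp: Ck_bounded_0 intro!: exI[of _ 1] continuous_intros)
next
  case (Suc k)
  then obtain K where K: "Ck_bounded k K (\<lambda>x. inverse (cosh (2 * x)))" ..
  obtain L where L: "Ck_bounded k L (\<lambda>x. tanh (2 * x))" using Ck_bounded_tanh by blast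
  have 1: "Ck_bounded k (\<bar>-2\<bar> * (2 ^ k * (real k + 1) * L * K)) (\<lambda>x. -2 * (tanh (2 * x) * inverse (cosh (2 * x))))"
    by (intro Ck_bounded_cmult Ck_bounded_mult K L)
  have "Ck_bounded (Suc k) (max K (\<bar>-2\<bar> * (2 ^ k * (real k + 1) * L * K))) (\<lambda>x. inverse (cosh (2 * x)))"
    by (rule Ck_bounded_SucI[OF sech2_DERIV _ Ck_bounded_mono[OF 1]])
      (use Ck_boundedD(3)[OF K] in \<open>auto intro: max.coboundedI1\<close>)
  then show ?case by blast
qed

lemma Ck_fun_tanh: "Ck_fun k (\<lambda>x. tanh (2 * x))"
  using Ck_bounded_tanh Ck_boundedD(1) by blast

lemma Ck_fun_sech: "Ck_fun k (\<lambda>x. inverse (cosh (2 * x)))"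
  using Ck_bounded_sech Ck_boundedD(1) by blast

lemma Ck_fun_cosh_sinh: "Ck_fun k (\<lambda>x. cosh (2 * x :: real)) \<and> Ck_fun k (\<lambda>x. sinh (2 * x :: real))"
proof (induction k)
  case 0
  show ?case by (auto simp: Ck_fun_0 intro!: continuous_intros)
next
  case (Suc k)
  have "Ck_fun (Suc k) (\<lambda>x. cosh (2 * x :: real))"
    by (rule Ck_fun_SucI[where f' = "\<lambda>x. 2 * sinh (2 * x)"])
      (auto intro!: derivative_eq_intros Ck_fun_cmult Suc[THEN conjunct2])
  moreover have "Ck_fun (Suc k) (\<lambda>x. sinh (2 * x :: real))"
    by (rule Ck_fun_SucI[where f' = "\<lambda>x. 2 * cosh (2 * x)"])
      (auto intro!: derivative_eq_intros Ck_fun_cmult Suc[THEN conjunct1])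
  ultimately show ?case by blast
qed

lemma Ck_fun_exp: "Ck_fun k (\<lambda>x. exp (c * x :: real))"
proof (induction k)
  case (Suc k)
  show ?case
    by (rule Ck_fun_SucI[where f' = "\<lambda>x. c * exp (c * x)"])
      (auto intro!: derivative_eq_intros Ck_fun_cmult Suc)
qed (auto simp: Ck_fun_0 intro!: continuous_intros)

text \<open>The order of quantifiers is the point: one L serves every g with these bounds. The final
  constant can depend on a bound for the data, and not on the data, because of this.\<close>

lemma Ck_bounded_inverse:
  "\<exists>L. \<forall>g. Ck_bounded k K g \<and> (\<forall>x. c \<le> g x) \<longrightarrow> Ck_bounded k L (\<lambda>x. inverse (g x))"
  if c: "c > (0::real)"
proof (induction k)
  case 0
  have "\<bar>inverse y\<bar> \<le> inverse c" "y \<noteq> 0" if "c \<le> y" for y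
    using c that by (auto simp: le_imp_inverse_le)
  then show ?case
    unfolding Ck_bounded_0 by (intro exI[of _ "inverse c"]) (auto intro!: continuous_intros simp del: abs_inverse)
next
  case (Suc k)
  then obtain L where L: "\<And>g. Ck_bounded k K g \<Longrightarrow> (\<And>x. c \<le> g x) \<Longrightarrow> Ck_bounded k L (\<lambda>x. inverse (g x))"
    by blast
  define M where "M = (2 ^ k * (real k + 1) * (2 ^ k * (real k + 1) * L * (\<bar>-1\<bar> * K)) * L)"
  have "Ck_bounded (Suc k) (max L M) (\<lambda>x. inverse (g x))"
    if g: "Ck_bounded (Suc k) K g" and gc: "\<And>x. c \<le> g x" for g
  proof -
    have nz: "g x \<noteq> 0" for x using gc[of x] c by auto
    have Lg: "Ck_bounded k L (\<lambda>x. inverse (g x))"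
      using g by (intro L gc Ck_bounded_mono[OF g]) auto
    have 1: "Ck_bounded k M (\<lambda>x. inverse (g x) * (-1 * deriv g x) * inverse (g x))"
      unfolding M_def using g
      by (intro Ck_bounded_mult Lg Ck_bounded_cmult) (auto simp: Ck_bounded_Suc)
    have "((\<lambda>x. inverse (g x)) has_real_derivative (inverse (g x) * (-1 * deriv g x) * inverse (g x))) (at x)" for x
      using DERIV_inverse'[OF Ck_fun_DERIV[OF Ck_boundedD(1)[OF g]] nz] by simp
    then show ?thesis
      by (rule Ck_bounded_SucI[OF _ _ Ck_bounded_mono[OF 1]])
        (use Ck_boundedD(3)[OF Lg] in \<open>auto intro: max.coboundedI1\<close>)
  qed
  then show ?case by blast
qed

section \<open>Calculus on the half plane\<close>

text \<open>Gives uniqueness of the one-sided derivatives behind \<open>Dt\<close>, including those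
  at t = 0.\<close>

lemma at_within_nonneg_neq_bot: "0 \<le> t \<Longrightarrow> at t within {0::real..} \<noteq> bot"
proof -
  assume "0 \<le> t"
  then have "at_right t \<le> at t within {0..}" by (intro at_le) auto
  then show ?thesis by (metis bot.extremum_uniqueI trivial_limit_at_right_real)
qed

lemma at_within_Icc_nonneg: "0 \<le> t \<Longrightarrow> t < b \<Longrightarrow> at t within {0..b} = at t within {0::real..}"
  by (rule at_within_nhd[of _ "{..<b}"]) auto

lemma DERIV_transform_nonneg:
  assumes "(f has_real_derivative d) (at t within {0..})" "0 \<le> t" "\<And>s. 0 \<le> s \<Longrightarrow> f s = g s"
  shows "(g has_real_derivative d) (at t within {0..})"
  by (rule has_field_derivative_transform_within[OF assms(1) zero_less_one]) (use assms in auto)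

lemma Dt_eqI: "((\<lambda>s. u s x) has_real_derivative d) (at t within {0..}) \<Longrightarrow> 0 \<le> t \<Longrightarrow> Dt u t x = d"
  unfolding Dt_def
  by (intro vector_derivative_within at_within_nonneg_neq_bot)
    (auto simp: has_real_derivative_iff_has_vector_derivative)

lemma Dx_eqI: "(u t has_real_derivative d) (at x) \<Longrightarrow> Dx u t x = d"
  unfolding Dx_def by (rule DERIV_imp_deriv)

lemma Dx_section: "Dx u t = deriv (u t)"
  by (simp add: Dx_def fun_eq_iff)

lemma Ck_halfplane_cont: "Ck_halfplane k u \<Longrightarrow> continuous_on ({0..} \<times> UNIV) (\<lambda>(t, x). u t x)"
  by (cases k) auto

lemma Ck_halfplane_0I: "Ck_halfplane k u \<Longrightarrow> Ck_halfplane 0 u"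
  using Ck_halfplane_cont by simp

lemma Ck_halfplane_Dt:
  "Ck_halfplane (Suc k) u \<Longrightarrow> 0 \<le> t \<Longrightarrow> ((\<lambda>s. u s x) has_real_derivative Dt u t x) (at t within {0..})"
  unfolding Dt_def has_real_derivative_iff_has_vector_derivative
  by (auto simp: vector_derivative_works[symmetric])

lemma Ck_halfplane_Dx:
  "Ck_halfplane (Suc k) u \<Longrightarrow> 0 \<le> t \<Longrightarrow> (u t has_real_derivative Dx u t x) (at x)"
  by (simp add: Dx_section DERIV_deriv_iff_real_differentiable)

lemma Ck_halfplane_DtD: "Ck_halfplane (Suc k) u \<Longrightarrow> Ck_halfplane k (Dt u)"
  and Ck_halfplane_DxD: "Ck_halfplane (Suc k) u \<Longrightarrow> Ck_halfplane k (Dx u)"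
  by auto

text \<open>Formulas for \<open>Dt u\<close> and \<open>Dx u\<close> are available for nonnegative
  times; this lemma lets them replace the derivatives themselves.\<close>

lemma Ck_halfplane_cong':
  "Ck_halfplane k u \<Longrightarrow> (\<And>t x. 0 \<le> t \<Longrightarrow> v t x = u t x) \<Longrightarrow> Ck_halfplane k v"
proof (induction k arbitrary: u v)
  case 0
  then show ?case by (auto cong: continuous_on_cong_simp intro!: continuous_on_eq[OF 0(1)[unfolded Ck_halfplane.simps]])
next
  case (Suc k)
  have sec: "v t = u t" if "0 \<le> t" for t using Suc(3)[OF that] by auto
  have t: "((\<lambda>s. v s x) has_real_derivative Dt u t x) (at t within {0..})" if "0 \<le> t" for t x
    by (rule DERIV_transform_nonneg[OF Ck_halfplane_Dt[OF Suc(2) that] that]) (simp add: Suc(3))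
  have Dt: "Dt v t x = Dt u t x" if "0 \<le> t" for t x by (rule Dt_eqI[OF t[OF that] that])
  have Dx: "Dx v t x = Dx u t x" if "0 \<le> t" for t x by (simp add: Dx_section sec that)
  have "Ck_halfplane k (Dt v)" "Ck_halfplane k (Dx v)"
    using Suc.IH Ck_halfplane_DtD[OF Suc(2)] Ck_halfplane_DxD[OF Suc(2)] Dt Dx by blast+
  moreover have "continuous_on ({0..} \<times> UNIV) (\<lambda>(t, x). v t x)"
    by (rule continuous_on_eq[OF Ck_halfplane_cont[OF Suc(2)]]) (auto simp: Suc(3))
  moreover have "(\<lambda>s. v s x) differentiable (at t within {0..})" if "0 \<le> t" for t x
    using t[OF that] real_differentiable_def by blast
  ultimately show ?case using sec Suc(2) by simp
qed

lemma Ck_halfplane_SucI: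
  assumes c: "continuous_on ({0..} \<times> UNIV) (\<lambda>(t, x). u t x)"
    and t: "\<And>t x. 0 \<le> t \<Longrightarrow> ((\<lambda>s. u s x) has_real_derivative ut t x) (at t within {0..})"
    and x: "\<And>t x. 0 \<le> t \<Longrightarrow> (u t has_real_derivative ux t x) (at x)"
    and "Ck_halfplane k ut" "Ck_halfplane k ux"
  shows "Ck_halfplane (Suc k) u"
proof -
  have "Ck_halfplane k (Dt u)"
    by (rule Ck_halfplane_cong'[OF assms(4)]) (rule Dt_eqI[OF t], assumption+)
  moreover have "Ck_halfplane k (Dx u)"
    by (rule Ck_halfplane_cong'[OF assms(5)]) (rule Dx_eqI[OF x])
  moreover have "(\<lambda>s. u s x) differentiable (at t within {0..})" if "0 \<le> t" for t x
    using t[OF that] real_differentiable_def by blast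
  moreover have "u t differentiable (at x)" if "0 \<le> t" for t x
    using x[OF that] real_differentiable_def by blast
  ultimately show ?thesis using c by simp
qed

lemma Ck_halfplane_Suc_mono: "Ck_halfplane (Suc k) u \<Longrightarrow> Ck_halfplane k u"
proof (induction k arbitrary: u)
  case (Suc k)
  show ?case
    by (rule Ck_halfplane_SucI[OF Ck_halfplane_cont[OF Suc(2)] Ck_halfplane_Dt[OF Suc(2)] Ck_halfplane_Dx[OF Suc(2)]
        Suc.IH[OF Ck_halfplane_DtD[OF Suc(2)]] Suc.IH[OF Ck_halfplane_DxD[OF Suc(2)]]])
qed auto

lemma Ck_halfplane_mono: "Ck_halfplane k u \<Longrightarrow> j \<le> k \<Longrightarrow> Ck_halfplane j u"
  by (induction k) (use Ck_halfplane_Suc_mono le_Suc_eq in blast)+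

lemma Ck_halfplane_add:
  "Ck_halfplane k u \<Longrightarrow> Ck_halfplane k v \<Longrightarrow> Ck_halfplane k (\<lambda>t x. u t x + v t x)"
proof (induction k arbitrary: u v)
  case 0
  then show ?case by (auto simp: case_prod_unfold intro!: continuous_on_add)
next
  case (Suc k)
  note u = Suc(2) and v = Suc(3)
  show ?case
  proof (rule Ck_halfplane_SucI)
    show "continuous_on ({0..} \<times> UNIV) (\<lambda>(t, x). u t x + v t x)"
      using Ck_halfplane_cont[OF u] Ck_halfplane_cont[OF v]
      by (auto simp: case_prod_unfold intro!: continuous_on_add)
    show "((\<lambda>s. u s x + v s x) has_real_derivative Dt u t x + Dt v t x) (at t within {0..})" if "0 \<le> t" for t x
      by (intro DERIV_add Ck_halfplane_Dt[OF u] Ck_halfplane_Dt[OF v] that)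
    show "((\<lambda>x. u t x + v t x) has_real_derivative Dx u t x + Dx v t x) (at x)" if "0 \<le> t" for t x
      by (intro DERIV_add Ck_halfplane_Dx[OF u] Ck_halfplane_Dx[OF v] that)
  qed (intro Suc.IH Ck_halfplane_DtD[OF u] Ck_halfplane_DtD[OF v] Ck_halfplane_DxD[OF u] Ck_halfplane_DxD[OF v])+
qed

lemma Ck_halfplane_mult:
  "Ck_halfplane k u \<Longrightarrow> Ck_halfplane k v \<Longrightarrow> Ck_halfplane k (\<lambda>t x. u t x * v t x)"
proof (induction k arbitrary: u v)
  case 0
  then show ?case by (auto simp: case_prod_unfold intro!: continuous_on_mult)
next
  case (Suc k)
  note u = Suc(2) and v = Suc(3)
  note u' = Ck_halfplane_Suc_mono[OF u] and v' = Ck_halfplane_Suc_mono[OF v]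
  show ?case
  proof (rule Ck_halfplane_SucI)
    show "continuous_on ({0..} \<times> UNIV) (\<lambda>(t, x). u t x * v t x)"
      using Ck_halfplane_cont[OF u] Ck_halfplane_cont[OF v]
      by (auto simp: case_prod_unfold intro!: continuous_on_mult)
    show "((\<lambda>s. u s x * v s x) has_real_derivative Dt u t x * v t x + Dt v t x * u t x) (at t within {0..})" if "0 \<le> t" for t x
      by (intro DERIV_mult Ck_halfplane_Dt[OF u] Ck_halfplane_Dt[OF v] that)
    show "((\<lambda>x. u t x * v t x) has_real_derivative Dx u t x * v t x + Dx v t x * u t x) (at x)" if "0 \<le> t" for t x
      by (intro DERIV_mult Ck_halfplane_Dx[OF u] Ck_halfplane_Dx[OF v] that)
  qed (intro Ck_halfplane_add Suc.IH u' v' Ck_halfplane_DtD[OF u] Ck_halfplane_DtD[OF v] Ck_halfplane_DxD[OF u] Ck_halfplane_DxD[OF v])+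
qed

lemma Ck_halfplane_x: "Ck_fun k f \<Longrightarrow> Ck_halfplane k (\<lambda>t. f)"
proof (induction k arbitrary: f)
  case 0
  then show ?case
    by (auto simp: Ck_fun_0 case_prod_unfold intro!: continuous_on_compose2[of UNIV f] continuous_intros)
next
  case (Suc k)
  have 0: "Ck_halfplane k (\<lambda>t x. 0)" using Suc.IH[OF Ck_fun_const[of k 0]] .
  show ?case
  proof (rule Ck_halfplane_SucI[OF _ _ _ 0 Suc.IH[OF Ck_fun_deriv[OF Suc(2)]]])
    show "continuous_on ({0..} \<times> UNIV) (\<lambda>(t::real, x). f x)"
      using Ck_fun_continuous[OF Suc(2)]
      by (auto simp: case_prod_unfold intro!: continuous_on_compose2[of UNIV f] continuous_intros)
  qed (auto intro: Ck_fun_DERIV[OF Suc(2)])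
qed

lemma Ck_halfplane_const: "Ck_halfplane k (\<lambda>t x. c)"
  by (rule Ck_halfplane_x[OF Ck_fun_const])

lemma Ck_halfplane_t: "Ck_fun k f \<Longrightarrow> Ck_halfplane k (\<lambda>t x. f t)"
proof (induction k arbitrary: f)
  case 0
  then show ?case
    by (auto simp: Ck_fun_0 case_prod_unfold intro!: continuous_on_compose2[of UNIV f] continuous_intros)
next
  case (Suc k)
  show ?case
  proof (rule Ck_halfplane_SucI[OF _ _ _ Suc.IH[OF Ck_fun_deriv[OF Suc(2)]] Ck_halfplane_const[of k 0]])
    show "continuous_on ({0..} \<times> UNIV) (\<lambda>(t, x::real). f t)"
      using Ck_fun_continuous[OF Suc(2)]
      by (auto simp: case_prod_unfold intro!: continuous_on_compose2[of UNIV f] continuous_intros)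
  qed (auto intro: has_field_derivative_at_within Ck_fun_DERIV[OF Suc(2)])
qed

lemma Ck_halfplane_cmult: "Ck_halfplane k u \<Longrightarrow> Ck_halfplane k (\<lambda>t x. c * u t x)"
  by (intro Ck_halfplane_mult Ck_halfplane_const)

lemma Ck_halfplane_minus: "Ck_halfplane k u \<Longrightarrow> Ck_halfplane k (\<lambda>t x. - u t x)"
  using Ck_halfplane_cmult[of k u "-1"] by simp

lemma Ck_halfplane_diff:
  "Ck_halfplane k u \<Longrightarrow> Ck_halfplane k v \<Longrightarrow> Ck_halfplane k (\<lambda>t x. u t x - v t x)"
  using Ck_halfplane_add[OF _ Ck_halfplane_minus] by fastforce

lemma Ck_halfplane_inverse:
  "Ck_halfplane k u \<Longrightarrow> (\<And>t x. 0 \<le> t \<Longrightarrow> u t x \<noteq> 0) \<Longrightarrow> Ck_halfplane k (\<lambda>t x. inverse (u t x))"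
proof (induction k)
  case 0
  then show ?case by (auto simp: case_prod_unfold intro!: continuous_on_inverse)
next
  case (Suc k)
  note u = Suc(2)
  have inv: "Ck_halfplane k (\<lambda>t x. inverse (u t x))"
    by (rule Suc.IH[OF Ck_halfplane_Suc_mono[OF u] Suc(3)])
  show ?case
  proof (rule Ck_halfplane_SucI)
    show "continuous_on ({0..} \<times> UNIV) (\<lambda>(t, x). inverse (u t x))"
      using Ck_halfplane_cont[OF u] Suc(3) by (auto simp: case_prod_unfold intro!: continuous_on_inverse)
    show "((\<lambda>s. inverse (u s x)) has_real_derivative - (inverse (u t x) * Dt u t x * inverse (u t x))) (at t within {0..})"
      if "0 \<le> t" for t x
      by (rule DERIV_inverse'[OF Ck_halfplane_Dt[OF u that] Suc(3)[OF that]])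
    show "((\<lambda>x. inverse (u t x)) has_real_derivative - (inverse (u t x) * Dx u t x * inverse (u t x))) (at x)"
      if "0 \<le> t" for t x
      by (rule DERIV_inverse'[OF Ck_halfplane_Dx[OF u that] Suc(3)[OF that]])
  qed (intro Ck_halfplane_minus Ck_halfplane_mult inv Ck_halfplane_DtD[OF u] Ck_halfplane_DxD[OF u])+
qed

lemma Ck_halfplane_divide:
  "Ck_halfplane k u \<Longrightarrow> Ck_halfplane k v \<Longrightarrow> (\<And>t x. 0 \<le> t \<Longrightarrow> v t x \<noteq> 0) \<Longrightarrow>
    Ck_halfplane k (\<lambda>t x. u t x / v t x)"
  unfolding divide_inverse by (intro Ck_halfplane_mult Ck_halfplane_inverse) auto

section \<open>Time slices and rules for \<open>Dt\<close> and \<open>Dx\<close>\<close>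

lemma Dx_funpow_section: "(Dx ^^ i) u t = (deriv ^^ i) (u t)"
  by (induction i) (auto simp: Dx_section)

lemma Dx_funpow_Suc: "(Dx ^^ Suc i) u = (Dx ^^ i) (Dx u)"
  by (simp only: funpow_Suc_right o_apply)

lemma Ck_halfplane_section_cont: "Ck_halfplane k u \<Longrightarrow> 0 \<le> t \<Longrightarrow> continuous_on A (u t)"
  by (rule continuous_on_compose2[OF Ck_halfplane_cont, of k u A "\<lambda>x. (t, x)", simplified])
    (auto intro!: continuous_intros)

lemma Ck_halfplane_time_cont: "Ck_halfplane k u \<Longrightarrow> A \<subseteq> {0..} \<Longrightarrow> continuous_on A (\<lambda>s. u s x)"
  by (rule continuous_on_compose2[OF Ck_halfplane_cont, of k u A "\<lambda>s. (s, x)", simplified])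
    (auto intro!: continuous_intros)

lemma Ck_halfplane_section: "Ck_halfplane k u \<Longrightarrow> 0 \<le> t \<Longrightarrow> Ck_fun k (u t)"
proof (induction k arbitrary: u)
  case 0
  then show ?case using Ck_halfplane_section_cont[OF 0] by (simp add: Ck_fun_0)
next
  case (Suc k)
  show ?case
    by (rule Ck_fun_SucI[OF Ck_halfplane_Dx[OF Suc(2,3)] Suc.IH[OF Ck_halfplane_DxD[OF Suc(2)] Suc(3)]])
qed

lemma Dt_cong: "(\<And>s. 0 \<le> s \<Longrightarrow> u s x = v s x) \<Longrightarrow> 0 \<le> t \<Longrightarrow> Dt u t x = Dt v t x"
  unfolding Dt_def by (rule vector_derivative_cong_eq) (auto simp: eventually_at_filter)

lemma Dt_diff: "Ck_halfplane (Suc k) u \<Longrightarrow> Ck_halfplane (Suc k) v \<Longrightarrow> 0 \<le> t \<Longrightarrow>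
    Dt (\<lambda>t x. u t x - v t x) t x = Dt u t x - Dt v t x"
  by (intro Dt_eqI DERIV_diff Ck_halfplane_Dt)

lemma Dx_add: "Ck_halfplane (Suc k) u \<Longrightarrow> Ck_halfplane (Suc k) v \<Longrightarrow> 0 \<le> t \<Longrightarrow>
    Dx (\<lambda>t x. u t x + v t x) t x = Dx u t x + Dx v t x"
  by (intro Dx_eqI DERIV_add Ck_halfplane_Dx)

lemma Dx_diff: "Ck_halfplane (Suc k) u \<Longrightarrow> Ck_halfplane (Suc k) v \<Longrightarrow> 0 \<le> t \<Longrightarrow>
    Dx (\<lambda>t x. u t x - v t x) t x = Dx u t x - Dx v t x"
  by (intro Dx_eqI DERIV_diff Ck_halfplane_Dx)

text \<open>Total differentiability from partial derivatives, with continuity of \<open>Dx u\<close>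
  as the essential input; the time derivative may then be one-sided at t = 0. The chain rule along
  the line s -> (s, x + c s) finishes.\<close>

lemma has_derivative_along_characteristic:
  assumes u: "Ck_halfplane (Suc k) u" and t: "0 \<le> t"
  shows "((\<lambda>s. u s (x + c * s)) has_real_derivative Dt u t (x + c * t) + c * Dx u t (x + c * t)) (at t within {0..})"
proof -
  let ?y = "x + c * t"
  have c: "continuous_on ({0..} \<times> UNIV) (\<lambda>(t, x). Dx u t x)"
    by (rule Ck_halfplane_cont[OF Ck_halfplane_DxD[OF u]])
  then have "((\<lambda>(t, x). Dx u t x) \<longlongrightarrow> Dx u t ?y) (at (t, ?y) within {0..} \<times> UNIV)"
    using t by (auto simp: continuous_on_def dest!: bspec[of _ _ "(t, ?y)"])
  from bounded_linear.tendsto[OF bounded_linear_blinfun_mult_right this]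
  have lim: "((\<lambda>(t, x). blinfun_mult_right (Dx u t x)) \<longlongrightarrow> blinfun_mult_right (Dx u t ?y)) (at (t, ?y) within {0..} \<times> UNIV)"
    by (simp add: case_prod_unfold)
  have "((\<lambda>(t, x). u t x) has_derivative (\<lambda>(tx, ty). Dt u t ?y * tx + blinfun_apply (blinfun_mult_right (Dx u t ?y)) ty))
     (at (t, ?y) within {0..} \<times> UNIV)"
  proof (rule has_derivative_partialsI)
    show "((\<lambda>s. u s ?y) has_derivative (\<lambda>tx. Dt u t ?y * tx)) (at t within {0..})"
      using Ck_halfplane_Dt[OF u t] by (simp add: has_field_derivative_def)
    show "(u s has_derivative blinfun_apply (blinfun_mult_right (Dx u s y))) (at y within UNIV)"
      if "s \<in> {0..}" for s y
      using Ck_halfplane_Dx[OF u, of s y] that by (simp add: has_field_derivative_def)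
    show "continuous (at (t, ?y) within {0..} \<times> UNIV) (\<lambda>(t, x). blinfun_mult_right (Dx u t x))"
      using lim by (simp add: continuous_within)
  qed auto
  then have 1: "((\<lambda>(t, x). u t x) has_derivative (\<lambda>(tx, ty). Dt u t ?y * tx + Dx u t ?y * ty))
     (at (t, ?y) within {0..} \<times> UNIV)" by simp
  have 2: "((\<lambda>s. (s, x + c * s)) has_derivative (\<lambda>h. (h, c * h))) (at t within {0..})"
    by (auto intro!: derivative_eq_intros)
  have "((\<lambda>s. u s (x + c * s)) has_derivative (\<lambda>h. Dt u t ?y * h + Dx u t ?y * (c * h))) (at t within {0..})"
  proof -
    have "(\<lambda>s. (s, x + c * s)) ` {0..} \<subseteq> {0..} \<times> UNIV" by auto
    from has_derivative_in_compose[OF 2 has_derivative_subset[OF 1 this]]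
    show ?thesis by simp
  qed
  then show ?thesis
    unfolding has_field_derivative_def by (rule has_derivative_eq_rhs) (simp add: fun_eq_iff algebra_simps)
qed

text \<open>Coordinates moving with speed c: transport along characteristics becomes integration in
  t at fixed x, and \<open>shift (- c)\<close> undoes \<open>shift c\<close>.\<close>

definition shift :: "real \<Rightarrow> (real \<Rightarrow> real \<Rightarrow> real) \<Rightarrow> real \<Rightarrow> real \<Rightarrow> real" where
  "shift c u t x = u t (x + c * t)"

lemma shift_DERIV_t:
  "Ck_halfplane (Suc k) u \<Longrightarrow> 0 \<le> t \<Longrightarrow>
    ((\<lambda>s. shift c u s x) has_real_derivative shift c (Dt u) t x + c * shift c (Dx u) t x) (at t within {0..})"
  unfolding shift_def by (rule has_derivative_along_characteristic)

lemma shift_DERIV_x: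
  "(u t has_real_derivative d) (at (x + c * t)) \<Longrightarrow> (shift c u t has_real_derivative d) (at x)"
  unfolding shift_def by (simp add: DERIV_shift)

lemma Ck_halfplane_shift: "Ck_halfplane k u \<Longrightarrow> Ck_halfplane k (shift c u)"
proof (induction k arbitrary: u)
  case 0
  show ?case
    using Ck_halfplane_cont[OF 0] unfolding shift_def Ck_halfplane.simps
    by (auto simp: case_prod_unfold intro!: continuous_intros
        continuous_on_compose2[of "{0..} \<times> UNIV" "\<lambda>z. u (fst z) (snd z)" _ "\<lambda>z. (fst z, snd z + c * fst z)", simplified])
next
  case (Suc k)
  show ?case
  proof (rule Ck_halfplane_SucI[OF _ shift_DERIV_t[OF Suc(2)] shift_DERIV_x])
    show "continuous_on ({0..} \<times> UNIV) (\<lambda>(t, x). shift c u t x)"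
      using Ck_halfplane_cont[OF Suc(2)] unfolding shift_def
      by (auto simp: case_prod_unfold intro!: continuous_intros
        continuous_on_compose2[of "{0..} \<times> UNIV" "\<lambda>z. u (fst z) (snd z)" _ "\<lambda>z. (fst z, snd z + c * fst z)", simplified])
    show "(u t has_real_derivative shift c (Dx u) t x) (at (x + c * t))" if "0 \<le> t" for t x
      unfolding shift_def by (rule Ck_halfplane_Dx[OF Suc(2) that])
    show "0 \<le> t" if "0 \<le> t" for t :: real by fact
    show "Ck_halfplane k (\<lambda>t x. shift c (Dt u) t x + c * shift c (Dx u) t x)" "Ck_halfplane k (shift c (Dx u))"
      using Suc.IH[OF Ck_halfplane_DtD[OF Suc(2)]] Suc.IH[OF Ck_halfplane_DxD[OF Suc(2)]]
      by (simp_all only: Ck_halfplane_add Ck_halfplane_cmult)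
  qed
qed

section \<open>Integration in time and exchange of derivatives\<close>

definition tint :: "(real \<Rightarrow> real \<Rightarrow> real) \<Rightarrow> real \<Rightarrow> real \<Rightarrow> real" where
  "tint u t x = integral {0..t} (\<lambda>s. u s x)"

lemma tint_DERIV_t:
  assumes "Ck_halfplane k u" "0 \<le> t"
  shows "((\<lambda>s. tint u s x) has_real_derivative u t x) (at t within {0..})"
proof -
  have "((\<lambda>s. tint u s x) has_real_derivative u t x) (at t within {0..t+1})"
    unfolding tint_def
    by (rule integral_has_real_derivative[OF Ck_halfplane_time_cont[OF assms(1)]]) (use assms in auto)
  then show ?thesis using at_within_Icc_nonneg[of t "t+1"] assms by simp
qed

lemma tint_DERIV_x:
  assumes u: "Ck_halfplane k u" and ux: "Ck_halfplane j ux"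
    and d: "\<And>t x. 0 \<le> t \<Longrightarrow> (u t has_real_derivative ux t x) (at x)" and t: "0 \<le> t"
  shows "(tint u t has_real_derivative tint ux t x) (at x)"
proof -
  have "((\<lambda>x. integral (cbox 0 t) (\<lambda>s. u s x)) has_field_derivative integral (cbox 0 t) (\<lambda>s. ux s x)) (at x within UNIV)"
  proof (rule leibniz_rule_field_derivative)
    show "continuous_on (UNIV \<times> cbox 0 t) (\<lambda>(x, s). ux s x)"
      using Ck_halfplane_cont[OF ux]
      by (auto simp: case_prod_unfold intro!: continuous_intros
        continuous_on_compose2[of "{0..} \<times> UNIV" "\<lambda>z. ux (fst z) (snd z)" _ "\<lambda>z. (snd z, fst z)", simplified])
    show "(\<lambda>s. u s x) integrable_on cbox 0 t" for x
      using integrable_continuous[of 0 t "\<lambda>s. u s x"] Ck_halfplane_time_cont[OF u, of "{0..t}" x] by auto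
  qed (use d in auto)
  then show ?thesis by (simp add: tint_def[abs_def] fun_eq_iff)
qed

lemma tint_cont:
  assumes u: "Ck_halfplane k u"
  shows "continuous_on ({0..} \<times> UNIV) (\<lambda>(t, x). tint u t x)"
proof -
  \<comment> \<open>Rescaling to the fixed interval [0, 1], because continuity of parameter
    integrals is available for an interval independent of the parameter.\<close>
  have eq: "tint u t x = integral (cbox 0 1) (\<lambda>\<sigma>. t * u (t * \<sigma>) x)" if t: "0 \<le> t" for t x
  proof -
    have "((\<lambda>\<sigma>. t * u (t * \<sigma>) x) has_integral tint u (t * 1) x - tint u (t * 0) x) {0..1}"
    proof (rule fundamental_theorem_of_calculus)
      fix \<sigma> :: real assume s: "\<sigma> \<in> {0..1}"
      have "(\<lambda>\<sigma>. t * \<sigma>) ` {0..1} \<subseteq> {0..}" using t by auto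
      then have "((\<lambda>s. tint u s x) has_real_derivative u (t * \<sigma>) x) (at (t * \<sigma>) within (\<lambda>\<sigma>. t * \<sigma>) ` {0..1})"
        using s t by (intro DERIV_subset[OF tint_DERIV_t[OF u]]) auto
      from DERIV_image_chain[OF this, of t]
      have "((\<lambda>\<sigma>. tint u (t * \<sigma>) x) has_real_derivative u (t * \<sigma>) x * t) (at \<sigma> within {0..1})"
        by (auto simp: o_def intro!: derivative_eq_intros)
      then show "((\<lambda>\<sigma>. tint u (t * \<sigma>) x) has_vector_derivative t * u (t * \<sigma>) x) (at \<sigma> within {0..1})"
        unfolding has_real_derivative_iff_has_vector_derivative[symmetric]
        by (simp add: mult.commute)
    qed auto
    then have "tint u t x = integral {0..1} (\<lambda>\<sigma>. t * u (t * \<sigma>) x)"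
      by (subst integral_unique) (simp_all add: tint_def)
    then show ?thesis by simp
  qed
  have "continuous_on ({0..} \<times> UNIV) (\<lambda>z. integral (cbox 0 1) (\<lambda>\<sigma>. fst z * u (fst z * \<sigma>) (snd z)))"
    by (rule integral_continuous_on_param)
      (use Ck_halfplane_cont[OF u] in \<open>auto simp: case_prod_unfold intro!: continuous_intros
        continuous_on_compose2[of "{0..} \<times> UNIV" "\<lambda>z. u (fst z) (snd z)" _ "\<lambda>z. (fst (fst z) * snd z, snd (fst z))", simplified]\<close>)
  then show ?thesis
    by (rule continuous_on_eq) (auto simp: eq)
qed

lemma Ck_halfplane_tint: "Ck_halfplane k u \<Longrightarrow> Ck_halfplane k (tint u)"
proof (induction k arbitrary: u)
  case 0
  then show ?case using tint_cont[OF 0] by (simp only: Ck_halfplane.simps)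
next
  case (Suc k)
  show ?case
    by (rule Ck_halfplane_SucI[OF tint_cont[OF Suc(2)] tint_DERIV_t[OF Suc(2)]
          tint_DERIV_x[OF Suc(2) Ck_halfplane_DxD[OF Suc(2)] Ck_halfplane_Dx[OF Suc(2)]]
          Ck_halfplane_Suc_mono[OF Suc(2)] Suc.IH[OF Ck_halfplane_DxD[OF Suc(2)]]])
qed

lemma tint_FTC:
  assumes w: "Ck_halfplane k w" and d: "\<And>t. 0 \<le> t \<Longrightarrow> ((\<lambda>s. u s x) has_real_derivative w t x) (at t within {0..})"
    and t: "0 \<le> t"
  shows "u t x = u 0 x + tint w t x"
proof -
  have "((\<lambda>s. w s x) has_integral u t x - u 0 x) {0..t}"
    by (rule fundamental_theorem_of_calculus)
      (use t in \<open>auto simp: has_real_derivative_iff_has_vector_derivative[symmetric] intro!: DERIV_subset[OF d]\<close>)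
  then show ?thesis by (simp add: tint_def integral_unique)
qed

text \<open>Schwarz's theorem by integration: u is its initial value plus the time integral of w,
  differentiation under the integral writes \<open>ux\<close> as a time integral of
  \<open>wx\<close>, and the fundamental theorem reads off its derivative.\<close>

lemma mixed_derivative:
  assumes ut: "\<And>t x. 0 \<le> t \<Longrightarrow> ((\<lambda>s. u s x) has_real_derivative w t x) (at t within {0..})"
    and ux: "\<And>t x. 0 \<le> t \<Longrightarrow> (u t has_real_derivative ux t x) (at x)"
    and wx: "\<And>t x. 0 \<le> t \<Longrightarrow> (w t has_real_derivative wx t x) (at x)"
    and w: "Ck_halfplane k w" and wxc: "Ck_halfplane j wx" and t: "0 \<le> t"
  shows "((\<lambda>s. ux s x) has_real_derivative wx t x) (at t within {0..})"
proof -
  have eq: "u s = (\<lambda>x. u 0 x + tint w s x)" if "0 \<le> s" for s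
    using tint_FTC[of k w u, OF w ut that] by auto
  have 1: "ux s x = ux 0 x + tint wx s x" if s: "0 \<le> s" for s x
  proof (rule DERIV_unique[OF ux[OF s]])
    have "((\<lambda>x. u 0 x + tint w s x) has_real_derivative ux 0 x + tint wx s x) (at x)"
    proof (rule DERIV_add)
      show "(u 0 has_real_derivative ux 0 x) (at x)" using ux by simp
      show "(tint w s has_real_derivative tint wx s x) (at x)"
        by (rule tint_DERIV_x[OF w wxc _ s]) (rule wx)
    qed
    then show "(u s has_real_derivative ux 0 x + tint wx s x) (at x)"
      by (simp only: eq[OF s, symmetric])
  qed
  have 2: "((\<lambda>s. ux 0 x + tint wx s x) has_real_derivative 0 + wx t x) (at t within {0..})"
    by (rule DERIV_add[OF DERIV_const tint_DERIV_t[OF wxc t]])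
  show ?thesis
    by (rule DERIV_transform_nonneg[OF 2[simplified] t]) (rule 1[symmetric])
qed

lemma Dx_Dt_DERIV:
  "Ck_halfplane (Suc (Suc k)) u \<Longrightarrow> 0 \<le> t \<Longrightarrow>
    ((\<lambda>s. Dx u s x) has_real_derivative Dx (Dt u) t x) (at t within {0..})"
proof -
  assume u: "Ck_halfplane (Suc (Suc k)) u" and t: "0 \<le> t"
  show ?thesis
    by (rule mixed_derivative[OF Ck_halfplane_Dt[OF u] _ _ Ck_halfplane_DtD[OF u] Ck_halfplane_DxD[OF Ck_halfplane_DtD[OF u]] t])
      (assumption | rule Ck_halfplane_Dx[OF u] | rule Ck_halfplane_Dx[OF Ck_halfplane_DtD[OF u]])+
qed

lemma Dt_Dx_commute:
  "Ck_halfplane (Suc (Suc k)) u \<Longrightarrow> 0 \<le> t \<Longrightarrow> Dt (Dx u) t x = Dx (Dt u) t x"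
  by (rule Dt_eqI[OF Dx_Dt_DERIV])

lemma DERIV_nonneg_mono:
  assumes d: "\<And>s. 0 \<le> s \<Longrightarrow> s \<le> t \<Longrightarrow> (g has_real_derivative g' s) (at s within {0..})"
    and nn: "\<And>s. 0 \<le> s \<Longrightarrow> s \<le> t \<Longrightarrow> 0 \<le> g' s" and t: "0 \<le> t"
  shows "g 0 \<le> g t"
proof (cases "t = 0")
  case False
  have i: "(g has_real_derivative g' s) (at s)" if "0 < s" "s < t" for s
    using d[of s] that at_within_interior[of s "{0..}"] by simp
  have "continuous_on {0..t} g"
    using d by (intro DERIV_continuous_on[of _ g g']) (auto intro!: DERIV_subset[OF d])
  then obtain l z where z: "0 < z" "z < t" "(g has_real_derivative l) (at z)" "g t - g 0 = (t - 0) * l"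
    using MVT[of 0 t g] i t False by (auto simp: real_differentiable_def)
  then have "l = g' z" using i DERIV_unique by blast
  then have "0 \<le> (t - 0) * l" using z nn[of z] t by simp
  then show ?thesis using z(4) by linarith
qed simp

text \<open>Comparison with an explicit primitive h replaces the evaluation of integrals in all
  bounds along characteristics.\<close>

lemma DERIV_bound_diff:
  assumes f: "\<And>s. 0 \<le> s \<Longrightarrow> s \<le> t \<Longrightarrow> (f has_real_derivative f' s) (at s within {0..})"
    and h: "\<And>s. 0 \<le> s \<Longrightarrow> s \<le> t \<Longrightarrow> (h has_real_derivative h' s) (at s within {0..})"
    and b: "\<And>s. 0 \<le> s \<Longrightarrow> s \<le> t \<Longrightarrow> \<bar>f' s\<bar> \<le> h' s" and t: "0 \<le> t"
  shows "\<bar>f t - f 0\<bar> \<le> h t - h 0"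
proof -
  have "h 0 - f 0 \<le> h t - f t"
    by (rule DERIV_nonneg_mono[where g = "\<lambda>s. h s - f s" and g' = "\<lambda>s. h' s - f' s", OF _ _ t])
      (use b in \<open>force intro!: DERIV_diff f h\<close>)+
  moreover have "h 0 + f 0 \<le> h t + f t"
    by (rule DERIV_nonneg_mono[where g = "\<lambda>s. h s + f s" and g' = "\<lambda>s. h' s + f' s", OF _ _ t])
      (use b in \<open>force intro!: DERIV_add f h\<close>)+
  ultimately show ?thesis by linarith
qed

section \<open>Uniqueness for the linear wave equation\<close>

text \<open>Along a characteristic, \<open>d\<^sub>t - c d\<^sub>x\<close> is the integral of a lower order term. On a backward
  triangle the weighted maximum of \<open>\<bar>d\<^sub>t + d\<^sub>x\<bar> + \<bar>d\<^sub>t - d\<^sub>x\<bar>\<close> is then at most half of itself.\<close>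

lemma wave_uniqueness:
  fixes d :: "real \<Rightarrow> real \<Rightarrow> real"
  assumes d: "Ck_halfplane 2 d" and al: "Ck_halfplane 0 al" and be: "Ck_halfplane 0 be"
    and eq: "\<And>t x. 0 \<le> t \<Longrightarrow> Dt (Dt d) t x - Dx (Dx d) t x + al t x * Dt d t x + be t x * Dx d t x = 0"
    and init: "\<And>x. d 0 x = 0" "\<And>x. Dt d 0 x = 0" and T: "0 \<le> T"
  shows "d T x0 = 0"
proof -
  have d2: "Ck_halfplane (Suc (Suc 0)) d" using d by (simp add: numeral_2_eq_2)
  have dt: "Ck_halfplane (Suc 0) (Dt d)" and dx: "Ck_halfplane (Suc 0) (Dx d)"
    using Ck_halfplane_DtD[OF d2] Ck_halfplane_DxD[OF d2] by auto
  define P where "P c t x = Dt d t x - c * Dx d t x" for c t x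
  have P: "Ck_halfplane (Suc 0) (P c)" for c
    unfolding P_def[abs_def] by (intro Ck_halfplane_diff Ck_halfplane_cmult dt dx)
  have Pchar: "Dt (P c) t x + c * Dx (P c) t x = - (al t x * Dt d t x + be t x * Dx d t x)"
    if t: "0 \<le> t" and c: "c * c = 1" for c t x
  proof -
    have cdx: "Ck_halfplane (Suc 0) (\<lambda>t x. c * Dx d t x)" by (intro Ck_halfplane_cmult dx)
    have c1: "Dt (\<lambda>t x. c * Dx d t x) t x = c * Dx (Dt d) t x"
      by (intro Dt_eqI DERIV_cmult Dx_Dt_DERIV[OF d2] t)
    have c2: "Dx (\<lambda>t x. c * Dx d t x) t x = c * Dx (Dx d) t x"
      by (intro Dx_eqI DERIV_cmult Ck_halfplane_Dx[OF dx] t)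
    have "Dt (P c) t x + c * Dx (P c) t x = Dt (Dt d) t x - (c * c) * Dx (Dx d) t x"
      unfolding P_def[abs_def] Dt_diff[OF dt cdx t] Dx_diff[OF dt cdx t] c1 c2
      by (simp add: algebra_simps)
    then show ?thesis using eq[OF t, of x] c by simp
  qed
  have P0: "P c 0 x = 0" for c x
  proof -
    have "d 0 = (\<lambda>x. 0)" using init by auto
    then show ?thesis using init by (simp add: P_def Dx_section)
  qed
  \<comment> \<open>The backward triangle with apex (T, x0): going back in time along either
    characteristic from one of its points stays inside.\<close>
  define Om where "Om = {z :: real \<times> real. 0 \<le> fst z \<and> fst z + \<bar>snd z - x0\<bar> \<le> T}"
  have Omhp: "Om \<subseteq> {0..} \<times> UNIV" by (auto simp: Om_def)
  have "Om \<subseteq> {0..T} \<times> {x0 - T..x0 + T}" by (auto simp: Om_def)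
  then have "bounded Om" using bounded_Times[OF bounded_closed_interval bounded_closed_interval] bounded_subset by metis
  moreover have "closed Om"
    unfolding Om_def by (intro closed_Collect_conj closed_Collect_le continuous_intros)
  ultimately have cOm: "compact Om" by (simp add: compact_eq_bounded_closed)
  have cont: "continuous_on Om (\<lambda>z. u (fst z) (snd z))" if "Ck_halfplane k u" for k u
    using continuous_on_subset[OF Ck_halfplane_cont[OF that] Omhp] by (simp add: case_prod_unfold)
  have "compact ((\<lambda>z. \<bar>al (fst z) (snd z)\<bar> + \<bar>be (fst z) (snd z)\<bar>) ` Om)"
    by (intro compact_continuous_image cOm continuous_intros cont[OF al] cont[OF be])
  then obtain K0 where K0: "\<And>z. z \<in> Om \<Longrightarrow> \<bar>al (fst z) (snd z)\<bar> + \<bar>be (fst z) (snd z)\<bar> \<le> K0"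
    using compact_imp_bounded bounded_real by (smt (verit) imageI)
  define K where "K = max 1 K0"
  have K: "1 \<le> K" "K0 \<le> K" by (auto simp: K_def)
  \<comment> \<open>With this weight the lower order term, integrated along a characteristic,
    contributes at most a quarter of the maximum M: the integral of (M / 2) K e^(2 K s) is at most
    (M / 4) e^(2 K t). The two directions together give M / 2.\<close>
  define S where "S z = exp (- (2 * K) * fst z) * (\<bar>P 1 (fst z) (snd z)\<bar> + \<bar>P (-1) (fst z) (snd z)\<bar>)" for z
  have "continuous_on Om S" unfolding S_def by (intro continuous_intros cont[OF P])
  moreover have "(T, x0) \<in> Om" using T by (simp add: Om_def)
  ultimately obtain z0 where z0: "z0 \<in> Om" "\<And>z. z \<in> Om \<Longrightarrow> S z \<le> S z0"
    using continuous_attains_sup[OF cOm] by blast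
  define M where "M = S z0"
  have M0: "0 \<le> M" by (simp add: M_def S_def)
  have Pb: "\<bar>P c t x\<bar> \<le> (M / 4) * exp (2 * K * t)" if tx: "(t, x) \<in> Om" and c: "c = 1 \<or> c = -1" for c t x
  proof -
    define y where "y = x - c * t"
    have t: "0 \<le> t" using tx by (simp add: Om_def)
    have in_Om: "(s, y + c * s) \<in> Om" if "0 \<le> s" "s \<le> t" for s
      using tx that c by (auto simp: Om_def y_def)
    have "\<bar>P c t (y + c * t) - P c 0 (y + c * 0)\<bar> \<le> (M / 4) * exp (2 * K * t) - (M / 4) * exp (2 * K * 0)"
    proof (rule DERIV_bound_diff[OF _ _ _ t])
      fix s assume s: "0 \<le> s" "s \<le> t"
      show "((\<lambda>s. P c s (y + c * s)) has_real_derivative Dt (P c) s (y + c * s) + c * Dx (P c) s (y + c * s)) (at s within {0..})"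
        by (rule has_derivative_along_characteristic[OF P s(1)])
      show "((\<lambda>s. (M / 4) * exp (2 * K * s)) has_real_derivative (M / 2) * K * exp (2 * K * s)) (at s within {0..})"
        by (auto intro!: derivative_eq_intros)
      let ?z = "(s, y + c * s)"
      let ?q = "\<bar>P 1 s (y + c * s)\<bar> + \<bar>P (-1) s (y + c * s)\<bar>"
      have "S ?z \<le> M" using z0(2)[OF in_Om[OF s]] by (simp add: M_def)
      then have q: "?q \<le> M * exp (2 * K * s)"
        by (simp add: S_def exp_minus divide_simps mult.commute)
      have "\<bar>Dt (P c) s (y + c * s) + c * Dx (P c) s (y + c * s)\<bar>
         \<le> \<bar>al s (y + c * s)\<bar> * \<bar>Dt d s (y + c * s)\<bar> + \<bar>be s (y + c * s)\<bar> * \<bar>Dx d s (y + c * s)\<bar>"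
        using c by (subst Pchar) (auto simp: s abs_mult[symmetric] abs_triangle_ineq)
      also have "\<dots> \<le> \<bar>al s (y + c * s)\<bar> * (?q / 2) + \<bar>be s (y + c * s)\<bar> * (?q / 2)"
        unfolding P_def by (intro add_mono mult_left_mono) auto
      also have "\<dots> = (\<bar>al s (y + c * s)\<bar> + \<bar>be s (y + c * s)\<bar>) * (?q / 2)"
        by (simp only: ring_distribs)
      also have "\<dots> \<le> K * (M * exp (2 * K * s) / 2)"
        using K0[OF in_Om[OF s]] K q by (intro mult_mono) auto
      finally show "\<bar>Dt (P c) s (y + c * s) + c * Dx (P c) s (y + c * s)\<bar> \<le> (M / 2) * K * exp (2 * K * s)"
        by (simp add: mult_ac)
    qed
    then show ?thesis using M0 P0 by (simp add: y_def)
  qed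
  have "S z0 \<le> M / 2"
  proof -
    have "(fst z0, snd z0) \<in> Om" using z0 by simp
    from Pb[OF this, of 1] Pb[OF this, of "-1"]
    have "\<bar>P 1 (fst z0) (snd z0)\<bar> + \<bar>P (-1) (fst z0) (snd z0)\<bar> \<le> (M / 2) * exp (2 * K * fst z0)"
      by simp
    then show ?thesis by (simp add: S_def exp_minus divide_simps mult.commute)
  qed
  then have "M = 0" using M0 by (simp add: M_def)
  have "\<bar>d T x0 - d 0 x0\<bar> \<le> 0 - 0"
  proof (rule DERIV_bound_diff[OF Ck_halfplane_Dt[OF d2] DERIV_const _ T])
    fix s assume s: "0 \<le> s" "s \<le> T"
    then have "(s, x0) \<in> Om" by (simp add: Om_def)
    from Pb[OF this, of 1] Pb[OF this, of "-1"] \<open>M = 0\<close>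
    show "\<bar>Dt d s x0\<bar> \<le> 0" by (simp add: P_def)
  qed
  then show ?thesis using init by simp
qed

section \<open>Uniform limits on the half plane\<close>

text \<open>Short for uniformly Cauchy, with all x but bounded times. The Cauchy form allows
  statements about convergence before the limit has a name; \<open>hlim\<close> supplies it
  pointwise.\<close>

definition UC :: "(nat \<Rightarrow> real \<Rightarrow> real \<Rightarrow> real) \<Rightarrow> bool" where
  "UC u \<longleftrightarrow> (\<forall>T e. 0 < e \<longrightarrow> (\<exists>N. \<forall>m\<ge>N. \<forall>n\<ge>N. \<forall>t\<in>{0..T}. \<forall>x. \<bar>u m t x - u n t x\<bar> < e))"

definition hlim :: "(nat \<Rightarrow> real \<Rightarrow> real \<Rightarrow> real) \<Rightarrow> real \<Rightarrow> real \<Rightarrow> real" where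
  "hlim u t x = lim (\<lambda>n. u n t x)"

lemma UC_E:
  assumes "UC u" "0 < e"
  obtains N where "\<And>m n t x. N \<le> m \<Longrightarrow> N \<le> n \<Longrightarrow> 0 \<le> t \<Longrightarrow> t \<le> T \<Longrightarrow> \<bar>u m t x - u n t x\<bar> < e"
  using assms unfolding UC_def by (metis atLeastAtMost_iff)

lemma UC_I:
  assumes "\<And>T e. 0 \<le> T \<Longrightarrow> 0 < e \<Longrightarrow> \<exists>N. \<forall>m\<ge>N. \<forall>n\<ge>N. \<forall>t. 0 \<le> t \<longrightarrow> t \<le> T \<longrightarrow> (\<forall>x. \<bar>u m t x - u n t x\<bar> < e)"
  shows "UC u"
  unfolding UC_def
proof (intro allI impI)
  fix T e :: real assume e: "0 < e"
  from assms[of "max 0 T", OF _ this]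
  obtain N where "\<forall>m\<ge>N. \<forall>n\<ge>N. \<forall>t. 0 \<le> t \<longrightarrow> t \<le> max 0 T \<longrightarrow> (\<forall>x. \<bar>u m t x - u n t x\<bar> < e)" by auto
  then show "\<exists>N. \<forall>m\<ge>N. \<forall>n\<ge>N. \<forall>t\<in>{0..T}. \<forall>x. \<bar>u m t x - u n t x\<bar> < e"
    by (intro exI[of _ N]) auto
qed

lemma UC_tendsto: assumes "UC u" "0 \<le> t" shows "(\<lambda>n. u n t x) \<longlonglongrightarrow> hlim u t x"
proof -
  have "Cauchy (\<lambda>n. u n t x)"
  proof (rule metric_CauchyI)
    fix e :: real assume "0 < e"
    from UC_E[OF assms(1) this, of t] obtain N where
      "\<And>m n s x. N \<le> m \<Longrightarrow> N \<le> n \<Longrightarrow> 0 \<le> s \<Longrightarrow> s \<le> t \<Longrightarrow> \<bar>u m s x - u n s x\<bar> < e" by blast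
    then show "\<exists>M. \<forall>m\<ge>M. \<forall>n\<ge>M. dist (u m t x) (u n t x) < e"
      using assms(2) by (intro exI[of _ N]) (simp add: dist_real_def)
  qed
  then show ?thesis
    unfolding hlim_def using convergent_LIMSEQ_iff real_Cauchy_convergent by blast
qed

lemma UC_uniform:
  assumes "UC u" "0 < e"
  shows "\<exists>N. \<forall>n\<ge>N. \<forall>t. 0 \<le> t \<longrightarrow> t \<le> T \<longrightarrow> (\<forall>x. \<bar>u n t x - hlim u t x\<bar> \<le> e)"
proof -
  from UC_E[OF assms, of T] obtain N where
    N: "\<And>m n t x. N \<le> m \<Longrightarrow> N \<le> n \<Longrightarrow> 0 \<le> t \<Longrightarrow> t \<le> T \<Longrightarrow> \<bar>u m t x - u n t x\<bar> < e" by blast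
  have "\<bar>u n t x - hlim u t x\<bar> \<le> e" if n: "N \<le> n" and t: "0 \<le> t" "t \<le> T" for n t x
  proof (rule LIMSEQ_le_const2)
    show "(\<lambda>m. \<bar>u n t x - u m t x\<bar>) \<longlonglongrightarrow> \<bar>u n t x - hlim u t x\<bar>"
      by (intro tendsto_intros UC_tendsto assms t)
    show "\<exists>M. \<forall>m\<ge>M. \<bar>u n t x - u m t x\<bar> \<le> e"
      using N[OF n _ t] by (metis less_imp_le)
  qed
  then show ?thesis by blast
qed

lemma hlim_cont:
  assumes "\<And>n. Ck_halfplane 0 (u n)" "UC u"
  shows "Ck_halfplane 0 (hlim u)"
proof -
  have *: "continuous_on ({0..T} \<times> UNIV) (\<lambda>(t, x). hlim u t x)" for T
  proof (rule uniform_limit_theorem[where F = sequentially and f = "\<lambda>n (t, x). u n t x"])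
    show "\<forall>\<^sub>F n in sequentially. continuous_on ({0..T} \<times> UNIV) (\<lambda>(t, x). u n t x)"
      by (intro always_eventually allI continuous_on_subset[OF Ck_halfplane_cont[OF assms(1)]]) auto
    show "uniform_limit ({0..T} \<times> UNIV) (\<lambda>n (t, x). u n t x) (\<lambda>(t, x). hlim u t x) sequentially"
    proof (rule uniform_limitI)
      fix e :: real assume e: "0 < e"
      with UC_uniform[OF assms(2), of "e/2" T] obtain N where
        "\<forall>n\<ge>N. \<forall>t. 0 \<le> t \<longrightarrow> t \<le> T \<longrightarrow> (\<forall>x. \<bar>u n t x - hlim u t x\<bar> \<le> e/2)" by auto
      then show "\<forall>\<^sub>F n in sequentially. \<forall>z\<in>{0..T} \<times> UNIV.
          dist (case z of (t, x) \<Rightarrow> u n t x) (case z of (t, x) \<Rightarrow> hlim u t x) < e"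
        unfolding eventually_sequentially using e
        by (intro exI[of _ N]) (auto simp: dist_real_def intro: order.strict_trans1[where b = "e/2"])
    qed
  qed auto
  have "continuous (at z within {0..} \<times> UNIV) (\<lambda>(t, x). hlim u t x)" if z: "z \<in> {0..} \<times> UNIV" for z
  proof -
    have "at z within {0..} \<times> UNIV = at z within {0..fst z + 1} \<times> UNIV"
      by (rule at_within_nhd[of _ "{..<fst z + 1} \<times> UNIV"]) (auto simp: mem_Times_iff intro: open_Times)
    moreover have "continuous (at z within {0..fst z + 1} \<times> UNIV) (\<lambda>(t, x). hlim u t x)"
      using *[of "fst z + 1"] z unfolding continuous_on_eq_continuous_within by auto
    ultimately show ?thesis by simp
  qed
  then show ?thesis by (simp add: continuous_on_eq_continuous_within)
qed

lemma DERIV_uniform_limit: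
  fixes f :: "nat \<Rightarrow> real \<Rightarrow> real"
  assumes S: "convex S" "x \<in> S"
    and d: "\<And>n x. x \<in> S \<Longrightarrow> (f n has_real_derivative f' n x) (at x within S)"
    and l: "\<And>x. x \<in> S \<Longrightarrow> (\<lambda>n. f n x) \<longlonglongrightarrow> g x"
    and u: "\<And>e. 0 < e \<Longrightarrow> \<exists>N. \<forall>n\<ge>N. \<forall>x\<in>S. \<bar>f' n x - g' x\<bar> \<le> e"
  shows "(g has_real_derivative g' x) (at x within S)"
proof -
  \<comment> \<open>The theorem on sequences of derivatives provides its own limit function h;
    uniqueness of limits identifies it with g on S.\<close>
  have "\<exists>h. \<forall>x\<in>S. (\<lambda>n. f n x) \<longlonglongrightarrow> h x \<and> (h has_derivative (\<lambda>y. g' x * y)) (at x within S)"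
  proof (rule has_derivative_sequence[where f = f and l = "g x" and f' = "\<lambda>n x y. f' n x * y", OF S(1) _ _ S(2) l[OF S(2)]])
    show "(f n has_derivative (\<lambda>y. f' n x * y)) (at x within S)" if "x \<in> S" for n x
      using d[OF that] by (simp add: has_field_derivative_def)
    show "\<forall>\<^sub>F n in sequentially. \<forall>x\<in>S. \<forall>h. norm (f' n x * h - g' x * h) \<le> e * norm h" if "0 < e" for e
    proof -
      obtain N where "\<forall>n\<ge>N. \<forall>x\<in>S. \<bar>f' n x - g' x\<bar> \<le> e" using u \<open>0 < e\<close> by blast
      then show ?thesis
        unfolding eventually_sequentially
        by (intro exI[of _ N]) (auto simp: left_diff_distrib[symmetric] abs_mult mult_right_mono)
    qed
  qed
  then obtain h where h: "\<And>x. x \<in> S \<Longrightarrow> (\<lambda>n. f n x) \<longlonglongrightarrow> h x" "(h has_real_derivative g' x) (at x within S)"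
    using S(2) unfolding has_field_derivative_def by blast
  show ?thesis
    by (rule has_field_derivative_transform_within[OF h(2) zero_less_one S(2)])
      (use LIMSEQ_unique[OF h(1) l] in auto)
qed

lemma hlim_DERIV_x:
  assumes d: "\<And>n t x. 0 \<le> t \<Longrightarrow> (u n t has_real_derivative u' n t x) (at x)"
    and "UC u" "UC u'" and t: "0 \<le> t"
  shows "(hlim u t has_real_derivative hlim u' t x) (at x)"
proof (rule DERIV_uniform_limit[where S = UNIV, OF _ _ d[OF t] UC_tendsto[OF assms(2) t]])
  show "\<exists>N. \<forall>n\<ge>N. \<forall>x\<in>UNIV. \<bar>u' n t x - hlim u' t x\<bar> \<le> e" if "0 < e" for e
    using UC_uniform[OF assms(3) that, of t] t by auto
qed auto

lemma hlim_DERIV_t: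
  assumes d: "\<And>n t. 0 \<le> t \<Longrightarrow> ((\<lambda>s. u n s x) has_real_derivative u' n t x) (at t within {0..})"
    and "UC u" "UC u'" and t: "0 \<le> t"
  shows "((\<lambda>s. hlim u s x) has_real_derivative hlim u' t x) (at t within {0..})"
proof -
  have "((\<lambda>s. hlim u s x) has_real_derivative hlim u' t x) (at t within {0..t+1})"
  proof (rule DERIV_uniform_limit[where f = "\<lambda>n s. u n s x" and f' = "\<lambda>n s. u' n s x" and S = "{0..t+1}"])
    show "\<exists>N. \<forall>n\<ge>N. \<forall>s\<in>{0..t+1}. \<bar>u' n s x - hlim u' s x\<bar> \<le> e" if "0 < e" for e
      using UC_uniform[OF assms(3) that, of "t+1"] by (metis atLeastAtMost_iff)
  qed (use t d in \<open>auto intro!: UC_tendsto assms(2) DERIV_subset[OF d]\<close>)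
  then show ?thesis using at_within_Icc_nonneg[of t "t+1"] t by simp
qed

section \<open>Sums, products and series of uniformly Cauchy sequences\<close>

lemma UC_const: "UC (\<lambda>n. u)"
  unfolding UC_def by auto

lemma UC_add: assumes "UC u" "UC v" shows "UC (\<lambda>n t x. u n t x + v n t x)"
proof (rule UC_I)
  fix T e :: real assume "0 < e"
  then have e: "0 < e/2" by simp
  from UC_E[OF assms(1) e, of T] obtain N where
    N: "\<And>m n t x. N \<le> m \<Longrightarrow> N \<le> n \<Longrightarrow> 0 \<le> t \<Longrightarrow> t \<le> T \<Longrightarrow> \<bar>u m t x - u n t x\<bar> < e/2" by blast
  from UC_E[OF assms(2) e, of T] obtain M where
    M: "\<And>m n t x. M \<le> m \<Longrightarrow> M \<le> n \<Longrightarrow> 0 \<le> t \<Longrightarrow> t \<le> T \<Longrightarrow> \<bar>v m t x - v n t x\<bar> < e/2" by blast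
  have "\<bar>u m t x + v m t x - (u n t x + v n t x)\<bar> < e"
    if "max N M \<le> m" "max N M \<le> n" "0 \<le> t" "t \<le> T" for m n t x
    using N[of m n t x] M[of m n t x] that by (simp add: abs_if split: if_splits)
  then show "\<exists>N. \<forall>m\<ge>N. \<forall>n\<ge>N. \<forall>t. 0 \<le> t \<longrightarrow> t \<le> T \<longrightarrow> (\<forall>x. \<bar>u m t x + v m t x - (u n t x + v n t x)\<bar> < e)"
    by blast
qed

lemma UC_Suc: "UC u \<Longrightarrow> UC (\<lambda>n. u (Suc n))"
  unfolding UC_def by (meson Suc_leD Suc_le_mono le_SucI)

lemma UC_cong: "UC u \<Longrightarrow> (\<And>n t x. 0 \<le> t \<Longrightarrow> v n t x = u n t x) \<Longrightarrow> UC v"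
  unfolding UC_def by (simp add: Ball_def)

lemma UC_mult:
  assumes u: "UC u" and v: "UC v"
    and bu: "\<And>T. \<exists>K. \<forall>n t x. 0 \<le> t \<longrightarrow> t \<le> T \<longrightarrow> \<bar>u n t x\<bar> \<le> K"
    and bv: "\<And>T. \<exists>K. \<forall>n t x. 0 \<le> t \<longrightarrow> t \<le> T \<longrightarrow> \<bar>v n t x\<bar> \<le> K"
  shows "UC (\<lambda>n t x. u n t x * v n t x)"
proof (rule UC_I)
  fix T e :: real assume e: "0 < e" and T: "0 \<le> T"
  obtain Ku where Ku: "\<And>n t x. 0 \<le> t \<Longrightarrow> t \<le> T \<Longrightarrow> \<bar>u n t x\<bar> \<le> Ku" using bu by blast
  obtain Kv where Kv: "\<And>n t x. 0 \<le> t \<Longrightarrow> t \<le> T \<Longrightarrow> \<bar>v n t x\<bar> \<le> Kv" using bv by blast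
  define K where "K = 1 + \<bar>Ku\<bar> + \<bar>Kv\<bar>"
  have e': "0 < e / (2 * K)" using e by (auto simp: K_def intro!: divide_pos_pos)
  from UC_E[OF u e', of T] obtain N where
    N: "\<And>m n t x. N \<le> m \<Longrightarrow> N \<le> n \<Longrightarrow> 0 \<le> t \<Longrightarrow> t \<le> T \<Longrightarrow> \<bar>u m t x - u n t x\<bar> < e / (2 * K)" by blast
  from UC_E[OF v e', of T] obtain M where
    M: "\<And>m n t x. M \<le> m \<Longrightarrow> M \<le> n \<Longrightarrow> 0 \<le> t \<Longrightarrow> t \<le> T \<Longrightarrow> \<bar>v m t x - v n t x\<bar> < e / (2 * K)" by blast
  have "\<bar>u m t x * v m t x - u n t x * v n t x\<bar> < e"
    if mn: "max N M \<le> m" "max N M \<le> n" and t: "0 \<le> t" "t \<le> T" for m n t x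
  proof -
    have Kp: "0 < K" by (auto simp: K_def)
    have "u m t x * v m t x - u n t x * v n t x = (u m t x - u n t x) * v m t x + u n t x * (v m t x - v n t x)"
      by (simp add: algebra_simps)
    then have "\<bar>u m t x * v m t x - u n t x * v n t x\<bar> \<le> \<bar>u m t x - u n t x\<bar> * \<bar>v m t x\<bar> + \<bar>u n t x\<bar> * \<bar>v m t x - v n t x\<bar>"
      by (simp add: abs_mult[symmetric] abs_triangle_ineq)
    also have "\<dots> < e / (2 * K) * K + K * (e / (2 * K))"
    proof (rule add_less_le_mono)
      have "\<bar>v m t x\<bar> < K" using Kv[OF t, of m x] by (auto simp: K_def)
      then show "\<bar>u m t x - u n t x\<bar> * \<bar>v m t x\<bar> < e / (2 * K) * K"
        using N[of m n t x] mn t by (intro mult_strict_mono) auto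
      show "\<bar>u n t x\<bar> * \<bar>v m t x - v n t x\<bar> \<le> K * (e / (2 * K))"
        using M[of m n t x] mn t Ku[OF t, of n x] Kp by (intro mult_mono) (auto simp: K_def)
    qed
    also have "\<dots> = e" using Kp by simp
    finally show ?thesis .
  qed
  then show "\<exists>N. \<forall>m\<ge>N. \<forall>n\<ge>N. \<forall>t. 0 \<le> t \<longrightarrow> t \<le> T \<longrightarrow> (\<forall>x. \<bar>u m t x * v m t x - u n t x * v n t x\<bar> < e)"
    by blast
qed

text \<open>The Weierstrass test applied to the telescoping sum, in the form in which Picard
  iterates meet it.\<close>

lemma UC_summable:
  assumes "\<And>T. 0 \<le> T \<Longrightarrow> \<exists>g. summable g \<and> (\<forall>n t x. 0 \<le> t \<longrightarrow> t \<le> T \<longrightarrow> \<bar>u (Suc n) t x - u n t x\<bar> \<le> g n)"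
  shows "UC u"
proof (rule UC_I)
  fix T e :: real assume T: "0 \<le> T" and e: "0 < e"
  obtain g where g: "summable g" and ug: "\<And>n t x. 0 \<le> t \<Longrightarrow> t \<le> T \<Longrightarrow> \<bar>u (Suc n) t x - u n t x\<bar> \<le> g n"
    using assms[OF T] by blast
  from g e obtain N where N: "\<And>m n. N \<le> m \<Longrightarrow> norm (sum g {m..<n}) < e"
    unfolding summable_Cauchy by blast
  have step: "\<bar>u n t x - u m t x\<bar> \<le> sum g {m..<n}" if "m \<le> n" "0 \<le> t" "t \<le> T" for m n t x
    using that(1)
  proof (induction n rule: dec_induct)
    case (step n)
    show ?case using step(1,3) ug[OF that(2,3), of n x] by (simp)
  qed simp
  have lt: "\<bar>u n t x - u m t x\<bar> < e" if "N \<le> m" "m \<le> n" "0 \<le> t" "t \<le> T" for m n t x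
    using step[OF that(2-4), of x] N[OF that(1), of n] by auto
  have "\<bar>u m t x - u n t x\<bar> < e" if "N \<le> m" "N \<le> n" "0 \<le> t" "t \<le> T" for m n t x
    using lt[of m n t x] lt[of n m t x] that by (cases "m \<le> n") auto
  then show "\<exists>N. \<forall>m\<ge>N. \<forall>n\<ge>N. \<forall>t. 0 \<le> t \<longrightarrow> t \<le> T \<longrightarrow> (\<forall>x. \<bar>u m t x - u n t x\<bar> < e)" by blast
qed

section \<open>Regularity from spatial derivatives\<close>

text \<open>Regularity in x alone, with joint continuity in (t, x) at every order. Uniform
  convergence of x derivatives delivers exactly this; regularity in t has to come from the
  equations.\<close>

fun Ckx_halfplane :: "nat \<Rightarrow> (real \<Rightarrow> real \<Rightarrow> real) \<Rightarrow> bool" where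
  "Ckx_halfplane 0 u \<longleftrightarrow> Ck_halfplane 0 u"
| "Ckx_halfplane (Suc j) u \<longleftrightarrow> Ck_halfplane 0 u \<and>
     (\<forall>t\<ge>0. \<forall>x. (u t has_real_derivative Dx u t x) (at x)) \<and> Ckx_halfplane j (Dx u)"

lemma Ckx_halfplane_0D: "Ckx_halfplane j u \<Longrightarrow> Ck_halfplane 0 u"
  by (cases j) auto

lemma Ckx_halfplane_Suc_mono: "Ckx_halfplane (Suc j) u \<Longrightarrow> Ckx_halfplane j u"
  by (induction j arbitrary: u) (auto simp del: Ck_halfplane.simps)

lemma Ckx_halfplane_cong:
  "Ckx_halfplane j u \<Longrightarrow> (\<And>t x. 0 \<le> t \<Longrightarrow> v t x = u t x) \<Longrightarrow> Ckx_halfplane j v"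
proof (induction j arbitrary: u v)
  case 0
  then show ?case using Ck_halfplane_cong'[of 0 u v] by (simp del: Ck_halfplane.simps)
next
  case (Suc j)
  have sec: "v t = u t" if "0 \<le> t" for t using Suc(3)[OF that] by auto
  have "Dx v t x = Dx u t x" if "0 \<le> t" for t x by (simp add: Dx_section sec that)
  then show ?case
    using Suc Ck_halfplane_cong'[of 0 u v] sec by (auto simp del: Ck_halfplane.simps)
qed

lemma Ckx_halfplane_hlim:
  assumes "\<And>n. Ck_halfplane j (u n)" and "\<And>i. i \<le> j \<Longrightarrow> UC (\<lambda>n. (Dx ^^ i) (u n))"
  shows "Ckx_halfplane j (hlim u)"
  using assms
proof (induction j arbitrary: u)
  case 0
  then show ?case using hlim_cont[of u] by (simp del: Ck_halfplane.simps)
next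
  case (Suc j)
  have UC0: "UC u" using Suc(3)[of 0] by simp
  have UC1: "UC (\<lambda>n. Dx (u n))" using Suc(3)[of 1] by simp
  have d: "(hlim u t has_real_derivative hlim (\<lambda>n. Dx (u n)) t x) (at x)" if "0 \<le> t" for t x
    by (rule hlim_DERIV_x[OF Ck_halfplane_Dx[OF Suc(2)] UC0 UC1 that])
  have D: "Dx (hlim u) t x = hlim (\<lambda>n. Dx (u n)) t x" if "0 \<le> t" for t x
    by (rule Dx_eqI) (rule d[OF that])
  have "Ckx_halfplane j (hlim (\<lambda>n. Dx (u n)))"
  proof (rule Suc.IH)
    show "Ck_halfplane j (Dx (u n))" for n by (rule Ck_halfplane_DxD[OF Suc(2)])
    show "UC (\<lambda>n. (Dx ^^ i) (Dx (u n)))" if "i \<le> j" for i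
      using Suc(3)[of "Suc i"] that by (simp only: Dx_funpow_Suc)
  qed
  then have "Ckx_halfplane j (Dx (hlim u))" by (rule Ckx_halfplane_cong) (rule D)
  moreover have "Ck_halfplane 0 (hlim u)"
    by (rule hlim_cont[OF Ck_halfplane_0I[OF Suc(2)] UC0])
  ultimately show ?case using d D by (simp del: Ck_halfplane.simps)
qed

text \<open>Differentiating the system in \<open>x\<close> yields a system of the same form with a new source term,
  so time regularity can be traded against spatial regularity inductively. For \<open>j = 0\<close> the symbol
  \<open>Dx\<close> may be meaningless, hence the guard on the equations.\<close>

lemma characteristic_system_regularity:
  assumes "Ckx_halfplane j p" "Ckx_halfplane j s"
    and "Ck_halfplane j A" "Ck_halfplane j B" "Ck_halfplane j F"
    and "\<And>t x. 0 < j \<Longrightarrow> 0 \<le> t \<Longrightarrow>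
      ((\<lambda>\<tau>. p \<tau> x) has_real_derivative Dx p t x + (A t x * p t x + B t x * s t x + F t x)) (at t within {0..})"
    and "\<And>t x. 0 < j \<Longrightarrow> 0 \<le> t \<Longrightarrow>
      ((\<lambda>\<tau>. s \<tau> x) has_real_derivative - Dx s t x + (A t x * p t x + B t x * s t x + F t x)) (at t within {0..})"
  shows "Ck_halfplane j p \<and> Ck_halfplane j s"
  using assms
proof (induction j arbitrary: p s F)
  case 0
  then show ?case by (simp del: Ck_halfplane.simps)
next
  case (Suc j)
  note A = Suc.prems(3) and B = Suc.prems(4) and F = Suc.prems(5)
  note A' = Ck_halfplane_Suc_mono[OF A] and B' = Ck_halfplane_Suc_mono[OF B] and F' = Ck_halfplane_Suc_mono[OF F]
  have p0: "Ck_halfplane 0 p" and px: "\<And>t x. 0 \<le> t \<Longrightarrow> (p t has_real_derivative Dx p t x) (at x)" and p1: "Ckx_halfplane j (Dx p)"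
    and s0: "Ck_halfplane 0 s" and sx: "\<And>t x. 0 \<le> t \<Longrightarrow> (s t has_real_derivative Dx s t x) (at x)" and s1: "Ckx_halfplane j (Dx s)"
    using Suc.prems(1,2) by (auto simp del: Ck_halfplane.simps)
  note pt = Suc.prems(6)[OF zero_less_Suc] and st = Suc.prems(7)[OF zero_less_Suc]
  \<comment> \<open>The induction hypothesis is used twice: here for p and s themselves, which makes
    the new source \<open>F1\<close> regular enough, and below for their x derivatives.\<close>
  have IH: "Ck_halfplane j p \<and> Ck_halfplane j s"
    by (rule Suc.IH[OF Ckx_halfplane_Suc_mono[OF Suc.prems(1)] Ckx_halfplane_Suc_mono[OF Suc.prems(2)] A' B' F' pt st])
  then have pj: "Ck_halfplane j p" and sj: "Ck_halfplane j s" by auto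
  define h where "h t x = A t x * p t x + B t x * s t x + F t x" for t x
  \<comment> \<open>The part of the differentiated lower order term in which the derivative falls on
    a coefficient or on F. It contains p and s undifferentiated and so acts as a known
    source.\<close>
  define F1 where "F1 t x = Dx A t x * p t x + Dx B t x * s t x + Dx F t x" for t x
  have hj: "Ck_halfplane j h"
    unfolding h_def[abs_def] by (intro Ck_halfplane_add Ck_halfplane_mult A' B' F' pj sj)
  have F1j: "Ck_halfplane j F1"
    unfolding F1_def[abs_def]
    by (intro Ck_halfplane_add Ck_halfplane_mult Ck_halfplane_DxD[OF A] Ck_halfplane_DxD[OF B] Ck_halfplane_DxD[OF F] pj sj)
  have hx: "(h t has_real_derivative A t x * Dx p t x + B t x * Dx s t x + F1 t x) (at x)" if t: "0 \<le> t" for t x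
    unfolding h_def[abs_def] F1_def
    by (auto intro!: derivative_eq_intros px[OF t] sx[OF t] Ck_halfplane_Dx[OF A t] Ck_halfplane_Dx[OF B t] Ck_halfplane_Dx[OF F t])
  note p10 = Ckx_halfplane_0D[OF p1] and s10 = Ckx_halfplane_0D[OF s1]
  note A0 = Ck_halfplane_0I[OF A] and B0 = Ck_halfplane_0I[OF B]
  have "Ck_halfplane j (Dx p) \<and> Ck_halfplane j (Dx s)"
  proof (rule Suc.IH[OF p1 s1 A' B' F1j])
    fix t x :: real assume j: "0 < j" and t: "0 \<le> t"
    then obtain i where i: "j = Suc i" by (cases j) auto
    have pxx: "\<And>t x. 0 \<le> t \<Longrightarrow> (Dx p t has_real_derivative Dx (Dx p) t x) (at x)" "Ck_halfplane 0 (Dx (Dx p))"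
      and sxx: "\<And>t x. 0 \<le> t \<Longrightarrow> (Dx s t has_real_derivative Dx (Dx s) t x) (at x)" "Ck_halfplane 0 (Dx (Dx s))"
      using p1 s1 Ckx_halfplane_0D by (auto simp: i simp del: Ck_halfplane.simps)
    show "((\<lambda>\<tau>. Dx p \<tau> x) has_real_derivative Dx (Dx p) t x + (A t x * Dx p t x + B t x * Dx s t x + F1 t x)) (at t within {0..})"
    proof (rule mixed_derivative[where u = p and w = "\<lambda>t x. Dx p t x + h t x", OF _ px _ _ _ t])
      show "((\<lambda>s. p s x) has_real_derivative Dx p t x + h t x) (at t within {0..})" if "0 \<le> t" for t x
        using pt[OF that] by (simp add: h_def)
    qed (auto intro!: DERIV_add pxx hx Ck_halfplane_add Ck_halfplane_mult A0 B0 s10 Ck_halfplane_0I[OF F1j] p10 Ck_halfplane_0I[OF hj] simp del: Ck_halfplane.simps)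
    show "((\<lambda>\<tau>. Dx s \<tau> x) has_real_derivative - Dx (Dx s) t x + (A t x * Dx p t x + B t x * Dx s t x + F1 t x)) (at t within {0..})"
    proof (rule mixed_derivative[where u = s and w = "\<lambda>t x. - Dx s t x + h t x", OF _ sx _ _ _ t])
      show "((\<lambda>\<tau>. s \<tau> x) has_real_derivative - Dx s t x + h t x) (at t within {0..})" if "0 \<le> t" for t x
        using st[OF that] by (simp add: h_def)
    qed (auto intro!: DERIV_add DERIV_minus sxx hx Ck_halfplane_add Ck_halfplane_mult A0 B0 p10 Ck_halfplane_0I[OF F1j] Ck_halfplane_minus s10 Ck_halfplane_0I[OF hj] simp del: Ck_halfplane.simps add_uminus_conv_diff uminus_add_conv_diff)
  qed
  then have p1j: "Ck_halfplane j (Dx p)" and s1j: "Ck_halfplane j (Dx s)" by auto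
  show ?case
  proof
    show "Ck_halfplane (Suc j) p"
      by (rule Ck_halfplane_SucI[OF Ck_halfplane_cont[OF p0] pt px _ p1j])
        (use Ck_halfplane_add[OF p1j hj] in \<open>auto simp: h_def[abs_def] simp del: Ck_halfplane.simps\<close>)
    show "Ck_halfplane (Suc j) s"
      by (rule Ck_halfplane_SucI[OF Ck_halfplane_cont[OF s0] st sx _ s1j])
        (use Ck_halfplane_add[OF Ck_halfplane_minus[OF s1j] hj] in \<open>auto simp: h_def[abs_def] simp del: Ck_halfplane.simps\<close>)
  qed
qed

section \<open>Smooth solutions by iteration along characteristics\<close>

definition smooth_hp :: "(real \<Rightarrow> real \<Rightarrow> real) \<Rightarrow> bool" where
  "smooth_hp u \<longleftrightarrow> (\<forall>k. Ck_halfplane k u)"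

text \<open>Propagation from [-a, a] with speed at most 1. Every time slice has compact support, so
  continuous coefficients act as bounded ones on finite time intervals.\<close>

definition supp_cone :: "real \<Rightarrow> (real \<Rightarrow> real \<Rightarrow> real) \<Rightarrow> bool" where
  "supp_cone a u \<longleftrightarrow> (\<forall>t\<ge>0. \<forall>x. \<bar>x\<bar> > a + t \<longrightarrow> u t x = 0)"

lemma smooth_hpD: "smooth_hp u \<Longrightarrow> Ck_halfplane k u"
  by (simp add: smooth_hp_def)

lemma smooth_hp_intros:
  "smooth_hp u \<Longrightarrow> smooth_hp v \<Longrightarrow> smooth_hp (\<lambda>t x. u t x + v t x)"
  "smooth_hp u \<Longrightarrow> smooth_hp v \<Longrightarrow> smooth_hp (\<lambda>t x. u t x - v t x)"
  "smooth_hp u \<Longrightarrow> smooth_hp v \<Longrightarrow> smooth_hp (\<lambda>t x. u t x * v t x)"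
  "smooth_hp u \<Longrightarrow> smooth_hp (\<lambda>t x. - u t x)"
  "smooth_hp u \<Longrightarrow> smooth_hp (shift c u)"
  "smooth_hp u \<Longrightarrow> smooth_hp (tint u)"
  "smooth_hp u \<Longrightarrow> smooth_hp (Dx u)"
  "smooth_hp u \<Longrightarrow> smooth_hp (Dt u)"
  "smooth_hp (\<lambda>t x. c)"
  unfolding smooth_hp_def
  by (blast intro: Ck_halfplane_add Ck_halfplane_diff Ck_halfplane_mult Ck_halfplane_minus
      Ck_halfplane_shift Ck_halfplane_tint Ck_halfplane_DxD Ck_halfplane_DtD Ck_halfplane_const)+

lemma smooth_hp_x: "(\<And>k. Ck_fun k f) \<Longrightarrow> smooth_hp (\<lambda>t. f)"
  by (simp add: smooth_hp_def Ck_halfplane_x del: Ck_halfplane.simps)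

lemma smooth_hp_t: "(\<And>k. Ck_fun k f) \<Longrightarrow> smooth_hp (\<lambda>t x. f t)"
  by (simp add: smooth_hp_def Ck_halfplane_t del: Ck_halfplane.simps)

lemma smooth_hp_Dx_funpow: "smooth_hp u \<Longrightarrow> smooth_hp ((Dx ^^ i) u)"
  by (induction i) (auto intro: smooth_hp_intros)

lemma smooth_hp_DERIV:
  assumes "smooth_hp u" "0 \<le> t"
  shows smooth_hp_Dt: "((\<lambda>s. u s x) has_real_derivative Dt u t x) (at t within {0..})"
    and smooth_hp_Dx: "(u t has_real_derivative Dx u t x) (at x)"
    and smooth_hp_Dt_Dx: "Dt (Dx u) t x = Dx (Dt u) t x"
  using assms by (blast intro: Ck_halfplane_Dt Ck_halfplane_Dx Dt_Dx_commute smooth_hpD)+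

lemma Dx_shift: "smooth_hp u \<Longrightarrow> 0 \<le> t \<Longrightarrow> Dx (shift c u) t x = Dx u t (x + c * t)"
  by (rule Dx_eqI, rule shift_DERIV_x, rule smooth_hp_Dx)

lemma supp_cone_Dx: assumes "supp_cone a u" shows "supp_cone a (Dx u)"
  unfolding supp_cone_def
proof (intro allI impI)
  fix t x assume t: "0 \<le> t" and x: "a + t < \<bar>x\<bar>"
  have "open {y :: real. a + t < \<bar>y\<bar>}" by (intro open_Collect_less continuous_intros)
  from has_field_derivative_transform_within_open[OF DERIV_const this, of x 0 "u t"]
  show "Dx u t x = 0" using assms t x by (intro Dx_eqI) (auto simp: supp_cone_def)
qed

lemma supp_cone_Dt: assumes "supp_cone a u" shows "supp_cone a (Dt u)"
  unfolding supp_cone_def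
proof (intro allI impI)
  fix t x assume t: "0 \<le> t" and x: "a + t < \<bar>x\<bar>"
  have "((\<lambda>s. u s x) has_real_derivative 0) (at t within {0..})"
  proof (rule has_field_derivative_transform_within[OF DERIV_const])
    show "0 < \<bar>x\<bar> - (a + t)" using x by simp
    show "0 = u s x" if "s \<in> {0..}" "dist s t < \<bar>x\<bar> - (a + t)" for s
      using assms that by (auto simp: supp_cone_def dist_real_def)
  qed (use t in auto)
  then show "Dt u t x = 0" using t by (rule Dt_eqI)
qed

lemma supp_cone_Dx_funpow: "supp_cone a u \<Longrightarrow> supp_cone a ((Dx ^^ i) u)"
  by (induction i) (auto intro: supp_cone_Dx)

lemma supp_cone_add: "supp_cone a u \<Longrightarrow> supp_cone a v \<Longrightarrow> supp_cone a (\<lambda>t x. u t x + v t x)"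
  and supp_cone_diff: "supp_cone a u \<Longrightarrow> supp_cone a v \<Longrightarrow> supp_cone a (\<lambda>t x. u t x - v t x)"
  and supp_cone_mult: "supp_cone a v \<Longrightarrow> supp_cone a (\<lambda>t x. u t x * v t x)"
  by (auto simp: supp_cone_def)

lemma continuous_bounded_strip:
  assumes "Ck_halfplane k u"
  shows "\<exists>K\<ge>0. \<forall>t x. 0 \<le> t \<longrightarrow> t \<le> T \<longrightarrow> \<bar>x\<bar> \<le> X \<longrightarrow> \<bar>u t x\<bar> \<le> K"
proof -
  have "continuous_on ({0..T} \<times> {-X..X}) (\<lambda>(t, x). u t x)"
    by (rule continuous_on_subset[OF Ck_halfplane_cont[OF assms]]) auto
  then have "bounded ((\<lambda>(t, x). u t x) ` ({0..T} \<times> {-X..X}))"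
    by (intro compact_imp_bounded compact_continuous_image compact_Times) auto
  then obtain K where K: "\<And>z. z \<in> {0..T} \<times> {-X..X} \<Longrightarrow> \<bar>case z of (t, x) \<Rightarrow> u t x\<bar> \<le> K"
    unfolding bounded_real by blast
  have "\<bar>u t x\<bar> \<le> max 0 K" if "0 \<le> t" "t \<le> T" "\<bar>x\<bar> \<le> X" for t x
  proof -
    have "(t, x) \<in> {0..T} \<times> {-X..X}" using that by (auto simp: abs_le_iff)
    from K[OF this] show ?thesis by simp
  qed
  then show ?thesis by (intro exI[of _ "max 0 K"]) auto
qed

lemma supp_cone_bounded:
  assumes u: "Ck_halfplane k u" and s: "supp_cone a u"
  shows "\<exists>K\<ge>0. \<forall>t x. 0 \<le> t \<longrightarrow> t \<le> T \<longrightarrow> \<bar>u t x\<bar> \<le> K"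
proof -
  obtain K where K: "0 \<le> K" "\<And>t x. 0 \<le> t \<Longrightarrow> t \<le> T \<Longrightarrow> \<bar>x\<bar> \<le> a + T \<Longrightarrow> \<bar>u t x\<bar> \<le> K"
    using continuous_bounded_strip[OF u, of T "a + T"] by blast
  have "\<bar>u t x\<bar> \<le> K" if "0 \<le> t" "t \<le> T" for t x
    using K(1) K(2)[OF that, of x] s that by (cases "\<bar>x\<bar> \<le> a + T") (auto simp: supp_cone_def)
  then show ?thesis using K(1) by blast
qed

text \<open>Up to time T the products live on a compact piece of the cone, where the factor
  \<open>al\<close> is bounded by continuity.\<close>

lemma UC_mult_supp:
  assumes al: "Ck_halfplane k al" and u: "UC u" and s: "\<And>n. supp_cone a (u n)"
  shows "UC (\<lambda>n t x. al t x * u n t x)"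
proof (rule UC_I)
  fix T e :: real assume T: "0 \<le> T" and e: "0 < e"
  obtain K where K: "0 \<le> K" "\<And>t x. 0 \<le> t \<Longrightarrow> t \<le> T \<Longrightarrow> \<bar>x\<bar> \<le> a + T \<Longrightarrow> \<bar>al t x\<bar> \<le> K"
    using continuous_bounded_strip[OF al, of T "a + T"] by blast
  have e': "0 < e / (K + 1)" using e K by simp
  from UC_E[OF u e', of T] obtain N where
    N: "\<And>m n t x. N \<le> m \<Longrightarrow> N \<le> n \<Longrightarrow> 0 \<le> t \<Longrightarrow> t \<le> T \<Longrightarrow> \<bar>u m t x - u n t x\<bar> < e / (K + 1)" by blast
  have "\<bar>al t x * u m t x - al t x * u n t x\<bar> < e" if "N \<le> m" "N \<le> n" "0 \<le> t" "t \<le> T" for m n t x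
  proof (cases "\<bar>x\<bar> \<le> a + T")
    case True
    have "\<bar>al t x * u m t x - al t x * u n t x\<bar> = \<bar>al t x\<bar> * \<bar>u m t x - u n t x\<bar>"
      by (simp add: right_diff_distrib[symmetric] abs_mult)
    also have "\<dots> \<le> K * (e / (K + 1))"
      using K(2)[OF that(3,4) True] N[OF that, of x] K(1) by (intro mult_mono) auto
    also have "\<dots> < e" using e K(1) by (simp add: field_simps)
    finally show ?thesis .
  next
    case False
    then have "u m t x = 0" "u n t x = 0" using s[of m] s[of n] that by (auto simp: supp_cone_def)
    then show ?thesis using e by simp
  qed
  then show "\<exists>N. \<forall>m\<ge>N. \<forall>n\<ge>N. \<forall>t. 0 \<le> t \<longrightarrow> t \<le> T \<longrightarrow> (\<forall>x. \<bar>al t x * u m t x - al t x * u n t x\<bar> < e)"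
    by blast
qed

text \<open>Duhamel's integral: it vanishes at t = 0 and solves u_t = c u_x + h, integrating h along
  the characteristic that ends at (t, x).\<close>

definition char_int :: "real \<Rightarrow> (real \<Rightarrow> real \<Rightarrow> real) \<Rightarrow> real \<Rightarrow> real \<Rightarrow> real" where
  "char_int c h = shift c (tint (shift (- c) h))"

lemma smooth_hp_char_int: "smooth_hp h \<Longrightarrow> smooth_hp (char_int c h)"
  unfolding char_int_def by (intro smooth_hp_intros)

lemma char_int_DERIV_x:
  assumes h: "smooth_hp h" and t: "0 \<le> t"
  shows "(char_int c h t has_real_derivative char_int c (Dx h) t x) (at x)"
proof -
  have "(tint (shift (- c) h) t has_real_derivative char_int c (Dx h) t x) (at (x + c * t))"
    unfolding char_int_def shift_def[of c]
  proof (rule tint_DERIV_x[OF _ _ _ t])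
    show "(shift (- c) h t has_real_derivative shift (- c) (Dx h) t x) (at x)" if "0 \<le> t" for t x
      by (rule shift_DERIV_x) (simp add: shift_def smooth_hp_Dx[OF h that])
  qed (auto intro!: smooth_hpD smooth_hp_intros h simp del: Ck_halfplane.simps)
  then show ?thesis unfolding char_int_def by (rule shift_DERIV_x)
qed

lemma Dx_char_int: "smooth_hp h \<Longrightarrow> 0 \<le> t \<Longrightarrow> Dx (char_int c h) t x = char_int c (Dx h) t x"
  by (rule Dx_eqI) (rule char_int_DERIV_x)

lemma char_int_DERIV_t:
  assumes h: "smooth_hp h" and t: "0 \<le> t"
  shows "((\<lambda>s. char_int c h s x) has_real_derivative h t x + c * Dx (char_int c h) t x) (at t within {0..})"
proof -
  let ?u = "tint (shift (- c) h)"
  have u: "smooth_hp ?u" by (intro smooth_hp_intros h)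
  have "Dt ?u t y = shift (- c) h t y" for y
    by (rule Dt_eqI[OF tint_DERIV_t[OF smooth_hpD[OF smooth_hp_intros(5)[OF h]] t] t])
  moreover have "Dx (char_int c h) t x = shift c (Dx ?u) t x"
    unfolding char_int_def
    by (rule Dx_eqI, rule shift_DERIV_x) (simp only: shift_def[of c] smooth_hp_Dx[OF u t])
  ultimately show ?thesis
    using shift_DERIV_t[OF smooth_hpD[OF u] t, of c x] by (simp add: char_int_def shift_def)
qed

lemma Dx_funpow_char_int:
  "smooth_hp h \<Longrightarrow> 0 \<le> t \<Longrightarrow> (Dx ^^ i) (char_int c h) t x = char_int c ((Dx ^^ i) h) t x"
proof (induction i arbitrary: x)
  case (Suc i)
  have "(Dx ^^ i) (char_int c h) t = char_int c ((Dx ^^ i) h) t" using Suc by auto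
  then have "(Dx ^^ Suc i) (char_int c h) t x = Dx (char_int c ((Dx ^^ i) h)) t x"
    by (simp add: Dx_section)
  then show ?case using Suc by (simp add: Dx_char_int smooth_hp_Dx_funpow)
qed simp

lemma char_int_diff:
  assumes "smooth_hp g" "smooth_hp h" "0 \<le> t"
  shows "char_int c (\<lambda>t x. g t x - h t x) t x = char_int c g t x - char_int c h t x"
proof -
  have i: "(\<lambda>s. shift (- c) u s (x + c * t)) integrable_on {0..t}" if "smooth_hp u" for u
    using Ck_halfplane_time_cont[OF smooth_hpD[OF smooth_hp_intros(5)[OF that]], of "{0..t}"]
    by (intro integrable_continuous_real) auto
  show ?thesis
    using integral_diff[OF i[OF assms(1)] i[OF assms(2)]]
    by (simp add: char_int_def tint_def shift_def)
qed

lemma char_int_0: "char_int c h 0 x = 0"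
  by (simp add: char_int_def shift_def tint_def)

lemma supp_cone_char_int:
  assumes "supp_cone a h" "\<bar>c\<bar> = 1" shows "supp_cone a (char_int c h)"
  unfolding supp_cone_def
proof (intro allI impI)
  fix t x assume t: "0 \<le> t" and x: "a + t < \<bar>x\<bar>"
  have "integral {0..t} (\<lambda>s. h s (x + c * t - c * s)) = integral {0..t} (\<lambda>s. 0)"
  proof (rule integral_cong)
    fix s assume "s \<in> {0..t}"
    then have "a + s < \<bar>x + c * t - c * s\<bar>" using x assms(2) by (auto simp: abs_if split: if_splits)
    then show "h s (x + c * t - c * s) = 0" using assms(1) \<open>s \<in> {0..t}\<close> by (auto simp: supp_cone_def)
  qed
  then show "char_int c h t x = 0" by (simp add: char_int_def shift_def tint_def)
qed

lemma char_int_bound: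
  assumes h: "smooth_hp h" and t: "0 \<le> t"
    and k: "\<And>s. 0 \<le> s \<Longrightarrow> s \<le> t \<Longrightarrow> (k has_real_derivative k' s) (at s within {0..})"
    and b: "\<And>s y. 0 \<le> s \<Longrightarrow> s \<le> t \<Longrightarrow> \<bar>h s y\<bar> \<le> k' s"
  shows "\<bar>char_int c h t x\<bar> \<le> k t - k 0"
proof -
  let ?y = "x + c * t"
  have "\<bar>tint (shift (- c) h) t ?y - tint (shift (- c) h) 0 ?y\<bar> \<le> k t - k 0"
    by (rule DERIV_bound_diff[OF tint_DERIV_t[OF smooth_hpD[OF smooth_hp_intros(5)[OF h]]] k _ t])
      (use b in \<open>auto simp: shift_def\<close>)
  then show ?thesis by (simp add: char_int_def shift_def tint_def)
qed

lemma Dx_funpow_mult_bound: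
  assumes "smooth_hp u" "smooth_hp v" "0 \<le> t" and "\<And>i. i \<le> j \<Longrightarrow> \<bar>(Dx ^^ i) u t x\<bar> \<le> K"
  shows "\<bar>(Dx ^^ j) (\<lambda>t x. u t x * v t x) t x\<bar> \<le> 2 ^ j * K * (\<Sum>l\<le>j. \<bar>(Dx ^^ l) v t x\<bar>)"
  using assms unfolding Dx_funpow_section
  by (intro funpow_deriv_mult_bound Ck_halfplane_section) (auto intro: smooth_hpD simp del: Ck_halfplane.simps)

lemma Dx_funpow_add:
  assumes "smooth_hp u" "smooth_hp v" "0 \<le> t"
  shows "(Dx ^^ j) (\<lambda>t x. u t x + v t x) t x = (Dx ^^ j) u t x + (Dx ^^ j) v t x"
  unfolding Dx_funpow_section
  by (subst funpow_deriv_add[of j]) (auto intro!: Ck_halfplane_section smooth_hpD assms simp del: Ck_halfplane.simps)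

lemma Dx_funpow_diff:
  assumes "smooth_hp u" "smooth_hp v" "0 \<le> t"
  shows "(Dx ^^ j) (\<lambda>t x. u t x - v t x) t x = (Dx ^^ j) u t x - (Dx ^^ j) v t x"
  unfolding Dx_funpow_section
  by (subst funpow_deriv_diff[of j]) (auto intro!: Ck_halfplane_section smooth_hpD assms simp del: Ck_halfplane.simps)

lemma Dx_funpow_cong:
  assumes "\<And>t x. 0 \<le> t \<Longrightarrow> u t x = v t x" "0 \<le> t" shows "(Dx ^^ j) u t x = (Dx ^^ j) v t x"
proof -
  have "u t = v t" using assms by auto
  then show ?thesis by (simp add: Dx_funpow_section)
qed

context
  fixes A B F :: "real \<Rightarrow> real \<Rightarrow> real" and p0 s0 :: "real \<Rightarrow> real"
begin

text \<open>Both components receive the same lower order term of the previous iterate; their data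
  are carried along x + t and x - t respectively.\<close>

primrec picard :: "nat \<Rightarrow> (real \<Rightarrow> real \<Rightarrow> real) \<times> (real \<Rightarrow> real \<Rightarrow> real)" where
  "picard 0 = (\<lambda>t x. 0, \<lambda>t x. 0)"
| "picard (Suc n) = (let h = (\<lambda>t x. A t x * fst (picard n) t x + B t x * snd (picard n) t x + F t x) in
     (\<lambda>t x. shift 1 (\<lambda>t. p0) t x + char_int 1 h t x, \<lambda>t x. shift (- 1) (\<lambda>t. s0) t x + char_int (- 1) h t x))"

end

text \<open>Differences of successive iterates satisfy the iteration without data and source, and
  each time integration turns t^n / n! into t^(n+1) / (n+1)!. The iterates and all their x
  derivatives therefore converge uniformly on every bounded time interval, whatever the size of A
  and B.\<close>

lemma characteristic_system_solution:
  assumes A: "smooth_hp A" and B: "smooth_hp B" and F: "smooth_hp F" and Fs: "supp_cone a F"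
    and p0: "\<And>k. Ck_fun k p0" and s0: "\<And>k. Ck_fun k s0"
    and p0s: "\<And>x. a < \<bar>x\<bar> \<Longrightarrow> p0 x = 0" and s0s: "\<And>x. a < \<bar>x\<bar> \<Longrightarrow> s0 x = 0"
  obtains p s where "smooth_hp p" "smooth_hp s" "supp_cone a p" "supp_cone a s" "p 0 = p0" "s 0 = s0"
    "\<And>t x. 0 \<le> t \<Longrightarrow> ((\<lambda>\<tau>. p \<tau> x) has_real_derivative Dx p t x + (A t x * p t x + B t x * s t x + F t x)) (at t within {0..})"
    "\<And>t x. 0 \<le> t \<Longrightarrow> ((\<lambda>\<tau>. s \<tau> x) has_real_derivative - Dx s t x + (A t x * p t x + B t x * s t x + F t x)) (at t within {0..})"
proof -
  define p where "p n = fst (picard A B F p0 s0 n)" for n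
  define s where "s n = snd (picard A B F p0 s0 n)" for n
  define h where "h n t x = A t x * p n t x + B t x * s n t x + F t x" for n t x
  have p_0: "p 0 = (\<lambda>t x. 0)" and s_0: "s 0 = (\<lambda>t x. 0)" by (simp_all add: p_def s_def)
  have p_Suc: "p (Suc n) = (\<lambda>t x. shift 1 (\<lambda>t. p0) t x + char_int 1 (h n) t x)"
    and s_Suc: "s (Suc n) = (\<lambda>t x. shift (- 1) (\<lambda>t. s0) t x + char_int (- 1) (h n) t x)" for n
    by (simp_all add: p_def s_def h_def[abs_def] Let_def)
  note p0sm = smooth_hp_intros(5)[OF smooth_hp_x[OF p0]] and s0sm = smooth_hp_intros(5)[OF smooth_hp_x[OF s0]]
  have sm: "smooth_hp (p n) \<and> smooth_hp (s n)" for n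
  proof (induction n)
    case 0
    show ?case by (simp add: p_0 s_0 smooth_hp_intros)
  next
    case (Suc n)
    have "smooth_hp (h n)" unfolding h_def[abs_def] using Suc by (intro smooth_hp_intros A B F) auto
    then show ?case unfolding p_Suc s_Suc by (intro conjI smooth_hp_intros(1) p0sm s0sm smooth_hp_char_int)
  qed
  then have psm: "smooth_hp (p n)" and ssm: "smooth_hp (s n)" for n by auto
  have hsm: "smooth_hp (h n)" for n unfolding h_def[abs_def] by (intro smooth_hp_intros A B F psm ssm)
  have p0c: "supp_cone a (shift 1 (\<lambda>t. p0))" and s0c: "supp_cone a (shift (- 1) (\<lambda>t. s0))"
    using p0s s0s by (auto simp: supp_cone_def shift_def)
  have sc: "supp_cone a (p n) \<and> supp_cone a (s n)" for n
  proof (induction n)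
    case 0
    show ?case by (simp add: p_0 s_0 supp_cone_def)
  next
    case (Suc n)
    have "supp_cone a (h n)" unfolding h_def[abs_def] using Suc by (intro supp_cone_add supp_cone_mult Fs) auto
    then show ?case unfolding p_Suc s_Suc by (intro conjI supp_cone_add p0c s0c supp_cone_char_int) auto
  qed
  then have psc: "supp_cone a (p n)" and ssc: "supp_cone a (s n)" for n by auto
  define P where "P n t x = p (Suc n) t x - p n t x" for n t x
  define S where "S n t x = s (Suc n) t x - s n t x" for n t x
  have Psm: "smooth_hp (P n)" and Ssm: "smooth_hp (S n)" for n
    unfolding P_def[abs_def] S_def[abs_def] by (intro smooth_hp_intros psm ssm)+
  have Psc: "supp_cone a (P n)" and Ssc: "supp_cone a (S n)" for n
    unfolding P_def[abs_def] S_def[abs_def] by (intro supp_cone_diff psc ssc)+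
  \<comment> \<open>The lower order term for differences: F cancels, and so do the transported
    data.\<close>
  define H where "H n t x = A t x * P n t x + B t x * S n t x" for n t x
  have Hsm: "smooth_hp (H n)" for n unfolding H_def[abs_def] by (intro smooth_hp_intros A B Psm Ssm)
  have H_eq: "H n = (\<lambda>t x. h (Suc n) t x - h n t x)" for n
    by (simp add: H_def h_def P_def S_def fun_eq_iff algebra_simps)
  have P_Suc: "P (Suc n) t x = char_int 1 (H n) t x" and S_Suc: "S (Suc n) t x = char_int (- 1) (H n) t x"
    if "0 \<le> t" for n t x
    unfolding H_eq char_int_diff[OF hsm hsm that] P_def S_def p_Suc[of "Suc n"] p_Suc[of n] s_Suc[of "Suc n"] s_Suc[of n]
    by simp_all
  \<comment> \<open>All orders up to i at once, because the product rule mixes them. K and M may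
    depend on i and T, but not on the iterate n.\<close>
  have bound: "\<exists>K M. \<forall>n l t x. l \<le> i \<longrightarrow> 0 \<le> t \<longrightarrow> t \<le> T \<longrightarrow>
      \<bar>(Dx ^^ l) (P n) t x\<bar> \<le> M * ((K * t) ^ n / fact n) \<and> \<bar>(Dx ^^ l) (S n) t x\<bar> \<le> M * ((K * t) ^ n / fact n)" for T i
  proof -
    have "\<exists>K. \<forall>l. 0 \<le> K l \<and> (\<forall>t x. 0 \<le> t \<longrightarrow> t \<le> T \<longrightarrow> \<bar>x\<bar> \<le> a + T \<longrightarrow> \<bar>(Dx ^^ l) u t x\<bar> \<le> K l)" if "smooth_hp u" for u
    proof -
      have "\<forall>l. \<exists>K. 0 \<le> K \<and> (\<forall>t x. 0 \<le> t \<longrightarrow> t \<le> T \<longrightarrow> \<bar>x\<bar> \<le> a + T \<longrightarrow> \<bar>(Dx ^^ l) u t x\<bar> \<le> K)"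
        using continuous_bounded_strip[OF smooth_hpD[OF smooth_hp_Dx_funpow[OF that]]] by blast
      then show ?thesis by (rule choice)
    qed
    note ex = this
    obtain KA :: "nat \<Rightarrow> real" where
      KA: "\<And>l. 0 \<le> KA l" "\<And>l t x. 0 \<le> t \<Longrightarrow> t \<le> T \<Longrightarrow> \<bar>x\<bar> \<le> a + T \<Longrightarrow> \<bar>(Dx ^^ l) A t x\<bar> \<le> KA l"
      using ex[OF A] by metis
    obtain KB :: "nat \<Rightarrow> real" where
      KB: "\<And>l. 0 \<le> KB l" "\<And>l t x. 0 \<le> t \<Longrightarrow> t \<le> T \<Longrightarrow> \<bar>x\<bar> \<le> a + T \<Longrightarrow> \<bar>(Dx ^^ l) B t x\<bar> \<le> KB l"
      using ex[OF B] by metis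
    define L where "L = (\<Sum>l\<le>i. KA l + KB l)"
    have memL: "KA l \<le> L" "KB l \<le> L" if "l \<le> i" for l
    proof -
      have "KA l + KB l \<le> L" unfolding L_def using KA(1) KB(1) that by (intro member_le_sum) auto
      then show "KA l \<le> L" "KB l \<le> L" using KA(1)[of l] KB(1)[of l] by auto
    qed
    have L0: "0 \<le> L" unfolding L_def using KA(1) KB(1) by (intro sum_nonneg add_nonneg_nonneg) auto
    have "\<forall>l. \<exists>K. 0 \<le> K \<and> (\<forall>t x. 0 \<le> t \<longrightarrow> t \<le> T \<longrightarrow> \<bar>(Dx ^^ l) (P 0) t x\<bar> \<le> K \<and> \<bar>(Dx ^^ l) (S 0) t x\<bar> \<le> K)"
    proof
      fix l
      obtain K1 where "0 \<le> K1" "\<forall>t x. 0 \<le> t \<longrightarrow> t \<le> T \<longrightarrow> \<bar>(Dx ^^ l) (P 0) t x\<bar> \<le> K1"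
        using supp_cone_bounded[OF smooth_hpD[OF smooth_hp_Dx_funpow[OF Psm]] supp_cone_Dx_funpow[OF Psc]] by blast
      moreover obtain K2 where "0 \<le> K2" "\<forall>t x. 0 \<le> t \<longrightarrow> t \<le> T \<longrightarrow> \<bar>(Dx ^^ l) (S 0) t x\<bar> \<le> K2"
        using supp_cone_bounded[OF smooth_hpD[OF smooth_hp_Dx_funpow[OF Ssm]] supp_cone_Dx_funpow[OF Ssc]] by blast
      ultimately show "\<exists>K. 0 \<le> K \<and> (\<forall>t x. 0 \<le> t \<longrightarrow> t \<le> T \<longrightarrow> \<bar>(Dx ^^ l) (P 0) t x\<bar> \<le> K \<and> \<bar>(Dx ^^ l) (S 0) t x\<bar> \<le> K)"
        by (intro exI[of _ "K1 + K2"]) (simp add: add_increasing add_increasing2)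
    qed
    then obtain M0 :: "nat \<Rightarrow> real" where M0: "\<And>l. 0 \<le> M0 l"
        "\<And>l t x. 0 \<le> t \<Longrightarrow> t \<le> T \<Longrightarrow> \<bar>(Dx ^^ l) (P 0) t x\<bar> \<le> M0 l \<and> \<bar>(Dx ^^ l) (S 0) t x\<bar> \<le> M0 l"
      by metis
    define M where "M = (\<Sum>l\<le>i. M0 l)"
    have memM: "M0 l \<le> M" if "l \<le> i" for l
      unfolding M_def using M0(1) that by (intro member_le_sum) auto
    have Mnn: "0 \<le> M" unfolding M_def using M0(1) by (intro sum_nonneg) auto
    \<comment> \<open>The factor 2 stands for the two products in \<open>H\<close>; the rest is the
      Leibniz bound 2^i L summed over at most i + 1 orders.\<close>
    define K where "K = 2 * (2 ^ i * L * (real i + 1))"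
    have K0: "0 \<le> K" using L0 by (simp add: K_def)
    have "\<forall>l t x. l \<le> i \<longrightarrow> 0 \<le> t \<longrightarrow> t \<le> T \<longrightarrow>
      \<bar>(Dx ^^ l) (P n) t x\<bar> \<le> M * ((K * t) ^ n / fact n) \<and> \<bar>(Dx ^^ l) (S n) t x\<bar> \<le> M * ((K * t) ^ n / fact n)" for n
    proof (induction n)
      case 0
      show ?case using M0(2) memM by (fastforce intro: order_trans)
    next
      case (Suc n)
      have prodb: "\<bar>(Dx ^^ l) (\<lambda>t x. u t x * v t x) t x\<bar> \<le> (K / 2) * (M * ((K * t) ^ n / fact n))"
        if l: "l \<le> i" and t: "0 \<le> t" "t \<le> T" and u: "smooth_hp u" and v: "smooth_hp v" and vs: "supp_cone a v"
          and ub: "\<And>l t x. l \<le> i \<Longrightarrow> 0 \<le> t \<Longrightarrow> t \<le> T \<Longrightarrow> \<bar>x\<bar> \<le> a + T \<Longrightarrow> \<bar>(Dx ^^ l) u t x\<bar> \<le> L"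
          and vb: "\<And>l x. l \<le> i \<Longrightarrow> \<bar>(Dx ^^ l) v t x\<bar> \<le> M * ((K * t) ^ n / fact n)" for l t x u v
      proof (cases "\<bar>x\<bar> \<le> a + T")
        case True
        let ?q = "M * ((K * t) ^ n / fact n)"
        have q: "0 \<le> ?q" using Mnn K0 t by simp
        have "\<bar>(Dx ^^ l) (\<lambda>t x. u t x * v t x) t x\<bar> \<le> 2 ^ l * L * (\<Sum>l\<le>l. \<bar>(Dx ^^ l) v t x\<bar>)"
          using l by (intro Dx_funpow_mult_bound u v t ub True) auto
        also have "\<dots> \<le> 2 ^ i * L * ((real i + 1) * ?q)"
        proof (intro mult_mono)
          have "(\<Sum>l\<le>l. \<bar>(Dx ^^ l) v t x\<bar>) \<le> (\<Sum>l\<le>l. ?q)" using l by (intro sum_mono vb) auto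
          also have "\<dots> = (real l + 1) * ?q" by simp
          also have "\<dots> \<le> (real i + 1) * ?q" using l q by (intro mult_right_mono) auto
          finally show "(\<Sum>l\<le>l. \<bar>(Dx ^^ l) v t x\<bar>) \<le> (real i + 1) * ?q" .
        qed (use l L0 in \<open>auto intro: sum_nonneg\<close>)
        also have "\<dots> = (K / 2) * ?q" by (simp add: K_def)
        finally show ?thesis .
      next
        case False
        have "supp_cone a ((Dx ^^ l) (\<lambda>t x. u t x * v t x))"
          by (intro supp_cone_Dx_funpow supp_cone_mult vs)
        then have "(Dx ^^ l) (\<lambda>t x. u t x * v t x) t x = 0" using False t by (auto simp: supp_cone_def)
        then show ?thesis using Mnn K0 t by simp
      qed
      have Hb: "\<bar>(Dx ^^ l) (H n) t x\<bar> \<le> K * (M * ((K * t) ^ n / fact n))"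
        if l: "l \<le> i" and t: "0 \<le> t" "t \<le> T" for l t x
      proof -
        have "\<bar>(Dx ^^ l) (\<lambda>t x. A t x * P n t x) t x\<bar> \<le> (K / 2) * (M * ((K * t) ^ n / fact n))"
          by (rule prodb[OF l t A Psm Psc]) (rule order_trans[OF KA(2) memL(1)], assumption+, use Suc l t in blast)
        moreover have "\<bar>(Dx ^^ l) (\<lambda>t x. B t x * S n t x) t x\<bar> \<le> (K / 2) * (M * ((K * t) ^ n / fact n))"
          by (rule prodb[OF l t B Ssm Ssc]) (rule order_trans[OF KB(2) memL(2)], assumption+, use Suc l t in blast)
        moreover have "(Dx ^^ l) (H n) t x = (Dx ^^ l) (\<lambda>t x. A t x * P n t x) t x + (Dx ^^ l) (\<lambda>t x. B t x * S n t x) t x"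
          unfolding H_def[abs_def] by (intro Dx_funpow_add smooth_hp_intros A B Psm Ssm t)
        ultimately show ?thesis by (simp add: field_simps abs_le_iff)
      qed
      \<comment> \<open>A primitive of the bound on \<open>H n\<close>; here the factorial gains its
        next factor.\<close>
      have der: "((\<lambda>s. M * ((K * s) ^ Suc n / fact (Suc n))) has_real_derivative K * (M * ((K * s) ^ n / fact n))) (at s within {0..})" for s
        by (rule derivative_eq_intros refl | simp add: divide_simps)+
      have Jb: "\<bar>(Dx ^^ l) (char_int c (H n)) t x\<bar> \<le> M * ((K * t) ^ Suc n / fact (Suc n))"
        if l: "l \<le> i" and t: "0 \<le> t" "t \<le> T" for l t x c
        unfolding Dx_funpow_char_int[OF Hsm t(1)]
        using char_int_bound[OF smooth_hp_Dx_funpow[OF Hsm] t(1) der, of l n c x] Hb[OF l] t by fastforce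
      have E: "(Dx ^^ l) (P (Suc n)) t x = (Dx ^^ l) (char_int 1 (H n)) t x"
        "(Dx ^^ l) (S (Suc n)) t x = (Dx ^^ l) (char_int (- 1) (H n)) t x" if "0 \<le> t" for l t x
        by (rule Dx_funpow_cong; use P_Suc S_Suc that in simp)+
      show ?case
      proof (intro allI impI)
        fix l t x assume "l \<le> i" "0 \<le> t" "t \<le> T"
        then show "\<bar>(Dx ^^ l) (P (Suc n)) t x\<bar> \<le> M * ((K * t) ^ Suc n / fact (Suc n)) \<and>
            \<bar>(Dx ^^ l) (S (Suc n)) t x\<bar> \<le> M * ((K * t) ^ Suc n / fact (Suc n))"
          unfolding E[OF \<open>0 \<le> t\<close>] by (intro conjI Jb)
      qed
    qed
    then show ?thesis by blast
  qed
  have UCg: "UC (\<lambda>n. (Dx ^^ i) (u n))"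
    if u: "\<And>n. smooth_hp (u n)" and b: "\<And>T. \<exists>K M. \<forall>n t x. 0 \<le> t \<longrightarrow> t \<le> T \<longrightarrow>
      \<bar>(Dx ^^ i) (\<lambda>t x. u (Suc n) t x - u n t x) t x\<bar> \<le> M * ((K * t) ^ n / fact n)" for u i
  proof (rule UC_summable)
    fix T :: real assume T: "0 \<le> T"
    obtain K M where KM: "\<And>n t x. 0 \<le> t \<Longrightarrow> t \<le> T \<Longrightarrow>
        \<bar>(Dx ^^ i) (\<lambda>t x. u (Suc n) t x - u n t x) t x\<bar> \<le> M * ((K * t) ^ n / fact n)"
      using b[of T] by blast
    have "summable (\<lambda>n. \<bar>M\<bar> * (inverse (fact n) * (\<bar>K\<bar> * T) ^ n))"
      by (intro summable_mult summable_exp)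
    moreover have "\<bar>(Dx ^^ i) (u (Suc n)) t x - (Dx ^^ i) (u n) t x\<bar> \<le> \<bar>M\<bar> * (inverse (fact n) * (\<bar>K\<bar> * T) ^ n)"
      if t: "0 \<le> t" "t \<le> T" for n t x
    proof -
      have "\<bar>(Dx ^^ i) (u (Suc n)) t x - (Dx ^^ i) (u n) t x\<bar> \<le> M * ((K * t) ^ n / fact n)"
        using KM[OF t] by (simp only: Dx_funpow_diff[OF u u t(1)])
      also have "\<dots> \<le> \<bar>M * ((K * t) ^ n / fact n)\<bar>" by (rule abs_ge_self)
      also have "\<dots> = \<bar>M\<bar> * (inverse (fact n) * (\<bar>K\<bar> * t) ^ n)"
        using t by (simp add: abs_mult power_abs divide_inverse mult.commute)
      also have "\<dots> \<le> \<bar>M\<bar> * (inverse (fact n) * (\<bar>K\<bar> * T) ^ n)"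
        using t by (intro mult_left_mono power_mono) auto
      finally show ?thesis .
    qed
    ultimately show "\<exists>g. summable g \<and> (\<forall>n t x. 0 \<le> t \<longrightarrow> t \<le> T \<longrightarrow>
        \<bar>(Dx ^^ i) (u (Suc n)) t x - (Dx ^^ i) (u n) t x\<bar> \<le> g n)" by blast
  qed
  have UCp: "UC (\<lambda>n. (Dx ^^ i) (p n))" for i
  proof (rule UCg[OF psm])
    fix T
    obtain K M where KM: "\<forall>n l t x. l \<le> i \<longrightarrow> 0 \<le> t \<longrightarrow> t \<le> T \<longrightarrow>
      \<bar>(Dx ^^ l) (P n) t x\<bar> \<le> M * ((K * t) ^ n / fact n) \<and> \<bar>(Dx ^^ l) (S n) t x\<bar> \<le> M * ((K * t) ^ n / fact n)"
      using bound[of i T] by blast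
    show "\<exists>K M. \<forall>n t x. 0 \<le> t \<longrightarrow> t \<le> T \<longrightarrow>
      \<bar>(Dx ^^ i) (\<lambda>t x. p (Suc n) t x - p n t x) t x\<bar> \<le> M * ((K * t) ^ n / fact n)"
      unfolding P_def[symmetric] by (rule exI[of _ K], rule exI[of _ M]) (use KM in blast)
  qed
  have UCs: "UC (\<lambda>n. (Dx ^^ i) (s n))" for i
  proof (rule UCg[OF ssm])
    fix T
    obtain K M where KM: "\<forall>n l t x. l \<le> i \<longrightarrow> 0 \<le> t \<longrightarrow> t \<le> T \<longrightarrow>
      \<bar>(Dx ^^ l) (P n) t x\<bar> \<le> M * ((K * t) ^ n / fact n) \<and> \<bar>(Dx ^^ l) (S n) t x\<bar> \<le> M * ((K * t) ^ n / fact n)"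
      using bound[of i T] by blast
    show "\<exists>K M. \<forall>n t x. 0 \<le> t \<longrightarrow> t \<le> T \<longrightarrow>
      \<bar>(Dx ^^ i) (\<lambda>t x. s (Suc n) t x - s n t x) t x\<bar> \<le> M * ((K * t) ^ n / fact n)"
      unfolding S_def[symmetric] by (rule exI[of _ K], rule exI[of _ M]) (use KM in blast)
  qed
  have UCp0: "UC p" and UCs0: "UC s" and UCp1: "UC (\<lambda>n. Dx (p n))" and UCs1: "UC (\<lambda>n. Dx (s n))"
    using UCp[of 0] UCs[of 0] UCp[of 1] UCs[of 1] by simp_all
  have UCh: "UC h"
    unfolding h_def[abs_def]
    by (intro UC_add UC_const UC_mult_supp[OF smooth_hpD[OF A, of 0]] UC_mult_supp[OF smooth_hpD[OF B, of 0]] UCp0 UCs0) (rule psc ssc)+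
  define pp where "pp = hlim p"
  define ss where "ss = hlim s"
  have h_lim: "hlim h t x = A t x * pp t x + B t x * ss t x + F t x" if t: "0 \<le> t" for t x
  proof (rule LIMSEQ_unique[OF UC_tendsto[OF UCh t]])
    show "(\<lambda>n. h n t x) \<longlonglongrightarrow> A t x * pp t x + B t x * ss t x + F t x"
      unfolding h_def pp_def ss_def by (intro tendsto_intros UC_tendsto t UCp0 UCs0)
  qed
  have ppx: "Dx pp t x = hlim (\<lambda>n. Dx (p n)) t x" and ssx: "Dx ss t x = hlim (\<lambda>n. Dx (s n)) t x" if t: "0 \<le> t" for t x
    unfolding pp_def ss_def
    by (rule Dx_eqI, rule hlim_DERIV_x[OF smooth_hp_Dx[OF psm] UCp0 UCp1 t], assumption)
       (rule Dx_eqI, rule hlim_DERIV_x[OF smooth_hp_Dx[OF ssm] UCs0 UCs1 t], assumption)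
  have p_t: "((\<lambda>\<tau>. p (Suc n) \<tau> x) has_real_derivative Dx (p (Suc n)) t x + h n t x) (at t within {0..})" if t: "0 \<le> t" for n t x
  proof -
    have 1: "((\<lambda>\<tau>. shift 1 (\<lambda>t. p0) \<tau> x) has_real_derivative Dt (\<lambda>t. p0) t (x + t) + Dx (shift 1 (\<lambda>t. p0)) t x) (at t within {0..})"
      using shift_DERIV_t[OF smooth_hpD[OF smooth_hp_x[OF p0]] t, of 1 x]
        Dx_shift[OF smooth_hp_x[OF p0] t, of 1 x] by (simp add: shift_def)
    have 2: "Dt (\<lambda>t. p0) t y = 0" for y by (rule Dt_eqI[OF DERIV_const t])
    have 3: "Dx (p (Suc n)) t x = Dx (shift 1 (\<lambda>t. p0)) t x + Dx (char_int 1 (h n)) t x"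
      unfolding p_Suc by (rule Dx_add[OF smooth_hpD[OF p0sm] smooth_hpD[OF smooth_hp_char_int[OF hsm]] t])
    show ?thesis
      using DERIV_add[OF 1 char_int_DERIV_t[OF hsm[of n] t, of 1 x]] unfolding 2 3 unfolding p_Suc by (simp add: add_ac)
  qed
  have s_t: "((\<lambda>\<tau>. s (Suc n) \<tau> x) has_real_derivative - Dx (s (Suc n)) t x + h n t x) (at t within {0..})" if t: "0 \<le> t" for n t x
  proof -
    have 1: "((\<lambda>\<tau>. shift (- 1) (\<lambda>t. s0) \<tau> x) has_real_derivative Dt (\<lambda>t. s0) t (x - t) - Dx (shift (- 1) (\<lambda>t. s0)) t x) (at t within {0..})"
      using shift_DERIV_t[OF smooth_hpD[OF smooth_hp_x[OF s0]] t, of "- 1" x]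
        Dx_shift[OF smooth_hp_x[OF s0] t, of "- 1" x] by (simp add: shift_def)
    have 2: "Dt (\<lambda>t. s0) t y = 0" for y by (rule Dt_eqI[OF DERIV_const t])
    have 3: "Dx (s (Suc n)) t x = Dx (shift (- 1) (\<lambda>t. s0)) t x + Dx (char_int (- 1) (h n)) t x"
      unfolding s_Suc by (rule Dx_add[OF smooth_hpD[OF s0sm] smooth_hpD[OF smooth_hp_char_int[OF hsm]] t])
    show ?thesis
      using DERIV_add[OF 1 char_int_DERIV_t[OF hsm[of n] t, of "- 1" x]] unfolding 2 3 unfolding s_Suc by (simp add: algebra_simps)
  qed
  \<comment> \<open>The differential equation links iterate n + 1 with \<open>h n\<close>, so the
    limits are taken along the shifted sequence.\<close>
  have pp_alt: "pp t x = hlim (\<lambda>n. p (Suc n)) t x" and ss_alt: "ss t x = hlim (\<lambda>n. s (Suc n)) t x" if t: "0 \<le> t" for t x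
    using LIMSEQ_unique[OF LIMSEQ_Suc[OF UC_tendsto[OF UCp0 t]] UC_tendsto[OF UC_Suc[OF UCp0] t]]
      LIMSEQ_unique[OF LIMSEQ_Suc[OF UC_tendsto[OF UCs0 t]] UC_tendsto[OF UC_Suc[OF UCs0] t]]
    by (simp_all add: pp_def ss_def)
  have UCms1: "UC (\<lambda>n t x. - 1 * Dx (s n) t x)"
    by (intro UC_mult_supp[OF Ck_halfplane_const[of 0 "- 1"]] UCs1 supp_cone_Dx) (rule ssc)
  have UCpt: "UC (\<lambda>n t x. Dx (p (Suc n)) t x + h n t x)"
    by (intro UC_add UCh UC_Suc[OF UCp1])
  have UCst: "UC (\<lambda>n t x. - Dx (s (Suc n)) t x + h n t x)"
    using UC_add[OF UC_Suc[OF UCms1] UCh] by simp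
  have ppt: "((\<lambda>\<tau>. pp \<tau> x) has_real_derivative Dx pp t x + (A t x * pp t x + B t x * ss t x + F t x)) (at t within {0..})"
    if t: "0 \<le> t" for t x
  proof -
    have "hlim (\<lambda>n t x. Dx (p (Suc n)) t x + h n t x) t x = Dx pp t x + (A t x * pp t x + B t x * ss t x + F t x)"
      unfolding h_lim[OF t, symmetric] ppx[OF t]
      by (rule LIMSEQ_unique[OF UC_tendsto[OF UCpt t]])
        (intro tendsto_add LIMSEQ_Suc[OF UC_tendsto[OF UCp1 t]] UC_tendsto[OF UCh t])
    then have "((\<lambda>\<tau>. hlim (\<lambda>n. p (Suc n)) \<tau> x) has_real_derivative
        Dx pp t x + (A t x * pp t x + B t x * ss t x + F t x)) (at t within {0..})"
      using hlim_DERIV_t[of "\<lambda>n. p (Suc n)" x "\<lambda>n t x. Dx (p (Suc n)) t x + h n t x", OF p_t UC_Suc[OF UCp0] UCpt t] by simp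
    then show ?thesis by (rule DERIV_transform_nonneg[OF _ t]) (simp add: pp_alt)
  qed
  have sst: "((\<lambda>\<tau>. ss \<tau> x) has_real_derivative - Dx ss t x + (A t x * pp t x + B t x * ss t x + F t x)) (at t within {0..})"
    if t: "0 \<le> t" for t x
  proof -
    have "hlim (\<lambda>n t x. - Dx (s (Suc n)) t x + h n t x) t x = - Dx ss t x + (A t x * pp t x + B t x * ss t x + F t x)"
      unfolding h_lim[OF t, symmetric] ssx[OF t]
      by (rule LIMSEQ_unique[OF UC_tendsto[OF UCst t]])
        (intro tendsto_add tendsto_minus LIMSEQ_Suc[OF UC_tendsto[OF UCs1 t]] UC_tendsto[OF UCh t])
    then have "((\<lambda>\<tau>. hlim (\<lambda>n. s (Suc n)) \<tau> x) has_real_derivative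
        - Dx ss t x + (A t x * pp t x + B t x * ss t x + F t x)) (at t within {0..})"
      using hlim_DERIV_t[of "\<lambda>n. s (Suc n)" x "\<lambda>n t x. - Dx (s (Suc n)) t x + h n t x", OF s_t UC_Suc[OF UCs0] UCst t] by simp
    then show ?thesis by (rule DERIV_transform_nonneg[OF _ t]) (simp add: ss_alt)
  qed
  have ckx: "Ckx_halfplane j pp" "Ckx_halfplane j ss" for j
    unfolding pp_def ss_def by (intro Ckx_halfplane_hlim smooth_hpD psm ssm UCp UCs)+
  \<comment> \<open>Uniform convergence was established for x derivatives; the system itself
    supplies the time derivatives of every order.\<close>
  have fin: "smooth_hp pp" "smooth_hp ss"
    unfolding smooth_hp_def
    using characteristic_system_regularity[OF ckx smooth_hpD[OF A] smooth_hpD[OF B] smooth_hpD[OF F] ppt sst] by blast+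
  have supp: "supp_cone a (hlim u)" if "\<And>n. supp_cone a (u n)" for u
    using that by (simp add: supp_cone_def hlim_def)
  have i0: "pp 0 x = p0 x" "ss 0 x = s0 x" for x
  proof -
    have "hlim (\<lambda>n. p (Suc n)) 0 x = p0 x" "hlim (\<lambda>n. s (Suc n)) 0 x = s0 x"
      by (simp_all add: hlim_def p_Suc s_Suc char_int_0 shift_def)
    then show "pp 0 x = p0 x" "ss 0 x = s0 x" using pp_alt[of 0 x] ss_alt[of 0 x] by simp_all
  qed
  show ?thesis
  proof (rule that[OF fin _ _ _ _ ppt sst])
    show "supp_cone a pp" "supp_cone a ss" unfolding pp_def ss_def by (rule supp, rule psc) (rule supp, rule ssc)
    show "pp 0 = p0" "ss 0 = s0" using i0 by auto
  qed
qed

text \<open>The unknowns p = v_t + v_x and s = v_t - v_x turn the equation into the characteristic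
  system; A and B are the coefficients of p and s in al v_t + be v_x. The function v is rebuilt by
  integrating (p + s) / 2 in time.\<close>

lemma wave_equation_smooth_solution:
  assumes al: "smooth_hp al" and be: "smooth_hp be" and F: "smooth_hp F" and Fs: "supp_cone a F"
    and f: "\<And>k. Ck_fun k f" and g: "\<And>k. Ck_fun k g"
    and fs: "\<And>x. a < \<bar>x\<bar> \<Longrightarrow> f x = 0" and gs: "\<And>x. a < \<bar>x\<bar> \<Longrightarrow> g x = 0"
  obtains v where "smooth_hp v" "supp_cone a v" "v 0 = f" "\<And>x. Dt v 0 x = g x"
    "\<And>t x. 0 \<le> t \<Longrightarrow> Dt (Dt v) t x - Dx (Dx v) t x = al t x * Dt v t x + be t x * Dx v t x + F t x"
proof -
  define A where "A t x = (1/2) * (al t x + be t x)" for t x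
  define B where "B t x = (1/2) * (al t x - be t x)" for t x
  have A: "smooth_hp A" and B: "smooth_hp B"
    unfolding A_def[abs_def] B_def[abs_def] by (intro smooth_hp_intros al be)+
  have f': "Ck_fun k (deriv f)" for k by (rule Ck_fun_deriv[OF f])
  have f's: "deriv f x = 0" if "a < \<bar>x\<bar>" for x
  proof -
    have "open {y :: real. a < \<bar>y\<bar>}" by (intro open_Collect_less continuous_intros)
    from has_field_derivative_transform_within_open[OF DERIV_const this, of x 0 f]
    show ?thesis using fs that by (intro DERIV_imp_deriv) auto
  qed
  obtain p s where p: "smooth_hp p" and s: "smooth_hp s" and ps: "supp_cone a p" and ss: "supp_cone a s"
    and p0: "p 0 = (\<lambda>x. g x + deriv f x)" and s0: "s 0 = (\<lambda>x. g x - deriv f x)"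
    and pt: "\<And>t x. 0 \<le> t \<Longrightarrow> ((\<lambda>\<tau>. p \<tau> x) has_real_derivative Dx p t x + (A t x * p t x + B t x * s t x + F t x)) (at t within {0..})"
    and st: "\<And>t x. 0 \<le> t \<Longrightarrow> ((\<lambda>\<tau>. s \<tau> x) has_real_derivative - Dx s t x + (A t x * p t x + B t x * s t x + F t x)) (at t within {0..})"
    by (rule characteristic_system_solution[OF A B F Fs, where ?p0.0 = "\<lambda>x. g x + deriv f x" and ?s0.0 = "\<lambda>x. g x - deriv f x"])
      (auto intro!: Ck_fun_add Ck_fun_diff f' g simp: gs f's)
  define w where "w t x = (1/2) * (p t x + s t x)" for t x
  define y where "y t x = (1/2) * (p t x - s t x)" for t x
  define v where "v t x = f x + tint w t x" for t x
  have w: "smooth_hp w" unfolding w_def[abs_def] by (intro smooth_hp_intros p s)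
  have wx: "(w t has_real_derivative (1/2) * (Dx p t x + Dx s t x)) (at x)" if "0 \<le> t" for t x
    unfolding w_def[abs_def] by (intro DERIV_cmult DERIV_add smooth_hp_Dx p s that)
  have yx: "(y t has_real_derivative (1/2) * (Dx p t x - Dx s t x)) (at x)" if "0 \<le> t" for t x
    unfolding y_def[abs_def] by (intro DERIV_cmult DERIV_diff smooth_hp_Dx p s that)
  have v: "smooth_hp v" unfolding v_def[abs_def] by (intro smooth_hp_intros w smooth_hp_x f)
  have vt: "Dt v t x = w t x" if "0 \<le> t" for t x
    using DERIV_add[OF DERIV_const tint_DERIV_t[OF smooth_hpD[OF w] that], of "f x" x]
    unfolding v_def[abs_def] by (intro Dt_eqI that) simp
  let ?wx = "\<lambda>t x. (1/2) * (Dx p t x + Dx s t x)"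
  have wxs: "smooth_hp ?wx" by (intro smooth_hp_intros p s)
  \<comment> \<open>Compatibility: the system gives y_t = w_x, and y starts from
    \<open>deriv f\<close>, so y and the x derivative of v are the same integral.\<close>
  have vx: "Dx v t x = y t x" if t: "0 \<le> t" for t x
  proof -
    have "y t x = y 0 x + tint ?wx t x"
    proof (rule tint_FTC[OF smooth_hpD[OF wxs] _ t])
      fix t assume "0 \<le> (t::real)"
      then show "((\<lambda>\<tau>. y \<tau> x) has_real_derivative ?wx t x) (at t within {0..})"
        using DERIV_cmult[OF DERIV_diff[OF pt[of t x] st[of t x]], of "1/2"] unfolding y_def[abs_def] by simp
    qed
    moreover have "y 0 x = deriv f x" by (simp add: y_def p0 s0)
    moreover have "(v t has_real_derivative deriv f x + tint ?wx t x) (at x)"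
      unfolding v_def[abs_def]
      by (intro DERIV_add Ck_fun_DERIV[OF f] tint_DERIV_x[OF smooth_hpD[OF w] smooth_hpD[OF wxs] _ t]) (rule wx)
    ultimately show ?thesis by (intro Dx_eqI) simp
  qed
  have vsupp: "supp_cone a v"
    unfolding supp_cone_def
  proof (intro allI impI)
    fix t x assume t: "0 \<le> t" and x: "a + t < \<bar>x\<bar>"
    have "tint w t x = tint (\<lambda>t x. 0) t x"
      unfolding tint_def using x ps ss by (intro integral_cong) (auto simp: w_def supp_cone_def)
    then show "v t x = 0" using fs[of x] t x by (simp add: v_def tint_def)
  qed
  have "Dt (Dt v) t x - Dx (Dx v) t x = al t x * Dt v t x + be t x * Dx v t x + F t x" if t: "0 \<le> t" for t x
  proof -
    have "Dt (Dt v) t x = Dt w t x" by (rule Dt_cong[OF _ t]) (rule vt)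
    also have "\<dots> = (1/2) * ((Dx p t x + (A t x * p t x + B t x * s t x + F t x)) + (- Dx s t x + (A t x * p t x + B t x * s t x + F t x)))"
      unfolding w_def[abs_def] by (intro Dt_eqI DERIV_cmult DERIV_add pt st t)
    finally have 1: "Dt (Dt v) t x = (1/2) * (Dx p t x - Dx s t x) + (A t x * p t x + B t x * s t x + F t x)"
      by (simp add: field_simps)
    have "Dx v t = y t" using vx[OF t] by auto
    then have "Dx (Dx v) t x = Dx y t x" by (simp add: Dx_section)
    then have 2: "Dx (Dx v) t x = (1/2) * (Dx p t x - Dx s t x)" using Dx_eqI[where u = y, OF yx[OF t]] by simp
    show ?thesis unfolding 1 2 vt[OF t] vx[OF t] by (simp add: A_def B_def w_def y_def field_simps)
  qed
  then show ?thesis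
    by (intro that[OF v vsupp]) (auto simp: v_def[of 0] tint_def vt w_def p0 s0)
qed

section \<open>The weighted spaces\<close>

text \<open>Integrability is automatic in this class, which contains all integrands of the energy
  method; bilinearity of \<open>wip\<close> thus reduces to membership.\<close>

definition compact_cont :: "(real \<Rightarrow> real) \<Rightarrow> bool" where
  "compact_cont f \<longleftrightarrow> continuous_on UNIV f \<and> (\<exists>a. \<forall>x. a < \<bar>x\<bar> \<longrightarrow> f x = 0)"

lemma LINT_compact_support:
  fixes f :: "real \<Rightarrow> real"
  assumes c: "continuous_on UNIV f" and z: "\<And>x. a < \<bar>x\<bar> \<Longrightarrow> f x = 0"
  shows "integrable lebesgue f" "(LINT x|lebesgue. f x) = integral {-a..a} f"
proof -
  have 1: "set_integrable lebesgue {-a..a} f"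
    by (rule absolutely_integrable_continuous_real[OF continuous_on_subset[OF c]]) auto
  have 2: "(\<lambda>x. indicator {-a..a} x *\<^sub>R f x) = f"
  proof
    show "indicator {-a..a} x *\<^sub>R f x = f x" for x
    proof -
      have "a < \<bar>x\<bar> \<or> x \<in> {-a..a}" by auto
      then show ?thesis using z[of x] by auto
    qed
  qed
  show "integrable lebesgue f" using 1 unfolding set_integrable_def 2 .
  show "(LINT x|lebesgue. f x) = integral {-a..a} f"
    using set_lebesgue_integral_eq_integral(2)[OF 1] unfolding set_lebesgue_integral_def 2 .
qed

lemma compact_cont_integrable: "compact_cont f \<Longrightarrow> integrable lebesgue f"
  unfolding compact_cont_def using LINT_compact_support(1) by blast

lemma compact_cont_add: "compact_cont f \<Longrightarrow> compact_cont g \<Longrightarrow> compact_cont (\<lambda>x. f x + g x)"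
  unfolding compact_cont_def
proof (elim conjE exE, intro conjI)
  fix a b assume "\<forall>x. a < \<bar>x\<bar> \<longrightarrow> f x = 0" "\<forall>x. b < \<bar>x\<bar> \<longrightarrow> g x = 0"
  then show "\<exists>a. \<forall>x. a < \<bar>x\<bar> \<longrightarrow> f x + g x = 0" by (intro exI[of _ "max a b"]) auto
qed (rule continuous_on_add)

lemma compact_cont_mult:
  "continuous_on UNIV f \<Longrightarrow> compact_cont g \<Longrightarrow> compact_cont (\<lambda>x. f x * g x)"
  "compact_cont f \<Longrightarrow> continuous_on UNIV g \<Longrightarrow> compact_cont (\<lambda>x. f x * g x)"
  unfolding compact_cont_def by (auto intro: continuous_on_mult)

lemma compact_cont_continuous: "compact_cont f \<Longrightarrow> continuous_on UNIV f"
  by (simp add: compact_cont_def)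

lemma compact_cont_cmult: "compact_cont f \<Longrightarrow> compact_cont (\<lambda>x. c * f x)"
  by (intro compact_cont_mult(1) continuous_on_const)

lemma compact_cont_diff: "compact_cont f \<Longrightarrow> compact_cont g \<Longrightarrow> compact_cont (\<lambda>x. f x - g x)"
  using compact_cont_add[OF _ compact_cont_cmult[of g "- 1"]] by simp

lemma compact_cont_sum: "(\<And>i. i \<in> I \<Longrightarrow> compact_cont (f i)) \<Longrightarrow> compact_cont (\<lambda>x. \<Sum>i\<in>I. f i x)"
proof (induction I rule: infinite_finite_induct)
  case (insert i I)
  then show ?case using compact_cont_add[of "f i" "\<lambda>x. \<Sum>i\<in>I. f i x"] by simp
qed (auto simp: compact_cont_def)

lemma test_functionsD: "\<phi> \<in> test_functions \<Longrightarrow> Ck_fun k \<phi>"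
  by (simp add: test_functions_def)

lemma test_compact_cont: "\<phi> \<in> test_functions \<Longrightarrow> compact_cont \<phi>"
  unfolding compact_cont_def test_functions_def by (auto intro: Ck_fun_continuous)

lemma test_functionsI: "(\<And>k. Ck_fun k \<phi>) \<Longrightarrow> compact_cont \<phi> \<Longrightarrow> \<phi> \<in> test_functions"
  by (auto simp: test_functions_def compact_cont_def)

lemma test_add: "\<phi> \<in> test_functions \<Longrightarrow> \<psi> \<in> test_functions \<Longrightarrow> (\<lambda>x. \<phi> x + \<psi> x) \<in> test_functions"
  by (rule test_functionsI, rule Ck_fun_add, erule test_functionsD, erule test_functionsD,
      rule compact_cont_add; erule test_compact_cont)

lemma test_mult: "(\<And>k. Ck_fun k f) \<Longrightarrow> \<psi> \<in> test_functions \<Longrightarrow> (\<lambda>x. f x * \<psi> x) \<in> test_functions"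
  by (rule test_functionsI, rule Ck_fun_mult, assumption, erule test_functionsD,
      rule compact_cont_mult(1), rule Ck_fun_continuous[of 0], assumption, erule test_compact_cont)

lemma test_cmult: "\<psi> \<in> test_functions \<Longrightarrow> (\<lambda>x. c * \<psi> x) \<in> test_functions"
  by (intro test_mult Ck_fun_const)

lemma test_diff: "\<phi> \<in> test_functions \<Longrightarrow> \<psi> \<in> test_functions \<Longrightarrow> (\<lambda>x. \<phi> x - \<psi> x) \<in> test_functions"
  using test_add[OF _ test_cmult[of \<psi> "-1"]] by simp

lemma test_deriv: assumes "\<phi> \<in> test_functions" shows "deriv \<phi> \<in> test_functions"
proof -
  obtain a where a: "\<And>x. a < \<bar>x\<bar> \<Longrightarrow> \<phi> x = 0" using assms by (auto simp: test_functions_def)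
  have "deriv \<phi> x = 0" if "a < \<bar>x\<bar>" for x
  proof -
    have "open {y :: real. a < \<bar>y\<bar>}" by (intro open_Collect_less continuous_intros)
    from has_field_derivative_transform_within_open[OF DERIV_const this, of x 0 \<phi>]
    show ?thesis using a that by (intro DERIV_imp_deriv) auto
  qed
  then show ?thesis
    using Ck_fun_deriv[OF test_functionsD[OF assms]] by (auto simp: test_functions_def)
qed

lemma test_funpow_deriv: "\<phi> \<in> test_functions \<Longrightarrow> (deriv ^^ i) \<phi> \<in> test_functions"
  by (induction i) (auto intro: test_deriv)

lemma test_zero: "(\<lambda>x. 0) \<in> test_functions"
  by (auto simp: test_functions_def Ck_fun_const)

lemma test_DERIV: "\<phi> \<in> test_functions \<Longrightarrow> (\<phi> has_real_derivative deriv \<phi> x) (at x)"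
  by (rule Ck_fun_DERIV[OF test_functionsD])

lemma LINT_derivative_eq_0:
  assumes "\<And>x. (F has_real_derivative f x) (at x)" "continuous_on UNIV f" "compact_cont F" "compact_cont f"
  shows "(LINT x|lebesgue. f x) = 0"
proof -
  obtain a b where a: "\<And>x. a < \<bar>x\<bar> \<Longrightarrow> F x = 0" and b: "\<And>x. b < \<bar>x\<bar> \<Longrightarrow> f x = 0"
    using assms(3,4) by (auto simp: compact_cont_def)
  define c where "c = 1 + max 0 (max a b)"
  have c: "a < c" "b < c" "0 \<le> c" by (auto simp: c_def)
  have "(f has_integral F c - F (- c)) {-c..c}"
    by (rule fundamental_theorem_of_calculus)
      (use c assms(1) in \<open>auto simp: has_real_derivative_iff_has_vector_derivative[symmetric] intro: has_field_derivative_at_within\<close>)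
  moreover have "F c = 0" "F (- c) = 0" using a c by auto
  moreover have "(LINT x|lebesgue. f x) = integral {-c..c} f"
    using b c by (intro LINT_compact_support(2)[OF assms(2)]) auto
  ultimately show ?thesis by (simp add: integral_unique)
qed

section \<open>The weighted inner product and the operators adapted to it\<close>

definition wip :: "(real \<Rightarrow> real) \<Rightarrow> (real \<Rightarrow> real) \<Rightarrow> real" where
  "wip f g = (LINT x|lebesgue. f x * g x * cosh (2 * x))"

text \<open>The square of \<open>weighted_norm\<close>. Squares add up over the orders and can be
  differentiated in time, so the energy method is run with them and roots are taken only at the
  end.\<close>

definition wsq :: "nat \<Rightarrow> (real \<Rightarrow> real) \<Rightarrow> real" where
  "wsq k \<phi> = (\<Sum>i\<le>k. wip ((deriv ^^ i) \<phi>) ((deriv ^^ i) \<phi>))"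

lemma weighted_norm_wsq: "weighted_norm k \<phi> = sqrt (wsq k \<phi>)"
  by (simp add: weighted_norm_def wsq_def wip_def power2_eq_square)

lemma wip_compact_cont: "compact_cont f \<Longrightarrow> compact_cont g \<Longrightarrow> compact_cont (\<lambda>x. f x * g x * cosh (2 * x))"
  by (intro compact_cont_mult(2)) (auto intro!: continuous_intros dest: compact_cont_continuous)

lemmas wip_integrable = compact_cont_integrable[OF wip_compact_cont]

lemma wip_add_left: "compact_cont f \<Longrightarrow> compact_cont g \<Longrightarrow> compact_cont h \<Longrightarrow> wip (\<lambda>x. f x + g x) h = wip f h + wip g h"
  unfolding wip_def
  using Bochner_Integration.integral_add[OF wip_integrable wip_integrable, of f h g h] by (simp add: algebra_simps)

lemma wip_diff_left: "compact_cont f \<Longrightarrow> compact_cont g \<Longrightarrow> compact_cont h \<Longrightarrow> wip (\<lambda>x. f x - g x) h = wip f h - wip g h"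
  unfolding wip_def
  using Bochner_Integration.integral_diff[OF wip_integrable wip_integrable, of f h g h] by (simp add: algebra_simps)

lemma wip_commute: "wip f g = wip g f"
  by (simp add: wip_def mult.commute)

lemma wip_cmult_left: "wip (\<lambda>x. c * f x) g = c * wip f g"
  by (simp add: wip_def mult.assoc)

lemma wip_add_right: "compact_cont f \<Longrightarrow> compact_cont g \<Longrightarrow> compact_cont h \<Longrightarrow> wip h (\<lambda>x. f x + g x) = wip h f + wip h g"
  using wip_add_left[of f g h] by (simp only: wip_commute[of h])

lemma wip_diff_right: "compact_cont f \<Longrightarrow> compact_cont g \<Longrightarrow> compact_cont h \<Longrightarrow> wip h (\<lambda>x. f x - g x) = wip h f - wip h g"
  using wip_diff_left[of f g h] by (simp only: wip_commute[of h])

lemma wip_cmult_right: "wip g (\<lambda>x. c * f x) = c * wip g f"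
  using wip_cmult_left[of c f g] by (simp only: wip_commute[of g])

lemma wip_nonneg: "0 \<le> wip f f"
  unfolding wip_def by (intro integral_nonneg_AE) auto

lemma wsq_nonneg: "0 \<le> wsq k f"
  unfolding wsq_def by (intro sum_nonneg wip_nonneg)

text \<open>Does the work of the Cauchy-Schwarz inequality without roots: c is chosen anew in each
  application, later even as a function of time.\<close>

lemma wip_AMGM:
  assumes "compact_cont f" "compact_cont g" "0 < c"
  shows "2 * wip f g \<le> c * wip f f + wip g g / c"
proof -
  have "0 \<le> wip (\<lambda>x. c * f x - g x) (\<lambda>x. c * f x - g x)" by (rule wip_nonneg)
  also have "\<dots> = c * (c * wip f f) - 2 * (c * wip f g) + wip g g"
    using assms by (simp add: wip_diff_left wip_diff_right wip_cmult_left wip_cmult_right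
        compact_cont_cmult compact_cont_diff wip_commute[of g f] algebra_simps)
  finally show ?thesis using assms(3) by (simp add: field_simps)
qed

lemma wip_add_le:
  assumes "compact_cont f" "compact_cont g" "0 < c"
  shows "wip (\<lambda>x. f x + g x) (\<lambda>x. f x + g x) \<le> (1 + c) * wip f f + (1 + 1 / c) * wip g g"
proof -
  have "wip (\<lambda>x. f x + g x) (\<lambda>x. f x + g x) = wip f f + 2 * wip f g + wip g g"
    using assms by (simp add: wip_add_left wip_add_right compact_cont_add wip_commute[of g f])
  also have "\<dots> \<le> (1 + c) * wip f f + (1 + 1 / c) * wip g g"
    using wip_AMGM[OF assms] by (simp add: algebra_simps)
  finally show ?thesis .
qed

text \<open>Passes from pointwise bounds to weighted norms; k + 1 is the number of summands in the
  comparison of a squared sum with the sum of squares.\<close>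

lemma wip_sum_bound:
  assumes f: "compact_cont f" and g: "\<And>l. l \<le> k \<Longrightarrow> compact_cont (g l)"
    and b: "\<And>x. \<bar>f x\<bar> \<le> C * (\<Sum>l\<le>k. \<bar>g l x\<bar>)"
  shows "wip f f \<le> C\<^sup>2 * (real k + 1) * (\<Sum>l\<le>k. wip (g l) (g l))"
proof -
  have pt: "f x * f x * cosh (2 * x) \<le> C\<^sup>2 * (real k + 1) * (\<Sum>l\<le>k. g l x * g l x * cosh (2 * x))" for x
  proof -
    have "(f x)\<^sup>2 \<le> (C * (\<Sum>l\<le>k. \<bar>g l x\<bar>))\<^sup>2"
      using b[of x] by (simp add: abs_le_square_iff[symmetric])
    also have "\<dots> \<le> C\<^sup>2 * ((\<Sum>l\<le>k. \<bar>g l x\<bar>\<^sup>2) * card {..k})"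
      unfolding power_mult_distrib by (intro mult_left_mono sum_squared_le_sum_of_squares) auto
    finally have "f x * f x \<le> C\<^sup>2 * (real k + 1) * (\<Sum>l\<le>k. g l x * g l x)"
      by (simp add: power2_eq_square mult_ac add.commute)
    from mult_right_mono[OF this, of "cosh (2 * x)"] show ?thesis
      by (simp add: sum_distrib_right mult.assoc)
  qed
  have "wip f f \<le> (LINT x|lebesgue. C\<^sup>2 * (real k + 1) * (\<Sum>l\<le>k. g l x * g l x * cosh (2 * x)))"
    unfolding wip_def
    by (intro integral_mono wip_integrable f pt compact_cont_integrable compact_cont_cmult compact_cont_sum wip_compact_cont) (auto intro: g)
  also have "\<dots> = C\<^sup>2 * (real k + 1) * (\<Sum>l\<le>k. wip (g l) (g l))"
    unfolding wip_def by (subst integral_mult_right_zero, subst Bochner_Integration.integral_sum) (auto intro!: wip_integrable g)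
  finally show ?thesis .
qed

text \<open>The term 2 tanh (2x) is the logarithmic derivative of the weight. The explicit factor
  \<open>- 1 *\<close> matches rules for constant multiples such as
  \<open>test_cmult\<close>.\<close>

definition Dstar :: "(real \<Rightarrow> real) \<Rightarrow> real \<Rightarrow> real" where
  "Dstar \<phi> x = - 1 * (deriv \<phi> x + 2 * (tanh (2 * x) * \<phi> x))"

lemma test_Dstar: "\<phi> \<in> test_functions \<Longrightarrow> Dstar \<phi> \<in> test_functions"
  unfolding Dstar_def[abs_def] by (intro test_cmult test_add test_deriv test_mult Ck_fun_tanh)

lemma tanh_times_cosh: "tanh (2 * x) * cosh (2 * x) = sinh (2 * x :: real)"
  by (simp add: tanh_def cosh_real_nonzero)

text \<open>The difference of the two integrands is the derivative of f g cosh (2x), which has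
  compact support.\<close>

lemma wip_adjoint:
  assumes f: "f \<in> test_functions" and g: "g \<in> test_functions"
  shows "wip (deriv f) g = wip f (Dstar g)"
proof -
  note cc = test_compact_cont
  let ?h = "\<lambda>x. deriv f x * g x * cosh (2 * x) - f x * Dstar g x * cosh (2 * x)"
  have d: "((\<lambda>x. f x * g x * cosh (2 * x)) has_real_derivative ?h x) (at x)" for x
    by (rule derivative_eq_intros test_DERIV[OF f] test_DERIV[OF g] refl)+
      (use tanh_times_cosh[of x] in \<open>simp add: Dstar_def algebra_simps\<close>)
  have c: "compact_cont (\<lambda>x. deriv f x * g x * cosh (2 * x))" "compact_cont (\<lambda>x. f x * Dstar g x * cosh (2 * x))"
    by (intro wip_compact_cont cc test_deriv test_Dstar f g)+
  have h: "compact_cont ?h" by (rule compact_cont_diff[OF c])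
  have "(LINT x|lebesgue. ?h x) = 0"
    by (rule LINT_derivative_eq_0[OF d compact_cont_continuous[OF h] wip_compact_cont[OF cc[OF f] cc[OF g]] h])
  moreover have "(LINT x|lebesgue. ?h x) = wip (deriv f) g - wip f (Dstar g)"
    unfolding wip_def by (intro Bochner_Integration.integral_diff compact_cont_integrable c)
  ultimately show ?thesis by simp
qed

text \<open>Completing the square: \<open>z\<^sup>2 cosh \<le> z'\<^sup>2 cosh + (z\<^sup>2 sinh)'\<close>. This is the spectral gap that
  produces the decay rate \<open>e\<^sup>-\<^sup>t\<close>.\<close>

lemma weighted_Hardy:
  assumes z: "z \<in> test_functions"
  shows "wip z z \<le> wip (deriv z) (deriv z)"
proof -
  note cc = test_compact_cont
  let ?S = "\<lambda>x. z x * z x * sinh (2 * x)"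
  let ?S' = "\<lambda>x. 2 * (z x * deriv z x) * sinh (2 * x) + 2 * (z x * z x * cosh (2 * x))"
  have d: "(?S has_real_derivative ?S' x) (at x)" for x
    by (rule derivative_eq_intros test_DERIV[OF z] refl)+ (simp add: algebra_simps)
  have c: "compact_cont ?S" "compact_cont ?S'"
    by (intro compact_cont_add compact_cont_cmult wip_compact_cont cc z test_deriv compact_cont_mult(2) compact_cont_continuous[OF cc[OF z]]
        compact_cont_continuous[OF cc[OF test_deriv[OF z]]] continuous_intros)+
  have pt: "z x * z x * cosh (2 * x) \<le> deriv z x * deriv z x * cosh (2 * x) + ?S' x" for x
  proof -
    have c1: "0 < cosh (2 * x)" by simp
    \<comment> \<open>After multiplication by cosh (2x), the right hand side minus the left is this
      square plus z^2, because cosh^2 - sinh^2 = 1.\<close>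
    have "0 \<le> (deriv z x * cosh (2 * x) + z x * sinh (2 * x))\<^sup>2 + (z x)\<^sup>2" by simp
    also have "\<dots> = cosh (2 * x) * (deriv z x * deriv z x * cosh (2 * x) + ?S' x - z x * z x * cosh (2 * x))"
      using hyperbolic_pythagoras[of "2 * x"] by (simp add: power2_eq_square) algebra
    finally show ?thesis using c1 by (simp add: zero_le_mult_iff)
  qed
  have "wip z z \<le> (LINT x|lebesgue. deriv z x * deriv z x * cosh (2 * x) + ?S' x)"
    unfolding wip_def
    by (intro integral_mono pt compact_cont_integrable compact_cont_add wip_compact_cont c(2) cc z test_deriv)
  also have "\<dots> = wip (deriv z) (deriv z) + (LINT x|lebesgue. ?S' x)"
    unfolding wip_def by (intro Bochner_Integration.integral_add compact_cont_integrable wip_compact_cont c(2) cc z test_deriv)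
  also have "(LINT x|lebesgue. ?S' x) = 0"
    by (rule LINT_derivative_eq_0[OF d compact_cont_continuous[OF c(2)] c])
  finally show ?thesis by simp
qed

text \<open>\<open>Bop j\<close> plays the role of \<open>(Dstar D)\<^sup>j\<^sup>/\<^sup>2\<close>. Unlike plain derivatives, these operators commute
  (up to exchanging the two factors) with the elliptic part of the equation.\<close>

primrec Bop :: "nat \<Rightarrow> (real \<Rightarrow> real) \<Rightarrow> real \<Rightarrow> real" where
  "Bop 0 \<phi> = \<phi>"
| "Bop (Suc j) \<phi> = (if even j then deriv (Bop j \<phi>) else Dstar (Bop j \<phi>))"

lemma test_Bop: "\<phi> \<in> test_functions \<Longrightarrow> Bop j \<phi> \<in> test_functions"
  by (induction j) (auto intro: test_deriv test_Dstar)

text \<open>\<open>Bop j\<close> is an alternating word, so lengthening it by two letters at the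
  inner or at the outer end gives the same word; the parity of j decides which pair appears
  outside.\<close>

lemma Bop_Dstar_deriv:
  "Bop j (Dstar (deriv \<phi>)) = (if even j then Dstar (deriv (Bop j \<phi>)) else deriv (Dstar (Bop j \<phi>)))"
  by (induction j) auto

lemma wip_Bop_Dstar_deriv:
  assumes "\<phi> \<in> test_functions" "\<psi> \<in> test_functions"
  shows "wip (Bop j \<psi>) (Bop j (Dstar (deriv \<phi>))) = wip (Bop (Suc j) \<psi>) (Bop (Suc j) \<phi>)"
proof (cases "even j")
  case True
  have "wip (Bop j \<psi>) (Dstar (deriv (Bop j \<phi>))) = wip (deriv (Bop j \<psi>)) (deriv (Bop j \<phi>))"
    using assms by (intro wip_adjoint[symmetric] test_Bop test_deriv)
  then show ?thesis using True by (simp add: Bop_Dstar_deriv)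
next
  case False
  have "wip (Bop j \<psi>) (deriv (Dstar (Bop j \<phi>))) = wip (Dstar (Bop j \<psi>)) (Dstar (Bop j \<phi>))"
    using wip_adjoint[of "Dstar (Bop j \<phi>)" "Bop j \<psi>"] assms
    by (simp add: wip_commute test_Bop test_Dstar)
  then show ?thesis using False by (simp add: Bop_Dstar_deriv)
qed

text \<open>Even j is the Hardy inequality. \<open>Dstar\<close> has no such lower bound on all test
  functions: it annihilates sech (2x), which has finite weighted norm. On a derivative w = z' it
  does: wip w w = wip z (Dstar w) is at most half of wip z z plus half of the square of
  \<open>Dstar w\<close>, and the first of these is again controlled by Hardy.\<close>

lemma Bop_Hardy:
  assumes p: "\<phi> \<in> test_functions"
  shows "wip (Bop j \<phi>) (Bop j \<phi>) \<le> wip (Bop (Suc j) \<phi>) (Bop (Suc j) \<phi>)"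
proof (cases "even j")
  case True
  then show ?thesis using weighted_Hardy[OF test_Bop[OF p]] by simp
next
  case False
  then obtain i where j: "j = Suc i" and i: "even i" by (cases j) auto
  let ?z = "Bop i \<phi>" and ?w = "deriv (Bop i \<phi>)"
  have z: "?z \<in> test_functions" and w: "?w \<in> test_functions" by (intro test_Bop test_deriv p)+
  have "2 * wip ?w ?w = 2 * wip ?z (Dstar ?w)" using wip_adjoint[OF z w] by simp
  also have "\<dots> \<le> 1 * wip ?z ?z + wip (Dstar ?w) (Dstar ?w) / 1"
    by (intro wip_AMGM test_compact_cont z test_Dstar w) simp
  also have "wip ?z ?z \<le> wip ?w ?w" by (rule weighted_Hardy[OF z])
  finally show ?thesis using i by (simp add: j)
qed

section \<open>Equivalence of the norms built from plain derivatives and from alternating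
  words\<close>

lemma smooth_multiplier_bound:
  assumes f: "\<And>k. Ck_fun k f" and bf: "\<exists>K. Ck_bounded m K f"
  shows "\<exists>C\<ge>0. \<forall>\<psi> x. (\<forall>k. Ck_fun k \<psi>) \<longrightarrow>
    \<bar>(deriv ^^ m) (\<lambda>x. f x * \<psi> x) x\<bar> \<le> C * (\<Sum>l\<le>m. \<bar>(deriv ^^ l) \<psi> x\<bar>)"
proof -
  obtain K where K: "Ck_bounded m K f" using bf by blast
  show ?thesis
    using Ck_boundedD(4)[OF K]
    by (intro exI[of _ "2 ^ m * K"] conjI allI impI funpow_deriv_mult_bound f Ck_boundedD(2)[OF K]) auto
qed

lemma funpow_deriv_Dstar_bound:
  "\<exists>C\<ge>0. \<forall>\<psi> x. (\<forall>k. Ck_fun k \<psi>) \<longrightarrow>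
    \<bar>(deriv ^^ m) (\<lambda>x. 2 * (tanh (2 * x) * \<psi> x)) x\<bar> \<le> C * (\<Sum>l\<le>m. \<bar>(deriv ^^ l) \<psi> x\<bar>)"
  using smooth_multiplier_bound[of "\<lambda>x. 2 * tanh (2 * x)" m] Ck_bounded_tanh[of m] Ck_bounded_cmult
  by (simp add: mult.assoc[symmetric] Ck_fun_cmult Ck_fun_tanh) blast

lemma Dstar_funpow:
  assumes "\<And>k. Ck_fun k \<psi>"
  shows "(deriv ^^ m) (Dstar \<psi>) x = - (deriv ^^ Suc m) \<psi> x - (deriv ^^ m) (\<lambda>x. 2 * (tanh (2 * x) * \<psi> x)) x"
    and "(deriv ^^ Suc m) \<psi> x = - (deriv ^^ m) (Dstar \<psi>) x - (deriv ^^ m) (\<lambda>x. 2 * (tanh (2 * x) * \<psi> x)) x"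
proof -
  have "(deriv ^^ m) (Dstar \<psi>) = (\<lambda>x. - 1 * (deriv ^^ m) (\<lambda>x. deriv \<psi> x + 2 * (tanh (2 * x) * \<psi> x)) x)"
    unfolding Dstar_def[abs_def]
    by (rule funpow_deriv_cmult[of m]) (auto intro!: Ck_fun_add Ck_fun_deriv Ck_fun_cmult Ck_fun_mult Ck_fun_tanh assms)
  also have "(deriv ^^ m) (\<lambda>x. deriv \<psi> x + 2 * (tanh (2 * x) * \<psi> x))
      = (\<lambda>x. (deriv ^^ m) (deriv \<psi>) x + (deriv ^^ m) (\<lambda>x. 2 * (tanh (2 * x) * \<psi> x)) x)"
    by (rule funpow_deriv_add[of m]) (auto intro!: Ck_fun_deriv Ck_fun_cmult Ck_fun_mult Ck_fun_tanh assms)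
  finally show "(deriv ^^ m) (Dstar \<psi>) x = - (deriv ^^ Suc m) \<psi> x - (deriv ^^ m) (\<lambda>x. 2 * (tanh (2 * x) * \<psi> x)) x"
    and "(deriv ^^ Suc m) \<psi> x = - (deriv ^^ m) (Dstar \<psi>) x - (deriv ^^ m) (\<lambda>x. 2 * (tanh (2 * x) * \<psi> x)) x"
    by (simp_all add: deriv_funpow_Suc del: funpow.simps)
qed

lemma sum_abs_mono_atMost: "m \<le> (n::nat) \<Longrightarrow> (\<Sum>l\<le>m. \<bar>f l\<bar>) \<le> (\<Sum>l\<le>n. \<bar>f l :: real\<bar>)"
  by (rule sum_mono2) auto

text \<open>\<open>Bop i\<close> agrees with the i-th derivative up to sign and lower order terms
  with bounded coefficients. The m outer derivatives are carried along because later letters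
  differentiate the factor tanh (2x).\<close>

lemma Bop_upper_bound:
  "\<exists>C\<ge>0. \<forall>\<phi> x. \<phi> \<in> test_functions \<longrightarrow>
    \<bar>(deriv ^^ m) (Bop i \<phi>) x\<bar> \<le> C * (\<Sum>l\<le>i + m. \<bar>(deriv ^^ l) \<phi> x\<bar>)"
proof (induction i arbitrary: m)
  case 0
  show ?case by (intro exI[of _ 1]) (auto intro: member_le_sum)
next
  case (Suc i)
  obtain C1 where C1: "0 \<le> C1" "\<And>\<phi> x. \<phi> \<in> test_functions \<Longrightarrow>
      \<bar>(deriv ^^ Suc m) (Bop i \<phi>) x\<bar> \<le> C1 * (\<Sum>l\<le>i + Suc m. \<bar>(deriv ^^ l) \<phi> x\<bar>)"
    using Suc[of "Suc m"] by blast
  show ?case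
  proof (cases "even i")
    case True
    then show ?thesis
      using C1 by (intro exI[of _ C1]) (auto simp: deriv_funpow_Suc simp del: funpow.simps)
  next
    case False
    obtain Ct where Ct: "0 \<le> Ct" "\<And>\<psi> x. (\<And>k. Ck_fun k \<psi>) \<Longrightarrow>
        \<bar>(deriv ^^ m) (\<lambda>x. 2 * (tanh (2 * x) * \<psi> x)) x\<bar> \<le> Ct * (\<Sum>l\<le>m. \<bar>(deriv ^^ l) \<psi> x\<bar>)"
      using funpow_deriv_Dstar_bound[of m] by blast
    have "\<forall>l. \<exists>C\<ge>0. \<forall>\<phi> x. \<phi> \<in> test_functions \<longrightarrow> \<bar>(deriv ^^ l) (Bop i \<phi>) x\<bar> \<le> C * (\<Sum>l\<le>i + l. \<bar>(deriv ^^ l) \<phi> x\<bar>)"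
      using Suc by blast
    then obtain D where D: "\<And>l. 0 \<le> (D l :: real)" "\<And>l \<phi> x. \<phi> \<in> test_functions \<Longrightarrow>
        \<bar>(deriv ^^ l) (Bop i \<phi>) x\<bar> \<le> D l * (\<Sum>l\<le>i + l. \<bar>(deriv ^^ l) \<phi> x\<bar>)"
      by metis
    have "\<bar>(deriv ^^ m) (Bop (Suc i) \<phi>) x\<bar> \<le> (C1 + Ct * (\<Sum>l\<le>m. D l)) * (\<Sum>l\<le>Suc i + m. \<bar>(deriv ^^ l) \<phi> x\<bar>)"
      if p: "\<phi> \<in> test_functions" for \<phi> x
    proof -
      let ?S = "\<Sum>l\<le>Suc i + m. \<bar>(deriv ^^ l) \<phi> x\<bar>"
      have sm: "Ck_fun k (Bop i \<phi>)" for k using test_Bop[OF p] test_functionsD by blast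
      have "\<bar>(deriv ^^ m) (Bop (Suc i) \<phi>) x\<bar> \<le> \<bar>(deriv ^^ Suc m) (Bop i \<phi>) x\<bar> + \<bar>(deriv ^^ m) (\<lambda>x. 2 * (tanh (2 * x) * Bop i \<phi> x)) x\<bar>"
        using False by (simp add: Dstar_funpow(1)[OF sm] del: funpow.simps)
      also have "\<dots> \<le> C1 * ?S + Ct * (\<Sum>l\<le>m. \<bar>(deriv ^^ l) (Bop i \<phi>) x\<bar>)"
        using C1(2)[OF p, of x] Ct(2)[OF sm, of x] by (intro add_mono) auto
      also have "\<dots> \<le> C1 * ?S + Ct * (\<Sum>l\<le>m. D l * ?S)"
      proof (intro add_mono mult_left_mono sum_mono order_refl Ct(1) C1(1))
        fix l assume l: "l \<in> {..m}"
        have "\<bar>(deriv ^^ l) (Bop i \<phi>) x\<bar> \<le> D l * (\<Sum>l\<le>i + l. \<bar>(deriv ^^ l) \<phi> x\<bar>)" by (rule D(2)[OF p])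
        also have "\<dots> \<le> D l * ?S" using l by (intro mult_left_mono D(1) sum_abs_mono_atMost) auto
        finally show "\<bar>(deriv ^^ l) (Bop i \<phi>) x\<bar> \<le> D l * ?S" .
      qed
      also have "\<dots> = (C1 + Ct * (\<Sum>l\<le>m. D l)) * ?S" by (simp add: sum_distrib_right algebra_simps del: sum.atMost_Suc)
      finally show ?thesis .
    qed
    moreover have "0 \<le> C1 + Ct * (\<Sum>l\<le>m. D l)" using C1(1) Ct(1) D(1) by (simp add: sum_nonneg)
    ultimately show ?thesis by blast
  qed
qed

text \<open>Trades one outer derivative for a longer word: for even i the derivative is the next
  letter, for odd i it is minus \<open>Dstar\<close> up to a bounded multiple. Lowering m raises i,
  hence a constant uniform over i <= n, for every n.\<close>

lemma Bop_lower_bound: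
  "\<exists>C\<ge>0. \<forall>\<phi> x i. \<phi> \<in> test_functions \<longrightarrow> i \<le> n \<longrightarrow>
    \<bar>(deriv ^^ m) (Bop i \<phi>) x\<bar> \<le> C * (\<Sum>l\<le>i + m. \<bar>Bop l \<phi> x\<bar>)"
proof (induction m arbitrary: n rule: less_induct)
  case (less m)
  show ?case
  proof (cases m)
    case 0
    then show ?thesis by (intro exI[of _ 1]) (auto intro: member_le_sum)
  next
    case (Suc m')
    have "\<forall>l. \<exists>C\<ge>0. l \<le> m' \<longrightarrow> (\<forall>\<phi> x i. \<phi> \<in> test_functions \<longrightarrow> i \<le> Suc n \<longrightarrow>
        \<bar>(deriv ^^ l) (Bop i \<phi>) x\<bar> \<le> C * (\<Sum>l\<le>i + l. \<bar>Bop l \<phi> x\<bar>))"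
      using less[of _ "Suc n"] Suc by (metis less_Suc_eq_le order_refl)
    then obtain D where D: "\<And>l. 0 \<le> (D l :: real)" "\<And>l \<phi> x i. l \<le> m' \<Longrightarrow> \<phi> \<in> test_functions \<Longrightarrow> i \<le> Suc n \<Longrightarrow>
        \<bar>(deriv ^^ l) (Bop i \<phi>) x\<bar> \<le> D l * (\<Sum>l\<le>i + l. \<bar>Bop l \<phi> x\<bar>)"
      by metis
    obtain Ct where Ct: "0 \<le> Ct" "\<And>\<psi> x. (\<And>k. Ck_fun k \<psi>) \<Longrightarrow>
        \<bar>(deriv ^^ m') (\<lambda>x. 2 * (tanh (2 * x) * \<psi> x)) x\<bar> \<le> Ct * (\<Sum>l\<le>m'. \<bar>(deriv ^^ l) \<psi> x\<bar>)"
      using funpow_deriv_Dstar_bound[of m'] by blast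
    let ?C = "D m' + Ct * (\<Sum>l\<le>m'. D l)"
    have C0: "0 \<le> Ct * (\<Sum>l\<le>m'. D l)" using Ct(1) D(1) by (simp add: sum_nonneg)
    have "\<bar>(deriv ^^ m) (Bop i \<phi>) x\<bar> \<le> ?C * (\<Sum>l\<le>i + m. \<bar>Bop l \<phi> x\<bar>)"
      if p: "\<phi> \<in> test_functions" and i: "i \<le> n" for \<phi> x i
    proof -
      let ?S = "\<Sum>l\<le>i + m. \<bar>Bop l \<phi> x\<bar>"
      have S0: "0 \<le> ?S" by (intro sum_nonneg) auto
      have sm: "Ck_fun k (Bop i \<phi>)" for k using test_Bop[OF p] test_functionsD by blast
      have 1: "\<bar>(deriv ^^ m') (Bop (Suc i) \<phi>) x\<bar> \<le> D m' * ?S"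
        using D(2)[OF order_refl p, of "Suc i" x] i by (simp add: Suc)
      show ?thesis
      proof (cases "even i")
        case True
        then have "\<bar>(deriv ^^ m) (Bop i \<phi>) x\<bar> \<le> D m' * ?S"
          using 1 unfolding Suc deriv_funpow_Suc by simp
        also have "\<dots> \<le> ?C * ?S" using C0 S0 by (intro mult_right_mono) auto
        finally show ?thesis .
      next
        case False
        have "\<bar>(deriv ^^ m) (Bop i \<phi>) x\<bar> \<le> \<bar>(deriv ^^ m') (Bop (Suc i) \<phi>) x\<bar> + \<bar>(deriv ^^ m') (\<lambda>x. 2 * (tanh (2 * x) * Bop i \<phi> x)) x\<bar>"
          using False unfolding Suc by (simp add: Dstar_funpow(2)[OF sm] del: funpow.simps)
        also have "\<dots> \<le> D m' * ?S + Ct * (\<Sum>l\<le>m'. \<bar>(deriv ^^ l) (Bop i \<phi>) x\<bar>)"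
          using 1 Ct(2)[OF sm, of x] by (intro add_mono) auto
        also have "\<dots> \<le> D m' * ?S + Ct * (\<Sum>l\<le>m'. D l * ?S)"
        proof (intro add_mono mult_left_mono sum_mono order_refl Ct(1) D(1))
          fix l assume l: "l \<in> {..m'}"
          then have "\<bar>(deriv ^^ l) (Bop i \<phi>) x\<bar> \<le> D l * (\<Sum>l\<le>i + l. \<bar>Bop l \<phi> x\<bar>)"
            using i by (intro D(2) p) auto
          also have "\<dots> \<le> D l * ?S" using l by (intro mult_left_mono D(1) sum_abs_mono_atMost) (auto simp: Suc)
          finally show "\<bar>(deriv ^^ l) (Bop i \<phi>) x\<bar> \<le> D l * ?S" .
        qed
        also have "\<dots> = ?C * ?S" by (simp add: sum_distrib_right algebra_simps del: sum.atMost_Suc)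
        finally show ?thesis .
      qed
    qed
    moreover have "0 \<le> ?C" using D(1)[of m'] C0 by simp
    ultimately show ?thesis by blast
  qed
qed

text \<open>Equivalent to \<open>wsq k\<close>, but in this form the energy identity contains no
  commutators with tanh (2x).\<close>

definition Bsq :: "nat \<Rightarrow> (real \<Rightarrow> real) \<Rightarrow> real" where
  "Bsq k \<phi> = (\<Sum>j\<le>k. wip (Bop j \<phi>) (Bop j \<phi>))"

lemma Bsq_nonneg: "0 \<le> Bsq k f"
  unfolding Bsq_def by (intro sum_nonneg wip_nonneg)

lemma norm_equivalence_aux:
  fixes P Q :: "nat \<Rightarrow> (real \<Rightarrow> real) \<Rightarrow> real \<Rightarrow> real"
  assumes P: "\<And>i \<phi>. \<phi> \<in> test_functions \<Longrightarrow> P i \<phi> \<in> test_functions"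
    and Q: "\<And>i \<phi>. \<phi> \<in> test_functions \<Longrightarrow> Q i \<phi> \<in> test_functions"
    and b: "\<And>i. \<exists>C\<ge>0. \<forall>\<phi> x. \<phi> \<in> test_functions \<longrightarrow> \<bar>P i \<phi> x\<bar> \<le> C * (\<Sum>l\<le>i. \<bar>Q l \<phi> x\<bar>)"
  shows "\<exists>C\<ge>0. \<forall>\<phi>. \<phi> \<in> test_functions \<longrightarrow>
    (\<Sum>i\<le>k. wip (P i \<phi>) (P i \<phi>)) \<le> C * (\<Sum>i\<le>k. wip (Q i \<phi>) (Q i \<phi>))"
proof -
  have "\<forall>i. \<exists>C\<ge>0. \<forall>\<phi> x. \<phi> \<in> test_functions \<longrightarrow> \<bar>P i \<phi> x\<bar> \<le> C * (\<Sum>l\<le>i. \<bar>Q l \<phi> x\<bar>)" using b by blast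
  then obtain C where C: "\<And>i. 0 \<le> (C i :: real)"
    "\<And>i \<phi> x. \<phi> \<in> test_functions \<Longrightarrow> \<bar>P i \<phi> x\<bar> \<le> C i * (\<Sum>l\<le>i. \<bar>Q l \<phi> x\<bar>)" by metis
  let ?D = "\<Sum>i\<le>k. (C i)\<^sup>2 * (real i + 1)"
  have "(\<Sum>i\<le>k. wip (P i \<phi>) (P i \<phi>)) \<le> ?D * (\<Sum>i\<le>k. wip (Q i \<phi>) (Q i \<phi>))" if p: "\<phi> \<in> test_functions" for \<phi>
  proof -
    have "(\<Sum>i\<le>k. wip (P i \<phi>) (P i \<phi>)) \<le> (\<Sum>i\<le>k. (C i)\<^sup>2 * (real i + 1) * (\<Sum>l\<le>k. wip (Q l \<phi>) (Q l \<phi>)))"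
    proof (rule sum_mono)
      fix i assume i: "i \<in> {..k}"
      have "wip (P i \<phi>) (P i \<phi>) \<le> (C i)\<^sup>2 * (real i + 1) * (\<Sum>l\<le>i. wip (Q l \<phi>) (Q l \<phi>))"
        by (intro wip_sum_bound test_compact_cont P Q p C(2))
      also have "\<dots> \<le> (C i)\<^sup>2 * (real i + 1) * (\<Sum>l\<le>k. wip (Q l \<phi>) (Q l \<phi>))"
        using i by (intro mult_left_mono sum_mono2) (auto intro: wip_nonneg)
      finally show "wip (P i \<phi>) (P i \<phi>) \<le> (C i)\<^sup>2 * (real i + 1) * (\<Sum>l\<le>k. wip (Q l \<phi>) (Q l \<phi>))" .
    qed
    then show ?thesis by (simp add: sum_distrib_right)
  qed
  moreover have "0 \<le> ?D" by (intro sum_nonneg) auto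
  ultimately show ?thesis by blast
qed

lemma Bsq_le_wsq: "\<exists>C\<ge>0. \<forall>\<phi>. \<phi> \<in> test_functions \<longrightarrow> Bsq k \<phi> \<le> C * wsq k \<phi>"
  unfolding Bsq_def wsq_def
proof (rule norm_equivalence_aux)
  fix i
  show "\<exists>C\<ge>0. \<forall>\<phi> x. \<phi> \<in> test_functions \<longrightarrow> \<bar>Bop i \<phi> x\<bar> \<le> C * (\<Sum>l\<le>i. \<bar>(deriv ^^ l) \<phi> x\<bar>)"
    using Bop_upper_bound[of 0 i] by simp
qed (auto intro: test_Bop test_funpow_deriv)

lemma wsq_le_Bsq: "\<exists>C\<ge>0. \<forall>\<phi>. \<phi> \<in> test_functions \<longrightarrow> wsq k \<phi> \<le> C * Bsq k \<phi>"
  unfolding Bsq_def wsq_def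
proof (rule norm_equivalence_aux)
  fix i
  show "\<exists>C\<ge>0. \<forall>\<phi> x. \<phi> \<in> test_functions \<longrightarrow> \<bar>(deriv ^^ i) \<phi> x\<bar> \<le> C * (\<Sum>l\<le>i. \<bar>Bop l \<phi> x\<bar>)"
    using Bop_lower_bound[of 0 i] by auto
qed (auto intro: test_Bop test_funpow_deriv)

section \<open>Rules for the squared norms\<close>

lemma wsq_Suc: "wsq (Suc n) \<phi> = wip \<phi> \<phi> + wsq n (deriv \<phi>)"
  unfolding wsq_def by (subst sum.atMost_Suc_shift) (simp add: deriv_funpow_Suc del: funpow.simps)

lemma wsq_mono: "m \<le> n \<Longrightarrow> wsq m \<phi> \<le> wsq n \<phi>"
  unfolding wsq_def by (intro sum_mono2) (auto intro: wip_nonneg)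

lemma wip_le_wsq: "i \<le> n \<Longrightarrow> wip ((deriv ^^ i) \<phi>) ((deriv ^^ i) \<phi>) \<le> wsq n \<phi>"
  unfolding wsq_def by (rule member_le_sum) (auto intro: wip_nonneg)

lemma wsq_cmult: "\<phi> \<in> test_functions \<Longrightarrow> wsq n (\<lambda>x. c * \<phi> x) = c\<^sup>2 * wsq n \<phi>"
proof -
  assume p: "\<phi> \<in> test_functions"
  have "(deriv ^^ i) (\<lambda>x. c * \<phi> x) = (\<lambda>x. c * (deriv ^^ i) \<phi> x)" for i
    by (rule funpow_deriv_cmult[OF test_functionsD[OF p] order_refl])
  then show ?thesis
    by (simp add: wsq_def sum_distrib_left wip_cmult_left wip_cmult_right power2_eq_square mult.assoc)
qed

lemma wsq_add_le:
  assumes p: "\<phi> \<in> test_functions" and q: "\<psi> \<in> test_functions" and c: "0 < c"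
  shows "wsq n (\<lambda>x. \<phi> x + \<psi> x) \<le> (1 + c) * wsq n \<phi> + (1 + 1 / c) * wsq n \<psi>"
  unfolding wsq_def sum_distrib_left sum.distrib[symmetric]
proof (rule sum_mono)
  fix i assume "i \<in> {..n}"
  then have "(deriv ^^ i) (\<lambda>x. \<phi> x + \<psi> x) = (\<lambda>x. (deriv ^^ i) \<phi> x + (deriv ^^ i) \<psi> x)"
    using test_functionsD[OF p] test_functionsD[OF q] by (intro funpow_deriv_add[of n]) auto
  then show "wip ((deriv ^^ i) (\<lambda>x. \<phi> x + \<psi> x)) ((deriv ^^ i) (\<lambda>x. \<phi> x + \<psi> x))
      \<le> (1 + c) * wip ((deriv ^^ i) \<phi>) ((deriv ^^ i) \<phi>) + (1 + 1 / c) * wip ((deriv ^^ i) \<psi>) ((deriv ^^ i) \<psi>)"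
    using wip_add_le[OF test_compact_cont[OF test_funpow_deriv[OF p]] test_compact_cont[OF test_funpow_deriv[OF q]] c] by simp
qed

lemma wsq_add_le2:
  "\<phi> \<in> test_functions \<Longrightarrow> \<psi> \<in> test_functions \<Longrightarrow> wsq n (\<lambda>x. \<phi> x + \<psi> x) \<le> 2 * wsq n \<phi> + 2 * wsq n \<psi>"
  using wsq_add_le[of \<phi> \<psi> 1 n] by simp

lemma wsq_diff_le2:
  assumes "\<phi> \<in> test_functions" "\<psi> \<in> test_functions"
  shows "wsq n (\<lambda>x. \<phi> x - \<psi> x) \<le> 2 * wsq n \<phi> + 2 * wsq n \<psi>"
  using wsq_add_le2[OF assms(1) test_cmult[OF assms(2), of "- 1"], of n] wsq_cmult[OF assms(2), of n "- 1"] by simp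

text \<open>Minkowski's inequality from a family of quadratic ones: the best choice c = b / a turns
  the right hand side into (a + b)^2. Enlarging a and b by e / 2 avoids division by zero.\<close>

lemma le_add_of_weighted_squares:
  fixes a b s :: real
  assumes "0 \<le> a" "0 \<le> b" and s: "\<And>c. 0 < c \<Longrightarrow> s\<^sup>2 \<le> (1 + c) * a\<^sup>2 + (1 + 1 / c) * b\<^sup>2"
  shows "s \<le> a + b"
proof (rule field_le_epsilon)
  fix e :: real assume e: "0 < e"
  define a' where "a' = a + e / 2"
  define b' where "b' = b + e / 2"
  have p: "0 < a'" "0 < b'" "a \<le> a'" "b \<le> b'" using assms(1,2) e by (auto simp: a'_def b'_def)
  define c where "c = b' / a'"
  have c: "0 < c" using p by (simp add: c_def)
  have "s\<^sup>2 \<le> (1 + c) * a\<^sup>2 + (1 + 1 / c) * b\<^sup>2" by (rule s[OF c])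
  also have "\<dots> \<le> (1 + c) * a'\<^sup>2 + (1 + 1 / c) * b'\<^sup>2"
    using c p assms(1,2) by (intro add_mono mult_left_mono power_mono) auto
  also have "\<dots> = (a' + b')\<^sup>2" using p by (simp add: c_def field_simps power2_eq_square)
  finally have "s \<le> a' + b'" using p by (intro power2_le_imp_le[of s]) auto
  then show "s \<le> a + b + e" by (simp add: a'_def b'_def)
qed

lemma weighted_norm_triangle:
  assumes "\<phi> \<in> test_functions" "\<psi> \<in> test_functions"
  shows "weighted_norm k (\<lambda>x. \<phi> x + \<psi> x) \<le> weighted_norm k \<phi> + weighted_norm k \<psi>"
  unfolding weighted_norm_wsq
  by (rule le_add_of_weighted_squares)
    (simp_all only: real_sqrt_pow2[OF wsq_nonneg] real_sqrt_ge_zero[OF wsq_nonneg] wsq_add_le[OF assms])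

lemma weighted_norm_minus:
  assumes "\<phi> \<in> test_functions" "\<psi> \<in> test_functions"
  shows "weighted_norm k (\<lambda>x. \<phi> x - \<psi> x) = weighted_norm k (\<lambda>x. \<psi> x - \<phi> x)"
  using wsq_cmult[OF test_diff[OF assms], of k "- 1"] by (simp add: weighted_norm_wsq)

lemma weighted_norm_diff_abs:
  assumes p: "\<phi> \<in> test_functions" and q: "\<psi> \<in> test_functions"
  shows "\<bar>weighted_norm k \<phi> - weighted_norm k \<psi>\<bar> \<le> weighted_norm k (\<lambda>x. \<phi> x - \<psi> x)"
  using weighted_norm_triangle[OF test_diff[OF p q] q, of k] weighted_norm_triangle[OF test_diff[OF q p] p, of k]
    weighted_norm_minus[OF p q, of k] by simp

lemma weighted_norm_nonneg: "0 \<le> weighted_norm k \<phi>"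
  by (simp add: weighted_norm_wsq wsq_nonneg)

subsection \<open>Multiplication and embedding estimates\<close>

lemma funpow_deriv_mult_Ck_bounded:
  assumes b: "Ck_bounded n K b" "Ck_fun n \<phi>" and i: "i \<le> n"
  shows "\<bar>(deriv ^^ i) (\<lambda>x. b x * \<phi> x) x\<bar> \<le> 2 ^ n * K * (\<Sum>l\<le>n. \<bar>(deriv ^^ l) \<phi> x\<bar>)"
proof -
  have K: "0 \<le> K" by (rule Ck_boundedD(4)[OF b(1)])
  have "\<bar>(deriv ^^ i) (\<lambda>x. b x * \<phi> x) x\<bar> \<le> 2 ^ i * K * (\<Sum>l\<le>i. \<bar>(deriv ^^ l) \<phi> x\<bar>)"
    using i by (intro funpow_deriv_mult_bound Ck_fun_mono[OF Ck_boundedD(1)[OF b(1)]] Ck_fun_mono[OF b(2)] Ck_boundedD(2)[OF b(1)]) auto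
  also have "\<dots> \<le> 2 ^ n * K * (\<Sum>l\<le>n. \<bar>(deriv ^^ l) \<phi> x\<bar>)"
    using i K by (intro mult_mono sum_abs_mono_atMost) (auto intro: sum_nonneg)
  finally show ?thesis .
qed

lemma wsq_mult:
  assumes b: "Ck_bounded n K b" and bs: "\<And>k. Ck_fun k b" and p: "\<phi> \<in> test_functions"
  shows "wsq n (\<lambda>x. b x * \<phi> x) \<le> (2 ^ n * (real n + 1))\<^sup>2 * K\<^sup>2 * wsq n \<phi>"
proof -
  have "wip ((deriv ^^ i) (\<lambda>x. b x * \<phi> x)) ((deriv ^^ i) (\<lambda>x. b x * \<phi> x)) \<le> (2 ^ n * K)\<^sup>2 * (real n + 1) * wsq n \<phi>"
    if "i \<le> n" for i
    unfolding wsq_def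
    by (intro wip_sum_bound test_compact_cont test_funpow_deriv p test_mult bs funpow_deriv_mult_Ck_bounded b that test_functionsD[OF p])
  then have "wsq n (\<lambda>x. b x * \<phi> x) \<le> (\<Sum>i\<le>n. (2 ^ n * K)\<^sup>2 * (real n + 1) * wsq n \<phi>)"
    unfolding wsq_def[of n "\<lambda>x. b x * \<phi> x"] by (intro sum_mono) auto
  then show ?thesis by (simp add: power_mult_distrib power2_eq_square mult_ac add.commute)
qed

text \<open>Since the derivative of sech (2x) is - 2 tanh (2x) sech (2x), every higher derivative is
  sech (2x) times a bounded smooth factor; that factor is built by induction.\<close>

lemma sech_derivative_bound:
  "\<exists>D\<ge>0. \<forall>x::real. \<bar>(deriv ^^ l) (\<lambda>x. inverse (cosh (2 * x))) x\<bar> \<le> D * inverse (cosh (2 * x))"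
proof -
  let ?s = "\<lambda>x :: real. inverse (cosh (2 * x))"
  have "\<exists>\<tau>. (\<forall>k. \<exists>K. Ck_bounded k K \<tau>) \<and> (deriv ^^ l) ?s = (\<lambda>x. \<tau> x * ?s x)"
  proof (induction l)
    case 0
    show ?case by (intro exI[of _ "\<lambda>x. 1"]) (auto intro: Ck_bounded_const)
  next
    case (Suc l)
    then obtain \<tau> where \<tau>: "\<And>k. \<exists>K. Ck_bounded k K \<tau>" "(deriv ^^ l) ?s = (\<lambda>x. \<tau> x * ?s x)" by blast
    let ?\<sigma> = "\<lambda>x. deriv \<tau> x - 2 * (tanh (2 * x) * \<tau> x)"
    have "\<exists>K. Ck_bounded k K ?\<sigma>" for k
    proof -
      obtain K where K: "Ck_bounded (Suc k) K \<tau>" using \<tau>(1) by blast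
      obtain L where L: "Ck_bounded k L (\<lambda>x. tanh (2 * x))" using Ck_bounded_tanh by blast
      have "Ck_bounded k K (deriv \<tau>)" using K by (simp add: Ck_bounded_Suc)
      moreover have "Ck_bounded k K \<tau>" by (rule Ck_bounded_mono[OF K]) auto
      ultimately show ?thesis
        using Ck_bounded_diff[OF _ Ck_bounded_cmult[OF Ck_bounded_mult[OF L], of K \<tau> 2]] by blast
    qed
    moreover have "deriv (\<lambda>x. \<tau> x * ?s x) = (\<lambda>x. ?\<sigma> x * ?s x)"
    proof (intro ext DERIV_imp_deriv)
      fix x
      obtain K where K: "Ck_bounded (Suc 0) K \<tau>" using \<tau>(1) by blast
      show "((\<lambda>x. \<tau> x * ?s x) has_real_derivative ?\<sigma> x * ?s x) (at x)"
        using DERIV_mult[OF Ck_fun_DERIV[OF Ck_boundedD(1)[OF K], of x] sech2_DERIV[of x]]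
        by (simp add: algebra_simps)
    qed
    ultimately show ?case using \<tau>(2) by (intro exI[of _ ?\<sigma>]) auto
  qed
  then obtain \<tau> K where \<tau>: "Ck_bounded 0 K \<tau>" "(deriv ^^ l) ?s = (\<lambda>x. \<tau> x * ?s x)" by blast
  show ?thesis
    using Ck_boundedD(3,4)[OF \<tau>(1)] by (intro exI[of _ K]) (auto simp: \<tau>(2) abs_mult intro!: mult_right_mono)
qed

text \<open>The integrand is at most M^2 / cosh (2x), which has the primitive M^2 arctan (e^(2x));
  its total increment is bounded by M^2 pi.\<close>

lemma wip_sech_bound:
  assumes f: "compact_cont f" and b: "\<And>x. \<bar>f x\<bar> \<le> M * inverse (cosh (2 * x))"
  shows "wip f f \<le> M\<^sup>2 * pi"
proof -
  let ?h = "\<lambda>x. f x * f x * cosh (2 * x)"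
  have h: "compact_cont ?h" by (intro wip_compact_cont f)
  obtain a0 where a0: "\<And>x. a0 < \<bar>x\<bar> \<Longrightarrow> ?h x = 0" using h by (auto simp: compact_cont_def)
  define a where "a = max 0 a0"
  have a: "\<And>x. a < \<bar>x\<bar> \<Longrightarrow> ?h x = 0" "0 \<le> a" using a0 by (auto simp: a_def)
  have d: "((\<lambda>x. M\<^sup>2 * arctan (exp (2 * x))) has_real_derivative M\<^sup>2 * inverse (cosh (2 * x))) (at x)" for x
  proof -
    have "2 * exp (2 * x) / (1 + (exp (2 * x))\<^sup>2) = inverse (cosh (2 * x))"
      by (simp add: cosh_def exp_minus field_simps power2_eq_square)
    then show ?thesis by (auto intro!: derivative_eq_intros simp: divide_inverse mult_ac)
  qed
  have I: "((\<lambda>x. M\<^sup>2 * inverse (cosh (2 * x))) has_integral (M\<^sup>2 * arctan (exp (2 * a)) - M\<^sup>2 * arctan (exp (2 * (- a))))) {-a..a}"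
    by (rule fundamental_theorem_of_calculus)
      (use a d in \<open>auto simp: has_real_derivative_iff_has_vector_derivative[symmetric] intro: has_field_derivative_at_within\<close>)
  have pt: "?h x \<le> M\<^sup>2 * inverse (cosh (2 * x))" for x
  proof -
    have "\<bar>f x\<bar> * \<bar>f x\<bar> \<le> (M * inverse (cosh (2 * x))) * (M * inverse (cosh (2 * x)))"
      using b[of x] by (intro mult_mono) (auto intro: order_trans[OF abs_ge_zero b])
    then have "f x * f x \<le> (M * inverse (cosh (2 * x))) * (M * inverse (cosh (2 * x)))" by simp
    from mult_right_mono[OF this, of "cosh (2 * x)"] show ?thesis
      by (simp add: power2_eq_square field_simps)
  qed
  have "wip f f = integral {-a..a} ?h"
    unfolding wip_def by (rule LINT_compact_support(2)[OF compact_cont_continuous[OF h] a(1)])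
  also have "\<dots> \<le> M\<^sup>2 * arctan (exp (2 * a)) - M\<^sup>2 * arctan (exp (2 * (- a)))"
    by (rule has_integral_le[OF integrable_integral I pt])
      (intro integrable_continuous_real continuous_on_subset[OF compact_cont_continuous[OF h]], simp)
  also have "\<dots> = M\<^sup>2 * (arctan (exp (2 * a)) - arctan (exp (2 * (- a))))" by (simp add: algebra_simps)
  also have "\<dots> \<le> M\<^sup>2 * pi"
    using arctan_bounded[of "exp (2 * a)"] arctan_bounded[of "exp (2 * (- a))"] by (intro mult_left_mono) auto
  finally show ?thesis .
qed

text \<open>Made for the source of the perturbation equation: b enters through its C^n bound, and C
  does not see the support of b. The factor 1 / cosh (2x) makes the weighted norm finite.\<close>

lemma wsq_mult_sech:
  "\<exists>C\<ge>0. \<forall>b K. b \<in> test_functions \<longrightarrow> Ck_bounded n K b \<longrightarrow> wsq n (\<lambda>x. b x * inverse (cosh (2 * x))) \<le> C * K\<^sup>2"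
proof -
  let ?s = "\<lambda>x :: real. inverse (cosh (2 * x))"
  have "\<forall>l. \<exists>D\<ge>0. \<forall>x. \<bar>(deriv ^^ l) ?s x\<bar> \<le> D * ?s x" using sech_derivative_bound by blast
  then obtain D where D: "\<And>l. 0 \<le> (D l :: real)" "\<And>l x. \<bar>(deriv ^^ l) ?s x\<bar> \<le> D l * ?s x" by metis
  let ?D = "\<Sum>l\<le>n. D l"
  have "wsq n (\<lambda>x. b x * ?s x) \<le> ((real n + 1) * ((2 ^ n * ?D)\<^sup>2 * pi)) * K\<^sup>2"
    if b: "b \<in> test_functions" and K: "Ck_bounded n K b" for b K
  proof -
    have t: "(\<lambda>x. b x * ?s x) \<in> test_functions" using test_mult[OF Ck_fun_sech b] by (simp add: mult.commute)
    have "wip ((deriv ^^ i) (\<lambda>x. b x * ?s x)) ((deriv ^^ i) (\<lambda>x. b x * ?s x)) \<le> (2 ^ n * K * ?D)\<^sup>2 * pi" if i: "i \<le> n" for i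
    proof (rule wip_sech_bound[OF test_compact_cont[OF test_funpow_deriv[OF t]]])
      fix x
      have "\<bar>(deriv ^^ i) (\<lambda>x. b x * ?s x) x\<bar> \<le> 2 ^ n * K * (\<Sum>l\<le>n. \<bar>(deriv ^^ l) ?s x\<bar>)"
        by (rule funpow_deriv_mult_Ck_bounded[OF K Ck_fun_sech i])
      also have "\<dots> \<le> 2 ^ n * K * (\<Sum>l\<le>n. D l * ?s x)"
        using Ck_boundedD(4)[OF K] by (intro mult_left_mono sum_mono D(2)) auto
      finally show "\<bar>(deriv ^^ i) (\<lambda>x. b x * ?s x) x\<bar> \<le> 2 ^ n * K * ?D * ?s x"
        by (simp add: sum_distrib_right mult.assoc)
    qed
    then have "wsq n (\<lambda>x. b x * ?s x) \<le> (\<Sum>i\<le>n. (2 ^ n * K * ?D)\<^sup>2 * pi)"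
      unfolding wsq_def by (intro sum_mono) auto
    then show ?thesis by (simp add: power_mult_distrib mult_ac add.commute)
  qed
  moreover have "0 \<le> (real n + 1) * ((2 ^ n * ?D)\<^sup>2 * pi)" by simp
  ultimately show ?thesis by blast
qed

text \<open>The square of \<open>\<phi>\<close> is the integral of twice \<open>\<phi>\<close> times
  its derivative, and the weight is at least 1.\<close>

lemma Sobolev_wip:
  assumes p: "\<phi> \<in> test_functions"
  shows "(\<phi> x)\<^sup>2 \<le> wip \<phi> \<phi> + wip (deriv \<phi>) (deriv \<phi>)"
proof -
  note cc = test_compact_cont
  let ?h = "\<lambda>x. \<phi> x * \<phi> x * cosh (2 * x) + deriv \<phi> x * deriv \<phi> x * cosh (2 * x)"
  have h: "compact_cont ?h" by (rule compact_cont_add[OF wip_compact_cont[OF cc[OF p] cc[OF p]]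
        wip_compact_cont[OF cc[OF test_deriv[OF p]] cc[OF test_deriv[OF p]]]])
  obtain a0 b0 where a0: "\<And>x. a0 < \<bar>x\<bar> \<Longrightarrow> ?h x = 0" "\<And>x. b0 < \<bar>x\<bar> \<Longrightarrow> \<phi> x = 0"
    using h cc[OF p] unfolding compact_cont_def by blast
  define a where "a = 1 + max (max 0 \<bar>x\<bar>) (max a0 b0)"
  have a1: "?h y = 0" if "a < \<bar>y\<bar>" for y by (rule a0(1)) (use that in \<open>simp add: a_def\<close>)
  have a: "0 < a" "- a \<le> x" "x \<le> a" by (auto simp: a_def)
  have pa: "\<phi> (- a) = 0" by (rule a0(2)) (auto simp: a_def)
  have hi: "?h integrable_on {u..v}" for u v
    by (intro integrable_continuous_real continuous_on_subset[OF compact_cont_continuous[OF h]]) simp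
  have h0: "0 \<le> ?h x" for x by simp
  have "((\<lambda>y. 2 * \<phi> y * deriv \<phi> y) has_integral (\<phi> x)\<^sup>2 - (\<phi> (- a))\<^sup>2) {-a..x}"
  proof (rule fundamental_theorem_of_calculus)
    fix y
    have "((\<lambda>y. (\<phi> y)\<^sup>2) has_real_derivative 2 * \<phi> y * deriv \<phi> y) (at y within {-a..x})"
      by (rule has_field_derivative_at_within) (rule derivative_eq_intros test_DERIV[OF p] refl | simp)+
    then show "((\<lambda>y. (\<phi> y)\<^sup>2) has_vector_derivative 2 * \<phi> y * deriv \<phi> y) (at y within {-a..x})"
      by (simp add: has_real_derivative_iff_has_vector_derivative)
  qed (use a in simp)
  then have I: "((\<lambda>y. 2 * \<phi> y * deriv \<phi> y) has_integral (\<phi> x)\<^sup>2) {-a..x}" by (simp add: pa)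
  have "(\<phi> x)\<^sup>2 \<le> integral {-a..x} ?h"
  proof (rule has_integral_le[OF I integrable_integral[OF hi]])
    fix y
    have "2 * \<phi> y * deriv \<phi> y \<le> (\<phi> y * \<phi> y + deriv \<phi> y * deriv \<phi> y) * 1"
      using sum_squares_bound[of "\<phi> y" "deriv \<phi> y"] by (simp add: power2_eq_square)
    also have "\<dots> \<le> (\<phi> y * \<phi> y + deriv \<phi> y * deriv \<phi> y) * cosh (2 * y)"
      by (intro mult_left_mono cosh_real_ge_1) auto
    finally show "2 * \<phi> y * deriv \<phi> y \<le> ?h y" by (simp add: distrib_right)
  qed
  also have "\<dots> \<le> integral {-a..a} ?h"
    using a(3) h0 by (intro integral_subset_le hi) auto
  also have "\<dots> = (LINT x|lebesgue. ?h x)"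
    by (rule LINT_compact_support(2)[symmetric, OF compact_cont_continuous[OF h] a1])
  also have "\<dots> = wip \<phi> \<phi> + wip (deriv \<phi>) (deriv \<phi>)"
    unfolding wip_def by (intro Bochner_Integration.integral_add wip_integrable cc p test_deriv)
  finally show ?thesis .
qed

lemma Sobolev_wsq:
  assumes p: "\<phi> \<in> test_functions" and i: "i < k"
  shows "\<bar>(deriv ^^ i) \<phi> x\<bar> \<le> sqrt (wsq k \<phi>)"
proof -
  obtain n where n: "k = Suc n" using i by (cases k) auto
  have "((deriv ^^ i) \<phi> x)\<^sup>2 \<le> wip ((deriv ^^ i) \<phi>) ((deriv ^^ i) \<phi>) + wip ((deriv ^^ Suc i) \<phi>) ((deriv ^^ Suc i) \<phi>)"
    using Sobolev_wip[OF test_funpow_deriv[OF p]] by simp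
  also have "\<dots> \<le> (\<Sum>j\<in>{i, Suc i}. wip ((deriv ^^ j) \<phi>) ((deriv ^^ j) \<phi>))" by simp
  also have "\<dots> \<le> wsq k \<phi>"
    unfolding wsq_def using i by (intro sum_mono2 wip_nonneg) auto
  finally show ?thesis by (simp add: real_le_rsqrt)
qed

subsection \<open>The norm of the completion\<close>

text \<open>Closability of differentiation: pair the derivative with a fixed late member of the
  sequence and integrate by parts.\<close>

lemma deriv_closable:
  assumes t: "\<And>n. \<theta> n \<in> test_functions" and l: "(\<lambda>n. wip (\<theta> n) (\<theta> n)) \<longlonglongrightarrow> 0"
    and c: "\<And>e. 0 < e \<Longrightarrow> \<exists>N. \<forall>m\<ge>N. \<forall>n\<ge>N. wip (deriv (\<lambda>x. \<theta> m x - \<theta> n x)) (deriv (\<lambda>x. \<theta> m x - \<theta> n x)) < e"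
  shows "(\<lambda>n. wip (deriv (\<theta> n)) (deriv (\<theta> n))) \<longlonglongrightarrow> 0"
proof (rule LIMSEQ_I)
  fix e :: real assume e: "0 < e"
  note cc = test_compact_cont
  obtain N where N: "\<And>m n. N \<le> m \<Longrightarrow> N \<le> n \<Longrightarrow> wip (deriv (\<lambda>x. \<theta> m x - \<theta> n x)) (deriv (\<lambda>x. \<theta> m x - \<theta> n x)) < e / 3"
    using c[of "e / 3"] e by auto
  let ?w = "Dstar (deriv (\<theta> N))"
  have w: "?w \<in> test_functions" by (intro test_Dstar test_deriv t)
  \<comment> \<open>Chosen so that wip w w / d is at most e / 3; the summand 1 keeps d positive when
    w vanishes.\<close>
  define d where "d = (1 + wip ?w ?w) / (e / 3)"
  have d: "0 < d" using e wip_nonneg[of ?w] by (simp add: d_def)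
  have wd: "wip ?w ?w / d \<le> e / 3"
    using e wip_nonneg[of ?w] by (simp add: d_def field_simps)
  obtain N' where N': "\<And>n. N' \<le> n \<Longrightarrow> \<bar>wip (\<theta> n) (\<theta> n)\<bar> < e / 3 / d"
    using LIMSEQ_D[OF l, of "e / 3 / d"] e d by auto
  have "wip (deriv (\<theta> n)) (deriv (\<theta> n)) < e" if n: "max N N' \<le> n" for n
  proof -
    let ?p = "deriv (\<theta> n)" and ?q = "deriv (\<theta> N)"
    have p: "?p \<in> test_functions" and q: "?q \<in> test_functions" by (intro test_deriv t)+
    have pq: "deriv (\<lambda>x. \<theta> n x - \<theta> N x) = (\<lambda>x. ?p x - ?q x)"
      by (intro ext DERIV_imp_deriv DERIV_diff test_DERIV t)
    have "wip ?p ?p = wip ?p (\<lambda>x. ?p x - ?q x) + wip ?p ?q"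
      by (simp add: wip_diff_right cc p q)
    moreover have "2 * wip ?p (\<lambda>x. ?p x - ?q x) \<le> 1 * wip ?p ?p + wip (\<lambda>x. ?p x - ?q x) (\<lambda>x. ?p x - ?q x) / 1"
      by (intro wip_AMGM compact_cont_diff cc p q) auto
    moreover have "wip ?p ?q = wip (\<theta> n) ?w" by (rule wip_adjoint[OF t q])
    moreover have "2 * wip (\<theta> n) ?w \<le> d * wip (\<theta> n) (\<theta> n) + wip ?w ?w / d"
      by (intro wip_AMGM cc t w d)
    moreover have "d * wip (\<theta> n) (\<theta> n) < e / 3"
      using N'[of n] n d wip_nonneg[of "\<theta> n"] by (simp add: field_simps)
    moreover have "wip (\<lambda>x. ?p x - ?q x) (\<lambda>x. ?p x - ?q x) < e / 3"
      using N[of n N] n by (simp add: pq)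
    ultimately show ?thesis using wd by linarith
  qed
  then show "\<exists>no. \<forall>n\<ge>no. norm (wip (deriv (\<theta> n)) (deriv (\<theta> n)) - 0) < e"
    using wip_nonneg by (intro exI[of _ "max N N'"]) auto
qed

lemma wip_funpow_diff:
  assumes "\<phi> \<in> test_functions" "\<psi> \<in> test_functions"
  shows "(deriv ^^ i) (\<lambda>x. \<phi> x - \<psi> x) = (\<lambda>x. (deriv ^^ i) \<phi> x - (deriv ^^ i) \<psi> x)"
  using assms by (intro funpow_deriv_diff[of i] test_functionsD) auto

lemma wsq_closable:
  assumes t: "\<And>n. \<theta> n \<in> test_functions" and l: "(\<lambda>n. wip (\<theta> n) (\<theta> n)) \<longlonglongrightarrow> 0"
    and c: "\<And>e. 0 < e \<Longrightarrow> \<exists>N. \<forall>m\<ge>N. \<forall>n\<ge>N. wsq k (\<lambda>x. \<theta> m x - \<theta> n x) < e"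
  shows "(\<lambda>n. wsq k (\<theta> n)) \<longlonglongrightarrow> 0"
proof -
  have "(\<lambda>n. wip ((deriv ^^ i) (\<theta> n)) ((deriv ^^ i) (\<theta> n))) \<longlonglongrightarrow> 0" if "i \<le> k" for i
    using that
  proof (induction i)
    case 0
    then show ?case using l by simp
  next
    case (Suc i)
    have "(\<lambda>n. wip (deriv ((deriv ^^ i) (\<theta> n))) (deriv ((deriv ^^ i) (\<theta> n)))) \<longlonglongrightarrow> 0"
    proof (rule deriv_closable[OF test_funpow_deriv[OF t]])
      show "(\<lambda>n. wip ((deriv ^^ i) (\<theta> n)) ((deriv ^^ i) (\<theta> n))) \<longlonglongrightarrow> 0" using Suc by simp
      fix e :: real assume "0 < e"
      then obtain N where N: "\<And>m n. N \<le> m \<Longrightarrow> N \<le> n \<Longrightarrow> wsq k (\<lambda>x. \<theta> m x - \<theta> n x) < e" using c by blast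
      have "wip ((deriv ^^ Suc i) (\<lambda>x. \<theta> m x - \<theta> n x)) ((deriv ^^ Suc i) (\<lambda>x. \<theta> m x - \<theta> n x)) < e"
        if "N \<le> m" "N \<le> n" for m n
        using wip_le_wsq[OF Suc(2), of "\<lambda>x. \<theta> m x - \<theta> n x"] N[OF that] by linarith
      then show "\<exists>N. \<forall>m\<ge>N. \<forall>n\<ge>N. wip (deriv (\<lambda>x. (deriv ^^ i) (\<theta> m) x - (deriv ^^ i) (\<theta> n) x))
          (deriv (\<lambda>x. (deriv ^^ i) (\<theta> m) x - (deriv ^^ i) (\<theta> n) x)) < e"
        by (intro exI[of _ N]) (simp add: wip_funpow_diff[OF t t, symmetric])
    qed
    then show ?case by simp
  qed
  then show ?thesis unfolding wsq_def by (intro tendsto_null_sum) auto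
qed

text \<open>Squared weighted distance with values in \<open>ennreal\<close>, as the limit in
  \<open>represents\<close> is a priori only measurable.\<close>

definition nnsq :: "(real \<Rightarrow> real) \<Rightarrow> (real \<Rightarrow> real) \<Rightarrow> ennreal" where
  "nnsq f g = (\<integral>\<^sup>+ x. ennreal ((f x - g x)\<^sup>2 * cosh (2 * x)) \<partial>lebesgue)"

lemma represents_nnsq: "represents k \<phi> f \<longleftrightarrow>
     (\<forall>n. \<phi> n \<in> test_functions) \<and>
     (\<forall>e>0. \<exists>N. \<forall>m\<ge>N. \<forall>n\<ge>N. weighted_norm k (\<lambda>x. \<phi> m x - \<phi> n x) < e) \<and>
     f \<in> borel_measurable lebesgue \<and> (\<lambda>n. nnsq (\<phi> n) f) \<longlonglongrightarrow> 0"
  by (simp add: represents_def nnsq_def)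

lemma test_measurable: "\<phi> \<in> test_functions \<Longrightarrow> \<phi> \<in> borel_measurable lebesgue"
  by (intro measurable_completion) (simp add: borel_measurable_continuous_onI Ck_fun_continuous[OF test_functionsD[of _ 0]])

lemma cosh_measurable: "(\<lambda>x. cosh (2 * x) :: real) \<in> borel_measurable lebesgue"
  by (intro measurable_completion) (auto intro!: borel_measurable_continuous_onI continuous_intros)

lemma nnsq_measurable:
  assumes [measurable]: "f \<in> borel_measurable lebesgue" "g \<in> borel_measurable lebesgue"
  shows "(\<lambda>x. ennreal ((f x - g x)\<^sup>2 * cosh (2 * x))) \<in> borel_measurable lebesgue"
  using cosh_measurable by measurable

lemma nnsq_commute: "nnsq f g = nnsq g f"
  by (simp add: nnsq_def power2_commute)

lemma nnsq_triangle:
  assumes "f \<in> borel_measurable lebesgue" "g \<in> borel_measurable lebesgue" "h \<in> borel_measurable lebesgue"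
  shows "nnsq f g \<le> 2 * nnsq f h + 2 * nnsq h g"
proof -
  have "nnsq f g \<le> (\<integral>\<^sup>+ x. 2 * (ennreal ((f x - h x)\<^sup>2 * cosh (2 * x)) + ennreal ((h x - g x)\<^sup>2 * cosh (2 * x))) \<partial>lebesgue)"
    unfolding nnsq_def
  proof (rule nn_integral_mono)
    fix x
    have "(f x - g x)\<^sup>2 \<le> 2 * ((f x - h x)\<^sup>2 + (h x - g x)\<^sup>2)"
      using sum_squares_bound[of "f x - h x" "h x - g x"] by (simp add: power2_eq_square algebra_simps)
    then have "(f x - g x)\<^sup>2 * cosh (2 * x) \<le> 2 * ((f x - h x)\<^sup>2 * cosh (2 * x) + (h x - g x)\<^sup>2 * cosh (2 * x))"
      using mult_right_mono[of "(f x - g x)\<^sup>2" _ "cosh (2 * x)"] by (fastforce simp: algebra_simps)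
    then show "ennreal ((f x - g x)\<^sup>2 * cosh (2 * x)) \<le> 2 * (ennreal ((f x - h x)\<^sup>2 * cosh (2 * x)) + ennreal ((h x - g x)\<^sup>2 * cosh (2 * x)))"
      by (simp add: ennreal_plus[symmetric] ennreal_numeral[symmetric] ennreal_mult[symmetric] ennreal_leI
          del: ennreal_plus ennreal_numeral)
  qed
  also have "\<dots> = 2 * (nnsq f h + nnsq h g)"
    unfolding nnsq_def using nnsq_measurable[OF assms(1,3)] nnsq_measurable[OF assms(3,2)]
    by (simp only: nn_integral_cmult nn_integral_add borel_measurable_add)
  also have "\<dots> = 2 * nnsq f h + 2 * nnsq h g" by (rule distrib_left)
  finally show ?thesis .
qed

lemma nnsq_wip:
  assumes "\<phi> \<in> test_functions" "\<psi> \<in> test_functions"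
  shows "nnsq \<phi> \<psi> = ennreal (wip (\<lambda>x. \<phi> x - \<psi> x) (\<lambda>x. \<phi> x - \<psi> x))"
  unfolding nnsq_def wip_def power2_eq_square
  using assms by (intro nn_integral_eq_integral wip_integrable test_compact_cont test_diff) auto

text \<open>Makes the definite description in \<open>Ht_norm\<close> meaningful. The difference of
  the two sequences tends to zero in weighted L^2 and is Cauchy in the full norm, so closability
  forces convergence to zero in the full norm.\<close>

lemma represents_norm_unique:
  assumes p: "represents k \<phi> f" and q: "represents k \<psi> f"
  shows "(\<lambda>n. weighted_norm k (\<phi> n) - weighted_norm k (\<psi> n)) \<longlonglongrightarrow> 0"
proof -
  have pt: "\<And>n. \<phi> n \<in> test_functions" and qt: "\<And>n. \<psi> n \<in> test_functions" and f: "f \<in> borel_measurable lebesgue"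
    using p q by (auto simp: represents_nnsq)
  define \<theta> where "\<theta> n x = \<phi> n x - \<psi> n x" for n x
  have t: "\<theta> n \<in> test_functions" for n unfolding \<theta>_def[abs_def] by (intro test_diff pt qt)
  have "(\<lambda>n. wsq k (\<theta> n)) \<longlonglongrightarrow> 0"
  proof (rule wsq_closable[OF t])
    have "(\<lambda>n. 2 * nnsq (\<phi> n) f + 2 * nnsq f (\<psi> n)) \<longlonglongrightarrow> 2 * 0 + 2 * 0"
      using p q by (intro tendsto_add ennreal_tendsto_cmult) (auto simp: represents_nnsq nnsq_commute[of f])
    then have l: "(\<lambda>n. nnsq (\<phi> n) (\<psi> n)) \<longlonglongrightarrow> 0"
      by (intro tendsto_sandwich[OF _ _ tendsto_const, of 0 "\<lambda>n. nnsq (\<phi> n) (\<psi> n)" _ "\<lambda>n. 2 * nnsq (\<phi> n) f + 2 * nnsq f (\<psi> n)"])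
        (auto intro!: nnsq_triangle test_measurable pt qt f always_eventually)
    then have "(\<lambda>n. ennreal (wip (\<theta> n) (\<theta> n))) \<longlonglongrightarrow> ennreal 0"
      by (simp add: nnsq_wip[OF pt qt] \<theta>_def[abs_def])
    then show "(\<lambda>n. wip (\<theta> n) (\<theta> n)) \<longlonglongrightarrow> 0"
      by (subst (asm) tendsto_ennreal_iff) (auto intro!: always_eventually wip_nonneg)
    fix e :: real assume e: "0 < e"
    then have e2: "0 < sqrt e / 2" by simp
    obtain N where N: "\<And>m n. N \<le> m \<Longrightarrow> N \<le> n \<Longrightarrow> weighted_norm k (\<lambda>x. \<phi> m x - \<phi> n x) < sqrt e / 2"
      using p e2 unfolding represents_nnsq by blast
    obtain M where M: "\<And>m n. M \<le> m \<Longrightarrow> M \<le> n \<Longrightarrow> weighted_norm k (\<lambda>x. \<psi> m x - \<psi> n x) < sqrt e / 2"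
      using q e2 unfolding represents_nnsq by blast
    have "wsq k (\<lambda>x. \<theta> m x - \<theta> n x) < e" if "max N M \<le> m" "max N M \<le> n" for m n
    proof -
      have "(\<lambda>x. \<theta> m x - \<theta> n x) = (\<lambda>x. (\<phi> m x - \<phi> n x) + (\<psi> n x - \<psi> m x))"
        by (auto simp: \<theta>_def)
      then have "weighted_norm k (\<lambda>x. \<theta> m x - \<theta> n x) \<le> weighted_norm k (\<lambda>x. \<phi> m x - \<phi> n x) + weighted_norm k (\<lambda>x. \<psi> n x - \<psi> m x)"
        using weighted_norm_triangle[OF test_diff[OF pt pt] test_diff[OF qt qt]] by simp
      also have "\<dots> < sqrt e" using N[of m n] M[of n m] that by simp
      finally show ?thesis by (simp add: weighted_norm_wsq)
    qed
    then show "\<exists>N. \<forall>m\<ge>N. \<forall>n\<ge>N. wsq k (\<lambda>x. \<theta> m x - \<theta> n x) < e" by blast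
  qed
  then have w: "(\<lambda>n. weighted_norm k (\<theta> n)) \<longlonglongrightarrow> 0"
    unfolding weighted_norm_wsq using tendsto_real_sqrt by fastforce
  show ?thesis
    by (rule Lim_null_comparison[OF _ w])
      (use weighted_norm_diff_abs[OF pt qt] in \<open>simp add: \<theta>_def[abs_def]\<close>)
qed

lemma represents_Ht_norm:
  assumes p: "represents k \<phi> f"
  shows "(\<lambda>n. weighted_norm k (\<phi> n)) \<longlonglongrightarrow> Ht_norm k f"
proof -
  have pt: "\<And>n. \<phi> n \<in> test_functions" using p by (auto simp: represents_nnsq)
  have "Cauchy (\<lambda>n. weighted_norm k (\<phi> n))"
  proof (rule metric_CauchyI)
    fix e :: real assume "0 < e"
    then obtain N where N: "\<And>m n. N \<le> m \<Longrightarrow> N \<le> n \<Longrightarrow> weighted_norm k (\<lambda>x. \<phi> m x - \<phi> n x) < e"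
      using p unfolding represents_nnsq by blast
    show "\<exists>M. \<forall>m\<ge>M. \<forall>n\<ge>M. dist (weighted_norm k (\<phi> m)) (weighted_norm k (\<phi> n)) < e"
      using N weighted_norm_diff_abs[OF pt pt, of k] unfolding dist_real_def by (meson le_less_trans)
  qed
  then obtain l where l: "(\<lambda>n. weighted_norm k (\<phi> n)) \<longlonglongrightarrow> l"
    using real_Cauchy_convergent convergent_def by blast
  have "Ht_norm k f = l"
    unfolding Ht_norm_def
  proof (rule the_equality)
    show "\<exists>\<phi>. represents k \<phi> f \<and> (\<lambda>n. weighted_norm k (\<phi> n)) \<longlonglongrightarrow> l" using p l by blast
    fix l' assume "\<exists>\<psi>. represents k \<psi> f \<and> (\<lambda>n. weighted_norm k (\<psi> n)) \<longlonglongrightarrow> l'"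
    then obtain \<psi> where q: "represents k \<psi> f" "(\<lambda>n. weighted_norm k (\<psi> n)) \<longlonglongrightarrow> l'" by blast
    have "l' - l = 0"
      by (rule LIMSEQ_unique[OF tendsto_diff[OF q(2) l] represents_norm_unique[OF q(1) p]])
    then show "l' = l" by simp
  qed
  then show ?thesis using l by simp
qed

text \<open>Fatou's lemma identifies the pointwise limit with the limit in weighted L^2. Time slices
  of the limit solution become elements of the completion in this way.\<close>

lemma represents_pointwise_limit:
  assumes t: "\<And>n. \<phi> n \<in> test_functions"
    and c: "\<And>e. 0 < e \<Longrightarrow> \<exists>N. \<forall>m\<ge>N. \<forall>n\<ge>N. weighted_norm k (\<lambda>x. \<phi> m x - \<phi> n x) < e"
    and l: "\<And>x. (\<lambda>n. \<phi> n x) \<longlonglongrightarrow> f x"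
  shows "represents k \<phi> f"
proof -
  have f: "f \<in> borel_measurable lebesgue"
    by (rule borel_measurable_LIMSEQ_metric[where f = \<phi>]) (auto intro: test_measurable t l)
  have "(\<lambda>n. nnsq (\<phi> n) f) \<longlonglongrightarrow> 0"
  proof (rule tendsto_zero_ennreal)
    fix r :: real assume r: "0 < r"
    then obtain N where N: "\<And>m n. N \<le> m \<Longrightarrow> N \<le> n \<Longrightarrow> weighted_norm k (\<lambda>x. \<phi> m x - \<phi> n x) < sqrt (r / 2)"
      using c[of "sqrt (r / 2)"] by auto
    have "nnsq (\<phi> n) f < ennreal r" if n: "N \<le> n" for n
    proof -
      have b: "nnsq (\<phi> n) (\<phi> m) \<le> ennreal (r / 2)" if m: "N \<le> m" for m
      proof -
        have "wip (\<lambda>x. \<phi> n x - \<phi> m x) (\<lambda>x. \<phi> n x - \<phi> m x) \<le> wsq k (\<lambda>x. \<phi> n x - \<phi> m x)"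
          using wip_le_wsq[of 0 k] by simp
        also have "\<dots> < r / 2" using N[OF n m] by (simp add: weighted_norm_wsq)
        finally show ?thesis unfolding nnsq_wip[OF t t] by (intro ennreal_leI) simp
      qed
      have "nnsq (\<phi> n) f = (\<integral>\<^sup>+ x. liminf (\<lambda>m. ennreal ((\<phi> n x - \<phi> m x)\<^sup>2 * cosh (2 * x))) \<partial>lebesgue)"
        unfolding nnsq_def
      proof (intro nn_integral_cong)
        fix x
        have "(\<lambda>m. ennreal ((\<phi> n x - \<phi> m x)\<^sup>2 * cosh (2 * x))) \<longlonglongrightarrow> ennreal ((\<phi> n x - f x)\<^sup>2 * cosh (2 * x))"
          by (intro tendsto_ennrealI tendsto_intros l)
        from lim_imp_Liminf[OF _ this]
        show "ennreal ((\<phi> n x - f x)\<^sup>2 * cosh (2 * x)) = liminf (\<lambda>m. ennreal ((\<phi> n x - \<phi> m x)\<^sup>2 * cosh (2 * x)))"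
          by simp
      qed
      also have "\<dots> \<le> liminf (\<lambda>m. nnsq (\<phi> n) (\<phi> m))"
        unfolding nnsq_def by (intro nn_integral_liminf nnsq_measurable test_measurable t)
      also have "\<dots> \<le> ennreal (r / 2)"
        by (rule Liminf_le) (use b in \<open>auto simp: eventually_sequentially\<close>)
      also have "\<dots> < ennreal r" using r by (intro ennreal_lessI) auto
      finally show ?thesis .
    qed
    then show "\<forall>\<^sub>F n in sequentially. nnsq (\<phi> n) f < ennreal r"
      by (auto simp: eventually_sequentially)
  qed
  then show ?thesis using t c f by (auto simp: represents_nnsq)
qed

lemma represents_AE_unique:
  assumes p: "represents k \<phi> f" and q: "represents k \<phi> g"
  shows "AE x in lebesgue. f x = g x"
proof -
  have m: "f \<in> borel_measurable lebesgue" "g \<in> borel_measurable lebesgue" "\<phi> n \<in> borel_measurable lebesgue" for n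
    using p q by (auto simp: represents_nnsq intro: test_measurable)
  have "(\<lambda>n. 2 * nnsq f (\<phi> n) + 2 * nnsq (\<phi> n) g) \<longlonglongrightarrow> 2 * 0 + 2 * 0"
    using p q by (intro tendsto_add ennreal_tendsto_cmult) (auto simp: represents_nnsq nnsq_commute[of f])
  then have "nnsq f g \<le> 2 * 0 + 2 * 0"
    by (rule tendsto_lowerbound) (auto intro!: always_eventually nnsq_triangle m)
  then have "nnsq f g = 0" by simp
  then have "AE x in lebesgue. ennreal ((f x - g x)\<^sup>2 * cosh (2 * x)) = 0"
    unfolding nnsq_def by (simp only: nn_integral_0_iff_AE[OF nnsq_measurable[OF m(1,2)]])
  then show ?thesis
  proof (rule AE_mp, intro AE_I2 impI)
    fix x assume "ennreal ((f x - g x)\<^sup>2 * cosh (2 * x)) = 0"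
    moreover have "0 < cosh (2 * x)" by simp
    ultimately show "f x = g x"
      by (simp add: ennreal_eq_0_iff mult_le_0_iff del: cosh_real_pos)
  qed
qed

section \<open>The energy estimate\<close>

lemma smooth_section_Ck_fun: "smooth_hp u \<Longrightarrow> 0 \<le> t \<Longrightarrow> Ck_fun k (u t)"
  by (rule Ck_halfplane_section[OF smooth_hpD])

lemma smooth_section_test:
  assumes "smooth_hp u" "supp_cone a u" "0 \<le> t"
  shows "u t \<in> test_functions"
  unfolding test_functions_def
  using smooth_section_Ck_fun[OF assms(1,3)] assms(2,3) by (auto simp: supp_cone_def)

lemma LINT_DERIV_t:
  assumes z: "smooth_hp z" and s: "supp_cone a z" and t: "0 \<le> t"
  shows "((\<lambda>s. LINT x|lebesgue. z s x) has_real_derivative (LINT x|lebesgue. Dt z t x)) (at t within {0..})"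
proof -
  \<comment> \<open>One unit more than the support at time t: a fixed interval then contains the
    supports at all times up to t + 1, and the Leibniz rule applies near t.\<close>
  define b where "b = a + t + 1"
  have L: "(LINT x|lebesgue. w s x) = integral (cbox (- b) b) (w s)"
    if "smooth_hp w" "supp_cone a w" "0 \<le> s" "s \<le> t + 1" for w s
    unfolding box_real using that(2-4)
    by (intro LINT_compact_support(2) Ck_fun_continuous[OF smooth_section_Ck_fun[OF that(1,3), of 0]])
      (auto simp: b_def supp_cone_def)
  have "((\<lambda>s. integral (cbox (- b) b) (z s)) has_field_derivative integral (cbox (- b) b) (Dt z t)) (at t within {0..t + 1})"
  proof (rule leibniz_rule_field_derivative)
    show "((\<lambda>s. z s x) has_real_derivative Dt z s x) (at s within {0..t + 1})" if "s \<in> {0..t + 1}" for s x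
      using that by (intro DERIV_subset[OF smooth_hp_Dt[OF z]]) auto
    show "z s integrable_on cbox (- b) b" if "s \<in> {0..t + 1}" for s
      using that by (intro integrable_continuous continuous_on_subset[OF Ck_fun_continuous[OF smooth_section_Ck_fun[OF z, of _ 0]]]) auto
    show "continuous_on ({0..t + 1} \<times> cbox (- b) b) (\<lambda>(s, x). Dt z s x)"
      by (rule continuous_on_subset[OF Ck_halfplane_cont[OF smooth_hpD[OF smooth_hp_intros(8)[OF z], of 0]]]) auto
  qed (use t in auto)
  then have "((\<lambda>s. integral (cbox (- b) b) (z s)) has_real_derivative (LINT x|lebesgue. Dt z t x)) (at t within {0..})"
    using at_within_Icc_nonneg[of t "t + 1"] t L[OF smooth_hp_intros(8)[OF z] supp_cone_Dt[OF s] t] by simp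
  then show ?thesis
    by (rule has_field_derivative_transform_within[OF _ zero_less_one])
      (use t L[OF z s] in \<open>auto simp: dist_real_def\<close>)
qed

lemma wip_DERIV_t:
  assumes u: "smooth_hp u" "supp_cone a u" and w: "smooth_hp w" "supp_cone a w" and t: "0 \<le> t"
  shows "((\<lambda>s. wip (u s) (w s)) has_real_derivative wip (Dt u t) (w t) + wip (u t) (Dt w t)) (at t within {0..})"
proof -
  let ?z = "\<lambda>t x. u t x * w t x * cosh (2 * x)"
  have c: "smooth_hp (\<lambda>t x. cosh (2 * x))" using Ck_fun_cosh_sinh by (intro smooth_hp_x) auto
  have z: "smooth_hp ?z" by (intro smooth_hp_intros u w c)
  have sz: "supp_cone a ?z" using u(2) by (auto simp: supp_cone_def)
  have d: "Dt ?z t x = Dt u t x * w t x * cosh (2 * x) + u t x * Dt w t x * cosh (2 * x)" for x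
    by (rule Dt_eqI[OF _ t])
      (rule derivative_eq_intros smooth_hp_Dt[OF u(1) t] smooth_hp_Dt[OF w(1) t] refl | simp add: algebra_simps)+
  have "(LINT x|lebesgue. Dt ?z t x) = wip (Dt u t) (w t) + wip (u t) (Dt w t)"
    unfolding d wip_def
    by (intro Bochner_Integration.integral_add wip_integrable test_compact_cont)
      (rule smooth_section_test[OF _ _ t, where a = a]; fact smooth_hp_intros(8)[OF u(1)] smooth_hp_intros(8)[OF w(1)] supp_cone_Dt[OF u(2)] supp_cone_Dt[OF w(2)] u w)+
  then show ?thesis using LINT_DERIV_t[OF z sz t] by (simp add: wip_def)
qed

text \<open>The coefficients of \<open>Bop\<close> depend on x alone and mixed derivatives commute,
  so time derivatives pass through and \<open>wip_DERIV_t\<close> applies to each term of the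
  energy.\<close>

lemma Bop_halfplane:
  assumes u: "smooth_hp u" "supp_cone a u"
  shows "smooth_hp (\<lambda>s. Bop j (u s)) \<and> supp_cone a (\<lambda>s. Bop j (u s)) \<and>
    (\<forall>t\<ge>0. Dt (\<lambda>s. Bop j (u s)) t = Bop j (Dt u t))"
proof (induction j)
  case 0
  then show ?case using u by simp
next
  case (Suc j)
  let ?U = "\<lambda>s. Bop j (u s)"
  have U: "smooth_hp ?U" "supp_cone a ?U" and Ut: "\<And>t. 0 \<le> t \<Longrightarrow> Dt ?U t = Bop j (Dt u t)" using Suc by auto
  have DtDx: "Dt (Dx ?U) t x = deriv (Bop j (Dt u t)) x" if "0 \<le> t" for t x
    using smooth_hp_Dt_Dx[OF U(1) that, of x] Ut[OF that] by (simp add: Dx_section)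
  show ?case
  proof (cases "even j")
    case True
    then have eq: "(\<lambda>s. Bop (Suc j) (u s)) = Dx ?U" by (simp add: fun_eq_iff Dx_section)
    show ?thesis unfolding eq
      using True DtDx by (auto intro: smooth_hp_intros U supp_cone_Dx)
  next
    case False
    then have eq: "(\<lambda>s. Bop (Suc j) (u s)) = (\<lambda>s x. - 1 * (Dx ?U s x + 2 * (tanh (2 * x) * ?U s x)))"
      by (simp add: fun_eq_iff Dx_section Dstar_def)
    have "smooth_hp (\<lambda>s x. - 1 * (Dx ?U s x + 2 * (tanh (2 * x) * ?U s x)))"
      by (intro smooth_hp_intros U smooth_hp_x Ck_fun_tanh)
    moreover have "supp_cone a (\<lambda>s x. - 1 * (Dx ?U s x + 2 * (tanh (2 * x) * ?U s x)))"
      using supp_cone_Dx[OF U(2)] U(2) by (auto simp: supp_cone_def)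
    moreover have "Dt (\<lambda>s x. - 1 * (Dx ?U s x + 2 * (tanh (2 * x) * ?U s x))) t x = Bop (Suc j) (Dt u t) x" if t: "0 \<le> t" for t x
    proof -
      have "((\<lambda>s. - 1 * (Dx ?U s x + 2 * (tanh (2 * x) * ?U s x))) has_real_derivative
          - 1 * (Dt (Dx ?U) t x + 2 * (tanh (2 * x) * Dt ?U t x))) (at t within {0..})"
        by (intro DERIV_cmult DERIV_add smooth_hp_Dt smooth_hp_intros U t)
      then show ?thesis
        using Dt_eqI[OF _ t] False Ut[OF t] DtDx[OF t] by (simp add: Dstar_def)
    qed
    ultimately show ?thesis unfolding eq by auto
  qed
qed

lemma Bop_add:
  "\<phi> \<in> test_functions \<Longrightarrow> \<psi> \<in> test_functions \<Longrightarrow> Bop j (\<lambda>x. \<phi> x + \<psi> x) = (\<lambda>x. Bop j \<phi> x + Bop j \<psi> x)"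
proof (induction j)
  case (Suc j)
  have d: "deriv (\<lambda>x. Bop j \<phi> x + Bop j \<psi> x) = (\<lambda>x. deriv (Bop j \<phi>) x + deriv (Bop j \<psi>) x)"
    using Suc.prems by (intro ext DERIV_imp_deriv DERIV_add test_DERIV test_Bop)
  show ?case using Suc by (simp add: d Dstar_def[abs_def] algebra_simps)
qed simp

lemma Bop_cmult:
  "\<phi> \<in> test_functions \<Longrightarrow> Bop j (\<lambda>x. c * \<phi> x) = (\<lambda>x. c * Bop j \<phi> x)"
proof (induction j)
  case (Suc j)
  have d: "deriv (\<lambda>x. c * Bop j \<phi> x) = (\<lambda>x. c * deriv (Bop j \<phi>) x)"
    using Suc.prems by (intro ext DERIV_imp_deriv DERIV_cmult test_DERIV test_Bop)
  show ?case using Suc by (simp add: d Dstar_def[abs_def] algebra_simps)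
qed simp

text \<open>An abstract pair of differential inequalities. The combination \<open>E + e\<^sup>-\<^sup>t\<^sup>/\<^sup>2 X\<close> grows at an
  integrable rate; \<open>X\<close> itself then grows at most quadratically.\<close>

lemma energy_growth:
  fixes E X E' X' g :: "real \<Rightarrow> real"
  assumes E: "\<And>t. 0 \<le> t \<Longrightarrow> (E has_real_derivative E' t) (at t within {0..})"
    and X: "\<And>t. 0 \<le> t \<Longrightarrow> (X has_real_derivative X' t) (at t within {0..})"
    and nn: "\<And>t. 0 \<le> t \<Longrightarrow> 0 \<le> E t" "\<And>t. 0 \<le> t \<Longrightarrow> 0 \<le> X t" "0 \<le> K" "0 \<le> \<mu>"
    and E': "\<And>t c. 0 \<le> t \<Longrightarrow> 0 < c \<Longrightarrow> E' t \<le> c * E t + g t / c"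
    and X': "\<And>t c. 0 \<le> t \<Longrightarrow> 0 < c \<Longrightarrow> X' t \<le> c * X t + E t / c"
    and g: "\<And>t. 0 \<le> t \<Longrightarrow> g t \<le> K * ((1 + t)\<^sup>2 * exp (- 2 * t)) * (E t + X t + \<mu>)"
    and t: "0 \<le> t"
  shows "E t \<le> exp (4 * (3 + 4 * K)) * (E 0 + X 0 + \<mu>)"
    and "X t \<le> (1 + t)\<^sup>2 * (exp (4 * (3 + 4 * K)) * (E 0 + X 0 + \<mu>))"
proof -
  \<comment> \<open>The summands: 1 from c E with c = e^(-t/4), 2 from the bound on X', and 4 K from
    the source through (1 + t)^2 <= 4 e^t.\<close>
  define L where "L = 3 + 4 * K"
  define M where "M = exp (4 * L) * (E 0 + X 0 + \<mu>)"
  define Z where "Z t = E t + exp (- t / 2) * X t" for t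
  define Z' where "Z' t = E' t + (exp (- t / 2) * X' t - exp (- t / 2) / 2 * X t)" for t
  have Z: "(Z has_real_derivative Z' t) (at t within {0..})" if "0 \<le> t" for t
    unfolding Z_def[abs_def] Z'_def by (rule derivative_eq_intros E[OF that] X[OF that] refl | simp)+
  have Z'_le: "Z' t \<le> L * exp (- t / 4) * (Z t + \<mu>)" if t: "0 \<le> t" for t
  proof -
    have "1 + t / 2 \<le> exp (t / 2)" by (rule exp_ge_add_one_self)
    then have "1 + t \<le> 2 * exp (t / 2)" by linarith
    then have "(1 + t)\<^sup>2 \<le> (2 * exp (t / 2))\<^sup>2" using t by (intro power_mono) auto
    also have "\<dots> = 4 * exp t" by (simp add: power_mult_distrib exp_double[symmetric])
    finally have q: "(1 + t)\<^sup>2 \<le> 4 * exp t" .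
    have ex: "E t + X t + \<mu> \<le> exp (t / 2) * (Z t + \<mu>)"
    proof -
      have "1 \<le> exp (t / 2)" using t by simp
      then have "E t * 1 \<le> E t * exp (t / 2)" "\<mu> * 1 \<le> \<mu> * exp (t / 2)"
        by (rule mult_left_mono[OF _ nn(1)[OF t]], rule mult_left_mono[OF _ nn(4)])
      moreover have "exp (t / 2) * (exp (- t / 2) * X t) = X t"
        by (simp add: mult.assoc[symmetric] exp_add[symmetric])
      ultimately have "E t + X t + \<mu> \<le> E t * exp (t / 2) + exp (t / 2) * (exp (- t / 2) * X t) + \<mu> * exp (t / 2)"
        by linarith
      also have "\<dots> = exp (t / 2) * (Z t + \<mu>)" unfolding Z_def by (simp only: distrib_left mult.commute[of _ "exp (t / 2)"])
      finally show ?thesis .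
    qed
    have "g t / exp (- t / 4) = exp (t / 4) * g t" by (simp add: exp_minus divide_simps)
    also have "\<dots> \<le> exp (t / 4) * (K * ((1 + t)\<^sup>2 * exp (- 2 * t)) * (E t + X t + \<mu>))"
      by (intro mult_left_mono g t) auto
    also have "\<dots> \<le> exp (t / 4) * (K * (4 * exp t * exp (- 2 * t)) * (exp (t / 2) * (Z t + \<mu>)))"
      using nn t by (intro mult_left_mono mult_mono ex q order_refl) (auto simp: Z_def intro!: add_nonneg_nonneg mult_nonneg_nonneg)
    also have "\<dots> = (4 * K) * (exp (t / 4) * exp t * exp (- 2 * t) * exp (t / 2)) * (Z t + \<mu>)" by simp
    also have "exp (t / 4) * exp t * exp (- 2 * t) * exp (t / 2) = exp (- t / 4)"
      by (simp add: exp_add[symmetric])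
    finally have g1: "g t / exp (- t / 4) \<le> 4 * K * exp (- t / 4) * (Z t + \<mu>)" .
    \<comment> \<open>With this c both terms carry the integrable factor e^(-t/4): the bound on g
      decays like e^(-t), division by c costs e^(t/4), and comparing X with Z costs e^(t/2).\<close>
    have "E' t \<le> exp (- t / 4) * E t + g t / exp (- t / 4)" using E'[OF t, of "exp (- t / 4)"] by simp
    \<comment> \<open>The choice c = 1/2 makes c X cancel against the derivative of the weight
      e^(-t/2).\<close>
    moreover have "exp (- t / 2) * X' t \<le> exp (- t / 2) * (1 / 2 * X t + E t / (1 / 2))"
      using X'[OF t, of "1 / 2"] by (intro mult_left_mono) auto
    ultimately have "Z' t \<le> exp (- t / 4) * E t + 4 * K * exp (- t / 4) * (Z t + \<mu>) + 2 * exp (- t / 2) * E t"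
      using g1 by (simp add: Z'_def algebra_simps)
    also have "\<dots> \<le> exp (- t / 4) * (Z t + \<mu>) + 4 * K * exp (- t / 4) * (Z t + \<mu>) + 2 * exp (- t / 4) * (Z t + \<mu>)"
      using nn t by (intro add_mono mult_mono order_refl) (auto simp: Z_def)
    also have "\<dots> = L * exp (- t / 4) * (Z t + \<mu>)" by (simp add: L_def algebra_simps)
    finally show ?thesis .
  qed
  have Zb: "Z t + \<mu> \<le> M" if t: "0 \<le> t" for t
  proof -
    \<comment> \<open>Integrating factor: 4 L e^(-t/4) has derivative - L e^(-t/4), and its value 4
      L at t = 0 explains e^(4 L) in M.\<close>
    have "- ((Z 0 + \<mu>) * exp (4 * L * exp (- 0 / 4))) \<le> - ((Z t + \<mu>) * exp (4 * L * exp (- t / 4)))"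
    proof (rule DERIV_nonneg_mono[OF _ _ t, of "\<lambda>t. - ((Z t + \<mu>) * exp (4 * L * exp (- t / 4)))"])
      fix s assume s: "0 \<le> s" "s \<le> t"
      show "((\<lambda>t. - ((Z t + \<mu>) * exp (4 * L * exp (- t / 4)))) has_real_derivative
          (L * exp (- s / 4) * (Z s + \<mu>) - Z' s) * exp (4 * L * exp (- s / 4))) (at s within {0..})"
        by (rule derivative_eq_intros Z[OF s(1)] refl | simp add: algebra_simps)+
      show "0 \<le> (L * exp (- s / 4) * (Z s + \<mu>) - Z' s) * exp (4 * L * exp (- s / 4))"
        using Z'_le[OF s(1)] by simp
    qed
    then have "(Z t + \<mu>) * exp (4 * L * exp (- t / 4)) \<le> M"
      by (simp add: M_def Z_def mult.commute)
    moreover have "(Z t + \<mu>) * 1 \<le> (Z t + \<mu>) * exp (4 * L * exp (- t / 4))"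
      using nn t by (intro mult_left_mono) (auto simp: Z_def L_def)
    ultimately show ?thesis by simp
  qed
  have Eb: "E t \<le> M" if t: "0 \<le> t" for t
    using Zb[OF t] nn(2)[OF t] nn(4) by (simp add: Z_def) (smt (verit) exp_gt_zero mult_nonneg_nonneg)
  then show "E t \<le> exp (4 * (3 + 4 * K)) * (E 0 + X 0 + \<mu>)" using t by (simp add: M_def L_def)
  have X0: "X 0 \<le> M"
    using Zb[of 0] nn(1)[of 0] nn(4) by (simp add: Z_def)
  \<comment> \<open>With c = 1 / (1 + s) the bound on X' says that X / (1 + s) has derivative at
    most E, hence at most M; so this quotient grows at most linearly.\<close>
  have "M * 0 - X 0 / (1 + 0) \<le> M * t - X t / (1 + t)"
  proof (rule DERIV_nonneg_mono[OF _ _ t, of "\<lambda>t. M * t - X t / (1 + t)"])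
    fix s assume s: "0 \<le> s" "s \<le> t"
    show "((\<lambda>t. M * t - X t / (1 + t)) has_real_derivative M - (X' s * (1 + s) - X s) / (1 + s)\<^sup>2) (at s within {0..})"
      using s by (auto intro!: derivative_eq_intros X[OF s(1)] simp: power2_eq_square)
    have "X' s * (1 + s) \<le> (1 / (1 + s) * X s + E s / (1 / (1 + s))) * (1 + s)"
      using s by (intro mult_right_mono X') auto
    also have "\<dots> = X s + E s * (1 + s)\<^sup>2" using s by (simp add: field_simps power2_eq_square)
    also have "\<dots> \<le> X s + M * (1 + s)\<^sup>2" by (intro add_mono mult_right_mono Eb s) auto
    finally show "0 \<le> M - (X' s * (1 + s) - X s) / (1 + s)\<^sup>2"
      using s by (simp add: divide_le_eq)
  qed
  then have "X t / (1 + t) \<le> M * (1 + t)" using X0 by (simp add: algebra_simps)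
  then show "X t \<le> (1 + t)\<^sup>2 * (exp (4 * (3 + 4 * K)) * (E 0 + X 0 + \<mu>))"
    using t by (simp add: divide_le_eq power2_eq_square M_def L_def mult_ac)
qed

text \<open>Let G be the left hand side u_tt + \<open>Dstar\<close> D u - u. As words of type
  \<open>Bop\<close> commute with the elliptic part up to swapping factors, each summand of E has
  time derivative exactly twice the product of \<open>Bop j\<close> applied to u_t and to G. The
  quantity X supplies the norm of u, which E alone does not control, and
  \<open>energy_growth\<close> closes the pair.\<close>

lemma energy_bound:
  assumes u: "smooth_hp u" "supp_cone a u" and K: "0 \<le> K" "0 \<le> \<mu>" and t: "0 \<le> t"
    and g: "\<And>t. 0 \<le> t \<Longrightarrow> Bsq n (\<lambda>x. Dt (Dt u) t x + Dstar (deriv (u t)) x - u t x)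
      \<le> K * ((1 + t)\<^sup>2 * exp (- 2 * t)) * (Bsq n (Dt u t) + Bsq (Suc n) (u t) + \<mu>)"
  shows "Bsq n (Dt u t) + Bsq (Suc n) (u t)
    \<le> 4 * exp (4 * (3 + 8 * K)) * (1 + t)\<^sup>2 * (Bsq n (Dt u 0) + 2 * Bsq (Suc n) (u 0) + \<mu>)"
proof -
  let ?B = "\<lambda>j u s. Bop j (u s)"
  have ut: "smooth_hp (Dt u)" "supp_cone a (Dt u)" using u by (auto intro: smooth_hp_intros supp_cone_Dt)
  have utt: "smooth_hp (Dt (Dt u))" "supp_cone a (Dt (Dt u))" using ut by (auto intro: smooth_hp_intros supp_cone_Dt)
  note test = smooth_section_test[OF u] smooth_section_test[OF ut] smooth_section_test[OF utt]
  define G where "G t x = Dt (Dt u) t x + Dstar (deriv (u t)) x - u t x" for t x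
  \<comment> \<open>The subtracted term belongs to the zero order term - u; by
    \<open>Bop_Hardy\<close> the last two terms of each summand still have a nonnegative
    sum.\<close>
  define E where "E t = (\<Sum>j\<le>n. wip (Bop j (Dt u t)) (Bop j (Dt u t)) + wip (Bop (Suc j) (u t)) (Bop (Suc j) (u t)) - wip (Bop j (u t)) (Bop j (u t)))" for t
  define E' where "E' t = (\<Sum>j\<le>n. 2 * wip (Bop j (Dt u t)) (Bop j (G t)))" for t
  define X where "X t = Bsq n (u t)" for t
  define X' where "X' t = (\<Sum>j\<le>n. 2 * wip (Bop j (Dt u t)) (Bop j (u t)))" for t
  have wd: "((\<lambda>s. wip (Bop j (w s)) (Bop j (w s))) has_real_derivative 2 * wip (Bop j (Dt w t)) (Bop j (w t))) (at t within {0..})"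
    if "smooth_hp w" "supp_cone a w" "0 \<le> t" for w j t
  proof -
    have B: "smooth_hp (?B j w)" "supp_cone a (?B j w)" "Dt (?B j w) t = Bop j (Dt w t)"
      using Bop_halfplane[OF that(1,2), of j] that(3) by auto
    show ?thesis using wip_DERIV_t[OF B(1,2) B(1,2) that(3)] B(3) by (simp add: wip_commute)
  qed
  have BG: "Bop j (G t) = (\<lambda>x. Bop j (Dt (Dt u) t) x + Bop j (Dstar (deriv (u t))) x - Bop j (u t) x)" if "0 \<le> t" for j t
  proof -
    have "G t = (\<lambda>x. (Dt (Dt u) t x + Dstar (deriv (u t)) x) + - 1 * u t x)" by (simp add: G_def fun_eq_iff)
    then show ?thesis
      using that by (simp only: Bop_add Bop_cmult test test_add test_cmult test_Dstar test_deriv) simp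
  qed
  have Gtest: "G t \<in> test_functions" if "0 \<le> t" for t
    unfolding G_def[abs_def] using that by (intro test_diff test_add test_Dstar test_deriv test)
  have Ed: "(E has_real_derivative E' t) (at t within {0..})" if t: "0 \<le> t" for t
  proof -
    have "(E has_real_derivative (\<Sum>j\<le>n. 2 * wip (Bop j (Dt (Dt u) t)) (Bop j (Dt u t)) + 2 * wip (Bop (Suc j) (Dt u t)) (Bop (Suc j) (u t))
        - 2 * wip (Bop j (Dt u t)) (Bop j (u t)))) (at t within {0..})"
      unfolding E_def[abs_def] by (intro DERIV_sum DERIV_diff DERIV_add wd u ut t)
    moreover have "2 * wip (Bop j (Dt (Dt u) t)) (Bop j (Dt u t)) + 2 * wip (Bop (Suc j) (Dt u t)) (Bop (Suc j) (u t))
        - 2 * wip (Bop j (Dt u t)) (Bop j (u t)) = 2 * wip (Bop j (Dt u t)) (Bop j (G t))" for j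
    proof -
      note cc = test_compact_cont[OF test_Bop]
      have "wip (Bop j (Dt u t)) (Bop j (G t)) = wip (Bop j (Dt u t)) (Bop j (Dt (Dt u) t))
          + wip (Bop j (Dt u t)) (Bop j (Dstar (deriv (u t)))) - wip (Bop j (Dt u t)) (Bop j (u t))"
        unfolding BG[OF t] using t
        by (simp only: wip_add_right wip_diff_right compact_cont_add cc test test_Dstar test_deriv)
      then show ?thesis
        using wip_Bop_Dstar_deriv[OF test(1)[OF t] test(2)[OF t], of j] wip_commute[of "Bop j (Dt u t)" "Bop j (Dt (Dt u) t)"] by simp
    qed
    ultimately show ?thesis by (simp add: E'_def)
  qed
  have Xd: "(X has_real_derivative X' t) (at t within {0..})" if t: "0 \<le> t" for t
    unfolding X_def[abs_def] X'_def Bsq_def by (intro DERIV_sum wd u t)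
  have E_ge: "Bsq n (Dt u t) \<le> E t" if t: "0 \<le> t" for t
    unfolding Bsq_def E_def using Bop_Hardy[OF test(1)[OF t]] by (intro sum_mono) (simp add: le_diff_eq del: Bop.simps)
  have Bs: "Bsq (Suc n) (u t) \<le> 2 * X t + E t" if t: "0 \<le> t" for t
  proof -
    have "Bsq (Suc n) (u t) = wip (Bop 0 (u t)) (Bop 0 (u t)) + (\<Sum>j\<le>n. wip (Bop (Suc j) (u t)) (Bop (Suc j) (u t)))"
      unfolding Bsq_def by (rule sum.atMost_Suc_shift)
    also have "wip (Bop 0 (u t)) (Bop 0 (u t)) \<le> X t"
      unfolding X_def Bsq_def by (rule member_le_sum) (auto intro: wip_nonneg)
    also have "(\<Sum>j\<le>n. wip (Bop (Suc j) (u t)) (Bop (Suc j) (u t))) = E t - Bsq n (Dt u t) + X t"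
      by (simp add: E_def Bsq_def X_def sum.distrib sum_subtractf)
    finally show ?thesis using Bsq_nonneg[of n "Dt u t"] by linarith
  qed
  have E_le: "E t \<le> Bsq n (Dt u t) + Bsq (Suc n) (u t)" if t: "0 \<le> t" for t
  proof -
    have "(\<Sum>j\<le>n. wip (Bop (Suc j) (u t)) (Bop (Suc j) (u t))) \<le> Bsq (Suc n) (u t)"
      unfolding Bsq_def sum.atMost_Suc_shift[of _ n] by (simp add: wip_nonneg)
    moreover have "(\<Sum>j\<le>n. wip (Bop (Suc j) (u t)) (Bop (Suc j) (u t))) = E t - Bsq n (Dt u t) + X t"
      by (simp add: E_def Bsq_def X_def sum.distrib sum_subtractf)
    moreover have "0 \<le> X t" unfolding X_def by (rule Bsq_nonneg)
    ultimately show ?thesis by linarith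
  qed
  have X_le: "X t \<le> Bsq (Suc n) (u t)" for t
    unfolding X_def Bsq_def by (intro sum_mono2) (auto intro: wip_nonneg)
  have "0 \<le> E t" if "0 \<le> t" for t using E_ge[OF that] Bsq_nonneg[of n "Dt u t"] by linarith
  note nn = this
  have X0: "0 \<le> X t" for t unfolding X_def by (rule Bsq_nonneg)
  have E'b: "E' t \<le> c * E t + Bsq n (G t) / c" if t: "0 \<le> t" and c: "0 < c" for t c
  proof -
    have "E' t \<le> (\<Sum>j\<le>n. c * wip (Bop j (Dt u t)) (Bop j (Dt u t)) + wip (Bop j (G t)) (Bop j (G t)) / c)"
      unfolding E'_def by (intro sum_mono wip_AMGM test_compact_cont test_Bop test t c Gtest)
    also have "\<dots> = c * Bsq n (Dt u t) + Bsq n (G t) / c"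
      by (simp add: Bsq_def sum.distrib sum_distrib_left sum_divide_distrib)
    also have "\<dots> \<le> c * E t + Bsq n (G t) / c" using E_ge[OF t] c by simp
    finally show ?thesis .
  qed
  have X'b: "X' t \<le> c * X t + E t / c" if t: "0 \<le> t" and c: "0 < c" for t c
  proof -
    have "X' t \<le> (\<Sum>j\<le>n. c * wip (Bop j (u t)) (Bop j (u t)) + wip (Bop j (Dt u t)) (Bop j (Dt u t)) / c)"
      unfolding X'_def wip_commute[of "Bop _ (Dt u t)" "Bop _ (u t)"]
      by (intro sum_mono wip_AMGM test_compact_cont test_Bop test t c)
    also have "\<dots> = c * X t + Bsq n (Dt u t) / c"
      by (simp add: X_def Bsq_def sum.distrib sum_distrib_left sum_divide_distrib)
    also have "\<dots> \<le> c * X t + E t / c" using E_ge[OF t] c by (simp add: divide_right_mono)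
    finally show ?thesis .
  qed
  \<comment> \<open>The factor 2 in \<open>Bs\<close> turns K into 2 K, hence 8 K in the exponent of
    the conclusion.\<close>
  have gb: "Bsq n (G t) \<le> (2 * K) * ((1 + t)\<^sup>2 * exp (- 2 * t)) * (E t + X t + \<mu>)" if t: "0 \<le> t" for t
  proof -
    have "Bsq n (G t) \<le> K * ((1 + t)\<^sup>2 * exp (- 2 * t)) * (Bsq n (Dt u t) + Bsq (Suc n) (u t) + \<mu>)"
      using g[OF t] by (simp add: G_def[abs_def])
    also have "\<dots> \<le> K * ((1 + t)\<^sup>2 * exp (- 2 * t)) * (2 * (E t + X t + \<mu>))"
      using E_ge[OF t] Bs[OF t] K nn[OF t] X0[of t] by (intro mult_left_mono) auto
    finally show ?thesis by (simp only: mult_ac)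
  qed
  let ?M = "exp (4 * (3 + 4 * (2 * K))) * (E 0 + X 0 + \<mu>)"
  have res: "E t \<le> ?M" "X t \<le> (1 + t)\<^sup>2 * ?M"
    using energy_growth[OF Ed Xd nn X0 _ K(2) E'b X'b gb t] K by simp_all
  have "1 \<le> (1 + t)\<^sup>2" using t by (simp add: power2_eq_square algebra_simps)
  moreover have M0: "0 \<le> ?M" using nn[of 0] X0[of 0] K by simp
  ultimately have "?M \<le> (1 + t)\<^sup>2 * ?M" using mult_right_mono[of 1 "(1 + t)\<^sup>2" ?M] by simp
  then have "Bsq n (Dt u t) + Bsq (Suc n) (u t) \<le> 4 * ((1 + t)\<^sup>2 * ?M)"
    using E_ge[OF t] Bs[OF t] res by linarith
  also have "\<dots> \<le> 4 * ((1 + t)\<^sup>2 * (exp (4 * (3 + 4 * (2 * K))) * (Bsq n (Dt u 0) + 2 * Bsq (Suc n) (u 0) + \<mu>)))"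
    using E_le[of 0] X_le[of 0] by (intro mult_left_mono) auto
  finally show ?thesis by (simp add: mult_ac)
qed

text \<open>Conjugation by e^t: the source for u = e^t v is e^t times that for v, which after
  squaring changes e^(-4t) into e^(-2t); the return to v contributes the decay e^(-2t). The number
  mu makes room for sources that v does not control, and C is fixed before v and mu.\<close>

lemma energy_decay:
  assumes K: "0 \<le> K"
  shows "\<exists>C\<ge>0. \<forall>v a \<mu>. smooth_hp v \<longrightarrow> supp_cone a v \<longrightarrow> 0 \<le> \<mu> \<longrightarrow>
    (\<forall>t\<ge>0. wsq n (\<lambda>x. Dt (Dt v) t x + 2 * Dt v t x - Dx (Dx v) t x - 2 * (tanh (2 * x) * Dx v t x))
       \<le> K * ((1 + t)\<^sup>2 * exp (- 4 * t)) * (wsq (Suc n) (v t) + wsq n (Dt v t) + \<mu>)) \<longrightarrow>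
    (\<forall>t\<ge>0. wsq (Suc n) (v t) + wsq n (Dt v t)
       \<le> C * ((1 + t)\<^sup>2 * exp (- 2 * t)) * (wsq (Suc n) (v 0) + wsq n (Dt v 0) + \<mu>))"
proof -
  obtain c1 where c1: "0 \<le> c1" "\<And>\<phi>. \<phi> \<in> test_functions \<Longrightarrow> Bsq n \<phi> \<le> c1 * wsq n \<phi>" using Bsq_le_wsq[of n] by blast
  obtain c2 where c2: "0 \<le> c2" "\<And>\<phi>. \<phi> \<in> test_functions \<Longrightarrow> Bsq (Suc n) \<phi> \<le> c2 * wsq (Suc n) \<phi>" using Bsq_le_wsq[of "Suc n"] by blast
  obtain d1 where d1: "0 \<le> d1" "\<And>\<phi>. \<phi> \<in> test_functions \<Longrightarrow> wsq n \<phi> \<le> d1 * Bsq n \<phi>" using wsq_le_Bsq[of n] by blast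
  obtain d2 where d2: "0 \<le> d2" "\<And>\<phi>. \<phi> \<in> test_functions \<Longrightarrow> wsq (Suc n) \<phi> \<le> d2 * Bsq (Suc n) \<phi>" using wsq_le_Bsq[of "Suc n"] by blast
  \<comment> \<open>Coefficient 3 d2: u is counted once for v and twice for v_t = e^(-t) (u_t - u).
    The part 2 d1 belongs to u_t, and the 1 gives D >= 1, so that D mu dominates mu.\<close>
  define D where "D = 1 + 3 * d2 + 2 * d1"
  have D: "1 \<le> D" using d1 d2 by (simp add: D_def)
  define K' where "K' = c1 * K * D"
  have K': "0 \<le> K'" using c1 K D by (simp add: K'_def)
  define Q where "Q = 4 * exp (4 * (3 + 8 * K'))"
  have Q: "0 \<le> Q" by (simp add: Q_def)
  define C where "C = D * (Q * (1 + 2 * c1 + 2 * c2))"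
  have C0: "0 \<le> C" using D Q c1 c2 by (simp add: C_def)
  have "wsq (Suc n) (v t) + wsq n (Dt v t) \<le> C * ((1 + t)\<^sup>2 * exp (- 2 * t)) * (wsq (Suc n) (v 0) + wsq n (Dt v 0) + \<mu>)"
    if v: "smooth_hp v" "supp_cone a v" and mu: "0 \<le> \<mu>" and t: "0 \<le> t" and
     h: "\<And>t. 0 \<le> t \<Longrightarrow> wsq n (\<lambda>x. Dt (Dt v) t x + 2 * Dt v t x - Dx (Dx v) t x - 2 * (tanh (2 * x) * Dx v t x))
       \<le> K * ((1 + t)\<^sup>2 * exp (- 4 * t)) * (wsq (Suc n) (v t) + wsq n (Dt v t) + \<mu>)" for v a \<mu> t
  proof -
    have vt: "smooth_hp (Dt v)" "supp_cone a (Dt v)" using v by (auto intro: smooth_hp_intros supp_cone_Dt)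
    define u where "u t x = exp t * v t x" for t x
    have ex: "smooth_hp (\<lambda>t x. exp t)" using Ck_fun_exp[of _ 1] by (intro smooth_hp_t) simp
    have u: "smooth_hp u" "supp_cone a u"
      unfolding u_def[abs_def] by (intro smooth_hp_intros ex v) (intro supp_cone_mult v)
    have Du: "Dt u t x = exp t * (v t x + Dt v t x)" if "0 \<le> t" for t x
      unfolding u_def[abs_def]
      by (rule Dt_eqI[OF _ that]) (rule derivative_eq_intros smooth_hp_Dt[OF v(1) that] refl | simp add: algebra_simps)+
    have DDu: "Dt (Dt u) t x = exp t * (v t x + 2 * Dt v t x + Dt (Dt v) t x)" if t: "0 \<le> t" for t x
    proof -
      have "Dt (Dt u) t x = Dt (\<lambda>t x. exp t * (v t x + Dt v t x)) t x" by (rule Dt_cong[OF _ t]) (rule Du)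
      also have "\<dots> = exp t * (v t x + 2 * Dt v t x + Dt (Dt v) t x)"
        by (rule Dt_eqI[OF _ t])
          (rule derivative_eq_intros smooth_hp_Dt[OF v(1) t] smooth_hp_Dt[OF vt(1) t] refl | simp add: algebra_simps)+
      finally show ?thesis .
    qed
    note tv = smooth_section_test[OF v] and tvt = smooth_section_test[OF vt] and tu = smooth_section_test[OF u]
    have tut: "Dt u t \<in> test_functions" if "0 \<le> t" for t
      using that by (intro smooth_section_test[OF smooth_hp_intros(8)[OF u(1)] supp_cone_Dt[OF u(2)]])
    let ?Lv = "\<lambda>t x. Dt (Dt v) t x + 2 * Dt v t x - Dx (Dx v) t x - 2 * (tanh (2 * x) * Dx v t x)"
    \<comment> \<open>Here the damping coefficient matters: u_tt = e^t (v_tt + 2 v_t + v), and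
      subtracting u removes the term e^t v.\<close>
    have G: "(\<lambda>x. Dt (Dt u) t x + Dstar (deriv (u t)) x - u t x) = (\<lambda>x. exp t * ?Lv t x)" if t: "0 \<le> t" for t
    proof
      fix x
      have d: "deriv (u t) = (\<lambda>x. exp t * deriv (v t) x)"
        unfolding u_def[abs_def] by (intro ext DERIV_imp_deriv DERIV_cmult test_DERIV tv t)
      have "deriv (deriv (u t)) x = exp t * deriv (deriv (v t)) x"
        unfolding d by (intro DERIV_imp_deriv DERIV_cmult test_DERIV test_deriv tv t)
      then show "Dt (Dt u) t x + Dstar (deriv (u t)) x - u t x = exp t * ?Lv t x"
        by (simp add: DDu[OF t] Dstar_def d u_def Dx_section algebra_simps)
    qed
    have Ltest: "?Lv t \<in> test_functions" if t: "0 \<le> t" for t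
      using t by (intro test_diff test_add test_cmult test_mult Ck_fun_tanh tvt)
        (simp_all add: Dx_section[abs_def] test_deriv tv smooth_section_test[OF smooth_hp_intros(8)[OF vt(1)] supp_cone_Dt[OF vt(2)]])
    have wv: "wsq m (v t) = exp (- 2 * t) * wsq m (u t)" if t: "0 \<le> t" for t m
    proof -
      have "v t = (\<lambda>x. exp (- t) * u t x)" by (simp add: u_def fun_eq_iff exp_minus)
      then show ?thesis using wsq_cmult[OF tu[OF t], of m "exp (- t)"] by (simp add: exp_double[symmetric])
    qed
    have wvt: "wsq n (Dt v t) \<le> exp (- 2 * t) * (2 * wsq n (Dt u t) + 2 * wsq n (u t))" if t: "0 \<le> t" for t
    proof -
      have "Dt v t = (\<lambda>x. exp (- t) * (Dt u t x - u t x))"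
        by (simp add: fun_eq_iff Du[OF t] u_def exp_minus field_simps)
      then have "wsq n (Dt v t) = exp (- 2 * t) * wsq n (\<lambda>x. Dt u t x - u t x)"
        using wsq_cmult[OF test_diff[OF tut tu], of t t n "exp (- t)"] t by (simp add: exp_double[symmetric])
      then show ?thesis using wsq_diff_le2[OF tut[OF t] tu[OF t], of n] by simp
    qed
    have N: "wsq (Suc n) (v t) + wsq n (Dt v t) \<le> exp (- 2 * t) * (D * (Bsq n (Dt u t) + Bsq (Suc n) (u t)))" if t: "0 \<le> t" for t
    proof -
      have "wsq (Suc n) (v t) + wsq n (Dt v t) \<le> exp (- 2 * t) * (wsq (Suc n) (u t) + (2 * wsq n (Dt u t) + 2 * wsq n (u t)))"
        using wv[OF t, of "Suc n"] wvt[OF t] by (simp add: algebra_simps)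
      also have "wsq (Suc n) (u t) + (2 * wsq n (Dt u t) + 2 * wsq n (u t)) \<le> D * (Bsq n (Dt u t) + Bsq (Suc n) (u t))"
      proof -
        have "wsq n (u t) \<le> wsq (Suc n) (u t)" by (rule wsq_mono) simp
        then have "wsq (Suc n) (u t) + (2 * wsq n (Dt u t) + 2 * wsq n (u t)) \<le> 3 * (d2 * Bsq (Suc n) (u t)) + 2 * (d1 * Bsq n (Dt u t))"
          using d2(2)[OF tu[OF t]] d1(2)[OF tut[OF t]] by linarith
        also have "\<dots> \<le> D * (Bsq n (Dt u t) + Bsq (Suc n) (u t))"
          using d1(1) d2(1) Bsq_nonneg[of n "Dt u t"] Bsq_nonneg[of "Suc n" "u t"]
          by (simp add: D_def algebra_simps)
        finally show ?thesis .
      qed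
      finally show ?thesis by simp
    qed
    have g: "Bsq n (\<lambda>x. Dt (Dt u) t x + Dstar (deriv (u t)) x - u t x)
      \<le> K' * ((1 + t)\<^sup>2 * exp (- 2 * t)) * (Bsq n (Dt u t) + Bsq (Suc n) (u t) + \<mu>)" if t: "0 \<le> t" for t
    proof -
      have B0: "0 \<le> Bsq n (Dt u t) + Bsq (Suc n) (u t)" using Bsq_nonneg by (simp add: add_nonneg_nonneg)
      have "Bsq n (\<lambda>x. exp t * ?Lv t x) \<le> c1 * ((exp t)\<^sup>2 * wsq n (?Lv t))"
        using c1(2)[OF test_cmult[OF Ltest[OF t]], of "exp t"] wsq_cmult[OF Ltest[OF t], of n "exp t"] by simp
      also have "\<dots> \<le> c1 * ((exp t)\<^sup>2 * (K * ((1 + t)\<^sup>2 * exp (- 4 * t)) * (wsq (Suc n) (v t) + wsq n (Dt v t) + \<mu>)))"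
        by (intro mult_left_mono h t c1) auto
      also have "\<dots> = c1 * (K * ((1 + t)\<^sup>2 * ((exp t)\<^sup>2 * exp (- 4 * t))) * (wsq (Suc n) (v t) + wsq n (Dt v t) + \<mu>))"
        by (simp only: mult_ac)
      also have "(exp t)\<^sup>2 * exp (- 4 * t) = exp (- 2 * t)"
        by (simp add: exp_double[symmetric] exp_add[symmetric])
      also have "c1 * (K * ((1 + t)\<^sup>2 * exp (- 2 * t)) * (wsq (Suc n) (v t) + wsq n (Dt v t) + \<mu>))
         \<le> c1 * (K * ((1 + t)\<^sup>2 * exp (- 2 * t)) * (D * (Bsq n (Dt u t) + Bsq (Suc n) (u t) + \<mu>)))"
      proof (intro mult_left_mono c1 mult_nonneg_nonneg K)
        have "wsq (Suc n) (v t) + wsq n (Dt v t) \<le> 1 * (D * (Bsq n (Dt u t) + Bsq (Suc n) (u t)))"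
          using t D B0 by (intro order_trans[OF N[OF t]] mult_right_mono) auto
        moreover have "1 * \<mu> \<le> D * \<mu>" using D mu by (intro mult_right_mono)
        ultimately show "wsq (Suc n) (v t) + wsq n (Dt v t) + \<mu> \<le> D * (Bsq n (Dt u t) + Bsq (Suc n) (u t) + \<mu>)"
          by (simp add: algebra_simps)
      qed auto
      finally show ?thesis unfolding G[OF t] by (simp add: K'_def mult_ac)
    qed
    have "Bsq n (Dt u t) + Bsq (Suc n) (u t) \<le> Q * (1 + t)\<^sup>2 * (Bsq n (Dt u 0) + 2 * Bsq (Suc n) (u 0) + \<mu>)"
      unfolding Q_def by (rule energy_bound[OF u K' mu t g])
    also have "\<dots> \<le> Q * (1 + t)\<^sup>2 * ((1 + 2 * c1 + 2 * c2) * (wsq (Suc n) (v 0) + wsq n (Dt v 0) + \<mu>))"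
    proof (intro mult_left_mono)
      have "u 0 = v 0" by (simp add: u_def fun_eq_iff)
      have "Dt u 0 = (\<lambda>x. v 0 x + Dt v 0 x)" by (simp add: fun_eq_iff Du)
      then have "wsq n (Dt u 0) \<le> 2 * wsq n (v 0) + 2 * wsq n (Dt v 0)"
        using wsq_add_le2[OF tv tvt, of 0 0 n] by simp
      moreover have "wsq n (v 0) \<le> wsq (Suc n) (v 0)" by (rule wsq_mono) simp
      ultimately have "wsq n (Dt u 0) \<le> 2 * (wsq (Suc n) (v 0) + wsq n (Dt v 0))" by simp
      then have "Bsq n (Dt u 0) \<le> c1 * (2 * (wsq (Suc n) (v 0) + wsq n (Dt v 0)))"
        using c1 by (intro order_trans[OF c1(2)[OF tut]] mult_left_mono) auto
      moreover have "Bsq (Suc n) (u 0) \<le> c2 * (wsq (Suc n) (v 0) + wsq n (Dt v 0))"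
        using c2 wsq_nonneg[of n "Dt v 0"] unfolding \<open>u 0 = v 0\<close> by (intro order_trans[OF c2(2)[OF tv]] mult_left_mono) auto
      ultimately have "Bsq n (Dt u 0) + 2 * Bsq (Suc n) (u 0) + \<mu> \<le> (2 * c1 + 2 * c2) * (wsq (Suc n) (v 0) + wsq n (Dt v 0)) + \<mu>"
        by (simp add: algebra_simps)
      also have "\<dots> \<le> (1 + 2 * c1 + 2 * c2) * (wsq (Suc n) (v 0) + wsq n (Dt v 0) + \<mu>)"
        using c1(1) c2(1) mu wsq_nonneg[of "Suc n" "v 0"] wsq_nonneg[of n "Dt v 0"]
        by (simp add: algebra_simps add_nonneg_nonneg)
      finally show "Bsq n (Dt u 0) + 2 * Bsq (Suc n) (u 0) + \<mu> \<le> (1 + 2 * c1 + 2 * c2) * (wsq (Suc n) (v 0) + wsq n (Dt v 0) + \<mu>)" .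
    qed (use Q in auto)
    finally have "wsq (Suc n) (v t) + wsq n (Dt v t) \<le> exp (- 2 * t) * (D * (Q * (1 + t)\<^sup>2 * ((1 + 2 * c1 + 2 * c2) * (wsq (Suc n) (v 0) + wsq n (Dt v 0) + \<mu>))))"
      using D by (intro order_trans[OF N[OF t]] mult_left_mono) auto
    then show ?thesis by (simp add: C_def mult_ac)
  qed
  then show ?thesis using C0 by blast
qed

section \<open>The coefficients of the equation for the perturbation\<close>

text \<open>This is sech (2x), not the square of sech.\<close>

definition sech2 :: "real \<Rightarrow> real" where "sech2 x = inverse (cosh (2 * x))"

lemma sech2_bounds: "0 < sech2 x" "sech2 x \<le> 1"
  by (auto simp: sech2_def cosh_real_ge_1 inverse_le_1_iff)

definition travel :: "(real \<Rightarrow> real) \<Rightarrow> (real \<Rightarrow> real) \<Rightarrow> real \<Rightarrow> real \<Rightarrow> real" where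
  "travel P Q t x = P (x + t) + Q (x - t)"

lemma travel_shift: "travel P Q = (\<lambda>t x. shift 1 (\<lambda>t. P) t x + shift (- 1) (\<lambda>t. Q) t x)"
  by (simp add: travel_def shift_def fun_eq_iff)

lemma Ck_halfplane_travel: "Ck_fun k P \<Longrightarrow> Ck_fun k Q \<Longrightarrow> Ck_halfplane k (travel P Q)"
  unfolding travel_shift by (intro Ck_halfplane_add Ck_halfplane_shift Ck_halfplane_x)

lemma Ck_bounded_translate: assumes f: "Ck_bounded k K f" shows "Ck_bounded k K (\<lambda>x. f (x + d))"
proof -
  have "(deriv ^^ i) (\<lambda>x. f (1 * x + d)) = (\<lambda>x. 1 ^ i * (deriv ^^ i) f (1 * x + d))" if "i \<le> k" for i
    by (rule funpow_deriv_affine[OF Ck_boundedD(1)[OF f] that])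
  then show ?thesis
    using Ck_fun_affine[OF Ck_boundedD(1)[OF f], of 1 d] f by (simp add: Ck_bounded_def)
qed

lemma Ck_bounded_travel: "Ck_bounded k K P \<Longrightarrow> Ck_bounded k L Q \<Longrightarrow> Ck_bounded k (K + L) (travel P Q t)"
  using Ck_bounded_add[OF Ck_bounded_translate[of k K P t] Ck_bounded_translate[of k L Q "- t"]]
  by (simp add: travel_def[abs_def])

text \<open>D'Alembert's formula for \<open>R - R\<^sub>b\<close> with initial position \<open>f\<close> and velocity \<open>deriv G\<close>.\<close>

definition rho where "rho f G = travel (\<lambda>x. (1/2) * (f x + G x)) (\<lambda>x. (1/2) * (f x - G x))"
definition rho_t where "rho_t f G = travel (\<lambda>x. (1/2) * (deriv f x + deriv G x)) (\<lambda>x. - (1/2) * (deriv f x - deriv G x))"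
definition rho_x where "rho_x f G = travel (\<lambda>x. (1/2) * (deriv f x + deriv G x)) (\<lambda>x. (1/2) * (deriv f x - deriv G x))"

lemma rho_DERIV:
  assumes f: "Ck_fun (Suc k) f" and G: "Ck_fun (Suc k) G"
  shows "((\<lambda>s. rho f G s x) has_real_derivative rho_t f G t x) (at t within S)"
    and "(rho f G t has_real_derivative rho_x f G t x) (at x)"
proof -
  note d = Ck_fun_DERIV[OF f] Ck_fun_DERIV[OF G]
  have t: "((\<lambda>s. h (x + s)) has_real_derivative h') (at t within S)" "((\<lambda>s. h (x - s)) has_real_derivative - h'') (at t within S)"
    if "(h has_real_derivative h') (at (x + t))" "(h has_real_derivative h'') (at (x - t))" for h h' h''
  proof -
    have "((\<lambda>s. x + s) has_real_derivative 1) (at t within S)" "((\<lambda>s. x - s) has_real_derivative - 1) (at t within S)"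
      by (rule derivative_eq_intros refl | simp)+
    from DERIV_chain2[where g = "\<lambda>s. x + s", OF that(1) this(1)] DERIV_chain2[where g = "\<lambda>s. x - s", OF that(2) this(2)]
    show "((\<lambda>s. h (x + s)) has_real_derivative h') (at t within S)" "((\<lambda>s. h (x - s)) has_real_derivative - h'') (at t within S)"
      by simp_all
  qed
  have s: "((\<lambda>x. h (x + t)) has_real_derivative h') (at x)" "((\<lambda>x. h (x - t)) has_real_derivative h'') (at x)"
    if "(h has_real_derivative h') (at (x + t))" "(h has_real_derivative h'') (at (x - t))" for h h' h''
  proof -
    have "((\<lambda>x. x + t) has_real_derivative 1) (at x)" "((\<lambda>x. x - t) has_real_derivative 1) (at x)"
      by (rule derivative_eq_intros refl | simp)+
    from DERIV_chain2[where g = "\<lambda>x. x + t", OF that(1) this(1)] DERIV_chain2[where g = "\<lambda>x. x - t", OF that(2) this(2)]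
    show "((\<lambda>x. h (x + t)) has_real_derivative h') (at x)" "((\<lambda>x. h (x - t)) has_real_derivative h'') (at x)"
      by simp_all
  qed
  show "((\<lambda>s. rho f G s x) has_real_derivative rho_t f G t x) (at t within S)"
    unfolding rho_def rho_t_def travel_def
    by (rule derivative_eq_intros t[OF d(1) d(1)] t[OF d(2) d(2)] refl | simp add: field_simps)+
  show "(rho f G t has_real_derivative rho_x f G t x) (at x)"
    unfolding rho_def rho_x_def travel_def[abs_def]
    by (rule derivative_eq_intros s[OF d(1) d(1)] s[OF d(2) d(2)] refl | simp)+
qed

lemma Ck_halfplane_rho:
  assumes f: "Ck_fun (Suc k) f" and G: "Ck_fun (Suc k) G"
  shows "Ck_halfplane (Suc k) (rho f G)" "Ck_halfplane k (rho_t f G)" "Ck_halfplane k (rho_x f G)"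
  unfolding rho_def rho_t_def rho_x_def
  by (intro Ck_halfplane_travel Ck_fun_cmult Ck_fun_add Ck_fun_diff Ck_fun_deriv f G)+

text \<open>First derivatives of rho involve G only through the velocity \<open>deriv G\<close>, so
  in contrast to rho their bounds do not grow in time.\<close>

lemma Ck_bounded_rho_derivs:
  assumes f: "Ck_bounded (Suc n) m f" and G: "Ck_bounded n m (deriv G)"
  shows "Ck_bounded n (2 * m) (rho_t f G t)" "Ck_bounded n (2 * m) (rho_x f G t)"
proof -
  have f': "Ck_bounded n m (deriv f)" using f by (simp add: Ck_bounded_Suc)
  have 1: "Ck_bounded n (\<bar>c\<bar> * (m + m)) (\<lambda>x. c * (deriv f x + deriv G x))"
    and 2: "Ck_bounded n (\<bar>c\<bar> * (m + m)) (\<lambda>x. c * (deriv f x - deriv G x))" for c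
    by (intro Ck_bounded_cmult Ck_bounded_add f' G) (intro Ck_bounded_cmult Ck_bounded_diff f' G)
  show "Ck_bounded n (2 * m) (rho_t f G t)"
    unfolding rho_t_def using Ck_bounded_travel[OF 1[of "1/2"] 2[of "- (1/2)"]] by simp
  show "Ck_bounded n (2 * m) (rho_x f G t)"
    unfolding rho_x_def using Ck_bounded_travel[OF 1[of "1/2"] 2[of "1/2"]] by simp
qed

text \<open>The mean value theorem for G on [x - t, x + t] gives the linear growth. The bounds m1
  and m2 stay separate and sharp, since the smallness condition limits their sum.\<close>

lemma rho_bound:
  assumes G: "Ck_fun (Suc k) G" and f: "\<And>x. \<bar>f x\<bar> \<le> m1" and g: "\<And>x. \<bar>deriv G x\<bar> \<le> m2" and t: "0 \<le> t"
  shows "\<bar>rho f G t x\<bar> \<le> m1 + t * m2"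
proof -
  have "norm (G (x + t) - G (x - t)) \<le> m2 * norm ((x + t) - (x - t))"
    by (rule field_differentiable_bound[of UNIV G "deriv G"]) (auto intro: Ck_fun_DERIV[OF G] g)
  then have "\<bar>G (x + t) - G (x - t)\<bar> \<le> 2 * (t * m2)" using t by (simp add: mult_ac)
  then show ?thesis using f[of "x + t"] f[of "x - t"] by (simp add: rho_def travel_def abs_le_iff field_simps)
qed

lemma Ck_bounded_rho:
  assumes f: "Ck_bounded (Suc n) m f" and G: "Ck_fun (Suc n) G" "Ck_bounded n m (deriv G)" and t: "0 \<le> t"
  shows "Ck_bounded (Suc n) (2 * (1 + t) * m) (rho f G t)"
proof (rule Ck_bounded_SucI)
  have m: "0 \<le> m" by (rule Ck_boundedD(4)[OF f])
  then have tm: "0 \<le> t * m" using t by simp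
  show "(rho f G t has_real_derivative rho_x f G t x) (at x)" for x
    by (rule rho_DERIV(2)[OF Ck_boundedD(1)[OF f] G(1)])
  show "\<bar>rho f G t x\<bar> \<le> 2 * (1 + t) * m" for x
    by (rule order_trans[OF rho_bound[OF G(1) Ck_boundedD(3)[OF f] Ck_boundedD(3)[OF G(2)] t]])
      (use m tm in \<open>simp add: algebra_simps\<close>)
  show "Ck_bounded n (2 * (1 + t) * m) (rho_x f G t)"
    by (rule Ck_bounded_mono[OF Ck_bounded_rho_derivs(2)[OF f G(2)] order_refl]) (use tm in \<open>simp add: algebra_simps\<close>)
qed

text \<open>With U = e^(-2t) c and V = e^(-2t) rho this is c / (\<open>Rb\<close> + rho), numerator
  and denominator having been divided by \<open>Rb\<close>. The denominator is then bounded below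
  uniformly, and a factor sech (2x) becomes visible.\<close>

definition quot :: "real \<Rightarrow> (real \<Rightarrow> real) \<Rightarrow> (real \<Rightarrow> real) \<Rightarrow> real \<Rightarrow> real" where
  "quot R0 U V x = (1 / R0) * (sech2 x * (U x * inverse (1 + (1 / R0) * (sech2 x * V x))))"

text \<open>Lipschitz dependence on the pair (U, V), with a constant determined by B, R0 and n.
  Choosing the second pair zero gives a bound for a single quotient.\<close>

lemma quot_diff_bound:
  assumes R0: "0 < R0" and B: "0 \<le> B"
  shows "\<exists>\<kappa>\<ge>0. \<forall>U1 U2 V1 V2 \<delta>. Ck_bounded n B U2 \<longrightarrow>
    Ck_bounded n B V1 \<longrightarrow> Ck_bounded n B V2 \<longrightarrow>
    Ck_bounded n \<delta> (\<lambda>x. U1 x - U2 x) \<longrightarrow> Ck_bounded n \<delta> (\<lambda>x. V1 x - V2 x) \<longrightarrow>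
    (\<forall>x. 1 / 3 \<le> 1 + (1 / R0) * (sech2 x * V1 x)) \<longrightarrow> (\<forall>x. 1 / 3 \<le> 1 + (1 / R0) * (sech2 x * V2 x)) \<longrightarrow>
    Ck_bounded n (\<kappa> * \<delta>) (\<lambda>x. quot R0 U1 V1 x - quot R0 U2 V2 x)"
proof -
  obtain S where S: "Ck_bounded n S sech2" using Ck_bounded_sech[of n] unfolding sech2_def[abs_def] by blast
  define c where "c = 2 ^ n * (real n + 1)"
  note mult = Ck_bounded_mult[of n, folded c_def]
  have S0: "0 \<le> S" by (rule Ck_boundedD(4)[OF S])
  have c0: "0 \<le> c" by (simp add: c_def)
  obtain Z where Z: "\<And>g. Ck_bounded n (1 + (1 / R0) * (c * S * B)) g \<Longrightarrow> (\<And>x. 1 / 3 \<le> g x) \<Longrightarrow> Ck_bounded n Z (\<lambda>x. inverse (g x))"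
    using Ck_bounded_inverse[of "1/3" n "1 + (1 / R0) * (c * S * B)"] by auto
  define \<kappa> where "\<kappa> = (1 / R0) * (c * S * (c * \<bar>Z\<bar> + c * B * ((1 / R0) * (c * (c * S) * (c * \<bar>Z\<bar> * \<bar>Z\<bar>)))))"
  have k0: "0 \<le> \<kappa>" unfolding \<kappa>_def using R0 c0 S0 B by simp
  have main: "Ck_bounded n (\<kappa> * \<delta>) (\<lambda>x. quot R0 U1 V1 x - quot R0 U2 V2 x)"
    if U2: "Ck_bounded n B U2" and V1: "Ck_bounded n B V1" and V2: "Ck_bounded n B V2"
      and dU: "Ck_bounded n \<delta> (\<lambda>x. U1 x - U2 x)" and dV: "Ck_bounded n \<delta> (\<lambda>x. V1 x - V2 x)"
      and l1: "\<And>x. 1 / 3 \<le> 1 + (1 / R0) * (sech2 x * V1 x)" and l2: "\<And>x. 1 / 3 \<le> 1 + (1 / R0) * (sech2 x * V2 x)"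
    for U1 U2 V1 V2 \<delta>
  proof -
    let ?g = "\<lambda>V x. 1 + (1 / R0) * (sech2 x * V x)"
    let ?z = "\<lambda>V x. inverse (?g V x)"
    have z: "Ck_bounded n \<bar>Z\<bar> (?z V)" if V: "Ck_bounded n B V" "\<And>x. 1 / 3 \<le> ?g V x" for V
    proof -
      have "Ck_bounded n (1 + \<bar>1 / R0\<bar> * (c * S * B)) (?g V)"
        by (intro Ck_bounded_add Ck_bounded_cmult mult S V Ck_bounded_const) simp
      then have "Ck_bounded n Z (?z V)" using R0 by (intro Z V(2)) simp
      then show ?thesis by (rule Ck_bounded_mono) auto
    qed
    note z1 = z[OF V1 l1] and z2 = z[OF V2 l2]
    have "Ck_bounded n (\<bar>1 / R0\<bar> * (c * S * (c * \<delta> * \<bar>Z\<bar> + c * B * (\<bar>- (1 / R0)\<bar> * (c * (c * S * \<delta>) * (c * \<bar>Z\<bar> * \<bar>Z\<bar>))))))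
      (\<lambda>x. (1 / R0) * (sech2 x * ((U1 x - U2 x) * ?z V1 x + U2 x * (- (1 / R0) * (sech2 x * (V1 x - V2 x) * (?z V1 x * ?z V2 x))))))"
      by (intro Ck_bounded_cmult mult Ck_bounded_add S U2 dU dV z1 z2)
    moreover have "\<bar>1 / R0\<bar> * (c * S * (c * \<delta> * \<bar>Z\<bar> + c * B * (\<bar>- (1 / R0)\<bar> * (c * (c * S * \<delta>) * (c * \<bar>Z\<bar> * \<bar>Z\<bar>))))) = \<kappa> * \<delta>"
      using R0 by (simp add: \<kappa>_def algebra_simps)
    \<comment> \<open>Every summand is to contain U1 - U2 or V1 - V2; the reciprocals are subtracted
      through 1/a - 1/b = (b - a) / (a b).\<close>
    moreover have "(1 / R0) * (sech2 x * ((U1 x - U2 x) * ?z V1 x + U2 x * (- (1 / R0) * (sech2 x * (V1 x - V2 x) * (?z V1 x * ?z V2 x)))))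
        = quot R0 U1 V1 x - quot R0 U2 V2 x" for x
    proof -
      have "0 < ?g V1 x" by (rule order.strict_trans2[OF _ l1]) simp
      moreover have "0 < ?g V2 x" by (rule order.strict_trans2[OF _ l2]) simp
      ultimately have nz: "?g V1 x \<noteq> 0" "?g V2 x \<noteq> 0" by linarith+
      have "?z V1 x - ?z V2 x = ?z V1 x * (?g V2 x - ?g V1 x) * ?z V2 x"
        using nz by (simp add: divide_simps inverse_eq_divide)
      also have "\<dots> = - (1 / R0) * (sech2 x * (V1 x - V2 x) * (?z V1 x * ?z V2 x))" by (simp add: algebra_simps)
      finally have e: "?z V1 x - ?z V2 x = - (1 / R0) * (sech2 x * (V1 x - V2 x) * (?z V1 x * ?z V2 x))" .
      show ?thesis unfolding e[symmetric] quot_def by (simp only: algebra_simps)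
    qed
    ultimately show ?thesis by simp
  qed
  show ?thesis using k0 main by blast
qed

text \<open>For \<open>R = R\<^sub>b + rho\<close> one has \<open>R\<^sub>t / R = 2 + acoef\<close> and \<open>R\<^sub>x / R = 2 tanh (2x) + bcoef\<close>.\<close>

definition acoef where
  "acoef R0 f G t = quot R0 (\<lambda>x. exp (- 2 * t) * (rho_t f G t x - 2 * rho f G t x)) (\<lambda>x. exp (- 2 * t) * rho f G t x)"
definition bcoef where
  "bcoef R0 f G t = quot R0 (\<lambda>x. exp (- 2 * t) * (rho_x f G t x - 2 * (tanh (2 * x) * rho f G t x))) (\<lambda>x. exp (- 2 * t) * rho f G t x)"

text \<open>The index n counts derivatives of the velocity; the position has one more. The last
  clause is the smallness assumption as a non-strict bound that approximating data can share. The
  primitive G is bounded only through its derivative.\<close>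

definition admissible :: "real \<Rightarrow> nat \<Rightarrow> real \<Rightarrow> (real \<Rightarrow> real) \<Rightarrow> (real \<Rightarrow> real) \<Rightarrow> bool" where
  "admissible R0 n B f G \<longleftrightarrow> Ck_bounded (Suc n) B f \<and> Ck_fun (Suc n) G \<and> Ck_bounded n B (deriv G) \<and>
    (\<exists>m1 m2. m1 + m2 \<le> 2 * R0 / 3 \<and> (\<forall>x. \<bar>f x\<bar> \<le> m1) \<and> (\<forall>x. \<bar>deriv G x\<bar> \<le> m2))"

lemma one_plus_le_exp2: "0 \<le> t \<Longrightarrow> (1 + t) * exp (- 2 * t) \<le> (1::real)"
proof -
  assume t: "0 \<le> t"
  have "1 + t \<le> 1 + 2 * t" using t by simp
  also have "\<dots> \<le> exp (2 * t)" by (rule exp_ge_add_one_self)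
  finally show ?thesis by (simp add: exp_minus divide_simps)
qed

text \<open>Here the smallness assumption acts: rho is at most (1 + t) 2 R0 / 3 in absolute value
  and (1 + t) e^(-2t) <= 1, so the correction relative to \<open>Rb\<close> is never below -
  2/3.\<close>

lemma admissible_lower:
  assumes a: "admissible R0 n B f G" and R0: "0 < R0" and t: "0 \<le> t"
  shows "1 / 3 \<le> 1 + (1 / R0) * (sech2 x * (exp (- 2 * t) * rho f G t x))"
proof -
  obtain m1 m2 where m: "m1 + m2 \<le> 2 * R0 / 3" "\<And>x. \<bar>f x\<bar> \<le> m1" "\<And>x. \<bar>deriv G x\<bar> \<le> m2" and G: "Ck_fun (Suc n) G"
    using a unfolding admissible_def by blast
  have p: "0 \<le> m1" "0 \<le> m2" using m(2,3) abs_ge_zero order_trans by blast+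
  have "\<bar>rho f G t x\<bar> \<le> m1 + t * m2" by (rule rho_bound[OF G m(2,3) t])
  also have "\<dots> \<le> (1 + t) * (m1 + m2)" using p t by (simp add: algebra_simps)
  also have "\<dots> \<le> (1 + t) * (2 * R0 / 3)" using t m by (intro mult_left_mono) auto
  finally have r: "\<bar>rho f G t x\<bar> \<le> (1 + t) * (2 * R0 / 3)" .
  have "\<bar>sech2 x * (exp (- 2 * t) * rho f G t x)\<bar> = sech2 x * (exp (- 2 * t) * \<bar>rho f G t x\<bar>)"
    using sech2_bounds(1)[of x] by (simp add: abs_mult)
  also have "\<dots> \<le> 1 * (exp (- 2 * t) * ((1 + t) * (2 * R0 / 3)))"
    using sech2_bounds[of x] r by (intro mult_mono) auto
  also have "\<dots> = ((1 + t) * exp (- 2 * t)) * (2 * R0 / 3)" by simp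
  also have "\<dots> \<le> 1 * (2 * R0 / 3)" using R0 by (intro mult_right_mono one_plus_le_exp2 t) auto
  finally have "- (2 * R0 / 3) \<le> sech2 x * (exp (- 2 * t) * rho f G t x)" unfolding abs_le_iff by linarith
  then have "(1 / R0) * (- (2 * R0 / 3)) \<le> (1 / R0) * (sech2 x * (exp (- 2 * t) * rho f G t x))"
    using R0 by (intro mult_left_mono) auto
  moreover have "(1 / R0) * (- (2 * R0 / 3)) = - 2 / 3" using R0 by simp
  ultimately show ?thesis by linarith
qed

definition Rsol where "Rsol R0 f G t x = Rb R0 t x + rho f G t x"

lemma Rsol_factor:
  assumes R0: "0 < R0"
  shows "Rsol R0 f G t x = Rb R0 t x * (1 + (1 / R0) * (sech2 x * (exp (- 2 * t) * rho f G t x)))"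
proof -
  have "Rb R0 t x * ((1 / R0) * (sech2 x * (exp (- 2 * t) * rho f G t x))) = rho f G t x"
    using R0 by (simp add: Rb_def sech2_def exp_minus field_simps)
  then show ?thesis by (simp add: Rsol_def distrib_left)
qed

lemma Rb_pos: "0 < R0 \<Longrightarrow> 0 < Rb R0 t x"
  by (simp add: Rb_def)

lemma Rsol_quotient:
  assumes a: "admissible R0 n B f G" and R0: "0 < R0" and t: "0 \<le> t"
  shows "Rsol R0 f G t x \<noteq> 0"
    and "(2 * Rb R0 t x + rho_t f G t x) / Rsol R0 f G t x = 2 + acoef R0 f G t x"
    and "(2 * (tanh (2 * x) * Rb R0 t x) + rho_x f G t x) / Rsol R0 f G t x = 2 * tanh (2 * x) + bcoef R0 f G t x"
proof -
  let ?q = "1 + (1 / R0) * (sech2 x * (exp (- 2 * t) * rho f G t x))"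
  have q: "0 < ?q" by (rule order.strict_trans2[OF _ admissible_lower[OF a R0 t]]) simp
  note F = Rsol_factor[OF R0, of f G t x]
  have Rp: "0 < Rsol R0 f G t x" unfolding F using q Rb_pos[OF R0, of t x] by (intro mult_pos_pos)
  then show "Rsol R0 f G t x \<noteq> 0" by simp
  have inv: "(1 / R0) * (sech2 x * (exp (- 2 * t) * c * inverse ?q)) = c / Rsol R0 f G t x" for c
    unfolding F using R0 q by (simp add: Rb_def sech2_def exp_minus divide_inverse mult_ac)
  have "2 * Rb R0 t x + rho_t f G t x = 2 * Rsol R0 f G t x + (rho_t f G t x - 2 * rho f G t x)"
    by (simp add: Rsol_def)
  then show "(2 * Rb R0 t x + rho_t f G t x) / Rsol R0 f G t x = 2 + acoef R0 f G t x"
    using Rp unfolding acoef_def quot_def inv by (simp only: add_divide_distrib) simp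
  have "2 * (tanh (2 * x) * Rb R0 t x) + rho_x f G t x = 2 * tanh (2 * x) * Rsol R0 f G t x + (rho_x f G t x - 2 * (tanh (2 * x) * rho f G t x))"
    by (simp add: Rsol_def algebra_simps)
  then show "(2 * (tanh (2 * x) * Rb R0 t x) + rho_x f G t x) / Rsol R0 f G t x = 2 * tanh (2 * x) + bcoef R0 f G t x"
    using Rp unfolding bcoef_def quot_def inv by (simp only: add_divide_distrib) simp
qed

lemma rho_diff:
  assumes "Ck_fun (Suc k) f1" "Ck_fun (Suc k) f2" "Ck_fun (Suc k) G1" "Ck_fun (Suc k) G2"
  shows "rho f1 G1 t x - rho f2 G2 t x = rho (\<lambda>x. f1 x - f2 x) (\<lambda>x. G1 x - G2 x) t x"
    and "rho_t f1 G1 t x - rho_t f2 G2 t x = rho_t (\<lambda>x. f1 x - f2 x) (\<lambda>x. G1 x - G2 x) t x"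
    and "rho_x f1 G1 t x - rho_x f2 G2 t x = rho_x (\<lambda>x. f1 x - f2 x) (\<lambda>x. G1 x - G2 x) t x"
proof -
  have "deriv (\<lambda>x. f1 x - f2 x) = (\<lambda>x. deriv f1 x - deriv f2 x)" "deriv (\<lambda>x. G1 x - G2 x) = (\<lambda>x. deriv G1 x - deriv G2 x)"
    by (intro ext DERIV_imp_deriv DERIV_diff Ck_fun_DERIV[OF assms(1)] Ck_fun_DERIV[OF assms(2)]
        Ck_fun_DERIV[OF assms(3)] Ck_fun_DERIV[OF assms(4)])+
  then show "rho f1 G1 t x - rho f2 G2 t x = rho (\<lambda>x. f1 x - f2 x) (\<lambda>x. G1 x - G2 x) t x"
    and "rho_t f1 G1 t x - rho_t f2 G2 t x = rho_t (\<lambda>x. f1 x - f2 x) (\<lambda>x. G1 x - G2 x) t x"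
    and "rho_x f1 G1 t x - rho_x f2 G2 t x = rho_x (\<lambda>x. f1 x - f2 x) (\<lambda>x. G1 x - G2 x) t x"
    by (simp_all add: rho_def rho_t_def rho_x_def travel_def field_simps)
qed

text \<open>The decisive gain: \<open>R\<^sub>b\<close> grows like \<open>e\<^sup>2\<^sup>t\<close> while \<open>R - R\<^sub>b\<close> grows at most linearly.\<close>

lemma coef_diff_bound:
  assumes R0: "0 < R0" and B: "0 \<le> B"
  shows "\<exists>\<kappa>\<ge>0. \<forall>f1 G1 f2 G2 \<delta> t. admissible R0 n B f1 G1 \<longrightarrow> admissible R0 n B f2 G2 \<longrightarrow>
    Ck_bounded (Suc n) \<delta> (\<lambda>x. f1 x - f2 x) \<longrightarrow> Ck_bounded n \<delta> (deriv (\<lambda>x. G1 x - G2 x)) \<longrightarrow> 0 \<le> t \<longrightarrow>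
    Ck_bounded n (\<kappa> * ((1 + t) * exp (- 2 * t)) * \<delta>) (\<lambda>x. acoef R0 f1 G1 t x - acoef R0 f2 G2 t x) \<and>
    Ck_bounded n (\<kappa> * ((1 + t) * exp (- 2 * t)) * \<delta>) (\<lambda>x. bcoef R0 f1 G1 t x - bcoef R0 f2 G2 t x)"
proof -
  obtain T where T: "Ck_bounded n T (\<lambda>x. tanh (2 * x))" using Ck_bounded_tanh by blast
  define c where "c = 2 ^ n * (real n + 1)"
  note mult = Ck_bounded_mult[of n, folded c_def]
  have T0: "0 \<le> T" by (rule Ck_boundedD(4)[OF T])
  have c0: "0 \<le> c" by (simp add: c_def)
  \<comment> \<open>The number 6 = 2 + 4 comes from rho_t - 2 rho, and 4 c T from the product of
    tanh (2x) with 2 rho.\<close>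
  define L where "L = 6 + 4 * (c * T)"
  have L6: "6 \<le> L" using T0 c0 by (simp add: L_def)
  obtain \<kappa> where k: "0 \<le> \<kappa>" "\<And>U1 U2 V1 V2 \<delta>. Ck_bounded n (L * B) U2 \<Longrightarrow>
    Ck_bounded n (L * B) V1 \<Longrightarrow> Ck_bounded n (L * B) V2 \<Longrightarrow>
    Ck_bounded n \<delta> (\<lambda>x. U1 x - U2 x) \<Longrightarrow> Ck_bounded n \<delta> (\<lambda>x. V1 x - V2 x) \<Longrightarrow>
    (\<And>x. 1 / 3 \<le> 1 + (1 / R0) * (sech2 x * V1 x)) \<Longrightarrow> (\<And>x. 1 / 3 \<le> 1 + (1 / R0) * (sech2 x * V2 x)) \<Longrightarrow>
    Ck_bounded n (\<kappa> * \<delta>) (\<lambda>x. quot R0 U1 V1 x - quot R0 U2 V2 x)"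
    using quot_diff_bound[OF R0, of "L * B" n] B L6 by auto
  let ?V = "\<lambda>f G t x. exp (- 2 * t) * rho f G t x"
  let ?Ua = "\<lambda>f G t x. exp (- 2 * t) * (rho_t f G t x - 2 * rho f G t x)"
  let ?Ub = "\<lambda>f G t x. exp (- 2 * t) * (rho_x f G t x - 2 * (tanh (2 * x) * rho f G t x))"
  have b: "Ck_bounded n (L * m * ((1 + t) * exp (- 2 * t))) (?V f G t)"
    "Ck_bounded n (L * m * ((1 + t) * exp (- 2 * t))) (?Ua f G t)"
    "Ck_bounded n (L * m * ((1 + t) * exp (- 2 * t))) (?Ub f G t)"
    if f: "Ck_bounded (Suc n) m f" and G: "Ck_fun (Suc n) G" "Ck_bounded n m (deriv G)" and t: "0 \<le> t" for f G m t
  proof -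
    have m: "0 \<le> m" by (rule Ck_boundedD(4)[OF f])
    have r: "Ck_bounded n (2 * (1 + t) * m) (rho f G t)"
      by (rule Ck_bounded_mono[OF Ck_bounded_rho[OF f G t]]) auto
    have rt: "Ck_bounded n (2 * (1 + t) * m) (rho_t f G t)" "Ck_bounded n (2 * (1 + t) * m) (rho_x f G t)"
      by (rule Ck_bounded_mono[OF Ck_bounded_rho_derivs(1)[OF f G(2)] order_refl] Ck_bounded_mono[OF Ck_bounded_rho_derivs(2)[OF f G(2)] order_refl],
          use m t in \<open>simp add: algebra_simps\<close>)+
    have tm: "0 \<le> (1 + t) * m" using t m by simp
    have "Ck_bounded n (\<bar>exp (- 2 * t)\<bar> * (2 * (1 + t) * m)) (?V f G t)"
      by (intro Ck_bounded_cmult r)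
    then show "Ck_bounded n (L * m * ((1 + t) * exp (- 2 * t))) (?V f G t)"
    proof (rule Ck_bounded_mono[OF _ order_refl])
      have "2 * ((1 + t) * m * exp (- 2 * t)) \<le> L * ((1 + t) * m * exp (- 2 * t))"
        using L6 tm by (intro mult_right_mono) auto
      then show "\<bar>exp (- 2 * t)\<bar> * (2 * (1 + t) * m) \<le> L * m * ((1 + t) * exp (- 2 * t))" by (simp add: algebra_simps)
    qed
    have "Ck_bounded n (\<bar>exp (- 2 * t)\<bar> * (2 * (1 + t) * m + \<bar>2\<bar> * (2 * (1 + t) * m))) (?Ua f G t)"
      by (intro Ck_bounded_cmult Ck_bounded_diff r rt)
    then show "Ck_bounded n (L * m * ((1 + t) * exp (- 2 * t))) (?Ua f G t)"
    proof (rule Ck_bounded_mono[OF _ order_refl])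
      have "6 * ((1 + t) * m * exp (- 2 * t)) \<le> L * ((1 + t) * m * exp (- 2 * t))"
        using L6 tm by (intro mult_right_mono) auto
      then show "\<bar>exp (- 2 * t)\<bar> * (2 * (1 + t) * m + \<bar>2\<bar> * (2 * (1 + t) * m)) \<le> L * m * ((1 + t) * exp (- 2 * t))"
        by (simp add: algebra_simps)
    qed
    have "Ck_bounded n (\<bar>exp (- 2 * t)\<bar> * (2 * (1 + t) * m + \<bar>2\<bar> * (c * T * (2 * (1 + t) * m)))) (?Ub f G t)"
      by (intro Ck_bounded_cmult Ck_bounded_diff mult T r rt)
    then show "Ck_bounded n (L * m * ((1 + t) * exp (- 2 * t))) (?Ub f G t)"
    proof (rule Ck_bounded_mono[OF _ order_refl])
      have "(2 + 4 * (c * T)) * ((1 + t) * m * exp (- 2 * t)) \<le> L * ((1 + t) * m * exp (- 2 * t))"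
        using tm by (intro mult_right_mono) (auto simp: L_def)
      then show "\<bar>exp (- 2 * t)\<bar> * (2 * (1 + t) * m + \<bar>2\<bar> * (c * T * (2 * (1 + t) * m))) \<le> L * m * ((1 + t) * exp (- 2 * t))"
        by (simp add: algebra_simps)
    qed
  qed
  \<comment> \<open>Since (1 + t) e^(-2t) <= 1, the Lipschitz constant of \<open>quot\<close> can be
    taken independent of t; the decay is kept in the differences.\<close>
  have bB: "Ck_bounded n (L * B) (?V f G t)" "Ck_bounded n (L * B) (?Ua f G t)" "Ck_bounded n (L * B) (?Ub f G t)"
    if a: "admissible R0 n B f G" and t: "0 \<le> t" for f G t
  proof -
    have "L * B * ((1 + t) * exp (- 2 * t)) \<le> L * B * 1"
      using B L6 by (intro mult_left_mono one_plus_le_exp2 t) auto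
    then show "Ck_bounded n (L * B) (?V f G t)" "Ck_bounded n (L * B) (?Ua f G t)" "Ck_bounded n (L * B) (?Ub f G t)"
      using b[of B f G t] a t Ck_bounded_mono[OF _ order_refl] by (auto simp: admissible_def)
  qed
  have "Ck_bounded n ((\<kappa> * L) * ((1 + t) * exp (- 2 * t)) * \<delta>) (\<lambda>x. acoef R0 f1 G1 t x - acoef R0 f2 G2 t x) \<and>
    Ck_bounded n ((\<kappa> * L) * ((1 + t) * exp (- 2 * t)) * \<delta>) (\<lambda>x. bcoef R0 f1 G1 t x - bcoef R0 f2 G2 t x)"
    if a: "admissible R0 n B f1 G1" "admissible R0 n B f2 G2" and df: "Ck_bounded (Suc n) \<delta> (\<lambda>x. f1 x - f2 x)"
      and dG: "Ck_bounded n \<delta> (deriv (\<lambda>x. G1 x - G2 x))" and t: "0 \<le> t" for f1 G1 f2 G2 \<delta> t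
  proof -
    have Ck: "Ck_fun (Suc n) f1" "Ck_fun (Suc n) f2" "Ck_fun (Suc n) G1" "Ck_fun (Suc n) G2"
      using a by (auto simp: admissible_def dest: Ck_boundedD(1))
    note d = b[OF df Ck_fun_diff[OF Ck(3,4)] dG t]
    note rd = rho_diff[OF Ck, symmetric]
    let ?\<delta> = "L * \<delta> * ((1 + t) * exp (- 2 * t))"
    have V: "Ck_bounded n ?\<delta> (\<lambda>x. ?V f1 G1 t x - ?V f2 G2 t x)"
      using d(1) unfolding rd by (simp add: algebra_simps)
    have Ua: "Ck_bounded n ?\<delta> (\<lambda>x. ?Ua f1 G1 t x - ?Ua f2 G2 t x)"
      using d(2) unfolding rd by (simp add: algebra_simps)
    have Ub: "Ck_bounded n ?\<delta> (\<lambda>x. ?Ub f1 G1 t x - ?Ub f2 G2 t x)"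
      using d(3) unfolding rd by (simp add: algebra_simps)
    note lo = admissible_lower[OF a(1) R0 t] admissible_lower[OF a(2) R0 t]
    show ?thesis
      using k(2)[OF bB(2)[OF a(2) t] bB(1)[OF a(1) t] bB(1)[OF a(2) t] Ua V lo]
        k(2)[OF bB(3)[OF a(2) t] bB(1)[OF a(1) t] bB(1)[OF a(2) t] Ub V lo]
      by (simp add: acoef_def bcoef_def mult_ac)
  qed
  moreover have "0 \<le> \<kappa> * L" using k(1) L6 by simp
  ultimately show ?thesis by blast
qed

section \<open>Density of test functions\<close>

text \<open>The standard flat function e^(-1/x) together with its multiples by powers of 1/x. The
  family is closed under differentiation up to linear combinations, so smoothness at 0 is one
  induction.\<close>

definition flat :: "nat \<Rightarrow> real \<Rightarrow> real" where
  "flat m x = (if 0 < x then (1 / x) ^ m * exp (- (1 / x)) else 0)"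

lemma flat_tendsto: "((\<lambda>x. (1 / x) ^ m * exp (- (1 / x))) \<longlongrightarrow> 0) (at_right (0::real))"
proof -
  have "((\<lambda>y::real. y ^ m * exp (- y)) \<longlongrightarrow> 0) at_top"
    using tendsto_power_div_exp_0[of m] by (simp add: exp_minus divide_inverse)
  from filterlim_compose[OF this filterlim_inverse_at_top_right] show ?thesis
    by (simp add: inverse_eq_divide)
qed

lemma flat_DERIV: "(flat m has_real_derivative flat (m + 2) x - real m * flat (m + 1) x) (at x)"
proof (cases x "0 :: real" rule: linorder_cases)
  case less
  have "((\<lambda>x. 0) has_real_derivative 0) (at x)" by simp
  then have "(flat m has_real_derivative 0) (at x)"
    by (rule has_field_derivative_transform_within_open[of _ _ _ "{..<0}"]) (use less in \<open>auto simp: flat_def\<close>)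
  then show ?thesis using less by (simp add: flat_def)
next
  case greater
  have 1: "((\<lambda>x. (1 / x) ^ m * exp (- (1 / x))) has_real_derivative
      real m * (1 / x) ^ (m - 1) * (- 1 / x\<^sup>2) * exp (- (1 / x)) + (1 / x) ^ m * (exp (- (1 / x)) * (1 / x\<^sup>2))) (at x)"
    by (rule derivative_eq_intros refl | use greater in \<open>simp add: power2_eq_square\<close>)+
  have 2: "real m * (1 / x) ^ (m - 1) * (- 1 / x\<^sup>2) = - (real m * (1 / x) ^ (m + 1))"
    by (cases m) (auto simp: power2_eq_square)
  have "((\<lambda>x. (1 / x) ^ m * exp (- (1 / x))) has_real_derivative flat (m + 2) x - real m * flat (m + 1) x) (at x)"
    using greater 1 unfolding 2 by (simp add: flat_def power2_eq_square algebra_simps)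
  then show ?thesis
    by (rule has_field_derivative_transform_within_open[of _ _ _ "{0<..}"]) (use greater in \<open>auto simp: flat_def\<close>)
next
  case equal
  \<comment> \<open>The difference quotient at 0 is the member with exponent m + 1: zero on the left
    and tending to 0 on the right.\<close>
  have "((\<lambda>y. flat m y / y) \<longlongrightarrow> 0) (at 0)"
  proof (rule filterlim_split_at_real)
    have "eventually (\<lambda>y. 0 = flat m y / y) (at_left 0)"
      by (auto simp: flat_def eventually_at_filter)
    then show "((\<lambda>y. flat m y / y) \<longlongrightarrow> 0) (at_left 0)"
      by (rule Lim_transform_eventually[OF tendsto_const])
    have "eventually (\<lambda>y. (1 / y) ^ (m + 1) * exp (- (1 / y)) = flat m y / y) (at_right 0)"
      by (auto simp: flat_def eventually_at_filter)
    then show "((\<lambda>y. flat m y / y) \<longlongrightarrow> 0) (at_right 0)"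
      by (rule Lim_transform_eventually[OF flat_tendsto])
  qed
  then show ?thesis unfolding equal has_field_derivative_iff by (simp add: flat_def)
qed

lemma Ck_fun_flat: "Ck_fun k (flat m)"
proof (induction k arbitrary: m)
  case 0
  show ?case unfolding Ck_fun_0
    by (intro continuous_at_imp_continuous_on ballI DERIV_isCont[OF flat_DERIV])
next
  case (Suc k)
  show ?case
    by (rule Ck_fun_SucI[OF flat_DERIV]) (intro Ck_fun_diff Ck_fun_cmult Suc)
qed

section \<open>Cutoff functions\<close>

definition smooth_step :: "real \<Rightarrow> real" where
  "smooth_step x = flat 0 x * inverse (flat 0 x + flat 0 (1 - x))"

lemma flat_0_pos: "0 < x \<Longrightarrow> 0 < flat 0 x" "x \<le> 0 \<Longrightarrow> flat 0 x = 0" "0 \<le> flat 0 x"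
  by (auto simp: flat_def)

lemma Ck_fun_smooth_step: "Ck_fun k smooth_step"
proof -
  have "0 < flat 0 x + flat 0 (1 - x)" for x
    using flat_0_pos[of x] flat_0_pos[of "1 - x"] by (cases "0 < x") auto
  then have nz: "flat 0 x + flat 0 (1 - x) \<noteq> 0" for x by (simp add: less_imp_neq[symmetric])
  have "Ck_fun k (\<lambda>x. flat 0 (- 1 * x + 1))" by (rule Ck_fun_affine[OF Ck_fun_flat])
  then show ?thesis
    unfolding smooth_step_def[abs_def] by (intro Ck_fun_mult Ck_fun_inverse Ck_fun_add Ck_fun_flat nz) simp
qed

lemma smooth_step_values: "x \<le> 0 \<Longrightarrow> smooth_step x = 0" "1 \<le> x \<Longrightarrow> smooth_step x = 1"
  using flat_0_pos(1)[of x] flat_0_pos(2)[of "1 - x"] by (auto simp: smooth_step_def flat_0_pos(2))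

definition cutoff :: "real \<Rightarrow> real" where "cutoff x = smooth_step (2 - x) * smooth_step (2 + x)"

lemma Ck_fun_cutoff: "Ck_fun k cutoff"
proof -
  have "Ck_fun k (\<lambda>x. smooth_step (- 1 * x + 2) * smooth_step (1 * x + 2))"
    by (intro Ck_fun_mult Ck_fun_affine Ck_fun_smooth_step)
  then show ?thesis by (simp add: cutoff_def[abs_def] add.commute)
qed

lemma cutoff_values: "\<bar>x\<bar> \<le> 1 \<Longrightarrow> cutoff x = 1" "2 \<le> \<bar>x\<bar> \<Longrightarrow> cutoff x = 0"
  by (auto simp: cutoff_def smooth_step_values abs_if split: if_splits)

lemma test_cutoff: "cutoff \<in> test_functions"
  using Ck_fun_cutoff cutoff_values(2) by (auto simp: test_functions_def intro!: exI[of _ 2])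

lemma Ck_bounded_of_pointwise:
  assumes f: "Ck_fun k f" and b: "\<And>i. i \<le> k \<Longrightarrow> \<exists>K. \<forall>x. \<bar>(deriv ^^ i) f x\<bar> \<le> K"
  shows "\<exists>K. Ck_bounded k K f"
proof -
  have "\<forall>i. \<exists>K. i \<le> k \<longrightarrow> (\<forall>x. \<bar>(deriv ^^ i) f x\<bar> \<le> K)" using b by blast
  then obtain K where K: "\<And>i x. i \<le> k \<Longrightarrow> \<bar>(deriv ^^ i) f x\<bar> \<le> K i" by metis
  have "\<bar>(deriv ^^ i) f x\<bar> \<le> (\<Sum>i\<le>k. \<bar>K i\<bar>)" if "i \<le> k" for i x
  proof -
    have "\<bar>K i\<bar> \<le> (\<Sum>i\<le>k. \<bar>K i\<bar>)" using that by (intro member_le_sum) auto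
    then show ?thesis using K[OF that, of x] by linarith
  qed
  then show ?thesis using f by (auto simp: Ck_bounded_def)
qed

lemma compact_cont_bounded:
  assumes "compact_cont f" shows "\<exists>K. \<forall>x. \<bar>f x\<bar> \<le> (K::real)"
proof -
  obtain a where a: "\<And>x. a < \<bar>x\<bar> \<Longrightarrow> f x = 0" using assms by (auto simp: compact_cont_def)
  have "bounded (f ` {-a..a})"
    by (intro compact_imp_bounded compact_continuous_image continuous_on_subset[OF compact_cont_continuous[OF assms]]) auto
  then obtain K where K: "\<And>x. x \<in> {-a..a} \<Longrightarrow> \<bar>f x\<bar> \<le> K" unfolding bounded_real by blast
  have "\<bar>f x\<bar> \<le> max 0 K" for x
  proof (cases "x \<in> {-a..a}")
    case True
    then show ?thesis using K[OF True] by simp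
  next
    case False
    then have "a < \<bar>x\<bar>" by auto
    then show ?thesis using a by simp
  qed
  then show ?thesis by blast
qed

lemma test_Ck_bounded: "\<phi> \<in> test_functions \<Longrightarrow> \<exists>K. Ck_bounded k K \<phi>"
  by (rule Ck_bounded_of_pointwise)
    (auto intro: test_functionsD compact_cont_bounded[OF test_compact_cont[OF test_funpow_deriv]])

section \<open>Approximation by test functions\<close>

lemma continuous_antiderivative:
  fixes g :: "real \<Rightarrow> real"
  assumes "continuous_on UNIV g"
  shows "\<exists>G. G 0 = c \<and> (\<forall>x. (G has_real_derivative g x) (at x))"
proof -
  have "((\<lambda>u. c + (LBINT y=0..u. g y)) has_real_derivative g x) (at x)" for x
  proof -
    let ?b = "\<bar>x\<bar> + 1"
    have "((\<lambda>u. LBINT y=0..u. g y) has_vector_derivative g x) (at x within {-?b..?b})"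
      using interval_integral_FTC2[of "- ?b" 0 ?b g x] continuous_on_subset[OF assms]
      by (simp add: zero_ereal_def)
    then have "((\<lambda>u. LBINT y=0..u. g y) has_real_derivative g x) (at x)"
    proof -
      have "at x within {-?b..?b} = at x" by (rule at_within_interior) auto
      then show ?thesis using \<open>(_ has_vector_derivative g x) _\<close> by (simp only: has_real_derivative_iff_has_vector_derivative)
    qed
    then show ?thesis by (auto intro!: derivative_eq_intros)
  qed
  note d = this
  define G where "G u = c + (LBINT y=0..u. g y)" for u :: real
  have "G 0 = c" by (simp add: G_def zero_ereal_def[symmetric])
  moreover have "(G has_real_derivative g x) (at x)" for x using d by (simp add: G_def[abs_def])
  ultimately show ?thesis by blast
qed

text \<open>Weierstrass approximation of the highest derivative, followed by k integrations from 0
  with the initial values of f. An integration over [-A, A] costs a factor A, hence the tolerance e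
  / A.\<close>

lemma smooth_approximation_on_interval:
  "Ck_fun k f \<Longrightarrow> 0 < A \<Longrightarrow> 0 < e \<Longrightarrow>
    \<exists>p. (\<forall>j. Ck_fun j p) \<and> (\<forall>i\<le>k. \<forall>x. \<bar>x\<bar> \<le> A \<longrightarrow> \<bar>(deriv ^^ i) (\<lambda>x. p x - f x) x\<bar> \<le> e)"
proof (induction k arbitrary: f e)
  case 0
  have "continuous_on {-A..A} f" using 0 by (auto simp: Ck_fun_0 intro: continuous_on_subset)
  then obtain p where p: "real_polynomial_function p" "\<And>x. x \<in> {-A..A} \<Longrightarrow> \<bar>f x - p x\<bar> < e"
    using Stone_Weierstrass_real_polynomial_function[of "{-A..A}" f e] 0 by auto
  have "Ck_fun j p" for j
  proof -
    obtain a n where pe: "p = (\<lambda>x. \<Sum>i\<le>n. a i * x ^ i)" using p(1) real_polynomial_function_iff_sum by blast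
    have "Ck_fun j (\<lambda>x. x ^ i)" for i
      by (induction i) (auto intro: Ck_fun_const Ck_fun_mult Ck_fun_ident)
    then have "Ck_fun j (\<lambda>x. \<Sum>i\<le>m. a i * x ^ i)" for m
      by (induction m) (auto simp del: power_Suc intro!: Ck_fun_add Ck_fun_cmult Ck_fun_const)
    then show ?thesis by (simp add: pe)
  qed
  moreover have "\<bar>p x - f x\<bar> \<le> e" if "\<bar>x\<bar> \<le> A" for x
    using p(2)[of x] that by (auto simp: abs_minus_commute abs_le_iff)
  ultimately show ?case by (intro exI[of _ p]) auto
next
  case (Suc k)
  define e' where "e' = min e (e / A)"
  have e': "0 < e'" "e' \<le> e" "A * e' \<le> e" using Suc.prems by (auto simp: e'_def min_def field_simps)
  obtain q where q: "\<And>j. Ck_fun j q" "\<And>i x. i \<le> k \<Longrightarrow> \<bar>x\<bar> \<le> A \<Longrightarrow> \<bar>(deriv ^^ i) (\<lambda>x. q x - deriv f x) x\<bar> \<le> e'"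
    using Suc.IH[OF Ck_fun_deriv[OF Suc.prems(1)] Suc.prems(2) e'(1)] by blast
  obtain p where p: "p 0 = f 0" "\<And>x. (p has_real_derivative q x) (at x)"
    using continuous_antiderivative[OF Ck_fun_continuous[OF q(1)[of 0]], of "f 0"] by blast
  have psm: "Ck_fun j p" for j
    using Ck_fun_SucI[OF p(2) q(1)] Ck_fun_Suc_mono by blast
  have d: "((\<lambda>x. p x - f x) has_real_derivative q x - deriv f x) (at x)" for x
    by (intro DERIV_diff p Ck_fun_DERIV[OF Suc.prems(1)])
  then have D: "deriv (\<lambda>x. p x - f x) = (\<lambda>x. q x - deriv f x)" by (intro ext DERIV_imp_deriv)
  have "\<bar>(deriv ^^ i) (\<lambda>x. p x - f x) x\<bar> \<le> e" if i: "i \<le> Suc k" and x: "\<bar>x\<bar> \<le> A" for i x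
  proof (cases i)
    case 0
    have "norm ((p x - f x) - (p 0 - f 0)) \<le> e' * norm (x - 0)"
      by (rule field_differentiable_bound[of "{-A..A}" "\<lambda>x. p x - f x" "\<lambda>x. q x - deriv f x"])
        (use q(2)[of 0] x Suc.prems(2) in \<open>auto intro: has_field_derivative_at_within d simp: abs_le_iff\<close>)
    also have "\<dots> \<le> e' * A" using e'(1) x by (intro mult_left_mono) auto
    finally show ?thesis using 0 p(1) e'(3) by (simp add: mult.commute)
  next
    case (Suc j)
    then show ?thesis using q(2)[of j x] i x e'(2) unfolding Suc deriv_funpow_Suc D by simp
  qed
  then show ?case using psm by blast
qed

text \<open>The error is split as chi (p - f) + (chi - 1) f with the cutoff chi at scale N. In the
  first term chi vanishes beyond 2 N while p is close to f up to 3 N; in the second chi - 1 vanishes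
  inside N while f is small outside. The margin between 2 N and 3 N places every point of the first
  case split well inside a region where one factor is under control with all derivatives.\<close>

lemma C0_space_test_approximation:
  assumes f: "f \<in> C0_space k" and e: "0 < e"
  shows "\<exists>\<phi>\<in>test_functions. Ck_bounded k e (\<lambda>x. \<phi> x - f x)"
proof -
  have fk: "Ck_fun k f" and fl: "\<And>i. i \<le> k \<Longrightarrow> ((deriv ^^ i) f \<longlongrightarrow> 0) at_infinity"
    using f by (auto simp: C0_space_def)
  obtain K0 where K0: "Ck_bounded k K0 cutoff" using test_Ck_bounded[OF test_cutoff] by blast
  define K where "K = K0 + 1"
  have K1: "0 < K" using Ck_boundedD(4)[OF K0] by (simp add: K_def)
  \<comment> \<open>The Leibniz constant with k + 1 summands; each of the two products then costs c
    d = e / 2.\<close>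
  define c where "c = 2 ^ k * K * (real k + 1)"
  have c: "0 < c" using K1 by (simp add: c_def)
  define d where "d = e / (2 * c)"
  have d: "0 < d" using e c by (simp add: d_def)
  have "\<exists>b. \<forall>i\<le>k. \<forall>x. b \<le> \<bar>x\<bar> \<longrightarrow> \<bar>(deriv ^^ i) f x\<bar> \<le> d"
  proof -
    have "\<forall>\<^sub>F x in at_infinity. \<forall>i\<in>{..k}. \<bar>(deriv ^^ i) f x\<bar> < d"
    proof (intro eventually_ball_finite ballI)
      fix i assume "i \<in> {..k}"
      then show "\<forall>\<^sub>F x in at_infinity. \<bar>(deriv ^^ i) f x\<bar> < d"
        using tendstoD[OF fl d, of i] by (simp add: dist_real_def)
    qed simp
    then obtain b where "\<And>x. b \<le> norm x \<Longrightarrow> \<forall>i\<in>{..k}. \<bar>(deriv ^^ i) f x\<bar> < d"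
      unfolding eventually_at_infinity by blast
    then show ?thesis by (intro exI[of _ b]) (auto intro: less_imp_le)
  qed
  then obtain b where b: "\<And>i x. i \<le> k \<Longrightarrow> b \<le> \<bar>x\<bar> \<Longrightarrow> \<bar>(deriv ^^ i) f x\<bar> \<le> d" by blast
  define N where "N = max 1 b"
  have N: "1 \<le> N" "b \<le> N" by (auto simp: N_def)
  define \<eta> where "\<eta> x = cutoff (x / N)" for x
  have chi_eq: "\<eta> = (\<lambda>x. cutoff ((1 / N) * x + 0))" by (simp add: \<eta>_def fun_eq_iff)
  have chi_sm: "Ck_fun j \<eta>" for j unfolding chi_eq by (intro Ck_fun_affine Ck_fun_cutoff)
  have chi_b: "Ck_bounded k K0 \<eta>"
    unfolding Ck_bounded_def
  proof (intro conjI allI impI chi_sm)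
    fix i x assume i: "i \<le> k"
    have "(deriv ^^ i) \<eta> x = (1 / N) ^ i * (deriv ^^ i) cutoff ((1 / N) * x + 0)"
      unfolding chi_eq by (subst funpow_deriv_affine[OF Ck_fun_cutoff order_refl]) simp
    moreover have "\<bar>(1 / N) ^ i\<bar> \<le> 1" using N by (simp add: power_le_one)
    ultimately show "\<bar>(deriv ^^ i) \<eta> x\<bar> \<le> K0"
      using mult_mono[of "\<bar>(1 / N) ^ i\<bar>" 1 _ K0, OF _ Ck_boundedD(2)[OF K0 i]] by (simp add: abs_mult)
  qed
  have chi_test: "\<eta> \<in> test_functions"
    unfolding test_functions_def using chi_sm cutoff_values(2) N
    by (auto simp: \<eta>_def intro!: exI[of _ "2 * N"] cutoff_values(2) simp: field_simps)
  have chi1: "Ck_bounded k K (\<lambda>x. \<eta> x - 1)"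
    unfolding K_def by (intro Ck_bounded_diff chi_b Ck_bounded_const) simp
  obtain p where p: "\<And>j. Ck_fun j p" "\<And>i x. i \<le> k \<Longrightarrow> \<bar>x\<bar> \<le> 3 * N \<Longrightarrow> \<bar>(deriv ^^ i) (\<lambda>x. p x - f x) x\<bar> \<le> d"
    using smooth_approximation_on_interval[OF fk, of "3 * N" d] N d by auto
  let ?\<phi> = "\<lambda>x. p x * \<eta> x"
  have test: "?\<phi> \<in> test_functions" by (rule test_mult[OF p(1) chi_test])
  have eq: "(\<lambda>x. ?\<phi> x - f x) = (\<lambda>x. \<eta> x * (p x - f x) + (\<eta> x - 1) * f x)" by (simp add: fun_eq_iff algebra_simps)
  have pf: "Ck_fun k (\<lambda>x. p x - f x)" by (intro Ck_fun_diff p fk)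
  have prod: "\<bar>(deriv ^^ i) (\<lambda>x. u x * w x) x\<bar> \<le> e / 2"
    if i: "i \<le> k" and u: "Ck_bounded k K u" and w: "Ck_fun k w" and cs: "(\<forall>l\<le>k. \<bar>(deriv ^^ l) w x\<bar> \<le> d) \<or> (\<forall>l\<le>k. (deriv ^^ l) u x = 0)" for i u w x
    using cs
  proof
    assume wd: "\<forall>l\<le>k. \<bar>(deriv ^^ l) w x\<bar> \<le> d"
    have "\<bar>(deriv ^^ i) (\<lambda>x. u x * w x) x\<bar> \<le> 2 ^ k * K * (\<Sum>l\<le>k. \<bar>(deriv ^^ l) w x\<bar>)"
      by (rule funpow_deriv_mult_Ck_bounded[OF u w i])
    also have "\<dots> \<le> 2 ^ k * K * (\<Sum>l\<le>k. d)" using wd K1 by (intro mult_left_mono sum_mono) auto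
    also have "\<dots> = e / 2" using c by (simp add: d_def c_def field_simps)
    finally show ?thesis .
  next
    assume u0: "\<forall>l\<le>k. (deriv ^^ l) u x = 0"
    have "\<bar>(deriv ^^ i) (\<lambda>x. u x * w x) x\<bar> \<le> 2 ^ i * 0 * (\<Sum>l\<le>i. \<bar>(deriv ^^ l) w x\<bar>)"
      using i u0 by (intro funpow_deriv_mult_bound Ck_fun_mono[OF Ck_boundedD(1)[OF u]] Ck_fun_mono[OF w]) auto
    then show ?thesis using e by simp
  qed
  have flat0: "(deriv ^^ l) u x = 0" if "open S" "x \<in> S" "\<And>y. y \<in> S \<Longrightarrow> u y = 0" for l u x S
    using that(3,2)
  proof (induction l arbitrary: u x)
    case (Suc l)
    have "deriv u y = 0" if y: "y \<in> S" for y
      by (rule DERIV_imp_deriv, rule has_field_derivative_transform_within_open[OF DERIV_const \<open>open S\<close> y])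
        (use Suc.prems in auto)
    then show ?case unfolding deriv_funpow_Suc using Suc by blast
  qed auto
  have "\<bar>(deriv ^^ i) (\<lambda>x. ?\<phi> x - f x) x\<bar> \<le> e" if i: "i \<le> k" for i x
  proof -
    have "(deriv ^^ i) (\<lambda>x. ?\<phi> x - f x) x = (deriv ^^ i) (\<lambda>x. \<eta> x * (p x - f x)) x + (deriv ^^ i) (\<lambda>x. (\<eta> x - 1) * f x) x"
      unfolding eq by (subst funpow_deriv_add[OF _ _ i]) (auto intro!: Ck_fun_mult chi_sm pf fk Ck_fun_diff Ck_fun_const)
    moreover have "\<bar>(deriv ^^ i) (\<lambda>x. \<eta> x * (p x - f x)) x\<bar> \<le> e / 2"
    proof (rule prod[OF i Ck_bounded_mono[OF chi_b] pf])
      show "(\<forall>l\<le>k. \<bar>(deriv ^^ l) (\<lambda>x. p x - f x) x\<bar> \<le> d) \<or> (\<forall>l\<le>k. (deriv ^^ l) \<eta> x = 0)"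
      proof (cases "\<bar>x\<bar> \<le> 3 * N")
        case False
        have "open {y. 2 * N < \<bar>y\<bar>}" by (intro open_Collect_less continuous_intros)
        then have "(deriv ^^ l) \<eta> x = 0" for l
          by (rule flat0) (use False N in \<open>auto simp: \<eta>_def field_simps intro!: cutoff_values(2)\<close>)
        then show ?thesis by blast
      qed (use p(2) in blast)
    qed (auto simp: K_def)
    moreover have "\<bar>(deriv ^^ i) (\<lambda>x. (\<eta> x - 1) * f x) x\<bar> \<le> e / 2"
    proof (rule prod[OF i chi1 fk])
      show "(\<forall>l\<le>k. \<bar>(deriv ^^ l) f x\<bar> \<le> d) \<or> (\<forall>l\<le>k. (deriv ^^ l) (\<lambda>x. \<eta> x - 1) x = 0)"
      proof (cases "N \<le> \<bar>x\<bar>")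
        case False
        have "open {y. \<bar>y\<bar> < N}" by (intro open_Collect_less continuous_intros)
        then have "(deriv ^^ l) (\<lambda>x. \<eta> x - 1) x = 0" for l
          by (rule flat0) (use False N in \<open>auto simp: \<eta>_def field_simps intro!: cutoff_values(1)\<close>)
        then show ?thesis by blast
      qed (use b N in \<open>auto intro: order_trans\<close>)
    qed
    ultimately show ?thesis by linarith
  qed
  then have "Ck_bounded k e (\<lambda>x. ?\<phi> x - f x)"
    unfolding Ck_bounded_def using test_functionsD[OF test] fk by (auto intro: Ck_fun_diff)
  then show ?thesis by (rule bexI[OF _ test])
qed

text \<open>Boundedness of the derivatives is inherited from a nearby test function; it makes the
  suprema in \<open>Ck_norm\<close> genuine upper bounds.\<close>

lemma C0_space_Ck_bounded:
  assumes f: "f \<in> C0_space k"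
  shows "Ck_bounded k (Ck_norm k f) f" and "\<bar>f x\<bar> \<le> Ck_norm 0 f" and "0 \<le> Ck_norm k f"
proof -
  have fk: "Ck_fun k f" using f by (auto simp: C0_space_def)
  obtain \<phi> where \<phi>: "\<phi> \<in> test_functions" "Ck_bounded k 1 (\<lambda>x. \<phi> x - f x)"
    using C0_space_test_approximation[OF f zero_less_one] by blast
  obtain K where K: "Ck_bounded k K \<phi>" using test_Ck_bounded[OF \<phi>(1)] by blast
  have "Ck_bounded k (K + 1) (\<lambda>x. \<phi> x - (\<phi> x - f x))" by (rule Ck_bounded_diff[OF K \<phi>(2)])
  then have b: "\<bar>(deriv ^^ i) f x\<bar> \<le> K + 1" if "i \<le> k" for i x using that by (simp add: Ck_bounded_def)
  have bdd: "bdd_above (range (\<lambda>x. \<bar>(deriv ^^ i) f x\<bar>))" if "i \<le> k" for i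
    using b[OF that] by (auto intro!: bdd_aboveI)
  have up: "\<bar>(deriv ^^ i) f x\<bar> \<le> (SUP x. \<bar>(deriv ^^ i) f x\<bar>)" if "i \<le> k" for i x
    by (rule cSUP_upper[OF _ bdd[OF that]]) simp
  then have nn: "0 \<le> (SUP x. \<bar>(deriv ^^ i) f x\<bar>)" if "i \<le> k" for i
    using that abs_ge_zero order_trans by blast
  have "\<bar>(deriv ^^ i) f x\<bar> \<le> Ck_norm k f" if i: "i \<le> k" for i x
  proof -
    have "(SUP x. \<bar>(deriv ^^ i) f x\<bar>) \<le> Ck_norm k f"
      unfolding Ck_norm_def using i nn by (intro member_le_sum) auto
    then show ?thesis using up[OF i, of x] by linarith
  qed
  then show "Ck_bounded k (Ck_norm k f) f" using fk by (simp add: Ck_bounded_def)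
  then show "0 \<le> Ck_norm k f" by (rule Ck_boundedD(4))
  show "\<bar>f x\<bar> \<le> Ck_norm 0 f" using up[of 0 x] by (simp add: Ck_norm_def)
qed

section \<open>The perturbation \<open>W - W\<^sub>b\<close>\<close>

text \<open>The two terms with x derivatives together are \<open>Dstar\<close> applied to the x
  derivative of v.\<close>

definition damped_wave :: "(real \<Rightarrow> real \<Rightarrow> real) \<Rightarrow> real \<Rightarrow> real \<Rightarrow> real" where
  "damped_wave v t x = Dt (Dt v) t x + 2 * Dt v t x - Dx (Dx v) t x - 2 * (tanh (2 * x) * Dx v t x)"

definition perturbation_eq where
  "perturbation_eq R0 W0 f G v \<longleftrightarrow> (\<forall>t\<ge>0. \<forall>x. damped_wave v t x =
     - (acoef R0 f G t x * Dt v t x) + bcoef R0 f G t x * Dx v t x + W0 * (bcoef R0 f G t x * sech2 x))"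

text \<open>The velocity \<open>deriv G\<close> vanishes for large arguments, while its primitive G
  may approach different constants at the two ends.\<close>

definition smooth_data :: "(real \<Rightarrow> real) \<Rightarrow> (real \<Rightarrow> real) \<Rightarrow> real \<Rightarrow> bool" where
  "smooth_data f G a \<longleftrightarrow> (\<forall>k. Ck_fun k f) \<and> (\<forall>k. Ck_fun k G) \<and> (\<forall>x. a < \<bar>x\<bar> \<longrightarrow> f x = 0 \<and> deriv G x = 0)"

lemma Ck_fun_sech2: "Ck_fun k sech2"
  unfolding sech2_def[abs_def] by (rule Ck_fun_sech)

lemma Ck_halfplane_coefs:
  assumes a: "admissible R0 n B f G" and R0: "0 < R0" and f: "Ck_fun (Suc k) f" and G: "Ck_fun (Suc k) G"
  shows "Ck_halfplane k (acoef R0 f G)" "Ck_halfplane k (bcoef R0 f G)"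
proof -
  note r = Ck_halfplane_Suc_mono[OF Ck_halfplane_rho(1)[OF f G]] Ck_halfplane_rho(2,3)[OF f G]
  have q: "Ck_halfplane k (\<lambda>t x. inverse (1 + (1 / R0) * (sech2 x * (exp (- 2 * t) * rho f G t x))))"
  proof (rule Ck_halfplane_inverse)
    show "Ck_halfplane k (\<lambda>t x. 1 + (1 / R0) * (sech2 x * (exp (- 2 * t) * rho f G t x)))"
      by (intro Ck_halfplane_add Ck_halfplane_mult Ck_halfplane_const Ck_halfplane_x[OF Ck_fun_sech2] Ck_halfplane_t[OF Ck_fun_exp] r)
    show "1 + (1 / R0) * (sech2 x * (exp (- 2 * t) * rho f G t x)) \<noteq> 0" if "0 \<le> t" for t x
      by (rule less_imp_neq[symmetric], rule order.strict_trans2[OF _ admissible_lower[OF a R0 that]]) simp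
  qed
  show "Ck_halfplane k (acoef R0 f G)" "Ck_halfplane k (bcoef R0 f G)"
    unfolding acoef_def[abs_def] bcoef_def[abs_def] quot_def
    by (intro Ck_halfplane_diff Ck_halfplane_mult Ck_halfplane_const Ck_halfplane_x[OF Ck_fun_sech2] Ck_halfplane_x[OF Ck_fun_tanh]
        Ck_halfplane_t[OF Ck_fun_exp] r q)+
qed

lemma smooth_hp_coefs:
  assumes a: "admissible R0 n B f G" and R0: "0 < R0" and d: "smooth_data f G c"
  shows "smooth_hp (acoef R0 f G)" "smooth_hp (bcoef R0 f G)"
  using Ck_halfplane_coefs[OF a R0] d by (auto simp: smooth_hp_def smooth_data_def simp del: Ck_halfplane.simps)

text \<open>Outside the cone the interval [x - t, x + t] misses the support of the velocity, so G is
  constant on it and d'Alembert's formula gives zero.\<close>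

lemma supp_cone_rho:
  assumes d: "smooth_data f G a"
  shows "supp_cone a (rho f G)" "supp_cone a (rho_x f G)"
proof -
  have f: "Ck_fun (Suc 0) f" and G: "Ck_fun (Suc 0) G" using d by (auto simp: smooth_data_def)
  show r: "supp_cone a (rho f G)"
    unfolding supp_cone_def
  proof (intro allI impI)
    fix t x assume t: "0 \<le> t" and x: "a + t < \<bar>x\<bar>"
    have "norm (G (x + t) - G (x - t)) \<le> 0 * norm ((x + t) - (x - t))"
    proof (rule field_differentiable_bound[of "{x - t..x + t}" G "deriv G"])
      show "(G has_real_derivative deriv G z) (at z within {x - t..x + t})" for z
        by (rule has_field_derivative_at_within[OF Ck_fun_DERIV[OF G]])
      show "norm (deriv G z) \<le> 0" if "z \<in> {x - t..x + t}" for z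
      proof -
        have "a < \<bar>z\<bar>" using that x by auto
        then show ?thesis using d by (simp add: smooth_data_def)
      qed
    qed (use t in auto)
    moreover have "f (x + t) = 0" "f (x - t) = 0"
      using d t x by (auto simp: smooth_data_def)
    ultimately show "rho f G t x = 0" by (simp add: rho_def travel_def)
  qed
  have "Dx (rho f G) t x = rho_x f G t x" for t x by (rule Dx_eqI) (rule rho_DERIV(2)[OF f G])
  then have "Dx (rho f G) = rho_x f G" by (simp add: fun_eq_iff)
  then show "supp_cone a (rho_x f G)" using supp_cone_Dx[OF r] by simp
qed

lemma supp_cone_bcoef: "smooth_data f G a \<Longrightarrow> supp_cone a (bcoef R0 f G)"
  using supp_cone_rho[of f G a] by (auto simp: supp_cone_def bcoef_def quot_def)

lemma perturbation_smooth_solution: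
  assumes R0: "0 < R0" and ad: "admissible R0 n B f G" and d: "smooth_data f G a"
    and p: "\<And>k. Ck_fun k \<phi>" "\<And>x. a < \<bar>x\<bar> \<Longrightarrow> \<phi> x = 0"
    and q: "\<And>k. Ck_fun k \<psi>" "\<And>x. a < \<bar>x\<bar> \<Longrightarrow> \<psi> x = 0"
  obtains v where "smooth_hp v" "supp_cone a v" "perturbation_eq R0 W0 f G v" "v 0 = \<phi>" "Dt v 0 = \<psi>"
proof -
  note s = smooth_hp_coefs[OF ad R0 d]
  have F: "supp_cone a (\<lambda>t x. W0 * (bcoef R0 f G t x * sech2 x))"
    using supp_cone_bcoef[OF d] by (auto simp: supp_cone_def)
  obtain v where v: "smooth_hp v" "supp_cone a v" "v 0 = \<phi>" "\<And>x. Dt v 0 x = \<psi> x"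
    "\<And>t x. 0 \<le> t \<Longrightarrow> Dt (Dt v) t x - Dx (Dx v) t x = - (2 + acoef R0 f G t x) * Dt v t x
       + (2 * tanh (2 * x) + bcoef R0 f G t x) * Dx v t x + W0 * (bcoef R0 f G t x * sech2 x)"
  proof (rule wave_equation_smooth_solution[of "\<lambda>t x. - (2 + acoef R0 f G t x)" "\<lambda>t x. 2 * tanh (2 * x) + bcoef R0 f G t x" _ a \<phi> \<psi>, OF _ _ _ F p(1) q(1) p(2) q(2)])
    show "smooth_hp (\<lambda>t x. - (2 + acoef R0 f G t x))" by (intro smooth_hp_intros s)
    show "smooth_hp (\<lambda>t x. 2 * tanh (2 * x) + bcoef R0 f G t x)" by (intro smooth_hp_intros smooth_hp_x Ck_fun_tanh s)
    show "smooth_hp (\<lambda>t x. W0 * (bcoef R0 f G t x * sech2 x))" by (intro smooth_hp_intros smooth_hp_x Ck_fun_sech2 s)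
    fix u assume "smooth_hp u" "supp_cone a u" "u 0 = \<phi>" "\<And>x. Dt u 0 x = \<psi> x"
      "\<And>t x. 0 \<le> t \<Longrightarrow> Dt (Dt u) t x - Dx (Dx u) t x = - (2 + acoef R0 f G t x) * Dt u t x
       + (2 * tanh (2 * x) + bcoef R0 f G t x) * Dx u t x + W0 * (bcoef R0 f G t x * sech2 x)"
    then show thesis by (rule that)
  qed
  have "perturbation_eq R0 W0 f G v"
    unfolding perturbation_eq_def damped_wave_def
  proof (intro allI impI)
    fix t x :: real assume "0 \<le> t"
    from v(5)[OF this, of x]
    show "Dt (Dt v) t x + 2 * Dt v t x - Dx (Dx v) t x - 2 * (tanh (2 * x) * Dx v t x) =
      - (acoef R0 f G t x * Dt v t x) + bcoef R0 f G t x * Dx v t x + W0 * (bcoef R0 f G t x * sech2 x)"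
      by (simp add: algebra_simps)
  qed
  then show ?thesis using v by (intro that[of v]) auto
qed

definition smooth_perturbation where
  "smooth_perturbation R0 W0 n B a f G v \<longleftrightarrow> admissible R0 n B f G \<and> smooth_data f G a \<and>
    smooth_hp v \<and> supp_cone a v \<and> perturbation_eq R0 W0 f G v"

lemma zero_coefs: "acoef R0 (\<lambda>x. 0) (\<lambda>x. 0) t x = 0" "bcoef R0 (\<lambda>x. 0) (\<lambda>x. 0) t x = 0"
  by (simp_all add: acoef_def bcoef_def quot_def rho_def rho_t_def rho_x_def travel_def)

lemma admissible_zero: "0 < R0 \<Longrightarrow> 0 \<le> B \<Longrightarrow> admissible R0 n B (\<lambda>x. 0) (\<lambda>x. 0)"
  by (auto simp: admissible_def intro!: Ck_bounded_const Ck_fun_const exI[of _ 0])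

lemma Dt_zero: "0 \<le> t \<Longrightarrow> Dt (\<lambda>t x. 0) t x = 0"
  by (rule Dt_eqI) auto

lemma Dx_zero: "Dx (\<lambda>t x. 0) t x = 0"
  by (simp add: Dx_def)

text \<open>Serves as the comparison partner that turns difference estimates into estimates for one
  solution.\<close>

lemma smooth_perturbation_zero:
  assumes "0 < R0" "0 \<le> B"
  shows "smooth_perturbation R0 W0 n B a (\<lambda>x. 0) (\<lambda>x. 0) (\<lambda>t x. 0)"
proof -
  have "Dt (Dt (\<lambda>t x. 0)) t x = 0" if t: "0 \<le> t" for t x
    using Dt_cong[of "Dt (\<lambda>t x. 0)" x "\<lambda>t x. 0" t] Dt_zero t by simp
  moreover have "Dx (Dx (\<lambda>t x. 0)) t x = 0" for t x
  proof -
    have "Dx (\<lambda>t x. 0) = (\<lambda>t x. 0)" by (simp add: fun_eq_iff Dx_zero)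
    then show ?thesis by (simp add: Dx_zero)
  qed
  ultimately show ?thesis
    using assms by (auto simp: smooth_perturbation_def admissible_zero smooth_data_def Ck_fun_const
        smooth_hp_intros supp_cone_def perturbation_eq_def damped_wave_def Dt_zero Dx_zero zero_coefs)
qed

section \<open>Differences of solutions with smooth data\<close>

lemma damped_wave_diff:
  assumes "smooth_hp v1" "smooth_hp v2" "0 \<le> t"
  shows "damped_wave (\<lambda>t x. v1 t x - v2 t x) t x = damped_wave v1 t x - damped_wave v2 t x"
    and "Dt (\<lambda>t x. v1 t x - v2 t x) t x = Dt v1 t x - Dt v2 t x"
    and "Dx (\<lambda>t x. v1 t x - v2 t x) t x = Dx v1 t x - Dx v2 t x"
proof -
  note s = smooth_hpD[OF assms(1)] smooth_hpD[OF assms(2)] smooth_hpD[OF smooth_hp_intros(8)[OF assms(1)]]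
    smooth_hpD[OF smooth_hp_intros(8)[OF assms(2)]] smooth_hpD[OF smooth_hp_intros(7)[OF assms(1)]] smooth_hpD[OF smooth_hp_intros(7)[OF assms(2)]]
  have Dt: "Dt (\<lambda>t x. v1 t x - v2 t x) t x = Dt v1 t x - Dt v2 t x"
    and Dx: "Dx (\<lambda>t x. v1 t x - v2 t x) t x = Dx v1 t x - Dx v2 t x" if "0 \<le> t" for t x
    by (rule Dt_diff[OF s(1,2) that] Dx_diff[OF s(1,2) that])+
  have DDt: "Dt (Dt (\<lambda>t x. v1 t x - v2 t x)) t x = Dt (Dt v1) t x - Dt (Dt v2) t x"
  proof -
    have "Dt (Dt (\<lambda>t x. v1 t x - v2 t x)) t x = Dt (\<lambda>t x. Dt v1 t x - Dt v2 t x) t x"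
      by (rule Dt_cong[OF _ assms(3)]) (rule Dt)
    then show ?thesis using Dt_diff[OF s(3,4) assms(3)] by simp
  qed
  have "Dx (\<lambda>t x. v1 t x - v2 t x) t = (\<lambda>x. Dx v1 t x - Dx v2 t x)" using Dx[OF assms(3)] by auto
  then have DDx: "Dx (Dx (\<lambda>t x. v1 t x - v2 t x)) t x = Dx (Dx v1) t x - Dx (Dx v2) t x"
    using Dx_diff[OF s(5,6) assms(3)] by (simp add: Dx_section)
  show "Dt (\<lambda>t x. v1 t x - v2 t x) t x = Dt v1 t x - Dt v2 t x" "Dx (\<lambda>t x. v1 t x - v2 t x) t x = Dx v1 t x - Dx v2 t x"
    by (rule Dt[OF assms(3)] Dx[OF assms(3)])+
  show "damped_wave (\<lambda>t x. v1 t x - v2 t x) t x = damped_wave v1 t x - damped_wave v2 t x"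
    unfolding damped_wave_def DDt DDx Dt[OF assms(3)] Dx[OF assms(3)] by (simp add: algebra_simps)
qed

text \<open>A sum of squared norms, despite its name.\<close>

definition energy_norm :: "nat \<Rightarrow> (real \<Rightarrow> real) \<Rightarrow> (real \<Rightarrow> real) \<Rightarrow> real" where
  "energy_norm n \<phi> \<psi> = wsq (Suc n) \<phi> + wsq n \<psi>"

lemma energy_norm_nonneg: "0 \<le> energy_norm n \<phi> \<psi>"
  unfolding energy_norm_def by (intro add_nonneg_nonneg wsq_nonneg)

lemma supp_cone_mono: "supp_cone a u \<Longrightarrow> a \<le> b \<Longrightarrow> supp_cone b u"
  by (auto simp: supp_cone_def)

text \<open>The source term of the perturbation equation is of the same type as the coefficient
  differences, so this single estimate (with \<open>v2 = 0\<close>) also yields the decay of one solution.\<close>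

lemma perturbation_difference_estimate:
  assumes R0: "0 < R0" and B: "0 \<le> B" and M: "0 \<le> M"
  shows "\<exists>C\<ge>0. \<forall>f1 G1 a1 v1 f2 G2 a2 v2 \<delta>. smooth_perturbation R0 W0 n B a1 f1 G1 v1 \<longrightarrow>
     smooth_perturbation R0 W0 n B a2 f2 G2 v2 \<longrightarrow>
     Ck_bounded (Suc n) \<delta> (\<lambda>x. f1 x - f2 x) \<longrightarrow> Ck_bounded n \<delta> (deriv (\<lambda>x. G1 x - G2 x)) \<longrightarrow>
     (\<forall>t\<ge>0. energy_norm n (v2 t) (Dt v2 t) \<le> M) \<longrightarrow>
     (\<forall>t\<ge>0. energy_norm n (\<lambda>x. v1 t x - v2 t x) (\<lambda>x. Dt v1 t x - Dt v2 t x)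
        \<le> C * ((1 + t)\<^sup>2 * exp (- 2 * t)) * (energy_norm n (\<lambda>x. v1 0 x - v2 0 x) (\<lambda>x. Dt v1 0 x - Dt v2 0 x) + \<delta>\<^sup>2))"
proof -
  obtain \<kappa> where k0: "0 \<le> \<kappa>" and kap: "\<And>f1 G1 f2 G2 \<delta> t. admissible R0 n B f1 G1 \<Longrightarrow> admissible R0 n B f2 G2 \<Longrightarrow>
    Ck_bounded (Suc n) \<delta> (\<lambda>x. f1 x - f2 x) \<Longrightarrow> Ck_bounded n \<delta> (deriv (\<lambda>x. G1 x - G2 x)) \<Longrightarrow> 0 \<le> t \<Longrightarrow>
    Ck_bounded n (\<kappa> * ((1 + t) * exp (- 2 * t)) * \<delta>) (\<lambda>x. acoef R0 f1 G1 t x - acoef R0 f2 G2 t x) \<and>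
    Ck_bounded n (\<kappa> * ((1 + t) * exp (- 2 * t)) * \<delta>) (\<lambda>x. bcoef R0 f1 G1 t x - bcoef R0 f2 G2 t x)"
    using coef_diff_bound[OF R0 B, of n] by blast
  obtain Cs where Cs: "0 \<le> Cs" "\<And>b K. b \<in> test_functions \<Longrightarrow> Ck_bounded n K b \<Longrightarrow> wsq n (\<lambda>x. b x * sech2 x) \<le> Cs * K\<^sup>2"
    using wsq_mult_sech[of n] unfolding sech2_def[symmetric] by blast
  define c where "c = (2 ^ n * (real n + 1))\<^sup>2 * \<kappa>\<^sup>2"
  have c0: "0 \<le> c" by (simp add: c_def)
  \<comment> \<open>c B^2 comes from the coefficients acting on the difference, 2 c M from
    coefficient differences acting on the second solution, and the last summand from the source; 16
    covers the repeated splitting of squares of sums.\<close>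
  define K where "K = 16 * (c * B\<^sup>2 + (2 * (c * M) + W0\<^sup>2 * (Cs * \<kappa>\<^sup>2)))"
  have K0: "0 \<le> K" using c0 M Cs(1) by (simp add: K_def)
  obtain C where C: "0 \<le> C" "\<And>v a \<mu>. smooth_hp v \<Longrightarrow> supp_cone a v \<Longrightarrow> 0 \<le> \<mu> \<Longrightarrow>
    (\<forall>t\<ge>0. wsq n (\<lambda>x. Dt (Dt v) t x + 2 * Dt v t x - Dx (Dx v) t x - 2 * (tanh (2 * x) * Dx v t x))
       \<le> K * ((1 + t)\<^sup>2 * exp (- 4 * t)) * (wsq (Suc n) (v t) + wsq n (Dt v t) + \<mu>)) \<Longrightarrow>
    (\<forall>t\<ge>0. wsq (Suc n) (v t) + wsq n (Dt v t)
       \<le> C * ((1 + t)\<^sup>2 * exp (- 2 * t)) * (wsq (Suc n) (v 0) + wsq n (Dt v 0) + \<mu>))"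
    using energy_decay[OF K0, of n] by blast
  have main: "energy_norm n (\<lambda>x. v1 t x - v2 t x) (\<lambda>x. Dt v1 t x - Dt v2 t x)
        \<le> C * ((1 + t)\<^sup>2 * exp (- 2 * t)) * (energy_norm n (\<lambda>x. v1 0 x - v2 0 x) (\<lambda>x. Dt v1 0 x - Dt v2 0 x) + \<delta>\<^sup>2)"
    if p1: "smooth_perturbation R0 W0 n B a1 f1 G1 v1" and p2: "smooth_perturbation R0 W0 n B a2 f2 G2 v2"
     and df: "Ck_bounded (Suc n) \<delta> (\<lambda>x. f1 x - f2 x)" and dG: "Ck_bounded n \<delta> (deriv (\<lambda>x. G1 x - G2 x))"
     and Mb: "\<And>t. 0 \<le> t \<Longrightarrow> energy_norm n (v2 t) (Dt v2 t) \<le> M" and t: "0 \<le> t"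
    for f1 G1 a1 v1 f2 G2 a2 v2 \<delta> t
  proof -
    define a where "a = max a1 a2"
    have ad1: "admissible R0 n B f1 G1" and d1: "smooth_data f1 G1 a" and v1: "smooth_hp v1" "supp_cone a v1" and e1: "perturbation_eq R0 W0 f1 G1 v1"
      using p1 by (auto simp: smooth_perturbation_def smooth_data_def a_def intro: supp_cone_mono)
    have ad2: "admissible R0 n B f2 G2" and d2: "smooth_data f2 G2 a" and v2: "smooth_hp v2" "supp_cone a v2" and e2: "perturbation_eq R0 W0 f2 G2 v2"
      using p2 by (auto simp: smooth_perturbation_def smooth_data_def a_def intro: supp_cone_mono)
    define d where "d t x = v1 t x - v2 t x" for t x
    have d: "smooth_hp d" "supp_cone a d" unfolding d_def[abs_def] by (intro smooth_hp_intros supp_cone_diff v1 v2)+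
    let ?a1 = "acoef R0 f1 G1" and ?a2 = "acoef R0 f2 G2" and ?b1 = "bcoef R0 f1 G1" and ?b2 = "bcoef R0 f2 G2"
    note sm1 = smooth_hp_coefs[OF ad1 R0 d1] and sm2 = smooth_hp_coefs[OF ad2 R0 d2]
    have est: "wsq n (damped_wave d t) \<le> K * ((1 + t)\<^sup>2 * exp (- 4 * t)) * (wsq (Suc n) (d t) + wsq n (Dt d t) + \<delta>\<^sup>2)"
      if t: "0 \<le> t" for t
    proof -
      define q where "q = (1 + t) * exp (- 2 * t)"
      have q2: "q\<^sup>2 = (1 + t)\<^sup>2 * exp (- 4 * t)"
        by (simp add: q_def power_mult_distrib exp_double[symmetric])
      have test: "d t \<in> test_functions" "Dt d t \<in> test_functions" "Dx d t \<in> test_functions"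
        "Dt v2 t \<in> test_functions" "Dx v2 t \<in> test_functions"
        by (intro smooth_section_test[OF _ _ t, where a = a] smooth_hp_intros supp_cone_Dt supp_cone_Dx d v2)+
      have Bf1: "Ck_bounded (Suc n) B f1" "Ck_bounded n B (deriv G1)" using ad1 by (auto simp: admissible_def)
      \<comment> \<open>Comparison with zero data, whose coefficients vanish, turns the difference
        bound into a bound for the coefficients themselves.\<close>
      have a1: "Ck_bounded n (\<kappa> * q * B) (?a1 t)" and b1: "Ck_bounded n (\<kappa> * q * B) (?b1 t)"
        using kap[OF ad1 admissible_zero[OF R0 B], of B t] Bf1 t by (simp_all add: zero_coefs q_def)
      have da: "Ck_bounded n (\<kappa> * q * \<delta>) (\<lambda>x. ?a1 t x - ?a2 t x)" and db: "Ck_bounded n (\<kappa> * q * \<delta>) (\<lambda>x. ?b1 t x - ?b2 t x)"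
        using kap[OF ad1 ad2 df dG t] by (simp_all add: q_def)
      have sm: "Ck_fun k (?a1 t)" "Ck_fun k (?b1 t)" "Ck_fun k (\<lambda>x. ?a1 t x - ?a2 t x)" "Ck_fun k (\<lambda>x. ?b1 t x - ?b2 t x)" for k
        by (intro Ck_fun_diff smooth_section_Ck_fun[OF _ t] sm1 sm2)+
      have tdb: "(\<lambda>x. ?b1 t x - ?b2 t x) \<in> test_functions"
        by (intro test_diff smooth_section_test[OF sm1(2) supp_cone_bcoef[OF d1] t] smooth_section_test[OF sm2(2) supp_cone_bcoef[OF d2] t])
      \<comment> \<open>Splitting a1 v1_t - a2 v2_t = a1 d_t + (a1 - a2) v2_t, and likewise for b.
        Coefficient differences meet first derivatives of v2, which M controls at the same level n,
        so no derivative is lost.\<close>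
      let ?x1 = "\<lambda>x. ?a1 t x * Dt d t x" and ?x2 = "\<lambda>x. ?b1 t x * Dx d t x"
      let ?x3 = "\<lambda>x. (?a1 t x - ?a2 t x) * Dt v2 t x" and ?x4 = "\<lambda>x. (?b1 t x - ?b2 t x) * Dx v2 t x"
      let ?x5 = "\<lambda>x. W0 * ((?b1 t x - ?b2 t x) * sech2 x)"
      have tx5': "(\<lambda>x. (?b1 t x - ?b2 t x) * sech2 x) \<in> test_functions"
        using test_mult[OF Ck_fun_sech2 tdb] by (simp add: mult.commute)
      have tx: "?x1 \<in> test_functions" "?x2 \<in> test_functions" "?x3 \<in> test_functions" "?x4 \<in> test_functions" "?x5 \<in> test_functions"
        by (intro test_mult sm test, intro test_mult sm test, intro test_mult sm test, intro test_mult sm test, intro test_cmult tx5')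
      have "damped_wave d t x = (?x2 x + ?x4 x + ?x5 x) - (?x1 x + ?x3 x)" for x
      proof -
        have "damped_wave d t x = damped_wave v1 t x - damped_wave v2 t x"
          unfolding d_def[abs_def] by (rule damped_wave_diff(1)[OF v1(1) v2(1) t])
        also have "\<dots> = (?x2 x + ?x4 x + ?x5 x) - (?x1 x + ?x3 x)"
          unfolding e1[unfolded perturbation_eq_def, rule_format, OF t] e2[unfolded perturbation_eq_def, rule_format, OF t]
            d_def[abs_def] damped_wave_diff(2,3)[OF v1(1) v2(1) t]
          by (simp add: algebra_simps)
        finally show ?thesis .
      qed
      then have "damped_wave d t = (\<lambda>x. (?x2 x + ?x4 x + ?x5 x) - (?x1 x + ?x3 x))" by (simp add: fun_eq_iff)
      then have "wsq n (damped_wave d t) \<le> 2 * wsq n (\<lambda>x. ?x2 x + ?x4 x + ?x5 x) + 2 * wsq n (\<lambda>x. ?x1 x + ?x3 x)"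
        using wsq_diff_le2[OF test_add[OF test_add[OF tx(2,4)] tx(5)] test_add[OF tx(1,3)], of n] by simp
      also have "\<dots> \<le> 16 * (wsq n ?x1 + wsq n ?x2 + wsq n ?x3 + wsq n ?x4 + wsq n ?x5)"
      proof -
        have "2 * y + 2 * z \<le> 16 * (w1 + w2 + w3 + w4 + w5)"
          if "y \<le> 2 * y' + 2 * w5" "y' \<le> 2 * w2 + 2 * w4" "z \<le> 2 * w1 + 2 * w3"
            "0 \<le> w1" "0 \<le> w2" "0 \<le> w3" "0 \<le> w4" "0 \<le> w5" for y y' z w1 w2 w3 w4 w5 :: real
          using that by simp
        from this[OF wsq_add_le2[OF test_add[OF tx(2,4)] tx(5)] wsq_add_le2[OF tx(2,4)] wsq_add_le2[OF tx(1,3)]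
            wsq_nonneg wsq_nonneg wsq_nonneg wsq_nonneg wsq_nonneg]
        show ?thesis .
      qed
      also have "\<dots> \<le> 16 * (c * B\<^sup>2 * q\<^sup>2 * wsq n (Dt d t) + c * B\<^sup>2 * q\<^sup>2 * wsq (Suc n) (d t) + c * \<delta>\<^sup>2 * q\<^sup>2 * M + c * \<delta>\<^sup>2 * q\<^sup>2 * M
          + W0\<^sup>2 * (Cs * \<kappa>\<^sup>2) * q\<^sup>2 * \<delta>\<^sup>2)"
      proof (intro mult_left_mono add_mono)
        show "wsq n ?x1 \<le> c * B\<^sup>2 * q\<^sup>2 * wsq n (Dt d t)"
          using wsq_mult[OF a1 sm(1) test(2)] by (simp add: c_def power_mult_distrib mult_ac)
        have "wsq n ?x2 \<le> c * B\<^sup>2 * q\<^sup>2 * wsq n (Dx d t)"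
          using wsq_mult[OF b1 sm(2) test(3)] by (simp add: c_def power_mult_distrib mult_ac)
        also have "\<dots> \<le> c * B\<^sup>2 * q\<^sup>2 * wsq (Suc n) (d t)"
          using c0 by (intro mult_left_mono) (auto simp: wsq_Suc Dx_section wip_nonneg)
        finally show "wsq n ?x2 \<le> c * B\<^sup>2 * q\<^sup>2 * wsq (Suc n) (d t)" .
        have "wsq n ?x3 \<le> c * \<delta>\<^sup>2 * q\<^sup>2 * wsq n (Dt v2 t)"
          using wsq_mult[OF da sm(3) test(4)] by (simp add: c_def power_mult_distrib mult_ac)
        also have "\<dots> \<le> c * \<delta>\<^sup>2 * q\<^sup>2 * M"
          using Mb[OF t] c0 wsq_nonneg[of "Suc n" "v2 t"] by (intro mult_left_mono) (auto simp: energy_norm_def)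
        finally show "wsq n ?x3 \<le> c * \<delta>\<^sup>2 * q\<^sup>2 * M" .
        have "wsq n ?x4 \<le> c * \<delta>\<^sup>2 * q\<^sup>2 * wsq n (Dx v2 t)"
          using wsq_mult[OF db sm(4) test(5)] by (simp add: c_def power_mult_distrib mult_ac)
        also have "\<dots> \<le> c * \<delta>\<^sup>2 * q\<^sup>2 * M"
        proof (intro mult_left_mono)
          have "wsq n (Dx v2 t) \<le> wsq (Suc n) (v2 t)" by (simp add: wsq_Suc Dx_section wip_nonneg)
          then show "wsq n (Dx v2 t) \<le> M" using Mb[OF t] wsq_nonneg[of n "Dt v2 t"] by (simp add: energy_norm_def)
        qed (use c0 in auto)
        finally show "wsq n ?x4 \<le> c * \<delta>\<^sup>2 * q\<^sup>2 * M" .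
        have "wsq n ?x5 = W0\<^sup>2 * wsq n (\<lambda>x. (?b1 t x - ?b2 t x) * sech2 x)" by (rule wsq_cmult[OF tx5'])
        also have "\<dots> \<le> W0\<^sup>2 * (Cs * (\<kappa> * q * \<delta>)\<^sup>2)" by (intro mult_left_mono Cs(2) tdb db) auto
        finally show "wsq n ?x5 \<le> W0\<^sup>2 * (Cs * \<kappa>\<^sup>2) * q\<^sup>2 * \<delta>\<^sup>2" by (simp add: power_mult_distrib mult_ac)
      qed auto
      also have "\<dots> = 16 * (c * B\<^sup>2) * (q\<^sup>2 * (wsq (Suc n) (d t) + wsq n (Dt d t))) + 16 * (2 * (c * M) + W0\<^sup>2 * (Cs * \<kappa>\<^sup>2)) * (q\<^sup>2 * \<delta>\<^sup>2)"
        by (simp add: algebra_simps)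
      also have "\<dots> \<le> K * (q\<^sup>2 * (wsq (Suc n) (d t) + wsq n (Dt d t))) + K * (q\<^sup>2 * \<delta>\<^sup>2)"
        using c0 M Cs(1) wsq_nonneg by (intro add_mono mult_right_mono) (auto simp: K_def)
      finally show ?thesis unfolding q2 by (simp add: algebra_simps)
    qed
    have "wsq (Suc n) (d t) + wsq n (Dt d t) \<le> C * ((1 + t)\<^sup>2 * exp (- 2 * t)) * (wsq (Suc n) (d 0) + wsq n (Dt d 0) + \<delta>\<^sup>2)"
      using C(2)[OF d, of "\<delta>\<^sup>2"] est t by (simp add: damped_wave_def[abs_def])
    moreover have "Dt d s = (\<lambda>x. Dt v1 s x - Dt v2 s x)" if "0 \<le> s" for s
      unfolding d_def[abs_def] using damped_wave_diff(2)[OF v1(1) v2(1) that] by auto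
    ultimately show ?thesis using t by (simp add: energy_norm_def d_def[abs_def])
  qed
  then show ?thesis using C(1) by blast
qed

lemma perturbation_estimate:
  assumes R0: "0 < R0" and B: "0 \<le> B"
  shows "\<exists>C\<ge>0. \<forall>f G a v \<delta>. smooth_perturbation R0 W0 n B a f G v \<longrightarrow>
     Ck_bounded (Suc n) \<delta> f \<longrightarrow> Ck_bounded n \<delta> (deriv G) \<longrightarrow>
     (\<forall>t\<ge>0. energy_norm n (v t) (Dt v t)
        \<le> C * ((1 + t)\<^sup>2 * exp (- 2 * t)) * (energy_norm n (v 0) (Dt v 0) + \<delta>\<^sup>2))"
proof -
  obtain C where C: "0 \<le> C" "\<forall>f1 G1 a1 v1 f2 G2 a2 v2 \<delta>. smooth_perturbation R0 W0 n B a1 f1 G1 v1 \<longrightarrow>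
     smooth_perturbation R0 W0 n B a2 f2 G2 v2 \<longrightarrow>
     Ck_bounded (Suc n) \<delta> (\<lambda>x. f1 x - f2 x) \<longrightarrow> Ck_bounded n \<delta> (deriv (\<lambda>x. G1 x - G2 x)) \<longrightarrow>
     (\<forall>t\<ge>0. energy_norm n (v2 t) (Dt v2 t) \<le> 0) \<longrightarrow>
     (\<forall>t\<ge>0. energy_norm n (\<lambda>x. v1 t x - v2 t x) (\<lambda>x. Dt v1 t x - Dt v2 t x)
        \<le> C * ((1 + t)\<^sup>2 * exp (- 2 * t)) * (energy_norm n (\<lambda>x. v1 0 x - v2 0 x) (\<lambda>x. Dt v1 0 x - Dt v2 0 x) + \<delta>\<^sup>2))"
    using perturbation_difference_estimate[OF R0 B order_refl, of W0 n] by blast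
  have z: "wsq k (\<lambda>x. 0) = 0" for k
    using wsq_cmult[OF test_zero, of k 0] by simp
  have "energy_norm n (v t) (Dt v t) \<le> C * ((1 + t)\<^sup>2 * exp (- 2 * t)) * (energy_norm n (v 0) (Dt v 0) + \<delta>\<^sup>2)"
    if "smooth_perturbation R0 W0 n B a f G v" "Ck_bounded (Suc n) \<delta> f" "Ck_bounded n \<delta> (deriv G)" "0 \<le> t" for f G a v \<delta> t
  proof -
    have "Dt (\<lambda>t x. 0) s = (\<lambda>x. 0)" if "0 \<le> s" for s using Dt_zero[OF that] by auto
    then show ?thesis
      using C(2)[rule_format, OF that(1) smooth_perturbation_zero[OF R0 B, of W0 n 0], of \<delta> t] that(2-4)
      by (simp add: energy_norm_def z)
  qed
  then show ?thesis using C(1) by blast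
qed

lemma UC_of_bound:
  assumes "\<And>e. 0 < e \<Longrightarrow> \<exists>N. \<forall>m\<ge>N. \<forall>l\<ge>N. \<forall>t\<ge>0. \<forall>x. \<bar>u m t x - u l t x\<bar> < e"
  shows "UC u"
  using assms by (intro UC_I) meson

text \<open>Sobolev embedding turns the energy Cauchy property into uniform convergence of x
  derivatives up to order n of v and up to order n - 1 of v_t. The characteristic variables are
  therefore C^(n-1) in x, the first order system makes them C^(n-1) jointly, and integrating once
  gives class C^n. The form of n provides two derivatives, as the limit equation requires.\<close>

lemma perturbation_limit:
  fixes e :: "nat \<Rightarrow> real"
  assumes R0: "0 < R0" and n: "n = Suc (Suc n')"
    and p: "\<And>m. smooth_perturbation R0 W0 n B (a m) (f m) (G m) (v m)"
    and ad: "admissible R0 n B F H"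
    and df: "\<And>m. Ck_bounded (Suc n) (e m) (\<lambda>x. f m x - F x)" and dG: "\<And>m. Ck_bounded n (e m) (deriv (\<lambda>x. G m x - H x))"
    and e: "e \<longlonglongrightarrow> 0"
    and M: "\<And>m t. 0 \<le> t \<Longrightarrow> energy_norm n (v m t) (Dt (v m) t) \<le> M"
    and cau: "\<And>\<epsilon>. 0 < \<epsilon> \<Longrightarrow> \<exists>N. \<forall>m\<ge>N. \<forall>l\<ge>N. \<forall>t\<ge>0. energy_norm n (\<lambda>x. v m t x - v l t x) (\<lambda>x. Dt (v m) t x - Dt (v l) t x) < \<epsilon>"
  obtains V where "Ck_halfplane n V" "perturbation_eq R0 W0 F H V"
    "\<And>t x. 0 \<le> t \<Longrightarrow> (\<lambda>m. v m t x) \<longlonglongrightarrow> V t x" "\<And>t x. 0 \<le> t \<Longrightarrow> (\<lambda>m. Dt (v m) t x) \<longlonglongrightarrow> Dt V t x"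
proof -
  have adm: "admissible R0 n B (f m) (G m)" and dat: "smooth_data (f m) (G m) (a m)" and v: "smooth_hp (v m)" "supp_cone (a m) (v m)"
    and eqv: "perturbation_eq R0 W0 (f m) (G m) (v m)" for m
    using p by (auto simp: smooth_perturbation_def)
  have B: "0 \<le> B" using ad by (auto simp: admissible_def dest: Ck_boundedD(4))
  have vt: "smooth_hp (Dt (v m))" "supp_cone (a m) (Dt (v m))" for m using v by (auto intro: smooth_hp_intros supp_cone_Dt)
  note tv = smooth_section_test[OF v] and tvt = smooth_section_test[OF vt]
  have diff_sob: "\<bar>(Dx ^^ i) (u m) t x - (Dx ^^ i) (u l) t x\<bar> \<le> sqrt (wsq k (\<lambda>x. u m t x - u l t x))"
    if "\<And>m. smooth_hp (u m)" "\<And>m. supp_cone (a m) (u m)" "0 \<le> t" "i < k" for u :: "nat \<Rightarrow> real \<Rightarrow> real \<Rightarrow> real" and m l t i x k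
  proof -
    have tu: "u m t \<in> test_functions" for m by (rule smooth_section_test[OF that(1,2,3)])
    show ?thesis
      using Sobolev_wsq[OF test_diff[OF tu tu] that(4), of m l x]
      by (simp add: Dx_funpow_section wip_funpow_diff[OF tu tu])
  qed
  have UCgen: "UC (\<lambda>m. (Dx ^^ i) (u m))"
    if u: "\<And>m. smooth_hp (u m)" "\<And>m. supp_cone (a m) (u m)" and ik: "i < k"
      and le: "\<And>m l t. 0 \<le> t \<Longrightarrow> wsq k (\<lambda>x. u m t x - u l t x) \<le> energy_norm n (\<lambda>x. v m t x - v l t x) (\<lambda>x. Dt (v m) t x - Dt (v l) t x)"
    for u :: "nat \<Rightarrow> real \<Rightarrow> real \<Rightarrow> real" and i k
  proof (rule UC_of_bound)
    fix \<epsilon> :: real assume "0 < \<epsilon>"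
    then obtain N where N: "\<And>m l t. N \<le> m \<Longrightarrow> N \<le> l \<Longrightarrow> 0 \<le> t \<Longrightarrow>
        energy_norm n (\<lambda>x. v m t x - v l t x) (\<lambda>x. Dt (v m) t x - Dt (v l) t x) < \<epsilon>\<^sup>2"
      using cau[of "\<epsilon>\<^sup>2"] by auto
    have "\<bar>(Dx ^^ i) (u m) t x - (Dx ^^ i) (u l) t x\<bar> < \<epsilon>" if "N \<le> m" "N \<le> l" "0 \<le> t" for m l t x
    proof -
      have "sqrt (wsq k (\<lambda>x. u m t x - u l t x)) < sqrt (\<epsilon>\<^sup>2)"
        by (rule real_sqrt_less_mono, rule le_less_trans[OF le[OF that(3)] N[OF that]])
      then show ?thesis using diff_sob[OF u that(3) ik, of m x l] \<open>0 < \<epsilon>\<close> by simp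
    qed
    then show "\<exists>N. \<forall>m\<ge>N. \<forall>l\<ge>N. \<forall>t\<ge>0. \<forall>x. \<bar>(Dx ^^ i) (u m) t x - (Dx ^^ i) (u l) t x\<bar> < \<epsilon>" by blast
  qed
  have UCv: "UC (\<lambda>m. (Dx ^^ i) (v m))" if "i < Suc n" for i
    by (rule UCgen[OF v that]) (simp add: energy_norm_def wsq_nonneg)
  have UCvt: "UC (\<lambda>m. (Dx ^^ i) (Dt (v m)))" if "i < n" for i
    by (rule UCgen[OF vt that]) (simp add: energy_norm_def wsq_nonneg)
  have UCv0: "UC v" and UCvx: "UC (\<lambda>m. Dx (v m))" and UCvt0: "UC (\<lambda>m. Dt (v m))"
    using UCv[of 0] UCv[of 1] UCvt[of 0] by (simp_all add: n)
  define L where "L = sqrt M"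
  have bv: "\<bar>Dx (v m) t x\<bar> \<le> L" and bvt: "\<bar>Dt (v m) t x\<bar> \<le> L" if t: "0 \<le> t" for m t x
  proof -
    have "wsq (Suc n) (v m t) \<le> M" "wsq n (Dt (v m) t) \<le> M"
      using M[OF t, of m] wsq_nonneg[of "Suc n" "v m t"] wsq_nonneg[of n "Dt (v m) t"] by (auto simp: energy_norm_def)
    then have "sqrt (wsq (Suc n) (v m t)) \<le> L" "sqrt (wsq n (Dt (v m) t)) \<le> L" by (auto simp: L_def)
    then show "\<bar>Dx (v m) t x\<bar> \<le> L" "\<bar>Dt (v m) t x\<bar> \<le> L"
      using Sobolev_wsq[OF tv[OF t], of 1 "Suc n" m x] Sobolev_wsq[OF tvt[OF t], of 0 n m x]
      by (auto simp: Dx_section n intro: order_trans)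
  qed
  obtain \<kappa> where k0: "0 \<le> \<kappa>" and kap: "\<And>f1 G1 f2 G2 \<delta> t. admissible R0 n B f1 G1 \<Longrightarrow> admissible R0 n B f2 G2 \<Longrightarrow>
    Ck_bounded (Suc n) \<delta> (\<lambda>x. f1 x - f2 x) \<Longrightarrow> Ck_bounded n \<delta> (deriv (\<lambda>x. G1 x - G2 x)) \<Longrightarrow> 0 \<le> t \<Longrightarrow>
    Ck_bounded n (\<kappa> * ((1 + t) * exp (- 2 * t)) * \<delta>) (\<lambda>x. acoef R0 f1 G1 t x - acoef R0 f2 G2 t x) \<and>
    Ck_bounded n (\<kappa> * ((1 + t) * exp (- 2 * t)) * \<delta>) (\<lambda>x. bcoef R0 f1 G1 t x - bcoef R0 f2 G2 t x)"
    using coef_diff_bound[OF R0 B, of n] by blast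
  have e0: "0 \<le> e m" for m by (rule Ck_boundedD(4)[OF df])
  let ?a = "\<lambda>m. acoef R0 (f m) (G m)" and ?b = "\<lambda>m. bcoef R0 (f m) (G m)"
  let ?A = "acoef R0 F H" and ?B = "bcoef R0 F H"
  have cd: "\<bar>?a m t x - ?A t x\<bar> \<le> \<kappa> * e m" "\<bar>?b m t x - ?B t x\<bar> \<le> \<kappa> * e m" if t: "0 \<le> t" for m t x
  proof -
    have "\<kappa> * ((1 + t) * exp (- 2 * t)) * e m \<le> \<kappa> * 1 * e m"
      using k0 e0 by (intro mult_right_mono mult_left_mono one_plus_le_exp2 t)
    then show "\<bar>?a m t x - ?A t x\<bar> \<le> \<kappa> * e m" "\<bar>?b m t x - ?B t x\<bar> \<le> \<kappa> * e m"
      using kap[OF adm ad df dG t] by (auto dest!: Ck_boundedD(3)[where x = x] intro: order_trans)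
  qed
  have cb: "\<bar>?a m t x\<bar> \<le> \<kappa> * B" "\<bar>?b m t x\<bar> \<le> \<kappa> * B" if t: "0 \<le> t" for m t x
  proof -
    have "\<kappa> * ((1 + t) * exp (- 2 * t)) * B \<le> \<kappa> * 1 * B"
      using k0 B by (intro mult_right_mono mult_left_mono one_plus_le_exp2 t)
    moreover have "Ck_bounded (Suc n) B (f m)" "Ck_bounded n B (deriv (G m))" using adm[of m] by (auto simp: admissible_def)
    ultimately show "\<bar>?a m t x\<bar> \<le> \<kappa> * B" "\<bar>?b m t x\<bar> \<le> \<kappa> * B"
      using kap[where \<delta> = B and t = t, OF adm[of m] admissible_zero[OF R0 B]] t
      by (auto simp: zero_coefs dest!: Ck_boundedD(3)[where x = x] intro: order_trans)
  qed
  have UCcoef: "UC u" if ud: "\<And>m t x. 0 \<le> t \<Longrightarrow> \<bar>u m t x - U t x\<bar> \<le> \<kappa> * e m" for u :: "nat \<Rightarrow> real \<Rightarrow> real \<Rightarrow> real" and U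
  proof (rule UC_of_bound)
    fix \<epsilon> :: real assume ep: "0 < \<epsilon>"
    have "(\<lambda>m. \<kappa> * e m) \<longlonglongrightarrow> \<kappa> * 0" by (intro tendsto_intros e)
    then obtain N where "\<forall>m\<ge>N. norm (\<kappa> * e m - \<kappa> * 0) < \<epsilon> / 2" using LIMSEQ_D[of _ _ "\<epsilon> / 2"] ep by (meson half_gt_zero)
    then have N: "\<And>m. N \<le> m \<Longrightarrow> \<kappa> * e m < \<epsilon> / 2" using k0 e0 by auto
    have "\<bar>u m t x - u l t x\<bar> < \<epsilon>" if "N \<le> m" "N \<le> l" "0 \<le> t" for m l t x
      using ud[OF that(3), of m x] ud[OF that(3), of l x] N[OF that(1)] N[OF that(2)] by linarith
    then show "\<exists>N. \<forall>m\<ge>N. \<forall>l\<ge>N. \<forall>t\<ge>0. \<forall>x. \<bar>u m t x - u l t x\<bar> < \<epsilon>" by blast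
  qed
  have lim_coef: "(\<lambda>m. u m t x) \<longlonglongrightarrow> U t x" if ud: "\<And>m t x. 0 \<le> t \<Longrightarrow> \<bar>u m t x - U t x\<bar> \<le> \<kappa> * e m" and t: "0 \<le> t"
    for u :: "nat \<Rightarrow> real \<Rightarrow> real \<Rightarrow> real" and U t x
  proof -
    have "(\<lambda>m. \<kappa> * e m) \<longlonglongrightarrow> \<kappa> * 0" by (intro tendsto_intros e)
    then have "(\<lambda>m. u m t x - U t x) \<longlonglongrightarrow> 0"
      using ud[OF t] by (intro Lim_null_comparison[of "\<lambda>m. u m t x - U t x" "\<lambda>m. \<kappa> * e m"]) (auto intro: always_eventually)
    then show ?thesis by (simp add: LIM_zero_iff)
  qed
  note la = lim_coef[of ?a ?A, OF cd(1)] and lb = lim_coef[of ?b ?B, OF cd(2)]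
  have UCa: "UC ?a" by (rule UCcoef[OF cd(1)])
  have UCb: "UC ?b" by (rule UCcoef[OF cd(2)])
  \<comment> \<open>The lower order terms in v_tt = v_xx + h, arranged as sums of products so that
    \<open>UC_add\<close> and \<open>UC_mult\<close> apply term by term.\<close>
  define h where "h m t x = (- 2 * Dt (v m) t x + - 1 * (?a m t x * Dt (v m) t x)) + ((2 * tanh (2 * x)) * Dx (v m) t x + ?b m t x * Dx (v m) t x) + (W0 * sech2 x) * ?b m t x" for m t x
  have tb: "\<bar>tanh (2 * x) :: real\<bar> \<le> 1" for x by (simp add: abs_le_iff tanh_real_lt_1 less_imp_le tanh_real_gt_neg1 minus_le_iff)
  have UCh: "UC h"
    unfolding h_def[abs_def]
  proof (intro UC_add)
    show "UC (\<lambda>m t x. - 2 * Dt (v m) t x)"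
      by (rule UC_mult[OF UC_const UCvt0]) (use bvt in auto)
    have ab: "UC (\<lambda>m t x. ?a m t x * Dt (v m) t x)"
      by (rule UC_mult[OF UCa UCvt0]) (use bvt cb in \<open>blast+\<close>)
    have "\<bar>?a m t x * Dt (v m) t x\<bar> \<le> (\<kappa> * B) * L" if "0 \<le> t" for m t x
      unfolding abs_mult using cb(1)[OF that] bvt[OF that] k0 B by (intro mult_mono) auto
    then show "UC (\<lambda>m t x. - 1 * (?a m t x * Dt (v m) t x))"
      by (intro UC_mult[OF UC_const ab]) (auto simp del: mult_minus1)
    show "UC (\<lambda>m t x. 2 * tanh (2 * x) * Dx (v m) t x)"
    proof (rule UC_mult[OF UC_const UCvx])
      show "\<exists>K. \<forall>(n::nat) t x. 0 \<le> t \<longrightarrow> t \<le> T \<longrightarrow> \<bar>2 * tanh (2 * x) :: real\<bar> \<le> K" for T :: real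
        using tb by (intro exI[of _ 2]) (simp add: abs_mult)
    qed (use bv in blast)
    show "UC (\<lambda>m t x. ?b m t x * Dx (v m) t x)"
      by (rule UC_mult[OF UCb UCvx]) (use bv cb in \<open>blast+\<close>)
    show "UC (\<lambda>m t x. (W0 * sech2 x) * ?b m t x)"
    proof (rule UC_mult[OF UC_const UCb])
      have "\<bar>W0 * sech2 x\<bar> \<le> \<bar>W0\<bar> * 1" for x
        unfolding abs_mult using sech2_bounds[of x] by (intro mult_left_mono) auto
      then show "\<exists>K. \<forall>(n::nat) t x. 0 \<le> t \<longrightarrow> t \<le> T \<longrightarrow> \<bar>W0 * sech2 x\<bar> \<le> K" for T by blast
    qed (use cb in blast)
  qed
  have DDv: "Dt (Dt (v m)) t x = Dx (Dx (v m)) t x + h m t x" if "0 \<le> t" for m t x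
    using eqv[of m] that by (simp add: perturbation_eq_def damped_wave_def h_def algebra_simps)
  define P where "P m t x = Dt (v m) t x + Dx (v m) t x" for m t x
  define S where "S m t x = Dt (v m) t x - Dx (v m) t x" for m t x
  have vx: "smooth_hp (Dx (v m))" for m using v by (auto intro: smooth_hp_intros)
  have Psm: "smooth_hp (P m)" and Ssm: "smooth_hp (S m)" for m
    unfolding P_def[abs_def] S_def[abs_def] by (intro smooth_hp_intros vt vx)+
  have UCneg: "UC (\<lambda>m t x. - u m t x)" if "UC u" for u
    using that by (simp add: UC_def abs_minus_commute)
  have UCP: "UC (\<lambda>m. (Dx ^^ i) (P m))" and UCS: "UC (\<lambda>m. (Dx ^^ i) (S m))" if "i < n" for i
  proof -
    have 1: "UC (\<lambda>m. (Dx ^^ i) (Dx (v m)))"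
      using UCv[of "Suc i"] that by (simp only: Dx_funpow_Suc)
    show "UC (\<lambda>m. (Dx ^^ i) (P m))"
      by (rule UC_cong[OF UC_add[OF UCvt[OF that] 1]]) (simp add: P_def[abs_def] Dx_funpow_add[OF vt(1) vx])
    show "UC (\<lambda>m. (Dx ^^ i) (S m))"
      by (rule UC_cong[OF UC_add[OF UCvt[OF that] UCneg[OF 1]]]) (simp add: S_def[abs_def] Dx_funpow_diff[OF vt(1) vx])
  qed
  have UCP0: "UC P" and UCS0: "UC S" and UCP1: "UC (\<lambda>m. Dx (P m))" and UCS1: "UC (\<lambda>m. Dx (S m))"
    using UCP[of 0] UCP[of 1] UCS[of 0] UCS[of 1] by (simp_all add: n)
  define pp where "pp = hlim P"
  define ss where "ss = hlim S"
  define V where "V = hlim v"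
  have hvt: "hlim (\<lambda>m. Dt (v m)) t x = (1/2) * (pp t x + ss t x)" if t: "0 \<le> t" for t x
  proof (rule LIMSEQ_unique[OF UC_tendsto[OF UCvt0 t]])
    have "(\<lambda>m. (1/2) * (P m t x + S m t x)) \<longlonglongrightarrow> (1/2) * (pp t x + ss t x)"
      unfolding pp_def ss_def by (intro tendsto_intros UC_tendsto UCP0 UCS0 t)
    then show "(\<lambda>m. Dt (v m) t x) \<longlonglongrightarrow> (1/2) * (pp t x + ss t x)" by (simp add: P_def S_def)
  qed
  have hvx: "hlim (\<lambda>m. Dx (v m)) t x = (1/2) * (pp t x - ss t x)" if t: "0 \<le> t" for t x
  proof (rule LIMSEQ_unique[OF UC_tendsto[OF UCvx t]])
    have "(\<lambda>m. (1/2) * (P m t x - S m t x)) \<longlonglongrightarrow> (1/2) * (pp t x - ss t x)"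
      unfolding pp_def ss_def by (intro tendsto_intros UC_tendsto UCP0 UCS0 t)
    then show "(\<lambda>m. Dx (v m) t x) \<longlonglongrightarrow> (1/2) * (pp t x - ss t x)" by (simp add: P_def S_def)
  qed
  have Vt: "((\<lambda>s. V s x) has_real_derivative (1/2) * (pp t x + ss t x)) (at t within {0..})" if t: "0 \<le> t" for t x
    unfolding hvt[OF t, symmetric] V_def by (rule hlim_DERIV_t[OF smooth_hp_Dt[OF v(1)] UCv0 UCvt0 t])
  have Vx: "(V t has_real_derivative (1/2) * (pp t x - ss t x)) (at x)" if t: "0 \<le> t" for t x
    unfolding hvx[OF t, symmetric] V_def by (rule hlim_DERIV_x[OF smooth_hp_Dx[OF v(1)] UCv0 UCvx t])
  have DVt: "Dt V t x = (1/2) * (pp t x + ss t x)" if "0 \<le> t" for t x by (rule Dt_eqI[OF Vt that]) (rule that)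
  have DVx: "Dx V t x = (1/2) * (pp t x - ss t x)" if "0 \<le> t" for t x by (rule Dx_eqI) (rule Vx[OF that])
  \<comment> \<open>Together with D and E below: the coefficients of the limit of h in the variables
    pp and ss, obtained from v_t = (pp + ss) / 2 and v_x = (pp - ss) / 2.\<close>
  define A where "A t x = (1/2) * ((- 2 - ?A t x) + (2 * tanh (2 * x) + ?B t x))" for t x
  define D where "D t x = (1/2) * ((- 2 - ?A t x) - (2 * tanh (2 * x) + ?B t x))" for t x
  define E where "E t x = (W0 * sech2 x) * ?B t x" for t x
  have Fk: "Ck_fun (Suc n) F" "Ck_fun (Suc n) H" using ad by (auto simp: admissible_def dest: Ck_boundedD(1))
  have coefn: "Ck_halfplane (Suc n') ?A" "Ck_halfplane (Suc n') ?B"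
    using Ck_halfplane_coefs[OF ad R0 Fk] by (auto simp: n intro: Ck_halfplane_Suc_mono simp del: Ck_halfplane.simps)
  have coef: "Ck_halfplane (Suc n') A" "Ck_halfplane (Suc n') D" "Ck_halfplane (Suc n') E"
    unfolding A_def[abs_def] D_def[abs_def] E_def[abs_def]
    by (intro Ck_halfplane_add Ck_halfplane_diff Ck_halfplane_mult Ck_halfplane_const coefn Ck_halfplane_x[OF Ck_fun_tanh] Ck_halfplane_x[OF Ck_fun_sech2])+
  have hl: "hlim h t x = A t x * pp t x + D t x * ss t x + E t x" if t: "0 \<le> t" for t x
  proof (rule LIMSEQ_unique[OF UC_tendsto[OF UCh t]])
    have l1: "(\<lambda>m. Dt (v m) t x) \<longlonglongrightarrow> (1/2) * (pp t x + ss t x)"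
      unfolding hvt[OF t, symmetric] by (rule UC_tendsto[OF UCvt0 t])
    have l2: "(\<lambda>m. Dx (v m) t x) \<longlonglongrightarrow> (1/2) * (pp t x - ss t x)"
      unfolding hvx[OF t, symmetric] by (rule UC_tendsto[OF UCvx t])
    have "(\<lambda>m. h m t x) \<longlonglongrightarrow> (- 2 * ((1/2) * (pp t x + ss t x)) + - 1 * (?A t x * ((1/2) * (pp t x + ss t x))))
        + ((2 * tanh (2 * x)) * ((1/2) * (pp t x - ss t x)) + ?B t x * ((1/2) * (pp t x - ss t x))) + (W0 * sech2 x) * ?B t x"
      unfolding h_def by (intro tendsto_add tendsto_mult tendsto_const l1 l2 la lb t)
    moreover have "(- 2 * ((1/2) * (pp t x + ss t x)) + - 1 * (?A t x * ((1/2) * (pp t x + ss t x))))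
        + ((2 * tanh (2 * x)) * ((1/2) * (pp t x - ss t x)) + ?B t x * ((1/2) * (pp t x - ss t x))) + (W0 * sech2 x) * ?B t x
        = A t x * pp t x + D t x * ss t x + E t x"
      by (simp add: A_def D_def E_def field_simps)
    ultimately show "(\<lambda>m. h m t x) \<longlonglongrightarrow> A t x * pp t x + D t x * ss t x + E t x" by simp
  qed
  have Pt: "((\<lambda>s. P m s x) has_real_derivative Dx (P m) t x + h m t x) (at t within {0..})"
    and St: "((\<lambda>s. S m s x) has_real_derivative - Dx (S m) t x + h m t x) (at t within {0..})" if t: "0 \<le> t" for m t x
  proof -
    have "Dx (P m) t x = Dx (Dt (v m)) t x + Dx (Dx (v m)) t x" "Dx (S m) t x = Dx (Dt (v m)) t x - Dx (Dx (v m)) t x"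
      unfolding P_def[abs_def] S_def[abs_def]
      by (rule Dx_add[OF smooth_hpD[OF vt(1)] smooth_hpD[OF vx] t] Dx_diff[OF smooth_hpD[OF vt(1)] smooth_hpD[OF vx] t])+
    then have e: "Dx (P m) t x + h m t x = Dt (Dt (v m)) t x + Dt (Dx (v m)) t x"
      "- Dx (S m) t x + h m t x = Dt (Dt (v m)) t x - Dt (Dx (v m)) t x"
      using DDv[OF t] smooth_hp_Dt_Dx[OF v(1) t] by simp_all
    show "((\<lambda>s. P m s x) has_real_derivative Dx (P m) t x + h m t x) (at t within {0..})"
      "((\<lambda>s. S m s x) has_real_derivative - Dx (S m) t x + h m t x) (at t within {0..})"
      unfolding e unfolding P_def S_def by (intro DERIV_add DERIV_diff smooth_hp_Dt[OF _ t] vt vx)+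
  qed
  have ppx: "Dx pp t x = hlim (\<lambda>m. Dx (P m)) t x" and ssx: "Dx ss t x = hlim (\<lambda>m. Dx (S m)) t x" if t: "0 \<le> t" for t x
    unfolding pp_def ss_def
    by (rule Dx_eqI, rule hlim_DERIV_x[OF smooth_hp_Dx[OF Psm] UCP0 UCP1 t], assumption)
       (rule Dx_eqI, rule hlim_DERIV_x[OF smooth_hp_Dx[OF Ssm] UCS0 UCS1 t], assumption)
  have UCPt: "UC (\<lambda>m t x. Dx (P m) t x + h m t x)" and UCSt: "UC (\<lambda>m t x. - Dx (S m) t x + h m t x)"
    by (rule UC_add[OF UCP1 UCh], rule UC_add[OF UCneg[OF UCS1] UCh])
  have ppt: "((\<lambda>\<tau>. pp \<tau> x) has_real_derivative Dx pp t x + (A t x * pp t x + D t x * ss t x + E t x)) (at t within {0..})"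
    if t: "0 \<le> t" for t x
  proof -
    have "hlim (\<lambda>m t x. Dx (P m) t x + h m t x) t x = Dx pp t x + (A t x * pp t x + D t x * ss t x + E t x)"
      unfolding hl[OF t, symmetric] ppx[OF t]
      by (rule LIMSEQ_unique[OF UC_tendsto[OF UCPt t]]) (intro tendsto_add UC_tendsto UCP1 UCh t)
    then show ?thesis
      using hlim_DERIV_t[of P x "\<lambda>m t x. Dx (P m) t x + h m t x", OF Pt UCP0 UCPt t] by (simp add: pp_def)
  qed
  have sst: "((\<lambda>\<tau>. ss \<tau> x) has_real_derivative - Dx ss t x + (A t x * pp t x + D t x * ss t x + E t x)) (at t within {0..})"
    if t: "0 \<le> t" for t x
  proof -
    have "hlim (\<lambda>m t x. - Dx (S m) t x + h m t x) t x = - Dx ss t x + (A t x * pp t x + D t x * ss t x + E t x)"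
      unfolding hl[OF t, symmetric] ssx[OF t]
      by (rule LIMSEQ_unique[OF UC_tendsto[OF UCSt t]]) (intro tendsto_add tendsto_minus UC_tendsto UCS1 UCh t)
    then show ?thesis
      using hlim_DERIV_t[of S x "\<lambda>m t x. - Dx (S m) t x + h m t x", OF St UCS0 UCSt t] by (simp add: ss_def)
  qed
  have ckx: "Ckx_halfplane (Suc n') pp" "Ckx_halfplane (Suc n') ss"
    unfolding pp_def ss_def
    by (rule Ckx_halfplane_hlim[OF smooth_hpD[OF Psm] UCP], simp add: n) (rule Ckx_halfplane_hlim[OF smooth_hpD[OF Ssm] UCS], simp add: n)
  have reg: "Ck_halfplane (Suc n') pp" "Ck_halfplane (Suc n') ss"
    using characteristic_system_regularity[OF ckx coef ppt sst] by blast+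
  have Vn: "Ck_halfplane n V"
    unfolding n
  proof (rule Ck_halfplane_SucI[OF _ Vt Vx])
    show "continuous_on ({0..} \<times> UNIV) (\<lambda>(t, x). V t x)"
      unfolding V_def by (rule Ck_halfplane_cont[OF hlim_cont[OF smooth_hpD[OF v(1)] UCv0]])
    show "Ck_halfplane (Suc n') (\<lambda>t x. (1/2) * (pp t x + ss t x))" "Ck_halfplane (Suc n') (\<lambda>t x. (1/2) * (pp t x - ss t x))"
      by (intro Ck_halfplane_cmult Ck_halfplane_add Ck_halfplane_diff reg)+
  qed
  have "perturbation_eq R0 W0 F H V"
    unfolding perturbation_eq_def
  proof (intro allI impI)
    fix t x :: real assume t: "0 \<le> t"
    have "Dt (Dt V) t x = Dt (\<lambda>t x. (1/2) * (pp t x + ss t x)) t x" by (rule Dt_cong[OF _ t]) (rule DVt)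
    also have "\<dots> = (1/2) * ((Dx pp t x + (A t x * pp t x + D t x * ss t x + E t x)) + (- Dx ss t x + (A t x * pp t x + D t x * ss t x + E t x)))"
      by (intro Dt_eqI DERIV_cmult DERIV_add ppt sst t)
    finally have 1: "Dt (Dt V) t x = (1/2) * (Dx pp t x - Dx ss t x) + (A t x * pp t x + D t x * ss t x + E t x)"
      by (simp add: field_simps)
    have "Dx V t = (\<lambda>x. (1/2) * (pp t x - ss t x))" using DVx[OF t] by auto
    then have "Dx (Dx V) t x = deriv (\<lambda>x. (1/2) * (pp t x - ss t x)) x" by (simp add: Dx_section)
    also have "\<dots> = (1/2) * (Dx pp t x - Dx ss t x)"
      by (intro DERIV_imp_deriv DERIV_cmult DERIV_diff Ck_halfplane_Dx[OF reg(1) t] Ck_halfplane_Dx[OF reg(2) t])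
    finally have 2: "Dx (Dx V) t x = (1/2) * (Dx pp t x - Dx ss t x)" .
    show "damped_wave V t x = - (?A t x * Dt V t x) + ?B t x * Dx V t x + W0 * (?B t x * sech2 x)"
      unfolding damped_wave_def 1 2 DVt[OF t] DVx[OF t] by (simp add: A_def D_def E_def field_simps)
  qed
  then show ?thesis
  proof (rule that[OF Vn])
    show "(\<lambda>m. v m t x) \<longlonglongrightarrow> V t x" if "0 \<le> t" for t x
      unfolding V_def by (rule UC_tendsto[OF UCv0 that])
    show "(\<lambda>m. Dt (v m) t x) \<longlonglongrightarrow> Dt V t x" if "0 \<le> t" for t x
      unfolding DVt[OF that] hvt[OF that, symmetric] by (rule UC_tendsto[OF UCvt0 that])
  qed
qed

section \<open>Construction of the perturbation from rough data\<close>

lemma one_plus_exp_le: "0 \<le> t \<Longrightarrow> (1 + t)\<^sup>2 * exp (- 2 * t) \<le> (1::real)"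
proof -
  assume t: "0 \<le> t"
  have "(1 + t) * exp (- t) \<le> 1" using exp_ge_add_one_self[of t] by (simp add: exp_minus divide_simps)
  then have "((1 + t) * exp (- t))\<^sup>2 \<le> 1\<^sup>2" using t by (intro power_mono) auto
  then show ?thesis by (simp add: power_mult_distrib exp_double[symmetric])
qed

lemma smooth_perturbation_mono:
  "smooth_perturbation R0 W0 n B a f G v \<Longrightarrow> B \<le> B' \<Longrightarrow> smooth_perturbation R0 W0 n B' a f G v"
  unfolding smooth_perturbation_def admissible_def by (auto intro: Ck_bounded_mono[OF _ order_refl])

lemma weighted_norm_sum_le:
  assumes "energy_norm n \<phi> \<psi> \<le> E"
  shows "weighted_norm (Suc n) \<phi> + weighted_norm n \<psi> \<le> 2 * sqrt E"
proof -
  have "wsq (Suc n) \<phi> \<le> E" "wsq n \<psi> \<le> E"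
    using assms wsq_nonneg[of "Suc n" \<phi>] wsq_nonneg[of n \<psi>] by (auto simp: energy_norm_def)
  then have "sqrt (wsq (Suc n) \<phi>) \<le> sqrt E" "sqrt (wsq n \<psi>) \<le> sqrt E" by (auto intro: real_sqrt_le_mono simp del: real_sqrt_le_iff)
  then show ?thesis unfolding weighted_norm_wsq by linarith
qed

lemma sqrt_energy_norm_le:
  assumes "0 \<le> \<delta>"
  shows "sqrt (energy_norm n \<phi> \<psi> + \<delta>\<^sup>2) \<le> weighted_norm (Suc n) \<phi> + weighted_norm n \<psi> + \<delta>"
proof (rule real_le_lsqrt)
  let ?a = "weighted_norm (Suc n) \<phi>" and ?b = "weighted_norm n \<psi>"
  have nn: "0 \<le> ?a" "0 \<le> ?b" by (rule weighted_norm_nonneg)+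
  show "0 \<le> ?a + ?b + \<delta>" using nn assms by simp
  have "energy_norm n \<phi> \<psi> = ?a\<^sup>2 + ?b\<^sup>2"
    by (simp add: energy_norm_def weighted_norm_wsq wsq_nonneg)
  also have "?a\<^sup>2 + ?b\<^sup>2 + \<delta>\<^sup>2 \<le> (?a + ?b + \<delta>)\<^sup>2"
  proof -
    have "0 \<le> 2 * (?a * ?b) + 2 * (?a * \<delta>) + 2 * (?b * \<delta>)" using nn assms by simp
    then show ?thesis by (simp add: power2_eq_square algebra_simps)
  qed
  finally show "energy_norm n \<phi> \<psi> + \<delta>\<^sup>2 \<le> (?a + ?b + \<delta>)\<^sup>2" by simp
qed

lemma smooth_antiderivative:
  assumes "\<phi> \<in> test_functions"
  obtains G where "\<And>k. Ck_fun k G" "deriv G = \<phi>"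
proof -
  obtain G where G: "\<And>x. (G has_real_derivative \<phi> x) (at x)"
    using continuous_antiderivative[OF Ck_fun_continuous[OF test_functionsD[OF assms, of 0]], of 0] by blast
  have "Ck_fun k G" for k
    using Ck_fun_SucI[OF G test_functionsD[OF assms]] Ck_fun_Suc_mono by blast
  moreover have "deriv G = \<phi>" by (intro ext DERIV_imp_deriv G)
  ultimately show ?thesis by (rule that)
qed

text \<open>The constants enter as a given function \<open>CE\<close> of B, so that all data with
  norm below B share one of them. The bound B0 belongs to the individual data and is used for
  existence and convergence.\<close>

lemma perturbation_rough_data:
  fixes f g w w' :: "real \<Rightarrow> real"
  assumes R0: "0 < R0" and n: "n = Suc (Suc n')"
    and f: "f \<in> C0_space (Suc n)" and g: "g \<in> C0_space n" and small: "m_norm 0 f g < 2 * R0 / 3"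
    and w: "w \<in> Ht_space (Suc n)" and w': "w' \<in> Ht_space n"
    and CE: "\<And>B f G a v \<delta> t. smooth_perturbation R0 W0 n (\<bar>B\<bar> + R0) a f G v \<Longrightarrow>
     Ck_bounded (Suc n) \<delta> f \<Longrightarrow> Ck_bounded n \<delta> (deriv G) \<Longrightarrow> 0 \<le> t \<Longrightarrow>
     energy_norm n (v t) (Dt v t) \<le> CE B * ((1 + t)\<^sup>2 * exp (- 2 * t)) * (energy_norm n (v 0) (Dt v 0) + \<delta>\<^sup>2)"
    and CE0: "\<And>B. 0 \<le> CE B"
  obtains G v B0 where "Ck_fun (Suc n) G" "deriv G = g" "admissible R0 n B0 f G"
    "Ck_halfplane n v" "perturbation_eq R0 W0 f G v"
    "AE x in lebesgue. v 0 x = w x \<and> Dt v 0 x = w' x"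
    "\<And>t. 0 \<le> t \<Longrightarrow> v t \<in> Ht_space (Suc n) \<and> Dt v t \<in> Ht_space n"
    "\<And>B t. m_norm (Suc n) f g < B \<Longrightarrow> 0 \<le> t \<Longrightarrow> Ht_norm (Suc n) (v t) + Ht_norm n (Dt v t)
       \<le> 2 * sqrt (CE B) * exp (- t) * (t + 1) * (Ht_norm (Suc n) (v 0) + Ht_norm n (Dt v 0) + m_norm (Suc n) f g)"
proof -
  note fb = C0_space_Ck_bounded[OF f] and gb = C0_space_Ck_bounded[OF g]
  define mk where "mk = m_norm (Suc n) f g"
  have mk: "mk = Ck_norm (Suc n) f + Ck_norm n g" by (simp add: mk_def m_norm_def)
  have mk0: "0 \<le> mk" unfolding mk using fb(3) gb(3) by simp
  define m0 where "m0 = Ck_norm 0 f + Ck_norm 0 g"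
  have m0: "m0 < 2 * R0 / 3" "0 \<le> m0"
    using small fb(2)[of 0] gb(2)[of 0] by (auto simp: m0_def m_norm_def)
  \<comment> \<open>Half of the slack in the smallness condition: position and velocity may each be
    off by this much and the approximants remain admissible.\<close>
  define ep where "ep = (2 * R0 / 3 - m0) / 2"
  have ep: "0 < ep" "ep \<le> R0" "m0 + 2 * ep \<le> 2 * R0 / 3" using m0 R0 by (auto simp: ep_def field_simps)
  define e where "e m = ep / real (Suc m)" for m
  have e0: "0 < e m" "e m \<le> ep" for m using ep by (auto simp: e_def divide_simps)
  have elim: "e \<longlonglongrightarrow> 0"
    unfolding e_def[abs_def] using LIMSEQ_inverse_real_of_nat tendsto_mult_right_zero[of "\<lambda>m. inverse (real (Suc m))" sequentially ep]
    by (simp add: divide_inverse)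
  have "\<forall>m. \<exists>\<phi>. \<phi> \<in> test_functions \<and> Ck_bounded (Suc n) (e m) (\<lambda>x. \<phi> x - f x)"
    using C0_space_test_approximation[OF f e0(1)] by blast
  then obtain F where F: "\<And>m. F m \<in> test_functions" "\<And>m. Ck_bounded (Suc n) (e m) (\<lambda>x. F m x - f x)" by metis
  have "\<forall>m. \<exists>\<phi>. \<phi> \<in> test_functions \<and> Ck_bounded n (e m) (\<lambda>x. \<phi> x - g x)"
    using C0_space_test_approximation[OF g e0(1)] by blast
  then obtain g' where g': "\<And>m. g' m \<in> test_functions" "\<And>m. Ck_bounded n (e m) (\<lambda>x. g' m x - g x)" by metis
  have "\<forall>m. \<exists>H. (\<forall>k. Ck_fun k H) \<and> deriv H = g' m" using smooth_antiderivative[OF g'(1)] by metis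
  then obtain H where H: "\<And>m k. Ck_fun k (H m)" "\<And>m. deriv (H m) = g' m" by metis
  have gk: "Ck_fun n g" and fk: "Ck_fun (Suc n) f" using f g by (auto simp: C0_space_def)
  obtain G where G: "\<And>x. (G has_real_derivative g x) (at x)"
    using continuous_antiderivative[OF Ck_fun_continuous[OF gk], of 0] by blast
  have GS: "Ck_fun (Suc n) G" by (rule Ck_fun_SucI[OF G gk])
  have Gd: "deriv G = g" by (intro ext DERIV_imp_deriv G)
  have Hd: "deriv (\<lambda>x. H m x - G x) = (\<lambda>x. g' m x - g x)" for m
    using Ck_fun_DERIV[OF H(1)] G by (intro ext DERIV_imp_deriv DERIV_diff) (auto simp: H(2)[symmetric])
  define B0 where "B0 = mk + R0"
  have B0: "0 \<le> B0" using mk0 R0 by (simp add: B0_def)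
  have Fb: "Ck_bounded (Suc n) (mk + e m) (F m)" for m
    using Ck_bounded_mono[OF Ck_bounded_add[OF fb(1) F(2)[of m]] order_refl, of "mk + e m"] gb(3) by (simp add: mk)
  have g'b: "Ck_bounded n (mk + e m) (g' m)" for m
    using Ck_bounded_mono[OF Ck_bounded_add[OF gb(1) g'(2)[of m]] order_refl, of "mk + e m"] fb(3) by (simp add: mk)
  have mB: "mk + e m \<le> B0" for m using e0(2)[of m] ep(2) by (simp add: B0_def)
  have adm: "admissible R0 n B0 (F m) (H m)" for m
    unfolding admissible_def H(2)
  proof (intro conjI exI allI)
    show "Ck_bounded (Suc n) B0 (F m)" "Ck_bounded n B0 (g' m)"
      by (rule Ck_bounded_mono[OF Fb order_refl mB] Ck_bounded_mono[OF g'b order_refl mB])+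
    show "(Ck_norm 0 f + ep) + (Ck_norm 0 g + ep) \<le> 2 * R0 / 3" using ep(3) by (simp add: m0_def)
    show "\<bar>F m x\<bar> \<le> Ck_norm 0 f + ep" for x
      using fb(2)[of x] Ck_boundedD(3)[OF F(2), of m x] e0(2)[of m] by linarith
    show "\<bar>g' m x\<bar> \<le> Ck_norm 0 g + ep" for x
      using gb(2)[of x] Ck_boundedD(3)[OF g'(2), of m x] e0(2)[of m] by linarith
  qed (rule H)
  have admf: "admissible R0 n B0 f G"
    unfolding admissible_def Gd
  proof (intro conjI exI allI)
    show "Ck_bounded (Suc n) B0 f" "Ck_bounded n B0 g"
      using fb(3) gb(3) R0 by (auto intro: Ck_bounded_mono[OF fb(1) order_refl] Ck_bounded_mono[OF gb(1) order_refl] simp: B0_def mk)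
    show "Ck_norm 0 f + Ck_norm 0 g \<le> 2 * R0 / 3" using m0 by (simp add: m0_def)
  qed (use fb gb GS in auto)
  obtain \<phi> where \<phi>: "represents (Suc n) \<phi> w" using w by (auto simp: Ht_space_def)
  obtain \<psi> where \<psi>: "represents n \<psi> w'" using w' by (auto simp: Ht_space_def)
  have pt: "\<phi> m \<in> test_functions" and qt: "\<psi> m \<in> test_functions" for m using \<phi> \<psi> by (auto simp: represents_nnsq)
  have "\<exists>a v. smooth_perturbation R0 W0 n B0 a (F m) (H m) v \<and> v 0 = \<phi> m \<and> Dt v 0 = \<psi> m" for m
  proof -
    obtain a1 a2 a3 a4 where s: "\<And>x. a1 < \<bar>x\<bar> \<Longrightarrow> F m x = 0" "\<And>x. a2 < \<bar>x\<bar> \<Longrightarrow> g' m x = 0"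
      "\<And>x. a3 < \<bar>x\<bar> \<Longrightarrow> \<phi> m x = 0" "\<And>x. a4 < \<bar>x\<bar> \<Longrightarrow> \<psi> m x = 0"
      using F(1)[of m] g'(1)[of m] pt[of m] qt[of m] unfolding test_functions_def by blast
    define a where "a = max (max a1 a2) (max a3 a4)"
    have d: "smooth_data (F m) (H m) a"
      using s(1,2) H test_functionsD[OF F(1)] by (auto simp: smooth_data_def a_def)
    obtain v where "smooth_hp v" "supp_cone a v" "perturbation_eq R0 W0 (F m) (H m) v" "v 0 = \<phi> m" "Dt v 0 = \<psi> m"
    proof (rule perturbation_smooth_solution[OF R0 adm[of m] d test_functionsD[OF pt[of m]] _ test_functionsD[OF qt[of m]], of W0])
      show "\<phi> m x = 0" "\<psi> m x = 0" if "a < \<bar>x\<bar>" for x using s(3,4) that by (auto simp: a_def)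
      fix u assume "smooth_hp u" "supp_cone a u" "perturbation_eq R0 W0 (F m) (H m) u" "u 0 = \<phi> m" "Dt u 0 = \<psi> m"
      then show thesis by (rule that)
    qed
    then show ?thesis using adm d unfolding smooth_perturbation_def by blast
  qed
  then obtain a v where v: "\<And>m. smooth_perturbation R0 W0 n B0 (a m) (F m) (H m) (v m)"
    and v0: "\<And>m. v m 0 = \<phi> m" and vt0: "\<And>m. Dt (v m) 0 = \<psi> m" by metis
  have vsm: "smooth_hp (v m)" "supp_cone (a m) (v m)" for m using v[of m] by (auto simp: smooth_perturbation_def)
  have tv: "v m t \<in> test_functions" and tvt: "Dt (v m) t \<in> test_functions" if "0 \<le> t" for m t
    by (rule smooth_section_test[OF vsm that], rule smooth_section_test[OF smooth_hp_intros(8)[OF vsm(1)] supp_cone_Dt[OF vsm(2)] that])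
  note lp = represents_Ht_norm[OF \<phi>] and lq = represents_Ht_norm[OF \<psi>]
  obtain N0 where N0: "\<And>m. energy_norm n (\<phi> m) (\<psi> m) \<le> N0"
  proof -
    obtain K1 where K1: "\<And>m. norm (weighted_norm (Suc n) (\<phi> m)) \<le> K1" using convergent_imp_Bseq[OF convergentI[OF lp]] by (auto simp: Bseq_def)
    obtain K2 where K2: "\<And>m. norm (weighted_norm n (\<psi> m)) \<le> K2" using convergent_imp_Bseq[OF convergentI[OF lq]] by (auto simp: Bseq_def)
    have "energy_norm n (\<phi> m) (\<psi> m) \<le> K1\<^sup>2 + K2\<^sup>2" for m
    proof -
      have "energy_norm n (\<phi> m) (\<psi> m) = (weighted_norm (Suc n) (\<phi> m))\<^sup>2 + (weighted_norm n (\<psi> m))\<^sup>2"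
        by (simp add: energy_norm_def weighted_norm_wsq wsq_nonneg)
      also have "\<dots> \<le> K1\<^sup>2 + K2\<^sup>2"
        using K1[of m] K2[of m] weighted_norm_nonneg by (intro add_mono power_mono) auto
      finally show ?thesis .
    qed
    then show ?thesis by (rule that)
  qed
  obtain C0 where C0: "0 \<le> C0" "\<forall>f G a v \<delta>. smooth_perturbation R0 W0 n B0 a f G v \<longrightarrow>
     Ck_bounded (Suc n) \<delta> f \<longrightarrow> Ck_bounded n \<delta> (deriv G) \<longrightarrow>
     (\<forall>t\<ge>0. energy_norm n (v t) (Dt v t) \<le> C0 * ((1 + t)\<^sup>2 * exp (- 2 * t)) * (energy_norm n (v 0) (Dt v 0) + \<delta>\<^sup>2))"
    using perturbation_estimate[OF R0 B0, of W0 n] by blast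
  define M where "M = C0 * (N0 + B0\<^sup>2)"
  have le1: "c * ((1 + t)\<^sup>2 * exp (- 2 * t)) * y \<le> c * y" if "0 \<le> c" "0 \<le> y" "0 \<le> t" for c y t :: real
    using mult_left_mono[OF one_plus_exp_le[OF that(3)], of "c * y"] that by (simp add: mult_ac)
  have M: "energy_norm n (v m t) (Dt (v m) t) \<le> M" if t: "0 \<le> t" for m t
  proof -
    have "energy_norm n (v m t) (Dt (v m) t) \<le> C0 * ((1 + t)\<^sup>2 * exp (- 2 * t)) * (energy_norm n (\<phi> m) (\<psi> m) + (mk + e m)\<^sup>2)"
      using C0(2)[rule_format, OF v[of m], of "mk + e m" t] Fb g'b t by (simp add: H(2) v0 vt0)
    also have "\<dots> \<le> C0 * (energy_norm n (\<phi> m) (\<psi> m) + (mk + e m)\<^sup>2)"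
      by (intro le1 C0(1) t add_nonneg_nonneg energy_norm_nonneg) simp
    also have "\<dots> \<le> M"
      unfolding M_def using mk0 e0(1)[of m] mB by (intro mult_left_mono add_mono N0 power_mono C0(1)) auto
    finally show ?thesis .
  qed
  have M0: "0 \<le> M" using M[of 0 0] energy_norm_nonneg[of n "v 0 0" "Dt (v 0) 0"] by linarith
  obtain C1 where C1: "0 \<le> C1" "\<forall>f1 G1 a1 v1 f2 G2 a2 v2 \<delta>. smooth_perturbation R0 W0 n B0 a1 f1 G1 v1 \<longrightarrow>
     smooth_perturbation R0 W0 n B0 a2 f2 G2 v2 \<longrightarrow>
     Ck_bounded (Suc n) \<delta> (\<lambda>x. f1 x - f2 x) \<longrightarrow> Ck_bounded n \<delta> (deriv (\<lambda>x. G1 x - G2 x)) \<longrightarrow>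
     (\<forall>t\<ge>0. energy_norm n (v2 t) (Dt v2 t) \<le> M) \<longrightarrow>
     (\<forall>t\<ge>0. energy_norm n (\<lambda>x. v1 t x - v2 t x) (\<lambda>x. Dt v1 t x - Dt v2 t x)
        \<le> C1 * ((1 + t)\<^sup>2 * exp (- 2 * t)) * (energy_norm n (\<lambda>x. v1 0 x - v2 0 x) (\<lambda>x. Dt v1 0 x - Dt v2 0 x) + \<delta>\<^sup>2))"
    using perturbation_difference_estimate[OF R0 B0 M0, of W0 n] by blast
  have cau: "\<exists>N. \<forall>m\<ge>N. \<forall>l\<ge>N. \<forall>t\<ge>0. energy_norm n (\<lambda>x. v m t x - v l t x) (\<lambda>x. Dt (v m) t x - Dt (v l) t x) < \<epsilon>"
    if ep: "0 < \<epsilon>" for \<epsilon>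
  proof -
    \<comment> \<open>Two squared initial differences and the squared coefficient error, each at
      most d, add up to 3 d; then C1 times 3 d is at most three quarters of the tolerance. The 1 in
      C1 + 1 guards against C1 = 0.\<close>
    define d where "d = \<epsilon> / (4 * (C1 + 1))"
    have d: "0 < d" using ep C1(1) by (simp add: d_def)
    obtain N1 where N1: "\<And>m l. N1 \<le> m \<Longrightarrow> N1 \<le> l \<Longrightarrow> weighted_norm (Suc n) (\<lambda>x. \<phi> m x - \<phi> l x) < sqrt d"
      using \<phi> d unfolding represents_nnsq by (metis real_sqrt_gt_zero)
    obtain N2 where N2: "\<And>m l. N2 \<le> m \<Longrightarrow> N2 \<le> l \<Longrightarrow> weighted_norm n (\<lambda>x. \<psi> m x - \<psi> l x) < sqrt d"
      using \<psi> d unfolding represents_nnsq by (metis real_sqrt_gt_zero)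
    obtain N3 where N3: "\<And>m. N3 \<le> m \<Longrightarrow> e m < sqrt d / 2"
    proof -
      have "0 < sqrt d / 2" using d by simp
      from LIMSEQ_D[OF elim this] obtain N where "\<forall>m\<ge>N. norm (e m - 0) < sqrt d / 2" by blast
      then show ?thesis using e0(1) by (intro that[of N]) (auto dest: less_imp_le)
    qed
    define N where "N = max N1 (max N2 N3)"
    have "energy_norm n (\<lambda>x. v m t x - v l t x) (\<lambda>x. Dt (v m) t x - Dt (v l) t x) < \<epsilon>"
      if m: "N \<le> m" and l: "N \<le> l" and t: "0 \<le> t" for m l t
    proof -
      let ?\<delta> = "e m + e l"
      have "Ck_bounded (Suc n) ?\<delta> (\<lambda>x. (F m x - f x) - (F l x - f x))" by (rule Ck_bounded_diff[OF F(2) F(2)])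
      then have dF: "Ck_bounded (Suc n) ?\<delta> (\<lambda>x. F m x - F l x)" by simp
      have "deriv (\<lambda>x. H m x - H l x) = (\<lambda>x. g' m x - g' l x)"
        using Ck_fun_DERIV[OF H(1)] by (intro ext DERIV_imp_deriv DERIV_diff) (auto simp: H(2)[symmetric])
      moreover have "Ck_bounded n ?\<delta> (\<lambda>x. (g' m x - g x) - (g' l x - g x))" by (rule Ck_bounded_diff[OF g'(2) g'(2)])
      ultimately have dG: "Ck_bounded n ?\<delta> (deriv (\<lambda>x. H m x - H l x))" by simp
      have "energy_norm n (\<lambda>x. v m t x - v l t x) (\<lambda>x. Dt (v m) t x - Dt (v l) t x)
        \<le> C1 * ((1 + t)\<^sup>2 * exp (- 2 * t)) * (energy_norm n (\<lambda>x. v m 0 x - v l 0 x) (\<lambda>x. Dt (v m) 0 x - Dt (v l) 0 x) + ?\<delta>\<^sup>2)"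
        by (rule C1(2)[rule_format, OF v v dF dG M t])
      also have "\<dots> \<le> C1 * (energy_norm n (\<lambda>x. v m 0 x - v l 0 x) (\<lambda>x. Dt (v m) 0 x - Dt (v l) 0 x) + ?\<delta>\<^sup>2)"
        by (intro le1 C1(1) t add_nonneg_nonneg energy_norm_nonneg) simp
      also have "\<dots> \<le> C1 * (3 * d)"
      proof (intro mult_left_mono C1(1))
        have "wsq (Suc n) (\<lambda>x. \<phi> m x - \<phi> l x) < d" "wsq n (\<lambda>x. \<psi> m x - \<psi> l x) < d"
          using N1[of m l] N2[of m l] m l by (auto simp: N_def weighted_norm_wsq)
        moreover have "?\<delta>\<^sup>2 \<le> (sqrt d)\<^sup>2"
          using N3[of m] N3[of l] m l e0(1)[of m] e0(1)[of l] by (intro power_mono) (auto simp: N_def)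
        ultimately show "energy_norm n (\<lambda>x. v m 0 x - v l 0 x) (\<lambda>x. Dt (v m) 0 x - Dt (v l) 0 x) + ?\<delta>\<^sup>2 \<le> 3 * d"
          using d by (simp add: energy_norm_def v0 vt0)
      qed
      also have "\<dots> < \<epsilon>"
      proof -
        have "C1 * (3 * d) \<le> (C1 + 1) * (3 * d)" using d by (intro mult_right_mono) auto
        also have "\<dots> = 3 / 4 * \<epsilon>"
        proof -
          have "C1 + 1 \<noteq> 0" using C1(1) by linarith
          moreover have "K \<noteq> 0 \<Longrightarrow> K * (3 * (\<epsilon> / (4 * K))) = 3 / 4 * \<epsilon>" for K by simp
          ultimately show ?thesis unfolding d_def by blast
        qed
        also have "\<dots> < \<epsilon>" using ep by simp
        finally show ?thesis .
      qed
      finally show ?thesis .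
    qed
    then show ?thesis by blast
  qed
  have Gdiff: "Ck_bounded n (e m) (deriv (\<lambda>x. H m x - G x))" for m unfolding Hd by (rule g'(2))
  obtain V where V: "Ck_halfplane n V" "perturbation_eq R0 W0 f G V"
    "\<And>t x. 0 \<le> t \<Longrightarrow> (\<lambda>m. v m t x) \<longlonglongrightarrow> V t x" "\<And>t x. 0 \<le> t \<Longrightarrow> (\<lambda>m. Dt (v m) t x) \<longlonglongrightarrow> Dt V t x"
    using perturbation_limit[OF R0 n v admf F(2) Gdiff elim M cau] by blast
  have cauw: "\<exists>N. \<forall>m\<ge>N. \<forall>l\<ge>N. \<forall>t\<ge>0. weighted_norm (Suc n) (\<lambda>x. v m t x - v l t x) < \<epsilon> \<and> weighted_norm n (\<lambda>x. Dt (v m) t x - Dt (v l) t x) < \<epsilon>"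
    if ep: "0 < \<epsilon>" for \<epsilon>
  proof -
    obtain N where N: "\<And>m l t. N \<le> m \<Longrightarrow> N \<le> l \<Longrightarrow> 0 \<le> t \<Longrightarrow>
        energy_norm n (\<lambda>x. v m t x - v l t x) (\<lambda>x. Dt (v m) t x - Dt (v l) t x) < (\<epsilon> / 2)\<^sup>2"
      using cau[of "(\<epsilon> / 2)\<^sup>2"] ep by auto
    have "weighted_norm (Suc n) (\<lambda>x. v m t x - v l t x) < \<epsilon> \<and> weighted_norm n (\<lambda>x. Dt (v m) t x - Dt (v l) t x) < \<epsilon>"
      if h: "N \<le> m" "N \<le> l" "0 \<le> t" for m l t
    proof -
      have "wsq (Suc n) (\<lambda>x. v m t x - v l t x) < (\<epsilon> / 2)\<^sup>2" "wsq n (\<lambda>x. Dt (v m) t x - Dt (v l) t x) < (\<epsilon> / 2)\<^sup>2"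
        using N[OF h] wsq_nonneg[of "Suc n" "\<lambda>x. v m t x - v l t x"] wsq_nonneg[of n "\<lambda>x. Dt (v m) t x - Dt (v l) t x"]
        unfolding energy_norm_def by linarith+
      then have "sqrt (wsq (Suc n) (\<lambda>x. v m t x - v l t x)) < sqrt ((\<epsilon> / 2)\<^sup>2)" "sqrt (wsq n (\<lambda>x. Dt (v m) t x - Dt (v l) t x)) < sqrt ((\<epsilon> / 2)\<^sup>2)"
        by (simp_all only: real_sqrt_less_iff)
      then show ?thesis using ep by (simp add: weighted_norm_wsq)
    qed
    then show ?thesis by blast
  qed
  have rep: "represents (Suc n) (\<lambda>m. v m t) (V t)" "represents n (\<lambda>m. Dt (v m) t) (Dt V t)" if t: "0 \<le> t" for t
  proof -
    show "represents (Suc n) (\<lambda>m. v m t) (V t)"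
      by (rule represents_pointwise_limit[OF tv[OF t] _ V(3)[OF t]]) (use cauw t in meson)
    show "represents n (\<lambda>m. Dt (v m) t) (Dt V t)"
      by (rule represents_pointwise_limit[OF tvt[OF t] _ V(4)[OF t]]) (use cauw t in meson)
  qed
  show ?thesis
  proof (rule that[OF GS Gd admf V(1,2)])
    have "represents (Suc n) \<phi> (V 0)" "represents n \<psi> (Dt V 0)"
      using rep[of 0] by (simp_all add: v0 vt0)
    then have "AE x in lebesgue. V 0 x = w x" "AE x in lebesgue. Dt V 0 x = w' x"
      using represents_AE_unique \<phi> \<psi> by blast+
    then show "AE x in lebesgue. V 0 x = w x \<and> Dt V 0 x = w' x" by (rule AE_conjI)
    show "V t \<in> Ht_space (Suc n) \<and> Dt V t \<in> Ht_space n" if "0 \<le> t" for t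
      using rep[OF that] by (auto simp: Ht_space_def)
    show "Ht_norm (Suc n) (V t) + Ht_norm n (Dt V t)
       \<le> 2 * sqrt (CE B) * exp (- t) * (t + 1) * (Ht_norm (Suc n) (V 0) + Ht_norm n (Dt V 0) + m_norm (Suc n) f g)"
      if B: "m_norm (Suc n) f g < B" and t: "0 \<le> t" for B t
    \<comment> \<open>The estimate holds for every approximating solution, with e m added to the
      norm of the data. It passes to the limit because norms along a representing sequence converge
      to \<open>Ht_norm\<close>.\<close>
    proof (rule LIMSEQ_le)
      show "(\<lambda>m. weighted_norm (Suc n) (v m t) + weighted_norm n (Dt (v m) t)) \<longlonglongrightarrow> Ht_norm (Suc n) (V t) + Ht_norm n (Dt V t)"
        by (intro tendsto_add represents_Ht_norm rep t)
      have "(\<lambda>m. 2 * sqrt (CE B) * exp (- t) * (t + 1) * (weighted_norm (Suc n) (v m 0) + weighted_norm n (Dt (v m) 0) + (mk + e m)))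
        \<longlonglongrightarrow> 2 * sqrt (CE B) * exp (- t) * (t + 1) * (Ht_norm (Suc n) (V 0) + Ht_norm n (Dt V 0) + (mk + 0))"
        by (intro tendsto_add tendsto_mult tendsto_const represents_Ht_norm rep elim order_refl)
      then show "(\<lambda>m. 2 * sqrt (CE B) * exp (- t) * (t + 1) * (weighted_norm (Suc n) (v m 0) + weighted_norm n (Dt (v m) 0) + (mk + e m)))
        \<longlonglongrightarrow> 2 * sqrt (CE B) * exp (- t) * (t + 1) * (Ht_norm (Suc n) (V 0) + Ht_norm n (Dt V 0) + m_norm (Suc n) f g)"
        by (simp add: mk_def)
      \<comment> \<open>Exchanges the bound of the individual data for the one that belongs to B,
        and thereby brings in the common constant \<open>CE B\<close>.\<close>
      have "B0 \<le> \<bar>B\<bar> + R0" using B by (simp add: B0_def mk_def)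
      note vB = smooth_perturbation_mono[OF v this]
      have "weighted_norm (Suc n) (v m t) + weighted_norm n (Dt (v m) t)
        \<le> 2 * sqrt (CE B) * exp (- t) * (t + 1) * (weighted_norm (Suc n) (v m 0) + weighted_norm n (Dt (v m) 0) + (mk + e m))" for m
      proof -
        let ?N = "energy_norm n (v m 0) (Dt (v m) 0) + (mk + e m)\<^sup>2"
        have "energy_norm n (v m t) (Dt (v m) t) \<le> CE B * ((1 + t)\<^sup>2 * exp (- 2 * t)) * ?N"
          using CE[OF vB Fb, of m t] g'b t by (simp add: H(2))
        from weighted_norm_sum_le[OF this]
        have "weighted_norm (Suc n) (v m t) + weighted_norm n (Dt (v m) t) \<le> 2 * sqrt (CE B * ((1 + t)\<^sup>2 * exp (- 2 * t)) * ?N)" .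
        also have "sqrt (CE B * ((1 + t)\<^sup>2 * exp (- 2 * t)) * ?N) = sqrt (CE B) * ((1 + t) * exp (- t)) * sqrt ?N"
        proof -
          have "(1 + t)\<^sup>2 * exp (- 2 * t) = ((1 + t) * exp (- t))\<^sup>2" by (simp add: power_mult_distrib exp_double[symmetric])
          then show ?thesis using t by (simp add: real_sqrt_mult)
        qed
        also have "2 * (sqrt (CE B) * ((1 + t) * exp (- t)) * sqrt ?N)
           \<le> 2 * (sqrt (CE B) * ((1 + t) * exp (- t)) * (weighted_norm (Suc n) (v m 0) + weighted_norm n (Dt (v m) 0) + (mk + e m)))"
          using t CE0 mk0 e0(1)[of m] by (intro mult_left_mono sqrt_energy_norm_le) auto
        finally show ?thesis by (simp add: mult_ac add.commute)
      qed
      then show "\<exists>N. \<forall>m\<ge>N. weighted_norm (Suc n) (v m t) + weighted_norm n (Dt (v m) t)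
        \<le> 2 * sqrt (CE B) * exp (- t) * (t + 1) * (weighted_norm (Suc n) (v m 0) + weighted_norm n (Dt (v m) 0) + (mk + e m))" by blast
    qed
  qed
qed

section \<open>The solution of the system\<close>

lemma travel_DERIV:
  assumes "Ck_fun (Suc k) P" "Ck_fun (Suc k) Q"
  shows "((\<lambda>s. travel P Q s x) has_real_derivative deriv P (x + t) - deriv Q (x - t)) (at t within S)"
    and "(travel P Q t has_real_derivative deriv P (x + t) + deriv Q (x - t)) (at x)"
proof -
  have "((\<lambda>s. P (x + s)) has_real_derivative deriv P (x + t) * 1) (at t within S)"
    by (rule DERIV_chain2[OF Ck_fun_DERIV[OF assms(1)]]) (rule derivative_eq_intros refl | simp)+
  moreover have "((\<lambda>s. Q (x - s)) has_real_derivative deriv Q (x - t) * - 1) (at t within S)"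
    by (rule DERIV_chain2[OF Ck_fun_DERIV[OF assms(2)]]) (rule derivative_eq_intros refl | simp)+
  ultimately show "((\<lambda>s. travel P Q s x) has_real_derivative deriv P (x + t) - deriv Q (x - t)) (at t within S)"
    unfolding travel_def using DERIV_add by fastforce
  have "((\<lambda>x. P (x + t)) has_real_derivative deriv P (x + t) * 1) (at x)"
    by (rule DERIV_chain2[OF Ck_fun_DERIV[OF assms(1)]]) (rule derivative_eq_intros refl | simp)+
  moreover have "((\<lambda>x. Q (x - t)) has_real_derivative deriv Q (x - t) * 1) (at x)"
    by (rule DERIV_chain2[OF Ck_fun_DERIV[OF assms(2)]]) (rule derivative_eq_intros refl | simp)+
  ultimately show "(travel P Q t has_real_derivative deriv P (x + t) + deriv Q (x - t)) (at x)"
    unfolding travel_def[abs_def] using DERIV_add by fastforce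
qed

lemma Rb_DERIV:
  "((\<lambda>s. Rb R0 s x) has_real_derivative 2 * Rb R0 t x) (at t within S)"
  "(Rb R0 t has_real_derivative 2 * (tanh (2 * x) * Rb R0 t x)) (at x)"
  "((\<lambda>x. 2 * (tanh (2 * x) * Rb R0 t x)) has_real_derivative 4 * Rb R0 t x) (at x)"
proof -
  show "((\<lambda>s. Rb R0 s x) has_real_derivative 2 * Rb R0 t x) (at t within S)"
    unfolding Rb_def by (auto intro!: derivative_eq_intros)
  have eq: "2 * (tanh (2 * x) * Rb R0 t x) = R0 * exp (2 * t) * (2 * sinh (2 * x))" for x
    by (simp add: Rb_def tanh_times_cosh[symmetric])
  show "(Rb R0 t has_real_derivative 2 * (tanh (2 * x) * Rb R0 t x)) (at x)"
    unfolding eq unfolding Rb_def[abs_def] by (auto intro!: derivative_eq_intros)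
  show "((\<lambda>x. 2 * (tanh (2 * x) * Rb R0 t x)) has_real_derivative 4 * Rb R0 t x) (at x)"
    unfolding eq unfolding Rb_def by (auto intro!: derivative_eq_intros)
qed

lemma Ck_halfplane_Rb: "Ck_halfplane k (Rb R0)"
proof -
  have "Ck_halfplane k (\<lambda>t x. R0 * exp (2 * t) * cosh (2 * x))"
    using Ck_fun_cosh_sinh by (intro Ck_halfplane_mult Ck_halfplane_const Ck_halfplane_t[OF Ck_fun_exp] Ck_halfplane_x) auto
  then show ?thesis by (simp add: Rb_def[abs_def])
qed

lemma Rsol_properties:
  assumes f: "Ck_fun (Suc (Suc (Suc k))) f" and G: "Ck_fun (Suc (Suc (Suc k))) G" and t: "0 \<le> t"
  shows "Dt (Rsol R0 f G) t x = 2 * Rb R0 t x + rho_t f G t x"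
    and "Dx (Rsol R0 f G) t x = 2 * (tanh (2 * x) * Rb R0 t x) + rho_x f G t x"
    and "Dx (Dx (Rsol R0 f G)) t x - Dt (Dt (Rsol R0 f G)) t x = 0"
proof -
  have Dt: "Dt (Rsol R0 f G) t x = 2 * Rb R0 t x + rho_t f G t x" if t: "0 \<le> t" for t x
    unfolding Rsol_def[abs_def] by (intro Dt_eqI DERIV_add Rb_DERIV rho_DERIV[OF f G] t)
  have Dx: "Dx (Rsol R0 f G) t x = 2 * (tanh (2 * x) * Rb R0 t x) + rho_x f G t x" for t x
    unfolding Rsol_def[abs_def] by (intro Dx_eqI DERIV_add Rb_DERIV rho_DERIV[OF f G])
  show "Dt (Rsol R0 f G) t x = 2 * Rb R0 t x + rho_t f G t x"
    "Dx (Rsol R0 f G) t x = 2 * (tanh (2 * x) * Rb R0 t x) + rho_x f G t x"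
    by (rule Dt[OF t] Dx)+
  let ?P = "\<lambda>x. (1/2) * (deriv f x + deriv G x)" and ?Q = "\<lambda>x. (1/2) * (deriv f x - deriv G x)"
  have P: "Ck_fun (Suc k) ?P" and Q: "Ck_fun (Suc k) ?Q" and Q': "Ck_fun (Suc k) (\<lambda>x. - (1/2) * (deriv f x - deriv G x))"
    by (intro Ck_fun_cmult Ck_fun_add Ck_fun_diff Ck_fun_deriv[OF Ck_fun_Suc_mono[OF f]] Ck_fun_deriv[OF Ck_fun_Suc_mono[OF G]])+
  have dQ: "deriv (\<lambda>x. - (1/2) * (deriv f x - deriv G x)) y = - deriv ?Q y" for y
  proof -
    have "((\<lambda>x. - 1 * ?Q x) has_real_derivative - 1 * deriv ?Q y) (at y)"
      by (rule DERIV_cmult[OF Ck_fun_DERIV[OF Q]])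
    moreover have "(\<lambda>x. - (1/2) * (deriv f x - deriv G x)) = (\<lambda>x. - 1 * ?Q x)" by (simp add: fun_eq_iff field_simps)
    ultimately show ?thesis using DERIV_imp_deriv by fastforce
  qed
  have "Dt (Dt (Rsol R0 f G)) t x = Dt (\<lambda>t x. 2 * Rb R0 t x + rho_t f G t x) t x"
    by (rule Dt_cong[OF _ t]) (rule Dt)
  also have "\<dots> = 2 * (2 * Rb R0 t x) + (deriv ?P (x + t) + deriv ?Q (x - t))"
  proof (intro Dt_eqI DERIV_add DERIV_cmult Rb_DERIV t)
    show "((\<lambda>s. rho_t f G s x) has_real_derivative deriv ?P (x + t) + deriv ?Q (x - t)) (at t within {0..})"
      unfolding rho_t_def using travel_DERIV(1)[OF P Q', of x t "{0..}"] by (simp only: dQ diff_minus_eq_add)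
  qed
  finally have 1: "Dt (Dt (Rsol R0 f G)) t x = 2 * (2 * Rb R0 t x) + (deriv ?P (x + t) + deriv ?Q (x - t))" .
  have "Dx (Rsol R0 f G) = (\<lambda>t x. 2 * (tanh (2 * x) * Rb R0 t x) + rho_x f G t x)" using Dx by (simp add: fun_eq_iff)
  moreover have "Dx (\<lambda>t x. 2 * (tanh (2 * x) * Rb R0 t x) + rho_x f G t x) t x = 4 * Rb R0 t x + (deriv ?P (x + t) + deriv ?Q (x - t))"
    unfolding rho_x_def by (intro Dx_eqI DERIV_add Rb_DERIV travel_DERIV(2)[OF P Q])
  ultimately show "Dx (Dx (Rsol R0 f G)) t x - Dt (Dt (Rsol R0 f G)) t x = 0" using 1 by simp
qed

text \<open>arctan (e^(2x)) is a primitive of sech (2x), which is the origin of the factor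
  \<open>sech2\<close> in the source.\<close>

lemma Wb_DERIV: "(Wb W0 W1 t has_real_derivative W0 * sech2 x) (at x)"
proof -
  have "W0 * (inverse (1 + (exp (2 * x))\<^sup>2) * (exp (2 * x) * 2)) = W0 * sech2 x"
  proof -
    have "inverse (1 + e\<^sup>2) * (e * 2) = inverse ((e + inverse e) / 2)" if "0 < e" for e :: real
    proof -
      have "e * ((e + inverse e) / 2) = (1 + e\<^sup>2) / 2" using that by (simp add: field_simps power2_eq_square)
      moreover have "(e + inverse e) / 2 \<noteq> 0" "1 + e\<^sup>2 \<noteq> 0" using that by (smt (verit) positive_imp_inverse_positive half_gt_zero zero_le_power2)+
      ultimately show ?thesis by (simp add: divide_simps)
    qed
    then show ?thesis by (simp add: sech2_def cosh_field_def exp_minus)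
  qed
  moreover have "((\<lambda>x. W1 + W0 * arctan (exp (2 * x))) has_real_derivative W0 * (inverse (1 + (exp (2 * x))\<^sup>2) * (exp (2 * x) * 2))) (at x)"
    by (rule derivative_eq_intros refl | simp)+
  ultimately show ?thesis unfolding Wb_def[abs_def] by (simp only:)
qed

lemma Ck_halfplane_Wb: "Ck_halfplane k (Wb W0 W1)"
proof -
  have "Ck_fun (Suc k) (Wb W0 W1 0)"
    by (rule Ck_fun_SucI[OF Wb_DERIV]) (intro Ck_fun_cmult Ck_fun_sech2)
  then have "Ck_halfplane k (\<lambda>t. Wb W0 W1 0)" by (rule Ck_halfplane_x[OF Ck_fun_Suc_mono])
  then show ?thesis by (simp add: Wb_def[abs_def] del: Ck_halfplane.simps)
qed

lemma sech2_DERIV': "((\<lambda>x. W0 * sech2 x) has_real_derivative W0 * (-2 * (tanh (2 * x) * sech2 x))) (at x)"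
  unfolding sech2_def by (intro DERIV_cmult sech2_DERIV)

text \<open>Data for W are attained almost everywhere; for continuous solutions this recovers the
  equality of initial values at every point that uniqueness requires.\<close>

lemma continuous_AE_eq:
  fixes u v :: "real \<Rightarrow> real"
  assumes "continuous_on UNIV u" "continuous_on UNIV v" "AE x in lebesgue. u x = v x"
  shows "u x = v x"
proof -
  have "closed {x. u x = v x}" by (rule closed_Collect_eq[OF assms(1,2)])
  from mem_closed_if_AE_lebesgue[OF this, of x] assms(3) show ?thesis by simp
qed

lemma second_derivatives_diff:
  assumes u: "Ck_halfplane (Suc (Suc k)) u" and v: "Ck_halfplane (Suc (Suc k)) v" and t: "0 \<le> t"
  shows "Dt (Dt (\<lambda>t x. u t x - v t x)) t x = Dt (Dt u) t x - Dt (Dt v) t x"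
    and "Dx (Dx (\<lambda>t x. u t x - v t x)) t x = Dx (Dx u) t x - Dx (Dx v) t x"
proof -
  have "Dt (Dt (\<lambda>t x. u t x - v t x)) t x = Dt (\<lambda>t x. Dt u t x - Dt v t x) t x"
    by (rule Dt_cong[OF _ t]) (rule Dt_diff[OF u v])
  then show "Dt (Dt (\<lambda>t x. u t x - v t x)) t x = Dt (Dt u) t x - Dt (Dt v) t x"
    using Dt_diff[OF Ck_halfplane_DtD[OF u] Ck_halfplane_DtD[OF v] t] by simp
  have "Dx (\<lambda>t x. u t x - v t x) t = (\<lambda>x. Dx u t x - Dx v t x)" using Dx_diff[OF u v t] by auto
  then show "Dx (Dx (\<lambda>t x. u t x - v t x)) t x = Dx (Dx u) t x - Dx (Dx v) t x"
    using Dx_diff[OF Ck_halfplane_DxD[OF u] Ck_halfplane_DxD[OF v] t] by (simp add: Dx_section)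
qed

lemma wave_uniqueness_diff:
  assumes u: "Ck_halfplane 2 u" and v: "Ck_halfplane 2 v" and al: "Ck_halfplane 0 al" and be: "Ck_halfplane 0 be"
    and eq: "\<And>t x. 0 \<le> t \<Longrightarrow> Dt (Dt u) t x - Dx (Dx u) t x + al t x * Dt u t x + be t x * Dx u t x
      = Dt (Dt v) t x - Dx (Dx v) t x + al t x * Dt v t x + be t x * Dx v t x"
    and init: "\<And>x. u 0 x = v 0 x" "\<And>x. Dt u 0 x = Dt v 0 x" and t: "0 \<le> t"
  shows "u t x = v t x"
proof -
  have u2: "Ck_halfplane (Suc (Suc 0)) u" and v2: "Ck_halfplane (Suc (Suc 0)) v" using u v by (simp_all add: numeral_2_eq_2)
  have "(\<lambda>t x. u t x - v t x) t x = 0"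
  proof (rule wave_uniqueness[OF Ck_halfplane_diff[OF u v] al be _ _ _ t])
    fix t x :: real assume t: "0 \<le> t"
    show "Dt (Dt (\<lambda>t x. u t x - v t x)) t x - Dx (Dx (\<lambda>t x. u t x - v t x)) t x
        + al t x * Dt (\<lambda>t x. u t x - v t x) t x + be t x * Dx (\<lambda>t x. u t x - v t x) t x = 0"
      unfolding second_derivatives_diff[OF u2 v2 t] Dt_diff[OF u2 v2 t] Dx_diff[OF u2 v2 t]
      using eq[OF t, of x] by (simp add: algebra_simps)
  next
    show "u 0 x - v 0 x = 0" for x using init(1) by simp
    show "Dt (\<lambda>t x. u t x - v t x) 0 x = 0" for x using Dt_diff[OF u2 v2 order_refl, of x] init(2) by simp
  qed
  then show ?thesis by simp
qed

text \<open>The equation for q1 is linear once R1 and W1 are treated as known coefficients, so zero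
  data force q1 = 0 despite the coupling. The quadratic terms in the equation for W then disappear,
  and both W solve the same linear equation. The second solution plays the part of the constructed
  one, with q2 = 0.\<close>

lemma system_uniqueness:
  assumes j: "2 \<le> j" and s1: "Ck_solution_with_data j r r' w w' R1 W1 q1" and s2: "Ck_solution_with_data j r r' w w' R2 W2 q2"
    and q2: "\<And>t x. q2 t x = 0" and t: "0 \<le> t"
  shows "R1 t x = R2 t x \<and> W1 t x = W2 t x \<and> q1 t x = q2 t x"
proof -
  have reg: "Ck_halfplane 2 R1" "Ck_halfplane 2 W1" "Ck_halfplane 2 q1" "Ck_halfplane 2 R2" "Ck_halfplane 2 W2" "Ck_halfplane 2 q2"
    using s1 s2 j by (auto simp: Ck_solution_with_data_def intro: Ck_halfplane_mono)
  have e1: "solves_system R1 W1 q1" and e2: "solves_system R2 W2 q2"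
    using s1 s2 by (auto simp: Ck_solution_with_data_def)
  note eq1 = e1[unfolded solves_system_def, rule_format] and eq2 = e2[unfolded solves_system_def, rule_format]
  have C1: "Ck_halfplane 0 (Dt u)" "Ck_halfplane 0 (Dx u)" if "Ck_halfplane 2 u" for u
    using Ck_halfplane_0I[OF Ck_halfplane_DtD[of "Suc 0" u]] Ck_halfplane_0I[OF Ck_halfplane_DxD[of "Suc 0" u]] that
    by (simp_all add: numeral_2_eq_2)
  have R: "R1 t x = R2 t x" if "0 \<le> t" for t x
    by (rule wave_uniqueness_diff[OF reg(1,4) Ck_halfplane_const[of 0 0] Ck_halfplane_const[of 0 0] _ _ _ that])
      (use eq1 eq2 s1 s2 in \<open>auto simp: Ck_solution_with_data_def\<close>)
  have R1nz: "R1 t x \<noteq> 0" if "0 \<le> t" for t x using eq1[OF that] by blast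
  have al: "Ck_halfplane 0 (\<lambda>t x. Dt R1 t x / R1 t x)" and be: "Ck_halfplane 0 (\<lambda>t x. Dx R1 t x / R1 t x)"
    by (intro Ck_halfplane_divide C1 reg Ck_halfplane_0I[OF reg(1)] R1nz, assumption)+
  have z2: "Ck_halfplane 2 (\<lambda>t x. 0)" by (rule Ck_halfplane_const)
  have q: "q1 t x = 0" if t: "0 \<le> t" for t x
  proof (rule wave_uniqueness[OF reg(3), of "\<lambda>t x. Dt R1 t x / R1 t x - 4 * Dt W1 t x" "\<lambda>t x. - (Dx R1 t x / R1 t x) + 4 * Dx W1 t x", OF _ _ _ _ _ t])
    show "Ck_halfplane 0 (\<lambda>t x. Dt R1 t x / R1 t x - 4 * Dt W1 t x)" "Ck_halfplane 0 (\<lambda>t x. - (Dx R1 t x / R1 t x) + 4 * Dx W1 t x)"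
      by (intro Ck_halfplane_add Ck_halfplane_diff Ck_halfplane_minus Ck_halfplane_cmult al be C1 reg)+
    show "q1 0 x = 0" "Dt q1 0 x = 0" for x using s1 by (auto simp: Ck_solution_with_data_def)
    fix t x :: real assume "0 \<le> t"
    from eq1[OF this, of x]
    show "Dt (Dt q1) t x - Dx (Dx q1) t x + (Dt R1 t x / R1 t x - 4 * Dt W1 t x) * Dt q1 t x
        + (- (Dx R1 t x / R1 t x) + 4 * Dx W1 t x) * Dx q1 t x = 0"
      by (simp add: algebra_simps)
  qed
  have Dq: "Dt u t x = 0" "Dx u t x = 0" if u: "\<And>t x. 0 \<le> t \<Longrightarrow> u t x = 0" and t: "0 \<le> t" for u :: "real \<Rightarrow> real \<Rightarrow> real" and t x
  proof -
    have "Dt u t x = Dt (\<lambda>t x. 0) t x" by (rule Dt_cong[OF _ t]) (rule u)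
    then show "Dt u t x = 0" using Dt_zero[OF t] by simp
    have "u t = (\<lambda>x. 0)" using u[OF t] by auto
    then show "Dx u t x = 0" by (simp add: Dx_section)
  qed
  have DR: "Dt R1 t x = Dt R2 t x" "Dx R1 t x = Dx R2 t x" if t: "0 \<le> t" for t x
  proof -
    show "Dt R1 t x = Dt R2 t x" by (rule Dt_cong[OF _ t]) (rule R)
    have "R1 t = R2 t" using R[OF t] by auto
    then show "Dx R1 t x = Dx R2 t x" by (simp add: Dx_section)
  qed
  have ae: "AE x in lebesgue. W1 0 x = W2 0 x" "AE x in lebesgue. Dt W1 0 x = Dt W2 0 x"
  proof -
    have a1: "AE x in lebesgue. W1 0 x = w x \<and> Dt W1 0 x = w' x" and a2: "AE x in lebesgue. W2 0 x = w x \<and> Dt W2 0 x = w' x"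
      using s1 s2 by (auto simp: Ck_solution_with_data_def)
    show "AE x in lebesgue. W1 0 x = W2 0 x" "AE x in lebesgue. Dt W1 0 x = Dt W2 0 x"
      using a1 a2 by (auto elim: AE_mp)
  qed
  have W: "W1 t x = W2 t x"
  proof (rule wave_uniqueness_diff[OF reg(2,5) al Ck_halfplane_minus[OF be] _ _ _ t])
    show "W1 0 x = W2 0 x" for x
      by (rule continuous_AE_eq[OF Ck_halfplane_section_cont[OF reg(2)] Ck_halfplane_section_cont[OF reg(5)] ae(1)]) auto
    show "Dt W1 0 x = Dt W2 0 x" for x
      by (rule continuous_AE_eq[OF Ck_halfplane_section_cont[OF C1(1)[OF reg(2)]] Ck_halfplane_section_cont[OF C1(1)[OF reg(5)]] ae(2)]) auto
    fix t x :: real assume t: "0 \<le> t"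
    have "Dt q1 t x = 0" "Dx q1 t x = 0" "Dt q2 t x = 0" "Dx q2 t x = 0"
      using Dq[of q1, OF q t] Dq[of q2, OF q2 t] by auto
    then show "Dt (Dt W1) t x - Dx (Dx W1) t x + Dt R1 t x / R1 t x * Dt W1 t x + - (Dx R1 t x / R1 t x) * Dx W1 t x
      = Dt (Dt W2) t x - Dx (Dx W2) t x + Dt R1 t x / R1 t x * Dt W2 t x + - (Dx R1 t x / R1 t x) * Dx W2 t x"
      using eq1[OF t, of x] eq2[OF t, of x] by (simp add: DR[OF t] R[OF t])
  qed
  show ?thesis using R[OF t] W q[OF t] q2 by simp
qed

text \<open>The contributions of \<open>Wb\<close> alone cancel, as its second x derivative plus 2
  tanh (2x) times the first is zero. What remains is b times its first derivative, the source in
  \<open>perturbation_eq\<close>.\<close>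

lemma polarized_solution:
  assumes R0: "0 < R0" and ad: "admissible R0 n B f G" and n: "n = Suc (Suc n')"
    and v: "Ck_halfplane n v" and eq: "perturbation_eq R0 W0 f G v"
  shows "solves_system (Rsol R0 f G) (\<lambda>t x. Wb W0 W1 t x + v t x) (\<lambda>t x. 0)"
    and "Ck_halfplane n (Rsol R0 f G)" and "Ck_halfplane n (\<lambda>t x. Wb W0 W1 t x + v t x)"
    and "\<And>t x. 0 \<le> t \<Longrightarrow> Dt (\<lambda>t x. Wb W0 W1 t x + v t x) t x = Dt v t x"
proof -
  have f: "Ck_fun (Suc n) f" and G: "Ck_fun (Suc n) G" using ad by (auto simp: admissible_def dest: Ck_boundedD(1))
  show "Ck_halfplane n (Rsol R0 f G)"
    unfolding Rsol_def[abs_def] by (intro Ck_halfplane_add Ck_halfplane_Rb Ck_halfplane_Suc_mono[OF Ck_halfplane_rho(1)[OF f G]])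
  show "Ck_halfplane n (\<lambda>t x. Wb W0 W1 t x + v t x)" by (intro Ck_halfplane_add Ck_halfplane_Wb v)
  let ?W = "\<lambda>t x. Wb W0 W1 t x + v t x"
  note v2 = v[unfolded n] and f2 = f[unfolded n] and G2 = G[unfolded n]
  have Wb_t: "((\<lambda>s. Wb W0 W1 s x) has_real_derivative 0) (at t within S)" for t x S by (simp add: Wb_def)
  have Wt: "Dt ?W t x = Dt v t x" if t: "0 \<le> t" for t x
    using DERIV_add[OF Wb_t Ck_halfplane_Dt[OF v2 t]] by (intro Dt_eqI[OF _ t]) simp
  then show "\<And>t x. 0 \<le> t \<Longrightarrow> Dt (\<lambda>t x. Wb W0 W1 t x + v t x) t x = Dt v t x" .
  show "solves_system (Rsol R0 f G) ?W (\<lambda>t x. 0)"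
    unfolding solves_system_def
  proof (intro allI impI)
    fix t x :: real assume t: "0 \<le> t"
    have Wtt: "Dt (Dt ?W) t x = Dt (Dt v) t x" by (rule Dt_cong[OF _ t]) (rule Wt)
    have Wx: "Dx ?W t y = W0 * sech2 y + Dx v t y" for y
      by (intro Dx_eqI DERIV_add Wb_DERIV Ck_halfplane_Dx[OF v2 t])
    then have "Dx ?W t = (\<lambda>y. W0 * sech2 y + Dx v t y)" by auto
    then have Wxx: "Dx (Dx ?W) t x = W0 * (-2 * (tanh (2 * x) * sech2 x)) + Dx (Dx v) t x"
      using DERIV_imp_deriv[OF DERIV_add[OF sech2_DERIV' Ck_halfplane_Dx[OF Ck_halfplane_DxD[OF v2] t]]] by (simp add: Dx_section)
    note Rp = Rsol_properties[OF f2 G2 t, where ?R0.0 = R0] and Rq = Rsol_quotient[OF ad R0 t]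
    have z: "Dt (\<lambda>t x. 0) t x = 0" "Dx (\<lambda>t x. 0) t x = 0" "Dt (Dt (\<lambda>t x. 0)) t x = 0" "Dx (Dx (\<lambda>t x. 0)) t x = 0"
    proof -
      show "Dt (\<lambda>t x. 0) t x = 0" "Dx (\<lambda>t x. 0) t x = 0" by (rule Dt_zero[OF t] Dx_zero)+
      have "Dt (Dt (\<lambda>t x. 0)) t x = Dt (\<lambda>t x. 0) t x" by (rule Dt_cong[OF _ t]) (rule Dt_zero)
      then show "Dt (Dt (\<lambda>t x. 0)) t x = 0" using Dt_zero[OF t] by simp
      have "Dx (\<lambda>t x. 0) = (\<lambda>t x. 0)" by (simp add: fun_eq_iff Dx_zero)
      then show "Dx (Dx (\<lambda>t x. 0)) t x = 0" by (simp add: Dx_zero)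
    qed
    have "damped_wave v t x = - (acoef R0 f G t x * Dt v t x) + bcoef R0 f G t x * Dx v t x + W0 * (bcoef R0 f G t x * sech2 x)"
      using eq t by (simp add: perturbation_eq_def)
    then have "Dt (Dt v) t x - (W0 * (-2 * (tanh (2 * x) * sech2 x)) + Dx (Dx v) t x)
        + (2 + acoef R0 f G t x) * Dt v t x - (2 * tanh (2 * x) + bcoef R0 f G t x) * (W0 * sech2 x + Dx v t x) = 0"
      by (simp add: damped_wave_def algebra_simps)
    then show "Rsol R0 f G t x \<noteq> 0 \<and> Dx (Dx (Rsol R0 f G)) t x - Dt (Dt (Rsol R0 f G)) t x = 0 \<and>
       Dt (Dt ?W) t x - Dx (Dx ?W) t x + Dt (Rsol R0 f G) t x / Rsol R0 f G t x * Dt ?W t x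
         - Dx (Rsol R0 f G) t x / Rsol R0 f G t x * Dx ?W t x
         + ((Dt (\<lambda>t x. 0) t x)\<^sup>2 - (Dx (\<lambda>t x. 0) t x)\<^sup>2) / 2 * exp (- 4 * ?W t x) = 0 \<and>
       Dt (Dt (\<lambda>t x. 0)) t x - Dx (Dx (\<lambda>t x. 0)) t x
         + Dt (Rsol R0 f G) t x / Rsol R0 f G t x * Dt (\<lambda>t x. 0) t x
         - Dx (Rsol R0 f G) t x / Rsol R0 f G t x * Dx (\<lambda>t x. 0) t x
         - 4 * Dt (\<lambda>t x. 0) t x * Dt ?W t x + 4 * Dx (\<lambda>t x. 0) t x * Dx ?W t x = 0"
      unfolding Wtt Wxx Wx Wt[OF t] Rp(1,2) Rq(2,3) z using Rq(1)[of x] Rp(3)[of x] by simp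
  qed
qed

lemma Ht_norm_zero: "Ht_norm k (\<lambda>x. 0) = 0"
proof -
  have z: "wsq k (\<lambda>x. 0) = 0" using wsq_cmult[OF test_zero, of k 0] by simp
  have "represents k (\<lambda>n x. 0) (\<lambda>x. 0)"
    by (rule represents_pointwise_limit) (auto simp: test_zero weighted_norm_wsq z)
  from represents_Ht_norm[OF this] show ?thesis
    by (simp add: weighted_norm_wsq z LIMSEQ_const_iff)
qed

text \<open>C is chosen after k and the background but before the data, and receives only the bound
  B. Membership of the slices in the completion accompanies the estimate, since
  \<open>Ht_norm\<close> has its intended meaning there.\<close>

theorem theorem3p3:
  fixes R0 W0 W1 :: real and k :: nat
  assumes "R0 > 0" and "W0 \<noteq> 0" and "k \<ge> 3"
  shows "\<exists>C :: real \<Rightarrow> real. \<forall>r r' w w' :: real \<Rightarrow> real.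
    let f = (\<lambda>x. r x - Rb R0 0 x); g = (\<lambda>x. r' x - Dt (Rb R0) 0 x) in
    f \<in> C0_space k \<and> g \<in> C0_space (k - 1) \<and>
    (\<lambda>x. w x - Wb W0 W1 0 x) \<in> Ht_space k \<and>
    (\<lambda>x. w' x - Dt (Wb W0 W1) 0 x) \<in> Ht_space (k - 1) \<and>
    m_norm 0 f g < 2 * R0 / 3 \<longrightarrow>
    (\<exists>R W q.
       Ck_solution_with_data (k - 1) r r' w w' R W q \<and>
       (\<forall>R' W' q'. Ck_solution_with_data (k - 1) r r' w w' R' W' q' \<longrightarrow>
          (\<forall>t\<ge>0. \<forall>x. R' t x = R t x \<and> W' t x = W t x \<and> q' t x = q t x)) \<and>
       (\<forall>t\<ge>0. \<forall>x. q t x = 0) \<and>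
       (\<forall>t\<ge>0. (\<lambda>x. W t x - Wb W0 W1 t x) \<in> Ht_space k \<and>
              Dt (\<lambda>s x. W s x - Wb W0 W1 s x) t \<in> Ht_space (k - 1)) \<and>
       (\<forall>B. m_norm k f g < B \<longrightarrow>
          (\<forall>t\<ge>0. M_norm W0 W1 k W q t
             \<le> C B * exp (- t) * (t + 1) * (M_norm W0 W1 k W q 0 + m_norm k f g))))"
proof -
  define n where "n = k - 1"
  have k: "k = Suc n" using assms(3) by (simp add: n_def)
  obtain n' where n: "n = Suc (Suc n')" using assms(3) by (metis n_def add_2_eq_Suc le_Suc_ex diff_le_mono numeral_3_eq_3 One_nat_def diff_Suc_Suc diff_zero numeral_2_eq_2)
  note R0 = assms(1)
  \<comment> \<open>The absolute value makes the bound nonnegative for every real B, and R0 leaves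
    room for approximating data whose norms exceed the given ones.\<close>
  have "\<forall>B. \<exists>C\<ge>0. \<forall>f G a v \<delta>. smooth_perturbation R0 W0 n (\<bar>B\<bar> + R0) a f G v \<longrightarrow>
     Ck_bounded (Suc n) \<delta> f \<longrightarrow> Ck_bounded n \<delta> (deriv G) \<longrightarrow>
     (\<forall>t\<ge>0. energy_norm n (v t) (Dt v t)
        \<le> C * ((1 + t)\<^sup>2 * exp (- 2 * t)) * (energy_norm n (v 0) (Dt v 0) + \<delta>\<^sup>2))"
    using perturbation_estimate[OF R0] R0 by simp
  then obtain CE where CE0: "\<And>B. 0 \<le> CE B" and CE: "\<And>B. \<forall>f G a v \<delta>. smooth_perturbation R0 W0 n (\<bar>B\<bar> + R0) a f G v \<longrightarrow>
     Ck_bounded (Suc n) \<delta> f \<longrightarrow> Ck_bounded n \<delta> (deriv G) \<longrightarrow>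
     (\<forall>t\<ge>0. energy_norm n (v t) (Dt v t)
        \<le> CE B * ((1 + t)\<^sup>2 * exp (- 2 * t)) * (energy_norm n (v 0) (Dt v 0) + \<delta>\<^sup>2))"
    by metis
  show ?thesis
    unfolding Let_def
  proof (intro exI[of _ "\<lambda>B. 2 * sqrt (CE B)"] allI impI, elim conjE)
    fix r r' w w' :: "real \<Rightarrow> real"
    let ?f = "\<lambda>x. r x - Rb R0 0 x" and ?g = "\<lambda>x. r' x - Dt (Rb R0) 0 x"
    assume f: "?f \<in> C0_space k" and g: "?g \<in> C0_space (k - 1)"
      and w: "(\<lambda>x. w x - Wb W0 W1 0 x) \<in> Ht_space k" and w': "(\<lambda>x. w' x - Dt (Wb W0 W1) 0 x) \<in> Ht_space (k - 1)"
      and small: "m_norm 0 ?f ?g < 2 * R0 / 3"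
    have k1: "k - 1 = n" by (simp add: k)
    have CE': "energy_norm n (v t) (Dt v t) \<le> CE B * ((1 + t)\<^sup>2 * exp (- 2 * t)) * (energy_norm n (v 0) (Dt v 0) + \<delta>\<^sup>2)"
      if "smooth_perturbation R0 W0 n (\<bar>B\<bar> + R0) a f G v" "Ck_bounded (Suc n) \<delta> f" "Ck_bounded n \<delta> (deriv G)" "0 \<le> t"
      for B f G a v \<delta> t
      using CE[of B] that by blast
    obtain G v B0 where G: "Ck_fun (Suc n) G" "deriv G = ?g" and ad: "admissible R0 n B0 ?f G"
      and v: "Ck_halfplane n v" "perturbation_eq R0 W0 ?f G v"
      and v0: "AE x in lebesgue. v 0 x = w x - Wb W0 W1 0 x \<and> Dt v 0 x = w' x - Dt (Wb W0 W1) 0 x"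
      and mem: "\<And>t. 0 \<le> t \<Longrightarrow> v t \<in> Ht_space (Suc n) \<and> Dt v t \<in> Ht_space n"
      and est: "\<And>B t. m_norm (Suc n) ?f ?g < B \<Longrightarrow> 0 \<le> t \<Longrightarrow> Ht_norm (Suc n) (v t) + Ht_norm n (Dt v t)
       \<le> 2 * sqrt (CE B) * exp (- t) * (t + 1) * (Ht_norm (Suc n) (v 0) + Ht_norm n (Dt v 0) + m_norm (Suc n) ?f ?g)"
      by (rule perturbation_rough_data[where ?W0.0 = W0 and CE = CE, OF R0 n f[unfolded k] g[unfolded k1] small w[unfolded k] w'[unfolded k1] _ CE0])
        ((rule CE'; assumption), (rule that; assumption))
    define R where "R = Rsol R0 ?f G"
    define W where "W t x = Wb W0 W1 t x + v t x" for t x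
    define q :: "real \<Rightarrow> real \<Rightarrow> real" where "q = (\<lambda>t x. 0)"
    have sol: "solves_system R W q" "Ck_halfplane n R" "Ck_halfplane n W" "\<And>t x. 0 \<le> t \<Longrightarrow> Dt W t x = Dt v t x"
      unfolding R_def W_def[abs_def] q_def by (rule polarized_solution[OF R0 ad n v]; assumption?)+
    have W0': "Dt (Wb W0 W1) 0 x = 0" for x by (rule Dt_eqI) (simp_all add: Wb_def)
    have Rinit: "R 0 x = r x" "Dt R 0 x = r' x" for x
    proof -
      show "R 0 x = r x" by (simp add: R_def Rsol_def rho_def travel_def) (simp add: field_simps)
      have "Ck_fun (Suc n) ?f" using ad by (auto simp: admissible_def dest: Ck_boundedD(1))
      then have "Dt R 0 x = 2 * Rb R0 0 x + rho_t ?f G 0 x"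
        unfolding R_def using Rsol_properties(1)[of n' ?f G 0 R0 x] G(1) by (simp only: n)
      moreover have "Dt (Rb R0) 0 x = 2 * Rb R0 0 x" by (rule Dt_eqI[OF Rb_DERIV(1)]) simp
      moreover have "rho_t ?f G 0 x = deriv G x" by (simp add: rho_t_def travel_def field_simps)
      ultimately show "Dt R 0 x = r' x" by (simp add: G(2))
    qed
    have Winit: "AE x in lebesgue. W 0 x = w x \<and> Dt W 0 x = w' x"
      using v0 by (rule AE_mp) (auto simp: W_def sol(4)[of 0] W0')
    have data: "Ck_solution_with_data n r r' w w' R W q"
      unfolding Ck_solution_with_data_def
      using sol Rinit Winit Ck_halfplane_const[of n 0] by (auto simp: q_def Dt_zero simp del: Ck_halfplane.simps)
    have diff: "(\<lambda>x. W t x - Wb W0 W1 t x) = v t" "(\<lambda>s x. W s x - Wb W0 W1 s x) = v" for t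
      by (auto simp: W_def)
    have Mn: "M_norm W0 W1 k W q t = Ht_norm (Suc n) (v t) + Ht_norm n (Dt v t)" if "0 \<le> t" for t
    proof -
      have "Dt q t = (\<lambda>x. 0)" using Dt_zero[OF that] by (auto simp: q_def)
      then show ?thesis by (simp add: M_norm_def diff k Ht_norm_zero) (simp add: q_def Ht_norm_zero)
    qed
    show "\<exists>R W q.
       Ck_solution_with_data (k - 1) r r' w w' R W q \<and>
       (\<forall>R' W' q'. Ck_solution_with_data (k - 1) r r' w w' R' W' q' \<longrightarrow>
          (\<forall>t\<ge>0. \<forall>x. R' t x = R t x \<and> W' t x = W t x \<and> q' t x = q t x)) \<and>
       (\<forall>t\<ge>0. \<forall>x. q t x = 0) \<and>
       (\<forall>t\<ge>0. (\<lambda>x. W t x - Wb W0 W1 t x) \<in> Ht_space k \<and>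
              Dt (\<lambda>s x. W s x - Wb W0 W1 s x) t \<in> Ht_space (k - 1)) \<and>
       (\<forall>B. m_norm k ?f ?g < B \<longrightarrow>
          (\<forall>t\<ge>0. M_norm W0 W1 k W q t
             \<le> 2 * sqrt (CE B) * exp (- t) * (t + 1) * (M_norm W0 W1 k W q 0 + m_norm k ?f ?g)))"
    proof (rule exI[of _ R], rule exI[of _ W], rule exI[of _ q], intro conjI allI impI)
      show "Ck_solution_with_data (k - 1) r r' w w' R W q" unfolding k1 by (rule data)
      show "q t x = 0" for t x by (simp add: q_def)
      show "(\<lambda>x. W t x - Wb W0 W1 t x) \<in> Ht_space k" "Dt (\<lambda>s x. W s x - Wb W0 W1 s x) t \<in> Ht_space (k - 1)"
        if "0 \<le> t" for t
        using mem[OF that] by (simp_all add: diff k)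
      show "M_norm W0 W1 k W q t \<le> 2 * sqrt (CE B) * exp (- t) * (t + 1) * (M_norm W0 W1 k W q 0 + m_norm k ?f ?g)"
        if "m_norm k ?f ?g < B" "0 \<le> t" for B t
        using est[of B t] that(1) Mn[OF that(2)] Mn[of 0] that(2) by (simp add: k)
      fix R' W' q' t x
      assume s: "Ck_solution_with_data (k - 1) r r' w w' R' W' q'" and t: "0 \<le> (t::real)"
      have "2 \<le> n" by (simp add: n)
      from system_uniqueness[OF this s[unfolded k1] data _ t, of x]
      show "R' t x = R t x" "W' t x = W t x" "q' t x = q t x" by (simp_all add: q_def)
    qed
  qed
qed

end
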